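(* Let $k$ be an algebraically closed field, let $G$ be a finite group, and let $A=\bigoplus_{g\in G}A_g$ be a finite dimensional $G$-graded self-injective $k$-algebra. Then $$\dim(\underline{\mathrm{mod}}\,A\#k[G]^* )\leq \dim(\underline{\mathrm{mod}}\,A).$$ Furthermore, if $A$ is separably graded, then $$\dim(\underline{\mathrm{mod}}\,A\#k[G]^* )=\dim(\underline{\mathrm{mod}}\,A),$$ and in this case $\mathrm{rep.dim}(A\#k[G]^* )\geq \dim(\underline{\mathrm{mod}}\,A)+2$.
   Context: Smash product. Let $G$ be a finite group with identity $e$ and $A=\bigoplus_{g\in G}A_g$ a $G$-graded $k$-algebra. For $a\in A$ and $g\in G$, $a_g$ denotes the degree-$g$ component of $a$, and $p_g:G\to k$ denotes the function $h\mapsto\delta_{h,g}$. The smash product is the $k$-algebra $A\#k[G]^*=\bigoplus_{g\in G}Ap_g$ with multiplication $ap_g\cdot bp_h=ab_{gh^{-1}}p_h$ for $a,b\in A$, $g,h\in G$ (its identity is $\sum_{g\in G}p_g$). Separably graded. $A$ is called separably graded if there is a family $\{x^g\mid g\in G\}$ of elements of the center of $A_e$ such that (1) $\sum_{g\in G}x^g=1$ and (2) $rx^g=x^{hg}r$ for all $h,g\in G$ and all $r\in A_h$. Modules and stable categories. $\mathrm{mod}\,A$ is the category of finitely generated left $A$-modules. The stable category $\underline{\mathrm{mod}}\,A$ has the same objects as $\mathrm{mod}\,A$, and $\mathrm{Hom}_{\underline{\mathrm{mod}}A}(X,Y)=\mathrm{Hom}_A(X,Y)/\mathcal I(X,Y)$,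 where $\mathcal I(X,Y)$ is the subgroup of homomorphisms factoring through an injective $A$-module. If $A$ is self-injective, $\underline{\mathrm{mod}}\,A$ is a triangulated category with shift the cosyzygy functor $\Omega^{-1}$ and with distinguished triangles induced by short exact sequences in $\mathrm{mod}\,A$. (It is known that $A\#k[G]^*$ is self-injective if and only if $A$ is.) Dimension of a triangulated category $\mathcal T$. For a subcategory $\mathcal I$ of $\mathcal T$, $\langle\mathcal I\rangle$ is the smallest full subcategory of $\mathcal T$ containing $\mathcal I$ and closed under finite direct sums, direct summands and shifts. For subcategories $\mathcal I,\mathcal J$, $\mathcal I\ast\mathcal J$ is the full subcategory of objects $N$ for which there is a distinguished triangle $I\to N\to J\to I[1]$ with $I\in\mathcal I$, $J\in\mathcal J$. Put $\langle\mathcal I\rangle_0=0$, $\langle\mathcal I\rangle_1=\langle\mathcal I\rangle$ and $\langle\mathcal I\rangle_{n+1}=\langle\langle\mathcal I\rangle_n\ast\langle\mathcal I\rangle\rangle$. Then $\dim\mathcal T$ is the minimal $n\in\mathbb N$ (including $0$) such that there is an object $M$ of $\mathcal T$ with $\mathcal T=\langle M\rangle_{n+1}$. Representation dimension. For a finite dimensional $k$-algebra $A$, $M\in\mathrm{mod}\,A$ is a generator-cogenerator if $A\in\mathrm{add}\,M$ and $DA\in\mathrm{add}\,M$, where $D=\mathrm{Hom}_k(-,k)$ and $\mathrm{add}\,M$ consists of all direct summands of finite direct sums of copies of $M$. Then $\mathrm{rep.dim}\,A=\inf\{\mathrm{gl.dim}\,\mathrm{End}_A(M)\mid M\text{ a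 generator-cogenerator in }\mathrm{mod}\,A\}$, where $\mathrm{gl.dim}$ denotes global dimension.
   Formalization: The bound rep.dim(A#k[G]* ) ≥ dim(stable mod A)+2 is stated only for A not semisimple; for semisimple A, e.g. A = k with G trivial, it fails, since the stable category has dimension 0 and rep.dim is 0. *)

theory Defs
  imports "HOL-Algebra.Algebra" "HOL-Library.Extended_Nat"
begin

section \<open>Left modules over a not necessarily commutative ring\<close>

text \<open>
  The library locale \<open>module\<close> requires a commutative ring of scalars, hence the following
  variant. The fields \<open>mult\<close> and \<open>one\<close> of the record of a module are never used.
\<close>

locale left_module = R?: ring R + M?: abelian_group M
  for R :: "('r, 'x) ring_scheme" (structure) and M :: "('r, 'm, 'y) module_scheme" (structure) +
  assumes smult_closed [simp, intro]:
      "\<lbrakk>a \<in> carrier R; x \<in> carrier M\<rbrakk> \<Longrightarrow> a \<odot>\<^bsub>M\<^esub> x \<in> carrier M"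
    and smult_l_distr:
      "\<lbrakk>a \<in> carrier R; b \<in> carrier R; x \<in> carrier M\<rbrakk> \<Longrightarrow>
       (a \<oplus>\<^bsub>R\<^esub> b) \<odot>\<^bsub>M\<^esub> x = a \<odot>\<^bsub>M\<^esub> x \<oplus>\<^bsub>M\<^esub> b \<odot>\<^bsub>M\<^esub> x"
    and smult_r_distr:
      "\<lbrakk>a \<in> carrier R; x \<in> carrier M; y \<in> carrier M\<rbrakk> \<Longrightarrow>
       a \<odot>\<^bsub>M\<^esub> (x \<oplus>\<^bsub>M\<^esub> y) = a \<odot>\<^bsub>M\<^esub> x \<oplus>\<^bsub>M\<^esub> a \<odot>\<^bsub>M\<^esub> y"
    and smult_assoc:
      "\<lbrakk>a \<in> carrier R; b \<in> carrier R; x \<in> carrier M\<rbrakk> \<Longrightarrow>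
       (a \<otimes>\<^bsub>R\<^esub> b) \<odot>\<^bsub>M\<^esub> x = a \<odot>\<^bsub>M\<^esub> (b \<odot>\<^bsub>M\<^esub> x)"
    and smult_one [simp]:
      "x \<in> carrier M \<Longrightarrow> \<one>\<^bsub>R\<^esub> \<odot>\<^bsub>M\<^esub> x = x"

definition fin_gen :: "('r, 'x) ring_scheme \<Rightarrow> ('r, 'm, 'y) module_scheme \<Rightarrow> bool" where
  "fin_gen R M \<longleftrightarrow>
     (\<exists>S. finite S \<and> S \<subseteq> carrier M \<and>
        (\<forall>x\<in>carrier M. \<exists>c\<in>S \<rightarrow> carrier R. x = finsum M (\<lambda>s. c s \<odot>\<^bsub>M\<^esub> s) S))"

text \<open>Homomorphisms are extensional, so that they are equal iff they agree on the carrier.\<close>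

definition mod_hom ::
  "('r, 'x) ring_scheme \<Rightarrow> ('r, 'm, 'y) module_scheme \<Rightarrow> ('r, 'n, 'z) module_scheme
   \<Rightarrow> ('m \<Rightarrow> 'n) set" where
  "mod_hom R M N =
     {f \<in> carrier M \<rightarrow>\<^sub>E carrier N.
        (\<forall>x\<in>carrier M. \<forall>y\<in>carrier M. f (x \<oplus>\<^bsub>M\<^esub> y) = f x \<oplus>\<^bsub>N\<^esub> f y) \<and>
        (\<forall>r\<in>carrier R. \<forall>x\<in>carrier M. f (r \<odot>\<^bsub>M\<^esub> x) = r \<odot>\<^bsub>N\<^esub> f x)}"

definition mod_iso ::
  "('r, 'x) ring_scheme \<Rightarrow> ('r, 'm, 'y) module_scheme \<Rightarrow> ('r, 'n, 'z) module_scheme \<Rightarrow> bool" where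
  "mod_iso R M N \<longleftrightarrow> (\<exists>f\<in>mod_hom R M N. bij_betw f (carrier M) (carrier N))"

definition short_exact ::
  "('r, 'x) ring_scheme \<Rightarrow> ('r, 'l, 'v) module_scheme \<Rightarrow> ('r, 'm, 'y) module_scheme
   \<Rightarrow> ('r, 'n, 'z) module_scheme \<Rightarrow> ('l \<Rightarrow> 'm) \<Rightarrow> ('m \<Rightarrow> 'n) \<Rightarrow> bool" where
  "short_exact R W Y Z f g \<longleftrightarrow>
     f \<in> mod_hom R W Y \<and> g \<in> mod_hom R Y Z \<and>
     inj_on f (carrier W) \<and>
     f ` carrier W = {y \<in> carrier Y. g y = \<zero>\<^bsub>Z\<^esub>} \<and>
     g ` carrier Y = carrier Z"

definition regular_module :: "('r, 'x) ring_scheme \<Rightarrow> ('r, 'r) module" where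
  "regular_module R =
     \<lparr>carrier = carrier R, monoid.mult = monoid.mult R, one = \<one>\<^bsub>R\<^esub>,
      ring.zero = \<zero>\<^bsub>R\<^esub>, ring.add = ring.add R, smult = monoid.mult R\<rparr>"

definition module_power :: "('r, 'm, 'y) module_scheme \<Rightarrow> nat \<Rightarrow> ('r, nat \<Rightarrow> 'm) module" where
  "module_power M n =
     \<lparr>carrier = {..<n} \<rightarrow>\<^sub>E carrier M, monoid.mult = undefined, one = undefined,
      ring.zero = (\<lambda>i\<in>{..<n}. \<zero>\<^bsub>M\<^esub>),
      ring.add = (\<lambda>x y. \<lambda>i\<in>{..<n}. x i \<oplus>\<^bsub>M\<^esub> y i),
      smult = (\<lambda>r x. \<lambda>i\<in>{..<n}. r \<odot>\<^bsub>M\<^esub> x i)\<rparr>"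

definition direct_summand ::
  "('r, 'x) ring_scheme \<Rightarrow> 'm set \<Rightarrow> ('r, 'm, 'y) module_scheme \<Rightarrow> bool" where
  "direct_summand R N M \<longleftrightarrow>
     submodule N R M \<and>
     (\<exists>N'. submodule N' R M \<and> N \<inter> N' = {\<zero>\<^bsub>M\<^esub>} \<and> N <+>\<^bsub>M\<^esub> N' = carrier M)"

definition in_add ::
  "('r, 'x) ring_scheme \<Rightarrow> ('r, 'n, 'z) module_scheme \<Rightarrow> ('r, 'm) module \<Rightarrow> bool" where
  "in_add R W M \<longleftrightarrow>
     left_module R W \<and>
     (\<exists>n N. direct_summand R N (module_power M n) \<and>
            mod_iso R W (module_power M n\<lparr>carrier := N\<rparr>))"

definition semisimple_ring :: "('r, 'x) ring_scheme \<Rightarrow> bool" where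
  "semisimple_ring R \<longleftrightarrow>
     ring R \<and>
     (\<forall>L. submodule L R (regular_module R) \<longrightarrow> direct_summand R L (regular_module R))"


subsection \<open>A universe of modules\<close>

text \<open>
  Whenever one has to range over modules, they have their elements in the type
  \<^typ>\<open>(nat \<Rightarrow> 'r) set\<close>. It contains all quotients of the free modules of finite rank (their elements
  are cosets, i.e. sets of tuples), so every finitely generated module has an isomorphic copy there;
  see lemma \<open>fin_gen_copy\<close>. In particular, it contains copies of the regular
  module and of all left ideals. By Baer's criterion, testing injectivity on this universe is
  therefore the same as testing it on all modules.
\<close>

type_synonym 'r lmod = "('r, (nat \<Rightarrow> 'r) set) module"

lemma fin_gen_copy:
  fixes R :: "('r, 'x) ring_scheme" and M :: "('r, 'm, 'y) module_scheme"
  assumes "left_module R M" "fin_gen R M"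
  shows "\<exists>N :: 'r lmod. left_module R N \<and> mod_iso R M N"
proof -
  interpret left_module R M by fact
  obtain S where S: "finite S" "S \<subseteq> carrier M"
    and gen: "\<And>x. x \<in> carrier M \<Longrightarrow>
      \<exists>c\<in>S \<rightarrow> carrier R. x = finsum M (\<lambda>s. c s \<odot>\<^bsub>M\<^esub> s) S"
    using assms(2) unfolding fin_gen_def by auto
  obtain e :: "nat \<Rightarrow> 'm" where e: "bij_betw e {..<card S} S"
    using ex_bij_betw_nat_finite[OF S(1)] by (auto simp: atLeast0LessThan)
  define \<phi> :: "'m \<Rightarrow> (nat \<Rightarrow> 'r) set" where
    "\<phi> x = {c. (\<forall>i<card S. c i \<in> carrier R) \<and>
               x = finsum M (\<lambda>s. c (the_inv_into {..<card S} e s) \<odot>\<^bsub>M\<^esub> s) S}" for x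
  have ne: "\<phi> x \<noteq> {}" if x: "x \<in> carrier M" for x
  proof -
    obtain c where c: "c \<in> S \<rightarrow> carrier R" "x = finsum M (\<lambda>s. c s \<odot>\<^bsub>M\<^esub> s) S"
      using gen[OF x] by auto
    have inv: "e (the_inv_into {..<card S} e s) = s" if "s \<in> S" for s
      using e that by (simp add: bij_betw_def f_the_inv_into_f)
    have "finsum M (\<lambda>s. c (e (the_inv_into {..<card S} e s)) \<odot>\<^bsub>M\<^esub> s) S
          = finsum M (\<lambda>s. c s \<odot>\<^bsub>M\<^esub> s) S"
      by (rule M.finsum_cong') (use inv c S in \<open>auto simp: Pi_iff\<close>)
    moreover have "\<forall>i<card S. c (e i) \<in> carrier R"
      using c(1) e by (auto simp: bij_betw_def)
    ultimately have "(\<lambda>i. c (e i)) \<in> \<phi> x"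
      using c(2) unfolding \<phi>_def by simp
    then show ?thesis by blast
  qed
  have inj: "inj_on \<phi> (carrier M)"
  proof (rule inj_onI)
    fix x y assume "x \<in> carrier M" "y \<in> carrier M" "\<phi> x = \<phi> y"
    then obtain c where "c \<in> \<phi> x" "c \<in> \<phi> y" using ne by blast
    then show "x = y" unfolding \<phi>_def by simp
  qed
  define \<psi> where "\<psi> = the_inv_into (carrier M) \<phi>"
  have \<psi>: "\<psi> (\<phi> x) = x" if "x \<in> carrier M" for x
    unfolding \<psi>_def using inj that by (rule the_inv_into_f_f)
  define N :: "'r lmod" where
    "N = \<lparr>carrier = \<phi> ` carrier M, monoid.mult = undefined, one = undefined, ring.zero = \<phi> \<zero>\<^bsub>M\<^esub>,
          ring.add = (\<lambda>x y. \<phi> (\<psi> x \<oplus>\<^bsub>M\<^esub> \<psi> y)), smult = (\<lambda>r x. \<phi> (r \<odot>\<^bsub>M\<^esub> \<psi> x))\<rparr>"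
  have "abelian_group N"
  proof (rule abelian_groupI)
    fix x assume "x \<in> carrier N"
    then obtain x' where x': "x' \<in> carrier M" "x = \<phi> x'" by (auto simp: N_def)
    then show "\<exists>y\<in>carrier N. y \<oplus>\<^bsub>N\<^esub> x = \<zero>\<^bsub>N\<^esub>"
      by (intro bexI[of _ "\<phi> (\<ominus>\<^bsub>M\<^esub> x')"]) (auto simp: N_def \<psi> M.l_neg)
  qed (auto simp: N_def \<psi> M.a_ac)
  then have "left_module R N"
    by (intro left_module.intro left_module_axioms.intro R.ring_axioms)
       (auto simp: N_def \<psi> smult_l_distr smult_r_distr smult_assoc)
  moreover have "mod_iso R M N"
    unfolding mod_iso_def
  proof (rule bexI)
    show "bij_betw (restrict \<phi> (carrier M)) (carrier M) (carrier N)"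
      using inj by (auto simp: bij_betw_def N_def)
    show "restrict \<phi> (carrier M) \<in> mod_hom R M N"
      by (auto simp: mod_hom_def N_def \<psi>)
  qed
  ultimately show ?thesis by blast
qed

definition injective_module :: "('r, 'x) ring_scheme \<Rightarrow> ('r, 'm) module \<Rightarrow> bool" where
  "injective_module R E \<longleftrightarrow>
     left_module R E \<and>
     (\<forall>(W :: 'r lmod) (Y :: 'r lmod). \<forall>i\<in>mod_hom R W Y. \<forall>f\<in>mod_hom R W E.
        left_module R W \<and> left_module R Y \<and> inj_on i (carrier W) \<longrightarrow>
        (\<exists>g\<in>mod_hom R Y E. compose (carrier W) g i = f))"

definition projective_module :: "('r, 'x) ring_scheme \<Rightarrow> ('r, 'm) module \<Rightarrow> bool" where
  "projective_module R P \<longleftrightarrow>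
     left_module R P \<and>
     (\<forall>(Y :: 'r lmod) (Z :: 'r lmod). \<forall>p\<in>mod_hom R Y Z. \<forall>f\<in>mod_hom R P Z.
        left_module R Y \<and> left_module R Z \<and> p ` carrier Y = carrier Z \<longrightarrow>
        (\<exists>g\<in>mod_hom R P Y. compose (carrier P) p g = f))"

definition self_injective :: "('r, 'x) ring_scheme \<Rightarrow> bool" where
  "self_injective R \<longleftrightarrow> injective_module R (regular_module R)"


section \<open>Dimension of a triangulated category\<close>

text \<open>
  The data of a triangulated category: \<open>Cmp T W Y Z v u\<close> is the composite of \<open>u\<close> in \<open>Mor T W Y\<close> and
  \<open>v\<close> in \<open>Mor T Y Z\<close>, and \<open>Plus\<close>, \<open>Null\<close> are the group structure on the sets of morphisms. The element
  \<open>(W, Y, Z, u, v, w)\<close> of \<open>Triangles\<close> is the triangle \<open>W \<rightarrow> Y \<rightarrow> Z \<rightarrow> Shift W\<close>.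
  Full subcategories are represented by their sets of objects.
\<close>

record ('o, 'm) shift_cat =
  Ob :: "'o set"
  Mor :: "'o \<Rightarrow> 'o \<Rightarrow> 'm set"
  Cmp :: "'o \<Rightarrow> 'o \<Rightarrow> 'o \<Rightarrow> 'm \<Rightarrow> 'm \<Rightarrow> 'm"
  Ident :: "'o \<Rightarrow> 'm"
  Plus :: "'o \<Rightarrow> 'o \<Rightarrow> 'm \<Rightarrow> 'm \<Rightarrow> 'm"
  Null :: "'o \<Rightarrow> 'o \<Rightarrow> 'm"
  Shift :: "'o \<Rightarrow> 'o"
  Shift_mor :: "'o \<Rightarrow> 'o \<Rightarrow> 'm \<Rightarrow> 'm"

record ('o, 'm) tri_cat = "('o, 'm) shift_cat" +
  Triangles :: "('o \<times> 'o \<times> 'o \<times> 'm \<times> 'm \<times> 'm) set"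

definition iso_mor :: "('o, 'm, 'z) shift_cat_scheme \<Rightarrow> 'o \<Rightarrow> 'o \<Rightarrow> 'm \<Rightarrow> bool" where
  "iso_mor T W Y a \<longleftrightarrow>
     a \<in> Mor T W Y \<and>
     (\<exists>b\<in>Mor T Y W. Cmp T W Y W b a = Ident T W \<and> Cmp T Y W Y a b = Ident T Y)"

fun iso_triangles ::
  "('o, 'm, 'z) shift_cat_scheme \<Rightarrow> 'o \<times> 'o \<times> 'o \<times> 'm \<times> 'm \<times> 'm
   \<Rightarrow> 'o \<times> 'o \<times> 'o \<times> 'm \<times> 'm \<times> 'm \<Rightarrow> bool" where
  "iso_triangles T (W, Y, Z, u, v, w) (W', Y', Z', u', v', w') \<longleftrightarrow>
     (\<exists>a b c. iso_mor T W W' a \<and> iso_mor T Y Y' b \<and> iso_mor T Z Z' c \<and>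
        Cmp T W Y Y' b u = Cmp T W W' Y' u' a \<and>
        Cmp T Y Z Z' c v = Cmp T Y Y' Z' v' b \<and>
        Cmp T Z (Shift T W) (Shift T W') (Shift_mor T W W' a) w = Cmp T Z Z' (Shift T W') w' c)"

definition zero_object :: "('o, 'm, 'z) shift_cat_scheme \<Rightarrow> 'o \<Rightarrow> bool" where
  "zero_object T Z \<longleftrightarrow> Z \<in> Ob T \<and> Ident T Z = Null T Z Z"

definition direct_sum :: "('o, 'm, 'z) shift_cat_scheme \<Rightarrow> 'o \<Rightarrow> 'o \<Rightarrow> 'o \<Rightarrow> bool" where
  "direct_sum T S W Y \<longleftrightarrow>
     S \<in> Ob T \<and> W \<in> Ob T \<and> Y \<in> Ob T \<and>
     (\<exists>i\<in>Mor T W S. \<exists>j\<in>Mor T Y S. \<exists>p\<in>Mor T S W. \<exists>q\<in>Mor T S Y.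
        Cmp T W S W p i = Ident T W \<and> Cmp T Y S Y q j = Ident T Y \<and>
        Cmp T W S Y q i = Null T W Y \<and> Cmp T Y S W p j = Null T Y W \<and>
        Plus T S S (Cmp T S W S i p) (Cmp T S Y S j q) = Ident T S)"

text \<open>
  Direct sums are only determined up to isomorphism (and \<open>W\<close> is a direct sum of any isomorphic object
  and a zero object), so the following subcategories are closed under isomorphism. Hence rule
  \<open>unshift\<close> is closure under the inverse of the shift.
\<close>

inductive_set closure_hull :: "('o, 'm, 'z) shift_cat_scheme \<Rightarrow> 'o set \<Rightarrow> 'o set"
  for T :: "('o, 'm, 'z) shift_cat_scheme" and I :: "'o set" where
  base: "W \<in> I \<Longrightarrow> W \<in> Ob T \<Longrightarrow> W \<in> closure_hull T I"
| zero: "zero_object T Z \<Longrightarrow> Z \<in> closure_hull T I"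
| sum: "W \<in> closure_hull T I \<Longrightarrow> Y \<in> closure_hull T I \<Longrightarrow> direct_sum T S W Y
          \<Longrightarrow> S \<in> closure_hull T I"
| summand: "S \<in> closure_hull T I \<Longrightarrow> direct_sum T S W Y \<Longrightarrow> W \<in> closure_hull T I"
| shift: "W \<in> closure_hull T I \<Longrightarrow> Shift T W \<in> closure_hull T I"
| unshift: "Shift T W \<in> closure_hull T I \<Longrightarrow> W \<in> Ob T \<Longrightarrow> W \<in> closure_hull T I"

definition ext_objects :: "('o, 'm, 'z) tri_cat_scheme \<Rightarrow> 'o set \<Rightarrow> 'o set \<Rightarrow> 'o set" where
  "ext_objects T I J =
     {N \<in> Ob T. \<exists>W\<in>I. \<exists>Y\<in>J. \<exists>u v w. (W, N, Y, u, v, w) \<in> Triangles T}"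

fun gen_level :: "('o, 'm, 'z) tri_cat_scheme \<Rightarrow> 'o set \<Rightarrow> nat \<Rightarrow> 'o set" where
  "gen_level T I 0 = {Z. zero_object T Z}"
| "gen_level T I (Suc 0) = closure_hull T I"
| "gen_level T I (Suc (Suc n)) =
     closure_hull T (ext_objects T (gen_level T I (Suc n)) (closure_hull T I))"

text \<open>The infimum of the empty set is \<open>\<infinity>\<close>.\<close>

definition tri_dim :: "('o, 'm, 'z) tri_cat_scheme \<Rightarrow> enat" where
  "tri_dim T = Inf {enat n |n. \<exists>M\<in>Ob T. gen_level T {M} (n + 1) = Ob T}"


section \<open>The stable module category\<close>

definition factors_injective ::
  "('r, 'x) ring_scheme \<Rightarrow> 'r lmod \<Rightarrow> 'r lmod
   \<Rightarrow> ((nat \<Rightarrow> 'r) set \<Rightarrow> (nat \<Rightarrow> 'r) set) \<Rightarrow> bool" where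
  "factors_injective R W Y f \<longleftrightarrow>
     (\<exists>E :: 'r lmod. injective_module R E \<and>
        (\<exists>a\<in>mod_hom R W E. \<exists>b\<in>mod_hom R E Y. f = compose (carrier W) b a))"

text \<open>The class of a homomorphism, as a coset in \<open>Hom(W, Y)\<close>.\<close>

definition stable_class ::
  "('r, 'x) ring_scheme \<Rightarrow> 'r lmod \<Rightarrow> 'r lmod
   \<Rightarrow> ((nat \<Rightarrow> 'r) set \<Rightarrow> (nat \<Rightarrow> 'r) set) \<Rightarrow> ((nat \<Rightarrow> 'r) set \<Rightarrow> (nat \<Rightarrow> 'r) set) set" where
  "stable_class R W Y f =
     {g \<in> mod_hom R W Y. factors_injective R W Y (\<lambda>x\<in>carrier W. g x \<ominus>\<^bsub>Y\<^esub> f x)}"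

text \<open>
  For each \<open>W\<close> an exact sequence \<open>0 \<rightarrow> W \<rightarrow> E \<rightarrow> C \<rightarrow> 0\<close> with \<open>E\<close> finitely generated injective is fixed,
  and \<open>C\<close> is the cosyzygy. Up to canonical isomorphism in the stable category, \<open>C\<close> does not depend on
  the choice, so \<open>E\<close> is not required to be an injective envelope.
\<close>

definition inj_presentation ::
  "('r, 'x) ring_scheme \<Rightarrow> 'r lmod \<Rightarrow>
   'r lmod \<times> 'r lmod \<times> ((nat \<Rightarrow> 'r) set \<Rightarrow> (nat \<Rightarrow> 'r) set) \<times> ((nat \<Rightarrow> 'r) set \<Rightarrow> (nat \<Rightarrow> 'r) set)" where
  "inj_presentation R W =
     (SOME (E, C, i, p). injective_module R E \<and> fin_gen R E \<and> left_module R C \<and>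
                         short_exact R W E C i p)"

definition cosyzygy :: "('r, 'x) ring_scheme \<Rightarrow> 'r lmod \<Rightarrow> 'r lmod" where
  "cosyzygy R W = (case inj_presentation R W of (E, C, i, p) \<Rightarrow> C)"

text \<open>The homomorphisms between cosyzygies induced by extending \<open>f\<close> to the injective modules.\<close>

definition cosyzygy_lifts ::
  "('r, 'x) ring_scheme \<Rightarrow> 'r lmod \<Rightarrow> 'r lmod
   \<Rightarrow> ((nat \<Rightarrow> 'r) set \<Rightarrow> (nat \<Rightarrow> 'r) set) \<Rightarrow> ((nat \<Rightarrow> 'r) set \<Rightarrow> (nat \<Rightarrow> 'r) set) set" where
  "cosyzygy_lifts R W Y f =
     (case inj_presentation R W of (E, C, i, p) \<Rightarrow>
      case inj_presentation R Y of (E', C', i', p') \<Rightarrow>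
        {h \<in> mod_hom R C C'. \<exists>g\<in>mod_hom R E E'.
           compose (carrier W) g i = compose (carrier W) i' f \<and>
           compose (carrier E) h p = compose (carrier E) p' g})"

definition stable_shift_cat ::
  "('r, 'x) ring_scheme \<Rightarrow>
   ('r lmod, ((nat \<Rightarrow> 'r) set \<Rightarrow> (nat \<Rightarrow> 'r) set) set) shift_cat" where
  "stable_shift_cat R =
     \<lparr>Ob = {W. left_module R W \<and> fin_gen R W},
      Mor = (\<lambda>W Y. stable_class R W Y ` mod_hom R W Y),
      Cmp = (\<lambda>W Y Z V U. \<Union>u\<in>U. \<Union>v\<in>V. stable_class R W Z (compose (carrier W) v u)),
      Ident = (\<lambda>W. stable_class R W W (\<lambda>x\<in>carrier W. x)),
      Plus = (\<lambda>W Y U V. \<Union>u\<in>U. \<Union>v\<in>V. stable_class R W Y (\<lambda>x\<in>carrier W. u x \<oplus>\<^bsub>Y\<^esub> v x)),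
      Null = (\<lambda>W Y. stable_class R W Y (\<lambda>x\<in>carrier W. \<zero>\<^bsub>Y\<^esub>)),
      Shift = cosyzygy R,
      Shift_mor = (\<lambda>W Y U. \<Union>u\<in>U. \<Union>h\<in>cosyzygy_lifts R W Y u.
                     stable_class R (cosyzygy R W) (cosyzygy R Y) h)\<rparr>"

text \<open>
  A short exact sequence \<open>0 \<rightarrow> W \<rightarrow> Y \<rightarrow> Z \<rightarrow> 0\<close> induces the triangle whose third morphism \<open>h\<close> completes
  a morphism to the fixed sequence \<open>0 \<rightarrow> W \<rightarrow> E \<rightarrow> C \<rightarrow> 0\<close> which is the identity on \<open>W\<close>. (Replacing \<open>h\<close>
  by its negative, as some authors do, gives an equivalent triangulated category.)
\<close>

definition standard_triangles ::
  "('r, 'x) ring_scheme \<Rightarrow>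
   ('r lmod \<times> 'r lmod \<times> 'r lmod \<times>
    ((nat \<Rightarrow> 'r) set \<Rightarrow> (nat \<Rightarrow> 'r) set) set \<times> ((nat \<Rightarrow> 'r) set \<Rightarrow> (nat \<Rightarrow> 'r) set) set \<times>
    ((nat \<Rightarrow> 'r) set \<Rightarrow> (nat \<Rightarrow> 'r) set) set) set" where
  "standard_triangles R =
     {(W, Y, Z, stable_class R W Y f, stable_class R Y Z g, stable_class R Z (cosyzygy R W) h)
      |W Y Z f g h.
        {W, Y, Z} \<subseteq> Ob (stable_shift_cat R) \<and> short_exact R W Y Z f g \<and>
        (case inj_presentation R W of (E, C, i, p) \<Rightarrow>
           h \<in> mod_hom R Z C \<and>
           (\<exists>e\<in>mod_hom R Y E. compose (carrier W) e f = i \<and>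
              compose (carrier Y) p e = compose (carrier Y) h g))}"

definition stable_category ::
  "('r, 'x) ring_scheme \<Rightarrow>
   ('r lmod, ((nat \<Rightarrow> 'r) set \<Rightarrow> (nat \<Rightarrow> 'r) set) set) tri_cat" where
  "stable_category R =
     shift_cat.extend (stable_shift_cat R)
       (tri_cat.fields
          {(W, Y, Z, u, v, w).
             W \<in> Ob (stable_shift_cat R) \<and> Y \<in> Ob (stable_shift_cat R) \<and>
             Z \<in> Ob (stable_shift_cat R) \<and>
             u \<in> Mor (stable_shift_cat R) W Y \<and> v \<in> Mor (stable_shift_cat R) Y Z \<and>
             w \<in> Mor (stable_shift_cat R) Z (cosyzygy R W) \<and>
             (\<exists>t\<in>standard_triangles R. iso_triangles (stable_shift_cat R) (W, Y, Z, u, v, w) t)})"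


section \<open>Global dimension and representation dimension\<close>

text \<open>
  \<open>\<dots> \<rightarrow> Q 2 \<rightarrow> Q 1 \<rightarrow> Q 0 = M \<rightarrow> 0\<close> is an exact sequence in which \<open>Q (i + 1)\<close> is the projective module
  in degree \<open>i\<close> of the resolution.
\<close>

definition proj_resolution_le :: "('r, 'x) ring_scheme \<Rightarrow> 'r lmod \<Rightarrow> nat \<Rightarrow> bool" where
  "proj_resolution_le R M n \<longleftrightarrow>
     (\<exists>(Q :: nat \<Rightarrow> 'r lmod) d.
        Q 0 = M \<and>
        (\<forall>i. projective_module R (Q (Suc i))) \<and>
        (\<forall>i>n. carrier (Q (Suc i)) = {\<zero>\<^bsub>Q (Suc i)\<^esub>}) \<and>
        (\<forall>i. d i \<in> mod_hom R (Q (Suc i)) (Q i)) \<and>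
        d 0 ` carrier (Q 1) = carrier M \<and>
        (\<forall>i. d (Suc i) ` carrier (Q (Suc (Suc i))) = {x \<in> carrier (Q (Suc i)). d i x = \<zero>\<^bsub>Q i\<^esub>}))"

definition proj_dim :: "('r, 'x) ring_scheme \<Rightarrow> 'r lmod \<Rightarrow> enat" where
  "proj_dim R M = Inf {enat n |n. proj_resolution_le R M n}"

definition gl_dim :: "('r, 'x) ring_scheme \<Rightarrow> enat" where
  "gl_dim R = (SUP M \<in> {M. left_module R M}. proj_dim R M)"

definition End_ring :: "('r, 'x) ring_scheme \<Rightarrow> ('r, 'm) module \<Rightarrow> ('m \<Rightarrow> 'm) ring" where
  "End_ring R M =
     \<lparr>carrier = mod_hom R M M, monoid.mult = compose (carrier M), one = (\<lambda>x\<in>carrier M. x),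
      ring.zero = (\<lambda>x\<in>carrier M. \<zero>\<^bsub>M\<^esub>), ring.add = (\<lambda>f g. \<lambda>x\<in>carrier M. f x \<oplus>\<^bsub>M\<^esub> g x)\<rparr>"

definition dual_module :: "('k, 'x) ring_scheme \<Rightarrow> ('k, 'a) module \<Rightarrow> ('a, 'a \<Rightarrow> 'k) module" where
  "dual_module K A =
     \<lparr>carrier = mod_hom K A (regular_module K), monoid.mult = undefined, one = undefined,
      ring.zero = (\<lambda>x\<in>carrier A. \<zero>\<^bsub>K\<^esub>),
      ring.add = (\<lambda>f g. \<lambda>x\<in>carrier A. f x \<oplus>\<^bsub>K\<^esub> g x),
      smult = (\<lambda>a f. \<lambda>x\<in>carrier A. f (x \<otimes>\<^bsub>A\<^esub> a))\<rparr>"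

definition generator_cogenerator ::
  "('k, 'x) ring_scheme \<Rightarrow> ('k, 'a) module \<Rightarrow> 'a lmod \<Rightarrow> bool" where
  "generator_cogenerator K A M \<longleftrightarrow>
     left_module A M \<and> fin_gen A M \<and>
     in_add A (regular_module A) M \<and> in_add A (dual_module K A) M"

definition rep_dim :: "('k, 'x) ring_scheme \<Rightarrow> ('k, 'a) module \<Rightarrow> enat" where
  "rep_dim K A = (INF M \<in> {M. generator_cogenerator K A M}. gl_dim (End_ring A M))"


section \<open>Graded algebras and smash products\<close>

text \<open>
  As in the library locale \<open>algebra\<close>, an algebra is a record of type \<open>module\<close> over its ground field,
  here without commutativity.
\<close>

locale k_algebra = K?: field K + module K A + A?: ring A
  for K :: "('k, 'x) ring_scheme" (structure) and A :: "('k, 'a) module" (structure) +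
  assumes smult_assoc_left:
      "\<lbrakk>c \<in> carrier K; x \<in> carrier A; y \<in> carrier A\<rbrakk> \<Longrightarrow>
       (c \<odot>\<^bsub>A\<^esub> x) \<otimes>\<^bsub>A\<^esub> y = c \<odot>\<^bsub>A\<^esub> (x \<otimes>\<^bsub>A\<^esub> y)"
    and smult_assoc_right:
      "\<lbrakk>c \<in> carrier K; x \<in> carrier A; y \<in> carrier A\<rbrakk> \<Longrightarrow>
       x \<otimes>\<^bsub>A\<^esub> (c \<odot>\<^bsub>A\<^esub> y) = c \<odot>\<^bsub>A\<^esub> (x \<otimes>\<^bsub>A\<^esub> y)"

locale graded_algebra = k_algebra K A + grp: group G
  for K :: "('k, 'x) ring_scheme" (structure) and A :: "('k, 'a) module" (structure)
    and G :: "('g, 'y) monoid_scheme" (structure) +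
  fixes Gr :: "'g \<Rightarrow> 'a set"
  assumes finite_group: "finite (carrier G)"
    and subspace: "g \<in> carrier G \<Longrightarrow> submodule (Gr g) K A"
    and direct: "a \<in> carrier A \<Longrightarrow>
      \<exists>!c. c \<in> (\<Pi>\<^sub>E g\<in>carrier G. Gr g) \<and> a = finsum A c (carrier G)"
    and mult_graded:
      "\<lbrakk>g \<in> carrier G; h \<in> carrier G; a \<in> Gr g; b \<in> Gr h\<rbrakk> \<Longrightarrow> a \<otimes>\<^bsub>A\<^esub> b \<in> Gr (g \<otimes>\<^bsub>G\<^esub> h)"

definition component ::
  "('g, 'y) monoid_scheme \<Rightarrow> ('k, 'a) module \<Rightarrow> ('g \<Rightarrow> 'a set) \<Rightarrow> 'a \<Rightarrow> 'g \<Rightarrow> 'a" where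
  "component G A Gr a =
     (THE c. c \<in> (\<Pi>\<^sub>E g\<in>carrier G. Gr g) \<and> a = finsum A c (carrier G))"

text \<open>
  The function \<open>u\<close> stands for the sum of the \<open>u(g) p\<^sub>g\<close>. The product is the bilinear extension of
  \<open>a p\<^sub>g \<cdot> b p\<^sub>h = a b\<^bsub>gh\<inverse>\<^esub> p\<^sub>h\<close>.
\<close>

definition smash_product ::
  "('g, 'y) monoid_scheme \<Rightarrow> ('k, 'a) module \<Rightarrow> ('g \<Rightarrow> 'a set) \<Rightarrow> ('k, 'g \<Rightarrow> 'a) module" where
  "smash_product G A Gr =
     \<lparr>carrier = carrier G \<rightarrow>\<^sub>E carrier A,
      monoid.mult = (\<lambda>u v. \<lambda>h\<in>carrier G.
                finsum A (\<lambda>g. u g \<otimes>\<^bsub>A\<^esub> component G A Gr (v h) (g \<otimes>\<^bsub>G\<^esub> inv\<^bsub>G\<^esub> h)) (carrier G)),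
      one = (\<lambda>g\<in>carrier G. \<one>\<^bsub>A\<^esub>),
      ring.zero = (\<lambda>g\<in>carrier G. \<zero>\<^bsub>A\<^esub>),
      ring.add = (\<lambda>u v. \<lambda>g\<in>carrier G. u g \<oplus>\<^bsub>A\<^esub> v g),
      smult = (\<lambda>c u. \<lambda>g\<in>carrier G. c \<odot>\<^bsub>A\<^esub> u g)\<rparr>"

definition separably_graded ::
  "('g, 'y) monoid_scheme \<Rightarrow> ('k, 'a) module \<Rightarrow> ('g \<Rightarrow> 'a set) \<Rightarrow> bool" where
  "separably_graded G A Gr \<longleftrightarrow>
     (\<exists>x :: 'g \<Rightarrow> 'a.
        (\<forall>g\<in>carrier G. x g \<in> Gr \<one>\<^bsub>G\<^esub> \<and> (\<forall>b\<in>Gr \<one>\<^bsub>G\<^esub>. x g \<otimes>\<^bsub>A\<^esub> b = b \<otimes>\<^bsub>A\<^esub> x g)) \<and>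
        finsum A x (carrier G) = \<one>\<^bsub>A\<^esub> \<and>
        (\<forall>g\<in>carrier G. \<forall>h\<in>carrier G. \<forall>r\<in>Gr h. r \<otimes>\<^bsub>A\<^esub> x g = x (h \<otimes>\<^bsub>G\<^esub> g) \<otimes>\<^bsub>A\<^esub> r))"

end

theory Submission
  imports Defs
begin
text \<open>
  Restriction of scalars along \<open>A \<rightarrow> A#k[G]\<^sup>*\<close> and the functor \<open>M \<mapsto> M \<otimes> k[G]\<close> are exact, adjoint to each other
  on both sides and preserve injective modules, hence induce exact functors of the stable categories. Every
  module over the smash product is a summand of one that is induced from its restriction, because of the
  idempotents \<open>p\<^sub>g\<close>; if \<open>A\<close> is separably graded, every \<open>A\<close>-module is a summand of the restriction of the module
  it induces. A functor with this property maps generators to generators in the same number of steps.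

  For the representation dimension, let \<open>M\<close> be a generator-cogenerator over a self-injective algebra and
  \<open>\<Gamma> = End(M)\<close>. As \<open>M\<close> is a cogenerator, every \<open>C\<close> embeds in some \<open>M\<^sup>r\<close> such that applying \<open>C \<mapsto> Hom(C, M)\<close> to
  \<open>0 \<rightarrow> C \<rightarrow> M\<^sup>r \<rightarrow> C' \<rightarrow> 0\<close> yields the beginning of a free resolution over \<open>\<Gamma>\<close>. As \<open>M\<close> is a generator, \<open>Hom(C, M)\<close> is a
  second syzygy, so it has projective dimension at most \<open>n - 2\<close> if \<open>\<Gamma>\<close> has global dimension \<open>n \<ge> 2\<close>. After \<open>n - 2\<close>
  steps the cokernel is a summand of a power of \<open>M\<close>, so \<open>C\<close> is reached from \<open>M\<close> by \<open>n - 2\<close> triangles.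
  If \<open>n \<le> 1\<close>, then all epimorphisms over the algebra split, which for a smash product with a separably
  graded algebra implies that the latter is semisimple.
\<close>

\<comment> \<open>The stable category consists of modules with elements in one fixed type, whereas
  induction, coinduction and endomorphism rings lead to elements of other types. Baer's criterion
  removes this obstacle: it makes injectivity independent of types, so constructions may leave the
  universe and return by a copy. Of the triangulated structure only two facts enter: a short exact
  sequence gives a triangle, and the objects of any triangle are isomorphic to those of a short
  exact sequence. Functors therefore need only act on modules.

  For the bound by the global dimension, \<open>Hom(-, M)\<close> is used because
  \<open>\<Gamma>\<close> acts on it from the left, by composition. The hypothesis on
  \<open>\<Gamma>\<close> yields some projective resolution, whose terms need not be finitely
  generated, while approximation by powers of \<open>M\<close> yields another, by free modules. They
  are compared by retractions up to maps through free modules, a relation that passes to syzygies.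
  The constant 2 stands for the two syzygies already spent on writing \<open>Hom(C, M)\<close> as
  the kernel of a map between free modules.\<close>
syntax "_index" :: "logic \<Rightarrow> index" ("\<^sub>_" [1000])
notation mod_hom ("Hom") and left_module ("LMod") and regular_module ("Reg")
type_synonym 'r lmap = "(nat \<Rightarrow> 'r) set \<Rightarrow> (nat \<Rightarrow> 'r) set"

section \<open>Left modules\<close>

lemma Hom_closed: "f \<in> Hom R M N \<Longrightarrow> x \<in> carrier M \<Longrightarrow> f x \<in> carrier N"
 by (auto simp: mod_hom_def)

lemma Hom_add: "f \<in> Hom R M N \<Longrightarrow> x \<in> carrier M \<Longrightarrow> y \<in> carrier M
  \<Longrightarrow> f (x \<oplus>\<^sub>M y) = f x \<oplus>\<^sub>N f y"
 by (auto simp: mod_hom_def)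

lemma Hom_smult: "f \<in> Hom R M N \<Longrightarrow> r \<in> carrier R \<Longrightarrow> x \<in> carrier M
  \<Longrightarrow> f (r \<odot>\<^sub>M x) = r \<odot>\<^sub>N f x"
 by (auto simp: mod_hom_def)

lemma Hom_eqI:
 "f \<in> Hom R M N \<Longrightarrow> g \<in> Hom R M N' \<Longrightarrow> (\<And>x. x \<in> carrier M \<Longrightarrow> f x = g x) \<Longrightarrow> f = g"
 by (auto simp: mod_hom_def PiE_def intro: extensionalityI)

lemma Hom_restrict_self: "f \<in> Hom R M N \<Longrightarrow> (\<lambda>x\<in>carrier M. f x) = f"
 by (auto simp: mod_hom_def PiE_def extensional_restrict)

section \<open>Cancellation and double sums in abelian groups\<close>

context abelian_group
begin
lemma minus_eq_zero_iff: "x \<in> carrier G \<Longrightarrow> y \<in> carrier G \<Longrightarrow> x \<ominus>\<^sub>G y = \<zero>\<^sub>G \<longleftrightarrow> x = y"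
 using minus_equality[of x "\<ominus>\<^sub>G y"] by (auto simp: a_minus_def r_neg)

text \<open>Sorting a sum by \<open>a_ac\<close> may leave \<open>x\<close> and its negative
  separated by up to two other summands. These rules, collected in \<open>add_cancel\<close>, remove
  such pairs, so that the identities in abelian groups needed below are settled by
  simplification.\<close>

lemma add_cancel2:
 assumes "x \<in> carrier G" "y \<in> carrier G"
 shows "x \<oplus>\<^sub>G (y \<oplus>\<^sub>G \<ominus>\<^sub>G x) = y" "\<ominus>\<^sub>G x \<oplus>\<^sub>G (y \<oplus>\<^sub>G x) = y" "x \<oplus>\<^sub>G (\<ominus>\<^sub>G x \<oplus>\<^sub>G y) = y" "\<ominus>\<^sub>G x \<oplus>\<^sub>G (x \<oplus>\<^sub>G y) = y"
 using assms a_lcomm[of x y "\<ominus>\<^sub>G x"] a_lcomm[of "\<ominus>\<^sub>G x" y x]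
 by (simp_all add: r_neg l_neg flip: a_assoc)

lemma add_cancel3:
 assumes "x \<in> carrier G" "y \<in> carrier G" "z \<in> carrier G"
 shows "x \<oplus>\<^sub>G (y \<oplus>\<^sub>G (\<ominus>\<^sub>G x \<oplus>\<^sub>G z)) = y \<oplus>\<^sub>G z" "\<ominus>\<^sub>G x \<oplus>\<^sub>G (y \<oplus>\<^sub>G (x \<oplus>\<^sub>G z)) = y \<oplus>\<^sub>G z"
  "x \<oplus>\<^sub>G (y \<oplus>\<^sub>G (z \<oplus>\<^sub>G \<ominus>\<^sub>G x)) = y \<oplus>\<^sub>G z" "\<ominus>\<^sub>G x \<oplus>\<^sub>G (y \<oplus>\<^sub>G (z \<oplus>\<^sub>G x)) = y \<oplus>\<^sub>G z"
 using assms add_cancel2[of x "y \<oplus>\<^sub>G z"] a_lcomm[of x y "\<ominus>\<^sub>G x \<oplus>\<^sub>G z"] a_lcomm[of "\<ominus>\<^sub>G x" y "x \<oplus>\<^sub>G z"]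
  add_cancel2[of x z]
 by (simp_all add: a_assoc)

lemmas add_cancel = r_neg l_neg add_cancel2 add_cancel3

end

lemma abelian_group_finsum_swap:
 assumes "abelian_group M" "finite I" "finite J" "\<And>i j. i \<in> I \<Longrightarrow> j \<in> J \<Longrightarrow> f i j \<in> carrier M"
 shows "finsum M (\<lambda>i. finsum M (f i) J) I = finsum M (\<lambda>j. finsum M (\<lambda>i. f i j) I) J"
proof -
 interpret M: abelian_group M by fact
 show ?thesis using assms(2,4)
 proof (induction rule: finite_induct)
  case empty then show ?case by simp
 next
  case (insert i I)
  have "finsum M (\<lambda>i. finsum M (f i) J) (insert i I)
    = finsum M (f i) J \<oplus>\<^sub>M finsum M (\<lambda>i. finsum M (f i) J) I"
   using insert by (intro M.finsum_insert) (auto intro!: M.finsum_closed)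
  also have "\<dots> = finsum M (f i) J \<oplus>\<^sub>M finsum M (\<lambda>j. finsum M (\<lambda>i. f i j) I) J"
   using insert by auto
  also have "\<dots> = finsum M (\<lambda>j. f i j \<oplus>\<^sub>M finsum M (\<lambda>i. f i j) I) J"
   using insert by (intro M.finsum_addf[symmetric]) (auto intro!: M.finsum_closed)
  also have "\<dots> = finsum M (\<lambda>j. finsum M (\<lambda>i. f i j) (insert i I)) J"
   using insert by (intro M.finsum_cong' refl) (auto simp: Pi_iff intro!: M.finsum_closed)
  finally show ?case .
 qed
qed

section \<open>Scalar multiplication and submodules\<close>

context left_module
begin
lemma smult_zero_left [simp]: "x \<in> carrier M \<Longrightarrow> \<zero>\<^sub>R \<odot>\<^sub>M x = \<zero>\<^sub>M"
 using smult_l_distr[of "\<zero>\<^sub>R" "\<zero>\<^sub>R" x] M.add.l_cancel_one'[of "\<zero>\<^sub>R \<odot>\<^sub>M x" "\<zero>\<^sub>R \<odot>\<^sub>M x"]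
 by simp

lemma smult_zero_right [simp]: "a \<in> carrier R \<Longrightarrow> a \<odot>\<^sub>M \<zero>\<^sub>M = \<zero>\<^sub>M"
 using smult_r_distr[of a "\<zero>\<^sub>M" "\<zero>\<^sub>M"] M.add.l_cancel_one'[of "a \<odot>\<^sub>M \<zero>\<^sub>M" "a \<odot>\<^sub>M \<zero>\<^sub>M"]
 by simp

lemma smult_neg_left: "a \<in> carrier R \<Longrightarrow> x \<in> carrier M \<Longrightarrow> (\<ominus>\<^sub>R a) \<odot>\<^sub>M x = \<ominus>\<^sub>M (a \<odot>\<^sub>M x)"
 using smult_l_distr[of "\<ominus>\<^sub>R a" a x] by (simp add: R.l_neg M.minus_equality)

lemma smult_neg_right: "a \<in> carrier R \<Longrightarrow> x \<in> carrier M \<Longrightarrow> a \<odot>\<^sub>M (\<ominus>\<^sub>M x) = \<ominus>\<^sub>M (a \<odot>\<^sub>M x)"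
 using smult_r_distr[of a "\<ominus>\<^sub>M x" x] by (simp add: M.l_neg M.minus_equality)

lemma smult_finsum:
 assumes "finite I" "a \<in> carrier R" "f \<in> I \<rightarrow> carrier M"
 shows "a \<odot>\<^sub>M finsum M f I = finsum M (\<lambda>i. a \<odot>\<^sub>M f i) I"
 using assms(1,3)
proof (induction rule: finite_induct)
 case (insert i I)
 then show ?case using assms(2) by (simp add: smult_r_distr Pi_iff)
qed (use assms in simp)

lemma finsum_smult:
 assumes "finite I" "x \<in> carrier M" "c \<in> I \<rightarrow> carrier R"
 shows "finsum R c I \<odot>\<^sub>M x = finsum M (\<lambda>i. c i \<odot>\<^sub>M x) I"
 using assms(1,3)
proof (induction rule: finite_induct)
 case (insert i I)
 then show ?case using assms(2) by (simp add: smult_l_distr Pi_iff)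
qed (use assms in simp)

lemma submoduleI:
 assumes "N \<subseteq> carrier M" "\<zero>\<^sub>M \<in> N" "\<And>x y. x \<in> N \<Longrightarrow> y \<in> N \<Longrightarrow> x \<oplus>\<^sub>M y \<in> N"
  and "\<And>r x. r \<in> carrier R \<Longrightarrow> x \<in> N \<Longrightarrow> r \<odot>\<^sub>M x \<in> N"
 shows "submodule N R M"
proof -
 \<comment> \<open>The negative is the multiple by \<open>\<ominus>\<^sub>R \<one>\<^sub>R\<close>,
   so closure under it follows from closure under scalars.\<close>
 have "\<ominus>\<^sub>M x \<in> N" if "x \<in> N" for x
  using assms(4)[of "\<ominus>\<^sub>R \<one>\<^sub>R" x] that assms(1) by (auto simp: smult_neg_left)
 then show ?thesis
  using assms by (auto intro!: submodule.intro M.add.subgroupI simp: submodule_axioms_def a_inv_def)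
qed

lemma submoduleD:
 assumes "submodule N R M"
 shows "N \<subseteq> carrier M" "\<zero>\<^sub>M \<in> N" "\<And>x y. x \<in> N \<Longrightarrow> y \<in> N \<Longrightarrow> x \<oplus>\<^sub>M y \<in> N"
  "\<And>x. x \<in> N \<Longrightarrow> \<ominus>\<^sub>M x \<in> N" "\<And>r x. r \<in> carrier R \<Longrightarrow> x \<in> N \<Longrightarrow> r \<odot>\<^sub>M x \<in> N"
  "\<And>x y. x \<in> N \<Longrightarrow> y \<in> N \<Longrightarrow> x \<ominus>\<^sub>M y \<in> N"
proof -
 interpret N: submodule N R M by fact
 show s: "N \<subseteq> carrier M" using N.subset by simp
 show "\<zero>\<^sub>M \<in> N" using N.one_closed by simp
 show a: "x \<oplus>\<^sub>M y \<in> N" if "x \<in> N" "y \<in> N" for x y using N.m_closed that by simp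
 show m: "r \<odot>\<^sub>M x \<in> N" if "r \<in> carrier R" "x \<in> N" for r x using that by simp
 show n: "\<ominus>\<^sub>M x \<in> N" if "x \<in> N" for x
  using m[of "\<ominus>\<^sub>R \<one>\<^sub>R" x] that subsetD[OF s that] by (simp add: smult_neg_left)
 show "x \<ominus>\<^sub>M y \<in> N" if "x \<in> N" "y \<in> N" for x y using a n that by (simp add: a_minus_def)
qed

lemma submodule_left_module:
 assumes "submodule N R M"
 shows "LMod R (M\<lparr>carrier := N\<rparr>)"
proof -
 note N = submoduleD[OF assms]
 have s: "x \<in> carrier M" if "x \<in> N" for x using N that by auto
 have "abelian_group (M\<lparr>carrier := N\<rparr>)"
 proof (rule abelian_groupI)
  fix x assume x: "x \<in> carrier (M\<lparr>carrier := N\<rparr>)"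
  then show "\<exists>y\<in>carrier (M\<lparr>carrier := N\<rparr>). y \<oplus>\<^bsub>M\<lparr>carrier := N\<rparr>\<^esub> x = \<zero>\<^bsub>M\<lparr>carrier := N\<rparr>\<^esub>"
   using N s by (intro bexI[of _ "\<ominus>\<^sub>M x"]) (auto simp: M.l_neg)
 qed (use N s in \<open>auto simp: M.a_ac\<close>)
 then show ?thesis
  using N s by (intro left_module.intro left_module_axioms.intro R.ring_axioms)
   (auto simp: smult_l_distr smult_r_distr smult_assoc)
qed

lemma Hom_inclusion:
 assumes "submodule N R M"
 shows "(\<lambda>x\<in>N. x) \<in> Hom R (M\<lparr>carrier := N\<rparr>) M"
 using submoduleD[OF assms] by (auto simp: mod_hom_def)

end

section \<open>Homomorphisms, their sums, inverses and factorisations\<close>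

locale lhom = W: left_module R W + Y: left_module R Y
 for R :: "('r, 'x) ring_scheme" (structure) and W :: "('r, 'm, 'y) module_scheme"
  and Y :: "('r, 'n, 'z) module_scheme" + fixes f
 assumes hom: "f \<in> Hom R W Y"
begin
lemma closed [simp, intro]: "x \<in> carrier W \<Longrightarrow> f x \<in> carrier Y"
 using hom by (rule Hom_closed)

lemma add [simp]: "x \<in> carrier W \<Longrightarrow> y \<in> carrier W \<Longrightarrow> f (x \<oplus>\<^sub>W y) = f x \<oplus>\<^sub>Y f y"
 using hom by (rule Hom_add)

lemma smult [simp]: "r \<in> carrier R \<Longrightarrow> x \<in> carrier W \<Longrightarrow> f (r \<odot>\<^sub>W x) = r \<odot>\<^sub>Y f x"
 using hom by (rule Hom_smult)

lemma zero [simp]: "f \<zero>\<^sub>W = \<zero>\<^sub>Y"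
 using smult[of "\<zero>\<^sub>R" "\<zero>\<^sub>W"] by simp

lemma neg [simp]: "x \<in> carrier W \<Longrightarrow> f (\<ominus>\<^sub>W x) = \<ominus>\<^sub>Y f x"
 using smult[of "\<ominus>\<^sub>R \<one>\<^sub>R" x] by (simp add: W.smult_neg_left Y.smult_neg_left)

lemma minus [simp]: "x \<in> carrier W \<Longrightarrow> y \<in> carrier W \<Longrightarrow> f (x \<ominus>\<^sub>W y) = f x \<ominus>\<^sub>Y f y"
 by (simp add: a_minus_def)

lemma finsum:
 assumes "finite I" "u \<in> I \<rightarrow> carrier W"
 shows "f (finsum W u I) = finsum Y (\<lambda>i. f (u i)) I"
 using assms
proof (induction rule: finite_induct)
 case (insert i I)
 then show ?case by (simp add: Pi_iff)
qed simp

lemma kernel: "submodule {x \<in> carrier W. f x = \<zero>\<^sub>Y} R W"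
 by (rule W.submoduleI) auto

lemma range: "submodule (f ` carrier W) R Y"
proof (rule Y.submoduleI)
 show "\<zero>\<^sub>Y \<in> f ` carrier W" using zero W.M.zero_closed by (metis imageI)
 show "x \<oplus>\<^sub>Y y \<in> f ` carrier W" if "x \<in> f ` carrier W" "y \<in> f ` carrier W" for x y
  using that by (auto simp flip: add)
 show "r \<odot>\<^sub>Y x \<in> f ` carrier W" if "r \<in> carrier R" "x \<in> f ` carrier W" for r x
  using that by (auto simp flip: smult)
qed auto

lemma inj_onI: "(\<And>x. x \<in> carrier W \<Longrightarrow> f x = \<zero>\<^sub>Y \<Longrightarrow> x = \<zero>\<^sub>W) \<Longrightarrow> inj_on f (carrier W)"
proof (rule Fun.inj_onI)
 fix x y assume *: "\<And>x. x \<in> carrier W \<Longrightarrow> f x = \<zero>\<^sub>Y \<Longrightarrow> x = \<zero>\<^sub>W"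
  "x \<in> carrier W" "y \<in> carrier W" "f x = f y"
 then have "f (x \<ominus>\<^sub>W y) = \<zero>\<^sub>Y" by (simp add: Y.M.r_neg a_minus_def)
 then have "x \<ominus>\<^sub>W y = \<zero>\<^sub>W" using * by simp
 then show "x = y" using * by (simp add: W.M.minus_eq_zero_iff)
qed

end

lemma lhomI: "LMod R W \<Longrightarrow> LMod R Y \<Longrightarrow> f \<in> Hom R W Y \<Longrightarrow> lhom R W Y f"
 by (intro lhom.intro lhom_axioms.intro)

lemma Hom_restrictI:
 assumes "LMod R M" "\<And>x. x \<in> carrier M \<Longrightarrow> f x \<in> carrier N"
  and "\<And>x y. x \<in> carrier M \<Longrightarrow> y \<in> carrier M \<Longrightarrow> f (x \<oplus>\<^sub>M y) = f x \<oplus>\<^sub>N f y"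
  and "\<And>r x. r \<in> carrier R \<Longrightarrow> x \<in> carrier M \<Longrightarrow> f (r \<odot>\<^sub>M x) = r \<odot>\<^sub>N f x"
 shows "(\<lambda>x\<in>carrier M. f x) \<in> Hom R M N"
proof -
 interpret left_module R M by fact
 show ?thesis using assms(2-) by (auto simp: mod_hom_def)
qed

lemma Hom_compose:
 assumes "LMod R W" "f \<in> Hom R W Y" "g \<in> Hom R Y Z"
 shows "compose (carrier W) g f \<in> Hom R W Z"
 unfolding compose_def using assms
 by (intro Hom_restrictI) (auto simp: Hom_add Hom_smult Hom_closed)

lemma Hom_comp:
 assumes "LMod R W" "f \<in> Hom R W Y" "g \<in> Hom R Y Z"
 shows "(\<lambda>x\<in>carrier W. g (f x)) \<in> Hom R W Z"
 using Hom_compose[OF assms] by (simp add: compose_def)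

lemma Hom_id: "LMod R W \<Longrightarrow> (\<lambda>x\<in>carrier W. x) \<in> Hom R W W"
 by (rule Hom_restrictI) auto

lemma Hom_zero:
 assumes "LMod R W" "LMod R Y"
 shows "(\<lambda>x\<in>carrier W. \<zero>\<^sub>Y) \<in> Hom R W Y"
proof -
 interpret Y: left_module R Y by fact
 show ?thesis using assms(1) by (rule Hom_restrictI) auto
qed

lemma Hom_plus:
 assumes "LMod R W" "LMod R Y" "f \<in> Hom R W Y" "g \<in> Hom R W Y"
 shows "(\<lambda>x\<in>carrier W. f x \<oplus>\<^sub>Y g x) \<in> Hom R W Y"
proof -
 interpret f: lhom R W Y f using assms by (intro lhomI)
 interpret g: lhom R W Y g using assms by (intro lhomI)
 show ?thesis using assms(1)
  by (rule Hom_restrictI) (auto simp: f.Y.smult_r_distr f.Y.M.a_ac)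
qed

lemma Hom_neg:
 assumes "LMod R W" "LMod R Y" "f \<in> Hom R W Y"
 shows "(\<lambda>x\<in>carrier W. \<ominus>\<^sub>Y f x) \<in> Hom R W Y"
proof -
 interpret f: lhom R W Y f using assms by (intro lhomI)
 show ?thesis using assms(1)
  by (rule Hom_restrictI) (auto simp: f.Y.smult_neg_right f.Y.M.minus_add f.Y.M.a_comm)
qed

lemma Hom_minus:
 assumes "LMod R W" "LMod R Y" "f \<in> Hom R W Y" "g \<in> Hom R W Y"
 shows "(\<lambda>x\<in>carrier W. f x \<ominus>\<^sub>Y g x) \<in> Hom R W Y"
proof -
 have "(\<lambda>x\<in>carrier W. f x \<oplus>\<^sub>Y (\<lambda>x\<in>carrier W. \<ominus>\<^sub>Y g x) x) \<in> Hom R W Y"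
  using assms by (intro Hom_plus Hom_neg)
 then show ?thesis by (simp add: a_minus_def cong: restrict_cong)
qed

lemma Hom_finsum:
 assumes "LMod R W" "LMod R Y" "finite I" "\<And>i. i \<in> I \<Longrightarrow> f i \<in> Hom R W Y"
 shows "(\<lambda>x\<in>carrier W. finsum Y (\<lambda>i. f i x) I) \<in> Hom R W Y"
proof -
 interpret W: left_module R W by fact
 interpret Y: left_module R Y by fact
 have c: "(\<lambda>i. f i x) \<in> I \<rightarrow> carrier Y" if "x \<in> carrier W" for x
  using that assms(4) by (auto intro: Hom_closed)
 show ?thesis using assms(1)
 proof (rule Hom_restrictI)
  fix x y assume xy: "x \<in> carrier W" "y \<in> carrier W"
  have "finsum Y (\<lambda>i. f i (x \<oplus>\<^sub>W y)) I = finsum Y (\<lambda>i. f i x \<oplus>\<^sub>Y f i y) I"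
   using xy c assms(4) by (intro Y.M.finsum_cong') (auto simp: Hom_add[OF assms(4)] Pi_iff)
  then show "finsum Y (\<lambda>i. f i (x \<oplus>\<^sub>W y)) I = finsum Y (\<lambda>i. f i x) I \<oplus>\<^sub>Y finsum Y (\<lambda>i. f i y) I"
   using c xy by (simp add: Y.M.finsum_addf)
 next
  fix r x assume x: "r \<in> carrier R" "x \<in> carrier W"
  have "finsum Y (\<lambda>i. f i (r \<odot>\<^sub>W x)) I = finsum Y (\<lambda>i. r \<odot>\<^sub>Y f i x) I"
   using x c assms(4) by (intro Y.M.finsum_cong') (auto simp: Hom_smult[OF assms(4)] Pi_iff)
  then show "finsum Y (\<lambda>i. f i (r \<odot>\<^sub>W x)) I = r \<odot>\<^sub>Y finsum Y (\<lambda>i. f i x) I"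
   using c[of x] x assms by (simp add: Y.smult_finsum)
 qed (use c in \<open>auto intro: Y.M.finsum_closed\<close>)
qed

lemma Hom_inv:
 assumes "LMod R M" "LMod R N" "f \<in> Hom R M N" "bij_betw f (carrier M) (carrier N)"
 obtains g where "g \<in> Hom R N M" "\<And>x. x \<in> carrier M \<Longrightarrow> g (f x) = x"
  "\<And>y. y \<in> carrier N \<Longrightarrow> f (g y) = y"
proof
 interpret f: lhom R M N f using assms by (intro lhomI)
 define h where "h = the_inv_into (carrier M) f"
 have inj: "inj_on f (carrier M)" and im: "f ` carrier M = carrier N"
  using assms(4) by (auto simp: bij_betw_def)
 have 1: "h (f x) = x" if "x \<in> carrier M" for x
  using inj that by (simp add: h_def the_inv_into_f_f)
 have 2: "f (h y) = y" "h y \<in> carrier M" if "y \<in> carrier N" for y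
  using that inj im by (auto simp: h_def f_the_inv_into_f the_inv_into_into)
 show "(\<lambda>y\<in>carrier N. h y) \<in> Hom R N M" using assms(2)
 proof (rule Hom_restrictI)
  fix x y assume "x \<in> carrier N" "y \<in> carrier N"
  then show "h (x \<oplus>\<^sub>N y) = h x \<oplus>\<^sub>M h y"
   using 1[of "h x \<oplus>\<^sub>M h y"] 2 by simp
 next
  fix r x assume "r \<in> carrier R" "x \<in> carrier N"
  then show "h (r \<odot>\<^sub>N x) = r \<odot>\<^sub>M h x"
   using 1[of "r \<odot>\<^sub>M h x"] 2 by simp
 qed (use 2 in auto)
 show "(\<lambda>y\<in>carrier N. h y) (f x) = x" if "x \<in> carrier M" for x using 1 that by simp
 show "f ((\<lambda>y\<in>carrier N. h y) y) = y" if "y \<in> carrier N" for y using 2 that by simp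
qed

text \<open>The factor module is realised on a set of representatives, which keeps the type.\<close>

lemma quotient_module_exists:
 fixes M :: "('r, 'm) module"
 assumes "LMod R M" "submodule N R M"
 obtains Q :: "('r, 'm) module" and q where "LMod R Q" "q \<in> Hom R M Q"
  "q ` carrier M = carrier Q" "\<And>x. x \<in> carrier M \<Longrightarrow> q x = \<zero>\<^sub>Q \<longleftrightarrow> x \<in> N"
proof -
 interpret left_module R M by fact
 note N = submoduleD[OF assms(2)]
 define rep where "rep x = (SOME y. y \<in> carrier M \<and> y \<ominus>\<^sub>M x \<in> N)" for x
 have rep: "rep x \<in> carrier M" "rep x \<ominus>\<^sub>M x \<in> N" if "x \<in> carrier M" for x
 proof -
  have "\<exists>y. y \<in> carrier M \<and> y \<ominus>\<^sub>M x \<in> N"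
   using that N by (intro exI[of _ x]) (auto simp: M.r_neg a_minus_def)
  then show "rep x \<in> carrier M" "rep x \<ominus>\<^sub>M x \<in> N"
   unfolding rep_def by (metis (mono_tags, lifting) someI_ex)+
 qed
 have eq: "rep x = rep y" if "x \<in> carrier M" "y \<in> carrier M" "x \<ominus>\<^sub>M y \<in> N" for x y
 proof -
  have "z \<ominus>\<^sub>M x \<in> N \<longleftrightarrow> z \<ominus>\<^sub>M y \<in> N" if "z \<in> carrier M" for z
  proof
   assume "z \<ominus>\<^sub>M x \<in> N"
   then have "(z \<ominus>\<^sub>M x) \<oplus>\<^sub>M (x \<ominus>\<^sub>M y) \<in> N" using N(3) \<open>x \<ominus>\<^sub>M y \<in> N\<close> by blast
   moreover have "(z \<ominus>\<^sub>M x) \<oplus>\<^sub>M (x \<ominus>\<^sub>M y) = z \<ominus>\<^sub>M y"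
    using \<open>x \<in> carrier M\<close> \<open>y \<in> carrier M\<close> that by (simp add: a_minus_def M.a_ac M.add_cancel)
   ultimately show "z \<ominus>\<^sub>M y \<in> N" by simp
  next
   assume "z \<ominus>\<^sub>M y \<in> N"
   then have "(z \<ominus>\<^sub>M y) \<ominus>\<^sub>M (x \<ominus>\<^sub>M y) \<in> N" using N(6) \<open>x \<ominus>\<^sub>M y \<in> N\<close> by blast
   moreover have "(z \<ominus>\<^sub>M y) \<ominus>\<^sub>M (x \<ominus>\<^sub>M y) = z \<ominus>\<^sub>M x"
    using \<open>x \<in> carrier M\<close> \<open>y \<in> carrier M\<close> that
    by (simp add: a_minus_def M.minus_add M.a_ac M.add_cancel)
   ultimately show "z \<ominus>\<^sub>M x \<in> N" by simp
  qed
  \<comment> \<open>The two predicates under \<open>SOME\<close> coincide, hence so do the chosen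
    elements; this is why \<open>rep\<close> is constant on cosets.\<close>
  then have "(\<lambda>z. z \<in> carrier M \<and> z \<ominus>\<^sub>M x \<in> N) = (\<lambda>z. z \<in> carrier M \<and> z \<ominus>\<^sub>M y \<in> N)" by auto
  then show ?thesis by (simp add: rep_def)
 qed
 \<comment> \<open>This rule and its variants below remove inner occurrences of \<open>rep\<close>,
   after which the module laws of \<open>Q\<close> reduce to those of \<open>M\<close>.\<close>
 have radd1: "rep (rep x \<oplus>\<^sub>M y) = rep (x \<oplus>\<^sub>M y)" if "x \<in> carrier M" "y \<in> carrier M" for x y
 proof (rule eq)
  have "(rep x \<oplus>\<^sub>M y) \<ominus>\<^sub>M (x \<oplus>\<^sub>M y) = rep x \<ominus>\<^sub>M x"
   using that rep by (simp add: a_minus_def M.minus_add M.a_ac M.add_cancel)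
  then show "(rep x \<oplus>\<^sub>M y) \<ominus>\<^sub>M (x \<oplus>\<^sub>M y) \<in> N" using rep that by simp
 qed (use rep that in auto)
 have radd2: "rep (y \<oplus>\<^sub>M rep x) = rep (y \<oplus>\<^sub>M x)" if "x \<in> carrier M" "y \<in> carrier M" for x y
  using radd1[of x y] that rep by (simp add: M.a_comm)
 have radd3: "rep (x \<oplus>\<^sub>M (y \<oplus>\<^sub>M rep z)) = rep (x \<oplus>\<^sub>M (y \<oplus>\<^sub>M z))"
  "rep (x \<oplus>\<^sub>M (rep z \<oplus>\<^sub>M y)) = rep (x \<oplus>\<^sub>M (y \<oplus>\<^sub>M z))"
  if "x \<in> carrier M" "y \<in> carrier M" "z \<in> carrier M" for x y z
  using radd2[of z "x \<oplus>\<^sub>M y"] that rep by (simp_all add: M.a_assoc M.a_comm[of "rep z" y])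
 have rsm: "rep (r \<odot>\<^sub>M rep x) = rep (r \<odot>\<^sub>M x)" if "r \<in> carrier R" "x \<in> carrier M" for r x
 proof (rule eq)
  have "(r \<odot>\<^sub>M rep x) \<ominus>\<^sub>M (r \<odot>\<^sub>M x) = r \<odot>\<^sub>M (rep x \<ominus>\<^sub>M x)"
   using that rep by (simp add: a_minus_def smult_r_distr smult_neg_right)
  then show "(r \<odot>\<^sub>M rep x) \<ominus>\<^sub>M (r \<odot>\<^sub>M x) \<in> N" using rep that N by simp
 qed (use rep that in auto)
 have rsm2: "rep (a \<odot>\<^sub>M rep x \<oplus>\<^sub>M b \<odot>\<^sub>M rep x) = rep (a \<odot>\<^sub>M x \<oplus>\<^sub>M b \<odot>\<^sub>M x)"
  "rep (a \<odot>\<^sub>M (b \<odot>\<^sub>M rep x)) = rep (a \<odot>\<^sub>M (b \<odot>\<^sub>M x))"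
  if "a \<in> carrier R" "b \<in> carrier R" "x \<in> carrier M" for a b x
  using rsm[of "a \<oplus>\<^sub>R b" x] rsm[of "a \<otimes>\<^sub>R b" x] that rep
  by (simp_all add: smult_l_distr smult_assoc)
 have rr: "rep (rep x) = rep x" if "x \<in> carrier M" for x
  using that rep by (intro eq) auto
 define Q :: "('r, 'm) module" where
  "Q = \<lparr>carrier = rep ` carrier M, monoid.mult = undefined, one = undefined,
     ring.zero = rep \<zero>\<^sub>M, ring.add = (\<lambda>x y. rep (x \<oplus>\<^sub>M y)), smult = (\<lambda>r x. rep (r \<odot>\<^sub>M x))\<rparr>"
 have "abelian_group Q"
 proof (rule abelian_groupI)
  fix x assume "x \<in> carrier Q"
  then obtain y where y: "y \<in> carrier M" "x = rep y" by (auto simp: Q_def)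
  then show "\<exists>z\<in>carrier Q. z \<oplus>\<^sub>Q x = \<zero>\<^sub>Q"
   by (intro bexI[of _ "rep (\<ominus>\<^sub>M y)"]) (auto simp: Q_def radd1 radd2 rep M.l_neg)
 qed (auto simp: Q_def radd1 radd2 radd3 rep M.a_ac rr)
 then have lm: "LMod R Q"
  by (intro left_module.intro left_module_axioms.intro R.ring_axioms)
    (auto simp: Q_def radd1 radd2 rep rsm rsm2 rr smult_l_distr smult_r_distr smult_assoc)
 have "q0 \<in> Hom R M Q" if "q0 = (\<lambda>x\<in>carrier M. rep x)" for q0
  unfolding that by (rule Hom_restrictI[OF assms(1)]) (auto simp: Q_def radd1 radd2 rep rsm)
 moreover have "rep x = rep \<zero>\<^sub>M \<longleftrightarrow> x \<in> N" if x: "x \<in> carrier M" for x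
 proof
  assume "rep x = rep \<zero>\<^sub>M"
  then have "rep x \<ominus>\<^sub>M x \<in> N" "rep x \<in> N" using rep[of x] rep[of "\<zero>\<^sub>M"] x M.minus_equality[of "\<zero>\<^sub>M" "\<zero>\<^sub>M"] by (auto simp: a_minus_def)
  then have "rep x \<ominus>\<^sub>M (rep x \<ominus>\<^sub>M x) \<in> N" using N by simp
  then show "x \<in> N" using x rep by (simp add: a_minus_def M.minus_add M.a_ac M.add_cancel)
 next
  assume "x \<in> N" then show "rep x = rep \<zero>\<^sub>M" using x by (intro eq) (auto simp: a_minus_def M.minus_equality[of "\<zero>\<^sub>M" "\<zero>\<^sub>M"])
 qed
 ultimately show ?thesis
  using lm that[of Q "\<lambda>x\<in>carrier M. rep x"] by (simp add: Q_def)
qed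

text \<open>The universal property of a cokernel. Two preimages of a point differ by an element of
  the kernel of \<open>p\<close>, which \<open>f\<close> annihilates, so it does not matter which
  preimages \<open>inv_into\<close> chooses.\<close>

lemma Hom_factor:
 assumes "LMod R W" "LMod R Y" "LMod R Z" "p \<in> Hom R W Y" "f \<in> Hom R W Z"
  and "p ` carrier W = carrier Y" "\<And>x. x \<in> carrier W \<Longrightarrow> p x = \<zero>\<^sub>Y \<Longrightarrow> f x = \<zero>\<^sub>Z"
 obtains h where "h \<in> Hom R Y Z" "\<And>x. x \<in> carrier W \<Longrightarrow> h (p x) = f x"
proof
 interpret p: lhom R W Y p using assms by (intro lhomI)
 interpret f: lhom R W Z f using assms by (intro lhomI)
 define h where "h y = f (inv_into (carrier W) p y)" for y
 have h: "h (p x) = f x" if x: "x \<in> carrier W" for x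
 proof -
  define x' where "x' = inv_into (carrier W) p (p x)"
  have x': "x' \<in> carrier W" "p x' = p x"
   using x by (auto simp: x'_def inv_into_into f_inv_into_f)
  then have "p (x' \<ominus>\<^sub>W x) = \<zero>\<^sub>Y" using x by (simp add: a_minus_def p.Y.M.r_neg)
  then have "f (x' \<ominus>\<^sub>W x) = \<zero>\<^sub>Z" using assms(7) x x' by simp
  then show ?thesis using x x' by (simp add: h_def f.Y.M.minus_eq_zero_iff flip: x'_def)
 qed
 have s: "\<exists>x\<in>carrier W. y = p x" if "y \<in> carrier Y" for y using that assms(6) by blast
 show "(\<lambda>y\<in>carrier Y. h y) \<in> Hom R Y Z"
  using assms(2)
 proof (rule Hom_restrictI)
  fix x assume "x \<in> carrier Y" then show "h x \<in> carrier Z" using s[of x] h by auto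
 next
  fix x y assume "x \<in> carrier Y" "y \<in> carrier Y"
  then obtain x' y' where "x' \<in> carrier W" "y' \<in> carrier W" "x = p x'" "y = p y'" using s by metis
  then show "h (x \<oplus>\<^sub>Y y) = h x \<oplus>\<^sub>Z h y" using h by (simp flip: p.add)
 next
  fix r x assume "r \<in> carrier R" "x \<in> carrier Y"
  then obtain x' where "r \<in> carrier R" "x' \<in> carrier W" "x = p x'" using s by metis
  then show "h (r \<odot>\<^sub>Y x) = r \<odot>\<^sub>Z h x" using h by (simp flip: p.smult)
 qed
 show "(\<lambda>y\<in>carrier Y. h y) (p x) = f x" if "x \<in> carrier W" for x using h that by simp
qed

text \<open>Several structures below have the additive group of a product or of \<open>star\<close>
  but are different records; the group laws are transferred instead of being proved again for each
  of them.\<close>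

lemma abelian_group_cong:
 assumes "abelian_group M" "carrier N = carrier M" "\<zero>\<^sub>N = \<zero>\<^sub>M"
  and "\<And>x y. x \<in> carrier M \<Longrightarrow> y \<in> carrier M \<Longrightarrow> x \<oplus>\<^sub>N y = x \<oplus>\<^sub>M y"
 shows "abelian_group N"
proof -
 interpret M: abelian_group M by fact
 show ?thesis
 proof (rule abelian_groupI)
  fix x assume "x \<in> carrier N"
  then show "\<exists>y\<in>carrier N. y \<oplus>\<^sub>N x = \<zero>\<^sub>N"
   using assms(2-4) by (intro bexI[of _ "\<ominus>\<^sub>M x"]) (simp_all add: M.l_neg)
 qed (use assms(2-4) in \<open>auto simp: M.a_ac\<close>)
qed

text \<open>\<open>Hom(C, M)\<close> as a left module over \<open>End_ring R M\<close>, which acts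
  by composition; it is contravariant in \<open>C\<close>. Its additive group also serves for
  endomorphism rings and coinduced modules.\<close>

definition star :: "('r, 'x) ring_scheme \<Rightarrow> ('r, 'm) module \<Rightarrow> ('r, 'c, 'y) module_scheme \<Rightarrow> ('m \<Rightarrow> 'm, 'c \<Rightarrow> 'm) module" where
 "star R M C = \<lparr>carrier = Hom R C M, monoid.mult = undefined, one = undefined,
   ring.zero = (\<lambda>x\<in>carrier C. \<zero>\<^sub>M), ring.add = (\<lambda>f g. \<lambda>x\<in>carrier C. f x \<oplus>\<^sub>M g x),
   smult = (\<lambda>\<gamma> f. \<lambda>x\<in>carrier C. \<gamma> (f x))\<rparr>"

lemma star_simps [simp]: "carrier (star R M C) = Hom R C M" "\<zero>\<^bsub>star R M C\<^esub> = (\<lambda>x\<in>carrier C. \<zero>\<^sub>M)"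
 "f \<oplus>\<^bsub>star R M C\<^esub> g = (\<lambda>x\<in>carrier C. f x \<oplus>\<^sub>M g x)" "\<gamma> \<odot>\<^bsub>star R M C\<^esub> f = (\<lambda>x\<in>carrier C. \<gamma> (f x))"
 by (simp_all add: star_def)

lemma star_abelian_group:
 assumes "LMod R C" "LMod R M" shows "abelian_group (star R M C)"
proof -
 interpret M: left_module R M by fact
 have c: "f x \<in> carrier M" if "f \<in> Hom R C M" "x \<in> carrier C" for f x using that by (rule Hom_closed)
 show ?thesis
 proof (rule abelian_groupI)
  show "\<zero>\<^bsub>star R M C\<^esub> \<in> carrier (star R M C)" using Hom_zero[OF assms] by simp
  fix f assume f: "f \<in> carrier (star R M C)"
  then have f': "f \<in> Hom R C M" by simp
  have "\<zero>\<^bsub>star R M C\<^esub> \<oplus>\<^bsub>star R M C\<^esub> f = (\<lambda>x\<in>carrier C. f x)" using c[OF f'] by (auto simp: fun_eq_iff)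
  then show "\<zero>\<^bsub>star R M C\<^esub> \<oplus>\<^bsub>star R M C\<^esub> f = f" using Hom_restrict_self[OF f'] by simp
  show "\<exists>g\<in>carrier (star R M C). g \<oplus>\<^bsub>star R M C\<^esub> f = \<zero>\<^bsub>star R M C\<^esub>"
   using Hom_neg[OF assms f'] c[OF f'] by (intro bexI[of _ "\<lambda>x\<in>carrier C. \<ominus>\<^sub>M f x"]) (auto simp: fun_eq_iff M.M.l_neg)
  fix g assume "g \<in> carrier (star R M C)"
  then have g': "g \<in> Hom R C M" by simp
  show "f \<oplus>\<^bsub>star R M C\<^esub> g \<in> carrier (star R M C)" using Hom_plus[OF assms f' g'] by simp
  show "f \<oplus>\<^bsub>star R M C\<^esub> g = g \<oplus>\<^bsub>star R M C\<^esub> f" using c[OF f'] c[OF g'] by (auto simp: fun_eq_iff M.M.a_comm)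
  fix h assume "h \<in> carrier (star R M C)"
  then have h': "h \<in> Hom R C M" by simp
  show "f \<oplus>\<^bsub>star R M C\<^esub> g \<oplus>\<^bsub>star R M C\<^esub> h = f \<oplus>\<^bsub>star R M C\<^esub> (g \<oplus>\<^bsub>star R M C\<^esub> h)"
   using c[OF f'] c[OF g'] c[OF h'] by (auto simp: fun_eq_iff M.M.a_assoc)
 qed
qed

section \<open>Generators\<close>

text \<open>Linear combinations grow by one multiple at a time, so that properties of spans follow
  by rule induction instead of by handling coefficient functions on finite sets.\<close>

inductive_set lspan :: "('r, 'x) ring_scheme \<Rightarrow> ('r, 'm, 'y) module_scheme \<Rightarrow> 'm set \<Rightarrow> 'm set"
 for R :: "('r, 'x) ring_scheme" and M :: "('r, 'm, 'y) module_scheme" and S :: "'m set" where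
 zero: "\<zero>\<^sub>M \<in> lspan R M S"
| step: "r \<in> carrier R \<Longrightarrow> s \<in> S \<Longrightarrow> x \<in> lspan R M S \<Longrightarrow> r \<odot>\<^sub>M s \<oplus>\<^sub>M x \<in> lspan R M S"

lemma lspan_mono: "S \<subseteq> T \<Longrightarrow> lspan R M S \<subseteq> lspan R M T"
proof
 fix x assume "x \<in> lspan R M S" "S \<subseteq> T"
 then show "x \<in> lspan R M T" by induction (auto intro: lspan.intros)
qed

text \<open>A span is formed from the operations alone, so generators of a submodule may be sought
  inside the ambient module.\<close>

lemma lspan_carrier_update: "lspan R (M\<lparr>carrier := N\<rparr>) S = lspan R M S"
proof
 show "lspan R (M\<lparr>carrier := N\<rparr>) S \<subseteq> lspan R M S"
 proof
  fix x assume "x \<in> lspan R (M\<lparr>carrier := N\<rparr>) S"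
  then show "x \<in> lspan R M S" by induction (auto intro: lspan.intros)
 qed
 show "lspan R M S \<subseteq> lspan R (M\<lparr>carrier := N\<rparr>) S"
 proof
  fix x assume "x \<in> lspan R M S"
  then show "x \<in> lspan R (M\<lparr>carrier := N\<rparr>) S"
  proof induction
   case zero show ?case using lspan.zero[of "M\<lparr>carrier := N\<rparr>" R S] by simp
  next
   case (step r s x)
   then show ?case using lspan.step[of r R s S x "M\<lparr>carrier := N\<rparr>"] by simp
  qed
 qed
qed

context left_module
begin
lemma lspan_closed: "S \<subseteq> carrier M \<Longrightarrow> x \<in> lspan R M S \<Longrightarrow> x \<in> carrier M"
 by (erule lspan.induct) auto

lemma lspan_add:
 assumes "S \<subseteq> carrier M" "x \<in> lspan R M S" "y \<in> lspan R M S"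
 shows "x \<oplus>\<^sub>M y \<in> lspan R M S"
 using assms(2)
proof induction
 case zero show ?case using assms lspan_closed by simp
next
 case (step r s x)
 have "r \<odot>\<^sub>M s \<oplus>\<^sub>M (x \<oplus>\<^sub>M y) \<in> lspan R M S" using step by (intro lspan.step)
 moreover have "s \<in> carrier M" using step assms by auto
 ultimately show ?case using step assms(1,3) lspan_closed by (simp add: M.a_assoc)
qed

lemma lspan_smult:
 assumes "S \<subseteq> carrier M" "x \<in> lspan R M S" "a \<in> carrier R"
 shows "a \<odot>\<^sub>M x \<in> lspan R M S"
 using assms(2)
proof induction
 case zero show ?case using assms by (simp add: lspan.zero)
next
 case (step r s x)
 have "(a \<otimes>\<^sub>R r) \<odot>\<^sub>M s \<oplus>\<^sub>M a \<odot>\<^sub>M x \<in> lspan R M S"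
  using step assms by (intro lspan.step) auto
 moreover have "s \<in> carrier M" using step assms by auto
 ultimately show ?case using step assms(1,3) lspan_closed by (simp add: smult_r_distr smult_assoc)
qed

lemma lspan_submodule: "S \<subseteq> carrier M \<Longrightarrow> submodule (lspan R M S) R M"
 by (rule submoduleI) (auto intro: lspan_closed lspan_add lspan_smult lspan.zero)

lemma lspan_incl: assumes "S \<subseteq> carrier M" "s \<in> S" shows "s \<in> lspan R M S"
 using lspan.step[of "\<one>\<^sub>R" R s S "\<zero>\<^sub>M" M] assms by (auto simp: lspan.zero subsetD)

lemma lspan_subset_submodule:
 assumes "submodule N R M" "S \<subseteq> N" shows "lspan R M S \<subseteq> N"
proof
 note N = submoduleD[OF assms(1)]
 fix x assume "x \<in> lspan R M S"
 then show "x \<in> N" using assms(2) N by induction auto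
qed

lemma lspan_insertE:
 assumes "x \<in> lspan R M (insert s S)" "insert s S \<subseteq> carrier M"
 obtains r t where "r \<in> carrier R" "t \<in> lspan R M S" "x = r \<odot>\<^sub>M s \<oplus>\<^sub>M t"
proof -
 have "\<exists>r\<in>carrier R. \<exists>t\<in>lspan R M S. x = r \<odot>\<^sub>M s \<oplus>\<^sub>M t"
  using assms(1)
 proof induction
  case zero
  show ?case using assms(2) by (intro bexI[of _ "\<zero>\<^sub>R"] bexI[of _ "\<zero>\<^sub>M"]) (auto simp: lspan.zero)
 next
  case (step a u x)
  then obtain r t where rt: "r \<in> carrier R" "t \<in> lspan R M S" "x = r \<odot>\<^sub>M s \<oplus>\<^sub>M t" by auto
  have c: "t \<in> carrier M" "s \<in> carrier M" "u \<in> carrier M"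
   using rt step assms(2) lspan_closed by auto
  show ?case
  \<comment> \<open>The generator \<open>s\<close> may be used in several steps of the derivation;
    its coefficients are gathered into one.\<close>
  proof (cases "u = s")
   case True
   then show ?thesis using rt step c
    by (intro bexI[of _ "a \<oplus>\<^sub>R r"] bexI[of _ t]) (auto simp: smult_l_distr M.a_assoc)
  next
   case False
   then have "a \<odot>\<^sub>M u \<oplus>\<^sub>M t \<in> lspan R M S" using step rt by (auto intro: lspan.step)
   then show ?thesis using rt step c
    by (intro bexI[of _ r] bexI[of _ "a \<odot>\<^sub>M u \<oplus>\<^sub>M t"]) (auto simp: M.a_ac)
  qed
 qed
 then show ?thesis using that by blast
qed

lemma lspan_eq_finsum:
 assumes "finite S" "S \<subseteq> carrier M" "x \<in> lspan R M S"
 obtains c where "c \<in> S \<rightarrow> carrier R" "x = finsum M (\<lambda>s. c s \<odot>\<^sub>M s) S"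
proof -
 have "\<exists>c\<in>S \<rightarrow> carrier R. x = finsum M (\<lambda>s. c s \<odot>\<^sub>M s) S"
  using assms
 proof (induction S arbitrary: x rule: finite_induct)
  case empty
  then have "x = \<zero>\<^sub>M" by (auto elim: lspan.cases)
  then show ?case by simp
 next
  case (insert s S)
  obtain r t where rt: "r \<in> carrier R" "t \<in> lspan R M S" "x = r \<odot>\<^sub>M s \<oplus>\<^sub>M t"
   using lspan_insertE[OF insert.prems(2,1)] by metis
  obtain c where c: "c \<in> S \<rightarrow> carrier R" "t = finsum M (\<lambda>s. c s \<odot>\<^sub>M s) S"
   using insert rt by auto
  have cc: "c u \<odot>\<^sub>M u \<in> carrier M" if "u \<in> S" for u
   using Pi_mem[OF c(1) that] insert.prems(1) that by auto
  have "finsum M (\<lambda>u. (if u = s then r else c u) \<odot>\<^sub>M u) (insert s S)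
   = r \<odot>\<^sub>M s \<oplus>\<^sub>M finsum M (\<lambda>u. (if u = s then r else c u) \<odot>\<^sub>M u) S"
   using insert rt(1) by (subst M.finsum_insert) (auto simp: cc)
  also have "finsum M (\<lambda>u. (if u = s then r else c u) \<odot>\<^sub>M u) S = t"
   unfolding c(2) using insert by (intro M.finsum_cong') (auto simp: cc)
  finally show ?case
   using rt c(1) by (intro bexI[of _ "\<lambda>u. if u = s then r else c u"]) auto
 qed
 then show ?thesis using that by blast
qed

lemma finsum_in_submodule:
 assumes "submodule N R M" "finite I" "f \<in> I \<rightarrow> N"
 shows "finsum M f I \<in> N"
 using assms(2,3)
proof (induction rule: finite_induct)
 case (insert i I)
 then have "f \<in> I \<rightarrow> carrier M" "f i \<in> carrier M" using submoduleD(1)[OF assms(1)] by auto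
 then show ?case using insert submoduleD(3)[OF assms(1)] by simp
qed (use submoduleD[OF assms(1)] in simp)

text \<open>The bridge from the coefficient functions of \<open>fin_gen\<close> to spans, through
  which finite generation is handled from here on.\<close>

lemma fin_gen_iff: "fin_gen R M \<longleftrightarrow> (\<exists>S. finite S \<and> S \<subseteq> carrier M \<and> carrier M \<subseteq> lspan R M S)"
proof
 assume "fin_gen R M"
 then obtain S where S: "finite S" "S \<subseteq> carrier M"
  "\<And>x. x \<in> carrier M \<Longrightarrow> \<exists>c\<in>S \<rightarrow> carrier R. x = finsum M (\<lambda>s. c s \<odot>\<^sub>M s) S"
  unfolding fin_gen_def by auto
 have "x \<in> lspan R M S" if "x \<in> carrier M" for x
 proof -
  from S(3)[OF that] obtain c where c: "c \<in> S \<rightarrow> carrier R" "x = finsum M (\<lambda>s. c s \<odot>\<^sub>M s) S" ..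
  show ?thesis unfolding c(2)
   using S(1,2) Pi_mem[OF c(1)] by (intro finsum_in_submodule lspan_submodule Pi_I lspan_smult lspan_incl)
 qed
 then show "\<exists>S. finite S \<and> S \<subseteq> carrier M \<and> carrier M \<subseteq> lspan R M S" using S by blast
next
 assume "\<exists>S. finite S \<and> S \<subseteq> carrier M \<and> carrier M \<subseteq> lspan R M S"
 then obtain S where S: "finite S" "S \<subseteq> carrier M" "carrier M \<subseteq> lspan R M S" by blast
 have "\<exists>c\<in>S \<rightarrow> carrier R. x = finsum M (\<lambda>s. c s \<odot>\<^sub>M s) S" if "x \<in> carrier M" for x
  using lspan_eq_finsum[OF S(1,2) subsetD[OF S(3) that]] by metis
 then show "fin_gen R M" unfolding fin_gen_def using S(1,2) by blast
qed

lemma fin_gen_image: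
 assumes "LMod R N" "f \<in> Hom R M N" "f ` carrier M = carrier N" "fin_gen R M"
 shows "fin_gen R N"
proof -
 interpret f: lhom R M N f using assms by (intro lhomI left_module_axioms)
 obtain S where S: "finite S" "S \<subseteq> carrier M" "carrier M \<subseteq> lspan R M S" using assms(4) fin_gen_iff by auto
 have "f x \<in> lspan R N (f ` S)" if "x \<in> lspan R M S" for x
  using that
 proof induction
  case (step r s x)
  then have "s \<in> carrier M" "x \<in> carrier M" using S lspan_closed by auto
  then show ?case using step by (auto intro!: lspan.step)
 qed (simp add: lspan.zero)
 then have "carrier N \<subseteq> lspan R N (f ` S)" unfolding assms(3)[symmetric] using S(3) by blast
 moreover have "finite (f ` S)" "f ` S \<subseteq> carrier N" using S by auto
 ultimately show ?thesis using f.Y.fin_gen_iff by blast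
qed

lemma zero_submodule_fin_gen: "fin_gen R (M\<lparr>carrier := {\<zero>\<^sub>M}\<rparr>)" "submodule {\<zero>\<^sub>M} R M"
proof -
 show s: "submodule {\<zero>\<^sub>M} R M" by (rule submoduleI) auto
 interpret N: left_module R "M\<lparr>carrier := {\<zero>\<^sub>M}\<rparr>" using s by (rule submodule_left_module)
 show "fin_gen R (M\<lparr>carrier := {\<zero>\<^sub>M}\<rparr>)"
  unfolding N.fin_gen_iff lspan_carrier_update by (intro exI[of _ "{}"]) (auto intro: lspan.zero)
qed

end

text \<open>It makes evaluation at a finite generating set injective on homomorphisms, which embeds
  spaces of homomorphisms in finite powers. The dimensions of \<open>coinduced\<close> and of
  \<open>star\<close> are bounded in this way.\<close>

lemma hom_eq_on_generators:
 assumes "LMod R W" "LMod R Y" "f \<in> Hom R W Y" "g \<in> Hom R W Y"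
  and S: "S \<subseteq> carrier W" "carrier W \<subseteq> lspan R W S" "\<And>s. s \<in> S \<Longrightarrow> f s = g s"
 shows "f = g"
proof -
 interpret f: lhom R W Y f using assms(1-3) by (rule lhomI)
 interpret g: lhom R W Y g using assms(1,2,4) by (rule lhomI)
 have "f x = g x" if "x \<in> lspan R W S" for x
  using that
 proof induction
  case zero show ?case using f.zero g.zero by simp
 next
  case (step c s b)
  then have "s \<in> carrier W" "b \<in> carrier W" using S(1) f.W.lspan_closed[of S b] by auto
  then show ?case using step S(3)[of s] f.W.smult_closed[OF step(1)] by (simp only: f.add g.add f.smult g.smult)
 qed
 then show ?thesis using S(2) by (intro Hom_eqI[OF assms(3,4)]) blast
qed

section \<open>Copies of modules in other types\<close>

lemma fin_gen_copy_iso: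
 fixes R :: "('r, 'x) ring_scheme" and M :: "('r, 'm, 'y) module_scheme"
 assumes "LMod R M" "fin_gen R M"
 obtains N :: "'r lmod" and f g where "LMod R N" "fin_gen R N" "f \<in> Hom R M N" "g \<in> Hom R N M"
  "\<And>x. x \<in> carrier M \<Longrightarrow> g (f x) = x" "\<And>y. y \<in> carrier N \<Longrightarrow> f (g y) = y"
proof -
 obtain N :: "'r lmod" and f where N: "LMod R N" "f \<in> Hom R M N" "bij_betw f (carrier M) (carrier N)"
  using fin_gen_copy[OF assms] unfolding mod_iso_def by blast
 moreover have "fin_gen R N"
  using left_module.fin_gen_image[OF assms(1) N(1,2)] N(3) assms(2) by (simp add: bij_betw_def)
 moreover obtain g where "g \<in> Hom R N M" "\<And>x. x \<in> carrier M \<Longrightarrow> g (f x) = x"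
  "\<And>y. y \<in> carrier N \<Longrightarrow> f (g y) = y"
  using Hom_inv[OF assms(1) N] by metis
 ultimately show ?thesis using that by blast
qed

text \<open>Transport of structure. It complements \<open>fin_gen_copy\<close>, which does not cover
  left ideals of an arbitrary ring, as these may fail to be finitely generated; Baer's criterion
  needs copies of all of them.\<close>

lemma copy_along_injection:
 fixes M :: "('r, 'm, 'y) module_scheme" and \<phi> :: "'m \<Rightarrow> 'n"
 assumes "LMod R M" "inj_on \<phi> (carrier M)"
 obtains N :: "('r, 'n) module" and f g where "LMod R N"
  "f \<in> Hom R M N" "g \<in> Hom R N M"
  "\<And>x. x \<in> carrier M \<Longrightarrow> g (f x) = x" "\<And>y. y \<in> carrier N \<Longrightarrow> f (g y) = y"
proof -
 interpret left_module R M by fact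
 define \<psi> where "\<psi> = the_inv_into (carrier M) \<phi>"
 have \<psi>: "\<psi> (\<phi> x) = x" if "x \<in> carrier M" for x
  unfolding \<psi>_def using assms(2) that by (rule the_inv_into_f_f)
 define N :: "('r, 'n) module" where
  "N = \<lparr>carrier = \<phi> ` carrier M, monoid.mult = undefined, one = undefined, ring.zero = \<phi> \<zero>\<^sub>M,
     ring.add = (\<lambda>x y. \<phi> (\<psi> x \<oplus>\<^sub>M \<psi> y)), smult = (\<lambda>r x. \<phi> (r \<odot>\<^sub>M \<psi> x))\<rparr>"
 have "abelian_group N"
 proof (rule abelian_groupI)
  fix x assume "x \<in> carrier N"
  then obtain x' where x': "x' \<in> carrier M" "x = \<phi> x'" by (auto simp: N_def)
  then show "\<exists>y\<in>carrier N. y \<oplus>\<^sub>N x = \<zero>\<^sub>N"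
   by (intro bexI[of _ "\<phi> (\<ominus>\<^sub>M x')"]) (auto simp: N_def \<psi> M.l_neg)
 qed (auto simp: N_def \<psi> M.a_ac)
 then have lm: "LMod R N"
  by (intro left_module.intro left_module_axioms.intro R.ring_axioms)
    (auto simp: N_def \<psi> smult_l_distr smult_r_distr smult_assoc)
 have f: "(\<lambda>x\<in>carrier M. \<phi> x) \<in> Hom R M N"
  by (rule Hom_restrictI[OF assms(1)]) (auto simp: N_def \<psi>)
 have "bij_betw (\<lambda>x\<in>carrier M. \<phi> x) (carrier M) (carrier N)"
  using assms(2) by (auto simp: bij_betw_def N_def)
 then obtain g where "g \<in> Hom R N M" "\<And>x. x \<in> carrier M \<Longrightarrow> g ((\<lambda>x\<in>carrier M. \<phi> x) x) = x"
  "\<And>y. y \<in> carrier N \<Longrightarrow> (\<lambda>x\<in>carrier M. \<phi> x) (g y) = y"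
  using Hom_inv[OF assms(1) lm f] by metis
 then show ?thesis using lm f that[of N] by (simp add: N_def)
qed

lemma regular_left_module: "ring R \<Longrightarrow> LMod R (Reg R)"
proof -
 assume "ring R"
 then interpret ring R .
 have "abelian_group (Reg R)"
  by (rule abelian_groupI)
   (auto simp: regular_module_def a_ac intro!: bexI[of _ "\<ominus>\<^sub>R x" for x] l_neg)
 then show "LMod R (Reg R)"
  by (intro left_module.intro left_module_axioms.intro \<open>ring R\<close>)
   (auto simp: regular_module_def l_distr r_distr m_assoc)
qed

lemma regular_simps [simp]: "carrier (Reg R) = carrier R" "\<zero>\<^bsub>Reg R\<^esub> = \<zero>\<^sub>R"
 "x \<oplus>\<^bsub>Reg R\<^esub> y = x \<oplus>\<^sub>R y" "a \<odot>\<^bsub>Reg R\<^esub> x = a \<otimes>\<^sub>R x"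
 by (auto simp: regular_module_def)

lemma regular_fin_gen: assumes "ring R" shows "fin_gen R (Reg R)"
proof -
 interpret ring R by fact
 interpret L: left_module R "Reg R" using assms by (rule regular_left_module)
 have "x \<in> lspan R (Reg R) {\<one>\<^sub>R}" if "x \<in> carrier R" for x
  using L.lspan_smult[of "{\<one>\<^sub>R}" "\<one>\<^sub>R" x] L.lspan_incl[of "{\<one>\<^sub>R}" "\<one>\<^sub>R"] that by auto
 then show ?thesis unfolding L.fin_gen_iff by (intro exI[of _ "{\<one>\<^sub>R}"]) auto
qed

text \<open>Gaussian elimination, one generator \<open>s\<close> at a time. Either \<open>U\<close>
  lies in the span of the other generators, or some \<open>u0\<close> in \<open>U\<close> has a
  non-zero coefficient at \<open>s\<close>; then subtracting a multiple of \<open>u0\<close> moves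
  any element of \<open>U\<close> into that span.\<close>

lemma field_submodule_lspan:
 assumes "field K" "LMod K V" "finite S" "S \<subseteq> carrier V" "submodule U K V" "U \<subseteq> lspan K V S"
 shows "\<exists>T. finite T \<and> T \<subseteq> U \<and> U \<subseteq> lspan K V T"
proof -
 interpret K: field K by fact
 interpret left_module K V by fact
 show ?thesis using assms(3-)
 proof (induction S arbitrary: U rule: finite_induct)
  case empty
  then show ?case by (intro exI[of _ "{}"]) auto
 next
  case (insert s S)
  note U = submoduleD[OF insert.prems(2)]
  have Sc: "S \<subseteq> carrier V" "s \<in> carrier V" using insert by auto
  note L = submoduleD[OF lspan_submodule[OF Sc(1)]]
  have "submodule (U \<inter> lspan K V S) K V" by (rule submoduleI) (use U L in auto)
  from insert.IH[OF Sc(1) this Int_lower2]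
  obtain T where T: "finite T" "T \<subseteq> U \<inter> lspan K V S" "U \<inter> lspan K V S \<subseteq> lspan K V T"
   by (elim exE conjE)
  show ?case
  proof (cases "U \<subseteq> lspan K V S")
   case True then show ?thesis using T by blast
  next
   case False
   then obtain u0 where u0: "u0 \<in> U" "u0 \<notin> lspan K V S" by auto
   obtain c t0 where c: "c \<in> carrier K" "t0 \<in> lspan K V S" "u0 = c \<odot>\<^sub>V s \<oplus>\<^sub>V t0"
    using lspan_insertE[of u0 s S] u0 insert.prems by blast
   have t0: "t0 \<in> carrier V" using c L by auto
   have "c \<noteq> \<zero>\<^sub>K" using c u0 Sc t0 by auto
   then have ci: "inv\<^bsub>K\<^esub> c \<in> carrier K" "inv\<^bsub>K\<^esub> c \<otimes>\<^sub>K c = \<one>\<^sub>K"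
    using c K.field_Units by (auto intro: K.Units_inv_closed K.Units_l_inv)
   have "u \<in> lspan K V (insert u0 T)" if u: "u \<in> U" for u
   proof -
    obtain d t where d: "d \<in> carrier K" "t \<in> lspan K V S" "u = d \<odot>\<^sub>V s \<oplus>\<^sub>V t"
     using lspan_insertE[of u s S] u insert.prems by blast
    have t: "t \<in> carrier V" using d L by auto
    \<comment> \<open>The multiple \<open>e\<close> of \<open>u0\<close> has the same coefficient at
      \<open>s\<close> as \<open>u\<close>.\<close>
    define e where "e = d \<otimes>\<^sub>K inv\<^bsub>K\<^esub> c"
    have e: "e \<in> carrier K" "e \<otimes>\<^sub>K c = d" using d ci c by (auto simp: e_def K.m_assoc)
    have "e \<odot>\<^sub>V u0 = d \<odot>\<^sub>V s \<oplus>\<^sub>V e \<odot>\<^sub>V t0"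
     using c e Sc t0 by (simp add: smult_r_distr flip: smult_assoc)
    then have "u \<ominus>\<^sub>V e \<odot>\<^sub>V u0 = t \<ominus>\<^sub>V e \<odot>\<^sub>V t0"
     using d t t0 e Sc by (simp add: a_minus_def M.minus_add M.a_ac M.add_cancel)
    moreover have "u \<ominus>\<^sub>V e \<odot>\<^sub>V u0 \<in> U" by (intro U u u0 e)
    moreover have "t \<ominus>\<^sub>V e \<odot>\<^sub>V t0 \<in> lspan K V S" by (intro L d c e)
    ultimately have "u \<ominus>\<^sub>V e \<odot>\<^sub>V u0 \<in> U \<inter> lspan K V S" by simp
    then have "u \<ominus>\<^sub>V e \<odot>\<^sub>V u0 \<in> lspan K V (insert u0 T)"
     using T lspan_mono[of T "insert u0 T"] by auto
    then have "e \<odot>\<^sub>V u0 \<oplus>\<^sub>V (u \<ominus>\<^sub>V e \<odot>\<^sub>V u0) \<in> lspan K V (insert u0 T)"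
     using e by (intro lspan.step) auto
    moreover have "u \<in> carrier V" "u0 \<in> carrier V" using u u0 U by auto
    ultimately show ?thesis using e by (simp add: a_minus_def M.add_cancel)
   qed
   then show ?thesis using T u0 by (intro exI[of _ "insert u0 T"]) auto
  qed
 qed
qed

lemma field_fin_gen_submodule:
 assumes "field K" "LMod K V" "fin_gen K V" "submodule U K V"
 shows "fin_gen K (V\<lparr>carrier := U\<rparr>)"
proof -
 interpret left_module K V by fact
 interpret U: left_module K "V\<lparr>carrier := U\<rparr>" using assms(4) by (rule submodule_left_module)
 obtain S where S: "finite S" "S \<subseteq> carrier V" "carrier V \<subseteq> lspan K V S" using assms(3) fin_gen_iff by auto
 obtain T where "finite T" "T \<subseteq> U" "U \<subseteq> lspan K V T"
  using field_submodule_lspan[OF assms(1,2) S(1,2) assms(4)] S(3) submoduleD(1)[OF assms(4)] by auto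
 then show ?thesis unfolding U.fin_gen_iff lspan_carrier_update by auto
qed

lemma field_fin_gen_inj:
 assumes "field K" "LMod K V" "LMod K V'" "f \<in> Hom K V V'" "inj_on f (carrier V)" "fin_gen K V'"
 shows "fin_gen K V"
proof -
 interpret f: lhom K V V' f using assms by (intro lhomI)
 let ?U = "V'\<lparr>carrier := f ` carrier V\<rparr>"
 have U: "LMod K ?U" using f.range by (rule f.Y.submodule_left_module)
 have f: "f \<in> Hom K V ?U" using assms(4) by (auto simp: mod_hom_def)
 obtain g where g: "g \<in> Hom K ?U V" "\<And>x. x \<in> carrier V \<Longrightarrow> g (f x) = x"
  using Hom_inv[OF assms(2) U f] assms(5) by (simp add: bij_betw_def) metis
 have "g ` carrier ?U = carrier V" using g(2) by (auto simp: image_image)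
 then show ?thesis
  using left_module.fin_gen_image[OF U assms(2) g(1)] field_fin_gen_submodule[OF assms(1,3,6) f.range] by blast
qed

section \<open>Products and restriction of scalars\<close>

text \<open>The index set may have any type: the construction yields powers of \<open>M\<close>,
  free modules, functions on the group and, with index type \<open>bool\<close>, direct sums of two
  modules.\<close>

definition pi_module :: "'i set \<Rightarrow> ('i \<Rightarrow> ('r, 'm, 'y) module_scheme) \<Rightarrow> ('r, 'i \<Rightarrow> 'm) module" where
 "pi_module I M =
   \<lparr>carrier = (\<Pi>\<^sub>E i\<in>I. carrier (M i)), monoid.mult = undefined, one = undefined,
   ring.zero = (\<lambda>i\<in>I. \<zero>\<^bsub>M i\<^esub>), ring.add = (\<lambda>x y. \<lambda>i\<in>I. x i \<oplus>\<^bsub>M i\<^esub> y i),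
   smult = (\<lambda>r x. \<lambda>i\<in>I. r \<odot>\<^bsub>M i\<^esub> x i)\<rparr>"

lemma module_power_eq: "module_power M n = pi_module {..<n} (\<lambda>_. M)"
 by (simp add: module_power_def pi_module_def)

lemma pi_module_simps [simp]:
 "carrier (pi_module I M) = (\<Pi>\<^sub>E i\<in>I. carrier (M i))" "\<zero>\<^bsub>pi_module I M\<^esub> = (\<lambda>i\<in>I. \<zero>\<^bsub>M i\<^esub>)"
 "x \<oplus>\<^bsub>pi_module I M\<^esub> y = (\<lambda>i\<in>I. x i \<oplus>\<^bsub>M i\<^esub> y i)" "r \<odot>\<^bsub>pi_module I M\<^esub> x = (\<lambda>i\<in>I. r \<odot>\<^bsub>M i\<^esub> x i)"
 by (auto simp: pi_module_def)

lemma pi_left_module: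
 assumes "ring R" "\<And>i. i \<in> I \<Longrightarrow> LMod R (M i)"
 shows "LMod R (pi_module I M)"
proof -
 have ag: "abelian_group (M i)" if "i \<in> I" for i
  using assms(2)[OF that] by (simp add: left_module_def)
 have sm: "r \<odot>\<^bsub>M i\<^esub> x \<in> carrier (M i)" if "i \<in> I" "r \<in> carrier R" "x \<in> carrier (M i)" for i r x
  using left_module.smult_closed[OF assms(2)[OF that(1)]] that by blast
 have am: "abelian_monoid (M i)" if "i \<in> I" for i using ag[OF that] by (rule abelian_group.axioms)
 have cl: "x \<oplus>\<^bsub>M i\<^esub> y \<in> carrier (M i)" if "i \<in> I" "x \<in> carrier (M i)" "y \<in> carrier (M i)" for i x y
  using abelian_monoid.a_closed[OF am] that by blast
 have "abelian_group (pi_module I M)"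
 proof (rule abelian_groupI)
  show "\<zero>\<^bsub>pi_module I M\<^esub> \<in> carrier (pi_module I M)" using am by (auto intro: abelian_monoid.zero_closed)
  fix x y z assume x: "x \<in> carrier (pi_module I M)" and y: "y \<in> carrier (pi_module I M)" and z: "z \<in> carrier (pi_module I M)"
  then have c: "x i \<in> carrier (M i)" "y i \<in> carrier (M i)" "z i \<in> carrier (M i)" if "i \<in> I" for i using that by auto
  show "x \<oplus>\<^bsub>pi_module I M\<^esub> y \<in> carrier (pi_module I M)" using c cl by auto
  show "x \<oplus>\<^bsub>pi_module I M\<^esub> y \<oplus>\<^bsub>pi_module I M\<^esub> z = x \<oplus>\<^bsub>pi_module I M\<^esub> (y \<oplus>\<^bsub>pi_module I M\<^esub> z)"
   by (auto simp: abelian_monoid.a_assoc[OF am] c)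
  show "x \<oplus>\<^bsub>pi_module I M\<^esub> y = y \<oplus>\<^bsub>pi_module I M\<^esub> x" by (auto simp: abelian_monoid.a_comm[OF am] c)
  show "\<zero>\<^bsub>pi_module I M\<^esub> \<oplus>\<^bsub>pi_module I M\<^esub> x = x"
   using PiE_arb[of x I] x by (auto simp: abelian_monoid.l_zero[OF am] c fun_eq_iff)
  show "\<exists>w\<in>carrier (pi_module I M). w \<oplus>\<^bsub>pi_module I M\<^esub> x = \<zero>\<^bsub>pi_module I M\<^esub>"
   by (intro bexI[of _ "\<lambda>i\<in>I. \<ominus>\<^bsub>M i\<^esub> x i"]) (auto simp: abelian_group.l_neg[OF ag] abelian_group.a_inv_closed[OF ag] c)
 qed
 moreover have ext: "x = (\<lambda>i\<in>I. x i)" if "x \<in> carrier (pi_module I M)" for x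
  using that by (auto simp: PiE_def extensional_restrict)
 show ?thesis
 proof (intro left_module.intro left_module_axioms.intro assms(1))
  show "abelian_group (pi_module I M)" by fact
 next
  fix x assume x: "x \<in> carrier (pi_module I M)"
  have "\<one>\<^sub>R \<odot>\<^bsub>pi_module I M\<^esub> x = (\<lambda>i\<in>I. x i)"
   using x by (auto simp: fun_eq_iff intro!: left_module.smult_one[OF assms(2)])
  then show "\<one>\<^sub>R \<odot>\<^bsub>pi_module I M\<^esub> x = x" using ext[OF x] by simp
 qed (auto simp: fun_eq_iff PiE_iff intro!: sm left_module.smult_l_distr[OF assms(2)]
   left_module.smult_r_distr[OF assms(2)] left_module.smult_assoc[OF assms(2)])
qed

lemma pi_finsum:
 assumes "abelian_group (pi_module I M)" "\<And>i. i \<in> I \<Longrightarrow> abelian_group (M i)" "finite J" "u \<in> J \<rightarrow> carrier (pi_module I M)" "i \<in> I"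
 shows "finsum (pi_module I M) u J i = finsum (M i) (\<lambda>j. u j i) J"
 using assms(3,4)
proof (induction rule: finite_induct)
 case empty
 interpret P: abelian_group "pi_module I M" by fact
 interpret Mi: abelian_group "M i" using assms by blast
 show ?case using P.finsum_empty[of u] assms(5) by simp
next
 case (insert j J)
 interpret P: abelian_group "pi_module I M" by fact
 interpret Mi: abelian_group "M i" using assms by blast
 have "(\<lambda>j. u j i) \<in> J \<rightarrow> carrier (M i)" "u j i \<in> carrier (M i)" using insert assms(5) by (auto simp: Pi_iff)
 then show ?case using insert assms(5) P.finsum_insert[of J j u] by simp
qed

lemma pi_proj_hom:
 assumes "ring R" "\<And>i. i \<in> I \<Longrightarrow> LMod R (M i)" "i \<in> I"
 shows "(\<lambda>x\<in>carrier (pi_module I M). x i) \<in> Hom R (pi_module I M) (M i)"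
 using pi_left_module[OF assms(1,2)] by (rule Hom_restrictI) (use assms in auto)

definition pi_inj :: "'i set \<Rightarrow> ('i \<Rightarrow> ('r, 'm, 'y) module_scheme) \<Rightarrow> 'i \<Rightarrow> 'm \<Rightarrow> 'i \<Rightarrow> 'm" where
 "pi_inj I M i x = (\<lambda>j\<in>I. if j = i then x else \<zero>\<^bsub>M j\<^esub>)"

lemma pi_inj_hom:
 assumes "ring R" "\<And>i. i \<in> I \<Longrightarrow> LMod R (M i)" "i \<in> I"
 shows "(\<lambda>x\<in>carrier (M i). pi_inj I M i x) \<in> Hom R (M i) (pi_module I M)"
proof (rule Hom_restrictI[OF assms(2)[OF assms(3)]])
 have am: "abelian_monoid (M i)" if "i \<in> I" for i
  using assms(2)[OF that] by (simp add: left_module_def abelian_group_def)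
 show "pi_inj I M i x \<in> carrier (pi_module I M)" if "x \<in> carrier (M i)" for x
  using that by (auto simp: pi_inj_def abelian_monoid.zero_closed[OF am])
 show "pi_inj I M i (x \<oplus>\<^bsub>M i\<^esub> y) = pi_inj I M i x \<oplus>\<^bsub>pi_module I M\<^esub> pi_inj I M i y"
  if "x \<in> carrier (M i)" "y \<in> carrier (M i)" for x y
  by (auto simp: pi_inj_def fun_eq_iff abelian_monoid.l_zero[OF am] abelian_monoid.zero_closed[OF am])
 show "pi_inj I M i (r \<odot>\<^bsub>M i\<^esub> x) = r \<odot>\<^bsub>pi_module I M\<^esub> pi_inj I M i x"
  if "r \<in> carrier R" "x \<in> carrier (M i)" for r x
  using that by (auto simp: pi_inj_def fun_eq_iff left_module.smult_zero_right[OF assms(2)])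
qed

lemma pi_decomp:
 assumes "ring R" "\<And>i. i \<in> I \<Longrightarrow> LMod R (M i)" "finite I" "x \<in> carrier (pi_module I M)"
 shows "x = finsum (pi_module I M) (\<lambda>i. pi_inj I M i (x i)) I"
proof -
 interpret P: left_module R "pi_module I M" using assms by (intro pi_left_module)
 have ih: "(\<lambda>x\<in>carrier (M i). pi_inj I M i x) \<in> Hom R (M i) (pi_module I M)" if "i \<in> I" for i
  using assms(1,2) that by (rule pi_inj_hom)
 have c: "(\<lambda>i. pi_inj I M i (x i)) \<in> I \<rightarrow> carrier (pi_module I M)"
 proof
  fix i assume i: "i \<in> I"
  then have xi: "x i \<in> carrier (M i)" using assms(4) by auto
  show "pi_inj I M i (x i) \<in> carrier (pi_module I M)"
   using Hom_closed[OF ih[OF i] xi] xi by (simp only: restrict_apply')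
 qed
 have ag: "abelian_group (M i)" if "i \<in> I" for i using assms(2)[OF that] by (simp add: left_module_def)
 have "finsum (pi_module I M) (\<lambda>i. pi_inj I M i (x i)) I j = x j" for j
 proof (cases "j \<in> I")
  case True
  interpret Mj: abelian_group "M j" using ag True .
  have xc: "x j \<in> carrier (M j)" using True assms(4) by auto
  have "finsum (pi_module I M) (\<lambda>i. pi_inj I M i (x i)) I j = finsum (M j) (\<lambda>i. pi_inj I M i (x i) j) I"
   using P.M.abelian_group_axioms ag assms(3) c True by (intro pi_finsum)
  also have "\<dots> = finsum (M j) (\<lambda>i. if j = i then x i else \<zero>\<^bsub>M j\<^esub>) I"
   using True xc by (intro Mj.finsum_cong') (auto simp: pi_inj_def)
  also have "\<dots> = finsum (M j) (\<lambda>i. if j = i then x j else \<zero>\<^bsub>M j\<^esub>) I"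
   using True xc by (intro Mj.finsum_cong') (auto simp: pi_inj_def)
  also have "\<dots> = x j" using True assms(3) xc by (subst Mj.finsum_singleton) auto
  finally show ?thesis .
 next
  case False
  have "finsum (pi_module I M) (\<lambda>i. pi_inj I M i (x i)) I \<in> carrier (pi_module I M)" using c by (rule P.M.finsum_closed)
  then show ?thesis using False assms(4) by (auto simp: PiE_def extensional_def)
 qed
 then show ?thesis by auto
qed

lemma pi_fin_gen:
 assumes "ring R" "\<And>i. i \<in> I \<Longrightarrow> LMod R (M i)" "finite I" "\<And>i. i \<in> I \<Longrightarrow> fin_gen R (M i)"
 shows "fin_gen R (pi_module I M)"
proof -
 interpret P: left_module R "pi_module I M" using assms by (intro pi_left_module)
 have "\<forall>i\<in>I. \<exists>S. finite S \<and> S \<subseteq> carrier (M i) \<and> carrier (M i) \<subseteq> lspan R (M i) S"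
  using left_module.fin_gen_iff[OF assms(2)] assms(4) by blast
 then obtain S where S: "finite (S i)" "S i \<subseteq> carrier (M i)" "carrier (M i) \<subseteq> lspan R (M i) (S i)" if "i \<in> I" for i
  by metis
 define T where "T = (\<Union>i\<in>I. pi_inj I M i ` S i)"
 have ih: "(\<lambda>x\<in>carrier (M i). pi_inj I M i x) \<in> Hom R (M i) (pi_module I M)" if "i \<in> I" for i
  using assms(1,2) that by (rule pi_inj_hom)
 have icl: "pi_inj I M i x \<in> carrier (pi_module I M)" if "i \<in> I" "x \<in> carrier (M i)" for i x
  using Hom_closed[OF ih[of i], of x] that by simp
 have T: "T \<subseteq> carrier (pi_module I M)" "finite T" using S icl assms(3) unfolding T_def by blast+
 have sp: "pi_inj I M i x \<in> lspan R (pi_module I M) T" if i: "i \<in> I" and x: "x \<in> carrier (M i)" for i x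
 proof -
  interpret Mi: left_module R "M i" using assms(2) i .
  interpret j: lhom R "M i" "pi_module I M" "\<lambda>x\<in>carrier (M i). pi_inj I M i x"
   using ih i by (intro lhomI Mi.left_module_axioms P.left_module_axioms)
  have "(\<lambda>x\<in>carrier (M i). pi_inj I M i x) x \<in> lspan R (pi_module I M) T" if "x \<in> lspan R (M i) (S i)"
   using that
  proof induction
   case zero show ?case unfolding j.zero by (rule lspan.zero)
  next
   case (step r s y)
   then have c: "s \<in> carrier (M i)" "y \<in> carrier (M i)" using S[OF i] Mi.lspan_closed by auto
   have "(\<lambda>x\<in>carrier (M i). pi_inj I M i x) s \<in> T" using c step i by (auto simp: T_def)
   then show ?case using step c by (auto simp del: pi_module_simps restrict_apply intro!: lspan.step)
  qed
  then show ?thesis using S(3)[OF i] x by auto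
 qed
 have "x \<in> lspan R (pi_module I M) T" if x: "x \<in> carrier (pi_module I M)" for x
  using pi_decomp[OF assms(1,2,3) x] P.finsum_in_submodule[OF P.lspan_submodule[OF T(1)] assms(3), of "\<lambda>i. pi_inj I M i (x i)"] sp x
  by auto
 then show ?thesis using T P.fin_gen_iff by blast
qed

section \<open>Restriction of scalars\<close>

definition restr :: "('s \<Rightarrow> 'r) \<Rightarrow> ('r, 'm) module \<Rightarrow> ('s, 'm) module" where
 "restr \<phi> M = \<lparr>carrier = carrier M, monoid.mult = undefined, one = undefined,
   ring.zero = \<zero>\<^sub>M, ring.add = ring.add M, smult = (\<lambda>s x. \<phi> s \<odot>\<^sub>M x)\<rparr>"

lemma restr_simps [simp]: "carrier (restr \<phi> M) = carrier M" "\<zero>\<^bsub>restr \<phi> M\<^esub> = \<zero>\<^sub>M"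
 "x \<oplus>\<^bsub>restr \<phi> M\<^esub> y = x \<oplus>\<^sub>M y" "s \<odot>\<^bsub>restr \<phi> M\<^esub> x = \<phi> s \<odot>\<^sub>M x"
 by (auto simp: restr_def)

lemma restr_left_module:
 assumes "ring S" "LMod R M" "\<phi> \<in> ring_hom S R"
 shows "LMod S (restr \<phi> M)"
proof -
 interpret left_module R M by fact
 note h = ring_hom_closed[OF assms(3)] ring_hom_mult[OF assms(3)] ring_hom_add[OF assms(3)] ring_hom_one[OF assms(3)]
 have "abelian_group (restr \<phi> M)"
  by (rule abelian_groupI) (auto simp: M.a_ac intro: bexI[of _ "\<ominus>\<^sub>M x" for x] M.l_neg)
 then show ?thesis
  using assms(1) by (intro left_module.intro left_module_axioms.intro)
   (auto simp: h smult_l_distr smult_r_distr smult_assoc)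
qed

lemma restr_hom: "\<phi> \<in> ring_hom S R \<Longrightarrow> f \<in> Hom R M N \<Longrightarrow> f \<in> Hom S (restr \<phi> M) (restr \<phi> N)"
 by (auto simp: mod_hom_def ring_hom_closed)

lemma fin_gen_restrD:
 assumes "ring S" "LMod R M" "\<phi> \<in> ring_hom S R" "fin_gen S (restr \<phi> M)"
 shows "fin_gen R M"
proof -
 interpret left_module R M by fact
 interpret S: left_module S "restr \<phi> M" using assms by (intro restr_left_module)
 obtain T where T: "finite T" "T \<subseteq> carrier M" "carrier M \<subseteq> lspan S (restr \<phi> M) T"
  using assms(4) S.fin_gen_iff by auto
 have "x \<in> lspan R M T" if "x \<in> lspan S (restr \<phi> M) T" for x
  using that by induction (auto intro: lspan.intros ring_hom_closed[OF assms(3)])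
 then show ?thesis using T fin_gen_iff by blast
qed

text \<open>Products of generators of the algebra over \<open>S\<close> with generators of
  \<open>M\<close> over the algebra generate \<open>M\<close> over \<open>S\<close>. With
  \<open>fin_gen_restrD\<close>, the finitely generated modules over a finite dimensional algebra
  are exactly the finite dimensional ones.\<close>

lemma fin_gen_restrI:
 assumes "ring S" "LMod R M" "\<phi> \<in> ring_hom S R" "fin_gen S (restr \<phi> (Reg R))" "fin_gen R M"
 shows "fin_gen S (restr \<phi> M)"
proof -
 interpret left_module R M by fact
 interpret S: left_module S "restr \<phi> M" using assms by (intro restr_left_module)
 interpret SR: left_module S "restr \<phi> (Reg R)"
  using assms(1) regular_left_module[OF R.ring_axioms] assms(3) by (rule restr_left_module)
 obtain B where B: "finite B" "B \<subseteq> carrier R" "carrier R \<subseteq> lspan S (restr \<phi> (Reg R)) B"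
  using assms(4) SR.fin_gen_iff by auto
 obtain T where T: "finite T" "T \<subseteq> carrier M" "carrier M \<subseteq> lspan R M T"
  using assms(5) fin_gen_iff by auto
 define U where "U = (\<lambda>(b, t). b \<odot>\<^sub>M t) ` (B \<times> T)"
 have U: "finite U" "U \<subseteq> carrier (restr \<phi> M)" using B T by (auto simp: U_def)
 have 1: "r \<odot>\<^sub>M t \<in> lspan S (restr \<phi> M) U" if "t \<in> T" "r \<in> lspan S (restr \<phi> (Reg R)) B" for r t
  using that(2)
 proof induction
  case zero show ?case using that T lspan.zero[of "restr \<phi> M" S U] by auto
 next
  case (step s b r)
  have c: "b \<in> carrier R" "t \<in> carrier M" "r \<in> carrier R" "\<phi> s \<in> carrier R"
   using step B T that SR.lspan_closed[of B r] ring_hom_closed[OF assms(3)] by auto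
  have "b \<odot>\<^sub>M t \<in> U" using step that by (auto simp: U_def)
  then have "s \<odot>\<^bsub>restr \<phi> M\<^esub> (b \<odot>\<^sub>M t) \<oplus>\<^bsub>restr \<phi> M\<^esub> r \<odot>\<^sub>M t \<in> lspan S (restr \<phi> M) U"
   using step by (intro lspan.step)
  then show ?case using c by (simp add: smult_l_distr smult_assoc)
 qed
 have "x \<in> lspan S (restr \<phi> M) U" if "x \<in> lspan R M T" for x
  using that
 proof induction
  case zero show ?case using lspan.zero[of "restr \<phi> M" S U] by simp
 next
  case (step r t x)
  then show ?case using S.lspan_add[OF U(2) 1[OF step.hyps(2) subsetD[OF B(3) step.hyps(1)]] step.IH] by simp
 qed
 then have "carrier (restr \<phi> M) \<subseteq> lspan S (restr \<phi> M) U" using T(3) unfolding restr_simps(1) by (meson subsetD subsetI)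
 then show ?thesis using U S.fin_gen_iff by blast
qed

section \<open>Injective modules\<close>

text \<open>A homomorphism on a left ideal extends to the whole ring iff it has the form
  \<open>r \<mapsto> r \<odot> e\<close>, with \<open>e\<close> the value of the extension at 1. The
  condition mentions no universe of modules.\<close>

definition baer :: "('r, 'x) ring_scheme \<Rightarrow> ('r, 'm) module \<Rightarrow> bool" where
 "baer R E \<longleftrightarrow> LMod R E \<and>
   (\<forall>L h. submodule L R (Reg R) \<longrightarrow> h \<in> Hom R (Reg R\<lparr>carrier := L\<rparr>) E \<longrightarrow>
    (\<exists>e\<in>carrier E. \<forall>r\<in>L. h r = r \<odot>\<^sub>E e))"

lemma injective_imp_baer:
 fixes E :: "('r, 'm) module"
 assumes "injective_module R E"
 shows "baer R E"
 unfolding baer_def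
proof (intro conjI allI impI)
 show E: "LMod R E" using assms by (simp add: injective_module_def)
 interpret E: left_module R E by fact
 interpret RR: left_module R "Reg R" using E.R.ring_axioms by (rule regular_left_module)
 fix L h assume L: "submodule L R (Reg R)" and h: "h \<in> Hom R (Reg R\<lparr>carrier := L\<rparr>) E"
 let ?L = "Reg R\<lparr>carrier := L\<rparr>"
 have Llm: "LMod R ?L" using L by (rule RR.submodule_left_module)
 have Lsub: "L \<subseteq> carrier R" using RR.submoduleD(1)[OF L] by simp
 \<comment> \<open>Any injection of the ring into the universe would do; here \<open>r\<close> goes
   to the singleton of the constant tuple.\<close>
 define \<phi> :: "'r \<Rightarrow> (nat \<Rightarrow> 'r) set" where "\<phi> r = {\<lambda>_. r}" for r
 have inj: "inj_on \<phi> S" for S by (auto simp: \<phi>_def inj_on_def fun_eq_iff)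
 obtain W :: "'r lmod" and fL gL where W: "LMod R W" "fL \<in> Hom R ?L W" "gL \<in> Hom R W ?L"
  "\<And>x. x \<in> carrier ?L \<Longrightarrow> gL (fL x) = x" "\<And>y. y \<in> carrier W \<Longrightarrow> fL (gL y) = y"
  by (rule copy_along_injection[OF Llm inj]) (rule that)
 obtain Y :: "'r lmod" and fR gR where Y: "LMod R Y" "fR \<in> Hom R (Reg R) Y"
  "gR \<in> Hom R Y (Reg R)"
  "\<And>x. x \<in> carrier (Reg R) \<Longrightarrow> gR (fR x) = x" "\<And>y. y \<in> carrier Y \<Longrightarrow> fR (gR y) = y"
  by (rule copy_along_injection[OF RR.left_module_axioms inj]) (rule that)
 interpret fR: lhom R "Reg R" Y fR using Y by (intro lhomI RR.left_module_axioms)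
 interpret gL: lhom R W ?L gL using W Llm by (intro lhomI)
 interpret fL: lhom R ?L W fL using W Llm by (intro lhomI)
 define i where "i = (\<lambda>x\<in>carrier W. fR (gL x))"
 define f where "f = (\<lambda>x\<in>carrier W. h (gL x))"
 have gLc: "gL x \<in> L" if "x \<in> carrier W" for x using gL.closed[OF that] by simp
 have i: "i \<in> Hom R W Y" unfolding i_def
  using gLc Lsub by (intro Hom_restrictI W) (auto simp: subsetD fR.add[simplified] fR.smult[simplified])
 have f: "f \<in> Hom R W E" unfolding f_def using W(1,3) h by (rule Hom_comp)
 have "inj_on i (carrier W)"
 proof (rule inj_onI)
  fix x y assume *: "x \<in> carrier W" "y \<in> carrier W" "i x = i y"
  then have "fR (gL x) = fR (gL y)" by (simp add: i_def)
  moreover have "gL x \<in> carrier R" "gL y \<in> carrier R"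
   by (rule subsetD[OF Lsub gLc[OF *(1)]], rule subsetD[OF Lsub gLc[OF *(2)]])
  ultimately have "gL x = gL y"
   using Y(4)[unfolded regular_simps, of "gL x"] Y(4)[unfolded regular_simps, of "gL y"] by metis
  then show "x = y" using W(5)[OF *(1)] W(5)[OF *(2)] by metis
 qed
 then obtain g where g: "g \<in> Hom R Y E" "compose (carrier W) g i = f"
  using assms i f W Y unfolding injective_module_def by meson
 interpret g: lhom R Y E g using Y E g by (intro lhomI)
 \<comment> \<open>The element required by \<open>baer\<close> is the value of the extension
   \<open>g\<close> at the copy of 1.\<close>
 have one: "fR \<one>\<^sub>R \<in> carrier Y" using fR.closed[of "\<one>\<^sub>R"] by simp
 show "\<exists>e\<in>carrier E. \<forall>r\<in>L. h r = r \<odot>\<^sub>E e"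
 proof (intro bexI ballI)
  fix r assume r: "r \<in> L"
  then have rR: "r \<in> carrier R" using Lsub by auto
  have c: "fL r \<in> carrier W" using fL.closed[of r] r by simp
  have "h r = f (fL r)" using W(4) r c by (simp add: f_def)
  also have "\<dots> = g (i (fL r))" using g(2) c by (auto simp: compose_def fun_eq_iff split: if_splits)
  also have "\<dots> = g (fR r)" using W(4) r c by (simp add: i_def)
  also have "fR r = r \<odot>\<^sub>Y fR \<one>\<^sub>R" using fR.smult[of r "\<one>\<^sub>R"] rR by simp
  also have "g \<dots> = r \<odot>\<^sub>E g (fR \<one>\<^sub>R)" using rR one by simp
  finally show "h r = r \<odot>\<^sub>E g (fR \<one>\<^sub>R)" .
 qed (use one in auto)
qed

text \<open>Baer's criterion: Zorn's lemma is applied to the graphs of partial extensions.\<close>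

lemma baer_extend:
 fixes E :: "('r, 'e) module" and W :: "('r, 'w, 'v) module_scheme" and Y :: "('r, 'z, 'u) module_scheme"
 assumes "baer R E" "LMod R W" "LMod R Y" "i \<in> Hom R W Y" "inj_on i (carrier W)" "f \<in> Hom R W E"
 obtains g where "g \<in> Hom R Y E" "\<And>x. x \<in> carrier W \<Longrightarrow> g (i x) = f x"
proof -
 have E: "LMod R E" using assms by (simp add: baer_def)
 interpret i: lhom R W Y i using assms by (intro lhomI)
 interpret f: lhom R W E f using assms E by (intro lhomI)
 interpret RR: left_module R "Reg R"
  using E by (intro regular_left_module) (simp add: left_module_def)
 \<comment> \<open>The graphs contain \<open>f\<close> along \<open>i\<close>, are closed under
   linear combinations and are single-valued at 0; by linearity they are then single-valued
   everywhere. All these conditions pass to unions of chains.\<close>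
 define \<A> where "\<A> = {G. G \<subseteq> carrier Y \<times> carrier E \<and> (\<lambda>w. (i w, f w)) ` carrier W \<subseteq> G \<and>
   (\<forall>r\<in>carrier R. \<forall>y e y' e'. (y, e) \<in> G \<longrightarrow> (y', e') \<in> G \<longrightarrow> (y \<oplus>\<^sub>Y r \<odot>\<^sub>Y y', e \<oplus>\<^sub>E r \<odot>\<^sub>E e') \<in> G) \<and>
   (\<forall>e. (\<zero>\<^sub>Y, e) \<in> G \<longrightarrow> e = \<zero>\<^sub>E)}"
 have "\<exists>G\<in>\<A>. \<forall>B\<in>\<A>. G \<subseteq> B \<longrightarrow> B = G"
 proof (rule subset_Zorn_nonempty)
  have "(\<lambda>w. (i w, f w)) ` carrier W \<in> \<A>"
   unfolding \<A>_def
  proof (intro CollectI conjI allI impI ballI)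
   fix e assume "(\<zero>\<^sub>Y, e) \<in> (\<lambda>w. (i w, f w)) ` carrier W"
   then obtain w where w: "w \<in> carrier W" "i w = i \<zero>\<^sub>W" "e = f w" by auto
   then have "w = \<zero>\<^sub>W" using assms(5) i.W.M.zero_closed by (meson inj_onD)
   then show "e = \<zero>\<^sub>E" using w by simp
  next
   fix r y e y' e' assume r: "r \<in> carrier R" and "(y, e) \<in> (\<lambda>w. (i w, f w)) ` carrier W" "(y', e') \<in> (\<lambda>w. (i w, f w)) ` carrier W"
   then obtain w w' where "w \<in> carrier W" "w' \<in> carrier W" "y = i w" "y' = i w'" "e = f w" "e' = f w'" by auto
   then show "(y \<oplus>\<^sub>Y r \<odot>\<^sub>Y y', e \<oplus>\<^sub>E r \<odot>\<^sub>E e') \<in> (\<lambda>w. (i w, f w)) ` carrier W"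
    using r by (intro image_eqI[of _ _ "w \<oplus>\<^sub>W r \<odot>\<^sub>W w'"]) auto
  qed auto
  then show "\<A> \<noteq> {}" by blast
  fix \<C> assume C: "\<C> \<noteq> {}" "subset.chain \<A> \<C>"
  then have sub: "\<C> \<subseteq> \<A>" and tot: "\<And>B B'. B \<in> \<C> \<Longrightarrow> B' \<in> \<C> \<Longrightarrow> B \<subseteq> B' \<or> B' \<subseteq> B"
   by (auto simp: subset_chain_def)
  show "\<Union>\<C> \<in> \<A>"
   unfolding \<A>_def
  proof (intro CollectI conjI allI impI ballI)
   show "\<Union>\<C> \<subseteq> carrier Y \<times> carrier E" using sub unfolding \<A>_def by blast
   show "(\<lambda>w. (i w, f w)) ` carrier W \<subseteq> \<Union>\<C>" using sub C(1) unfolding \<A>_def by blast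
   fix e assume "(\<zero>\<^sub>Y, e) \<in> \<Union>\<C>" then show "e = \<zero>\<^sub>E" using sub unfolding \<A>_def by blast
  next
   fix r y e y' e' assume r: "r \<in> carrier R" and "(y, e) \<in> \<Union>\<C>" "(y', e') \<in> \<Union>\<C>"
   then obtain B B' where "B \<in> \<C>" "(y, e) \<in> B" "B' \<in> \<C>" "(y', e') \<in> B'" by blast
   then obtain Z where Z: "Z \<in> \<C>" "(y, e) \<in> Z" "(y', e') \<in> Z" using tot[of B B'] by blast
   then have "(y \<oplus>\<^sub>Y r \<odot>\<^sub>Y y', e \<oplus>\<^sub>E r \<odot>\<^sub>E e') \<in> Z" using sub r unfolding \<A>_def by blast
   then show "(y \<oplus>\<^sub>Y r \<odot>\<^sub>Y y', e \<oplus>\<^sub>E r \<odot>\<^sub>E e') \<in> \<Union>\<C>" using Z by blast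
  qed
 qed
 then obtain G where G: "G \<in> \<A>" and max: "\<And>B. B \<in> \<A> \<Longrightarrow> G \<subseteq> B \<Longrightarrow> B = G" by blast
 have Gc: "y \<in> carrier Y" "e \<in> carrier E" if "(y, e) \<in> G" for y e using G that unfolding \<A>_def by blast+
 have Gi: "(i w, f w) \<in> G" if "w \<in> carrier W" for w using G that unfolding \<A>_def by blast
 have Gl: "(y \<oplus>\<^sub>Y r \<odot>\<^sub>Y y', e \<oplus>\<^sub>E r \<odot>\<^sub>E e') \<in> G" if "r \<in> carrier R" "(y, e) \<in> G" "(y', e') \<in> G" for r y e y' e'
  using G that unfolding \<A>_def by blast
 have G0: "e = \<zero>\<^sub>E" if "(\<zero>\<^sub>Y, e) \<in> G" for e using G that unfolding \<A>_def by blast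
 have G00: "(\<zero>\<^sub>Y, \<zero>\<^sub>E) \<in> G" using Gi[of "\<zero>\<^sub>W"] by simp
 have Ga: "(y \<oplus>\<^sub>Y y', e \<oplus>\<^sub>E e') \<in> G" if "(y, e) \<in> G" "(y', e') \<in> G" for y e y' e'
  using Gl[OF _ that, of "\<one>\<^sub>R"] Gc[OF that(2)] by simp
 have Gs: "(r \<odot>\<^sub>Y y, r \<odot>\<^sub>E e) \<in> G" if "r \<in> carrier R" "(y, e) \<in> G" for r y e
  using Gl[OF that(1) G00 that(2)] Gc[OF that(2)] that(1) by simp
 have Gn: "(\<ominus>\<^sub>Y y, \<ominus>\<^sub>E e) \<in> G" if "(y, e) \<in> G" for y e
  using Gs[of "\<ominus>\<^sub>R \<one>\<^sub>R", OF _ that] Gc[OF that] by (simp add: i.Y.smult_neg_left f.Y.smult_neg_left)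
 have Gf: "e = e'" if "(y, e) \<in> G" "(y, e') \<in> G" for y e e'
 proof -
  have "(y \<oplus>\<^sub>Y \<ominus>\<^sub>Y y, e \<oplus>\<^sub>E \<ominus>\<^sub>E e') \<in> G" using that Gn Ga by blast
  then have "e \<ominus>\<^sub>E e' = \<zero>\<^sub>E" using Gc[OF that(1)] G0 by (simp add: i.Y.M.r_neg a_minus_def)
  then show ?thesis using Gc that by (simp add: f.Y.M.minus_eq_zero_iff)
 qed
 have dom: "\<exists>e. (y, e) \<in> G" if y: "y \<in> carrier Y" for y
 proof -
  \<comment> \<open>\<open>L\<close> consists of the scalars that move \<open>y\<close> into the
    domain. Baer's condition describes the values of the graph on these multiples by an element
    \<open>e0\<close>, which is a consistent value at \<open>y\<close>; by maximality the graph
    already contains it.\<close>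
  define L where "L = {r \<in> carrier R. \<exists>e. (r \<odot>\<^sub>Y y, e) \<in> G}"
  define h where "h = (\<lambda>r\<in>L. THE e. (r \<odot>\<^sub>Y y, e) \<in> G)"
  have h: "h r = e" if "r \<in> carrier R" "(r \<odot>\<^sub>Y y, e) \<in> G" for r e
   using that Gf by (auto simp: h_def L_def intro!: the_equality)
  have hG: "(r \<odot>\<^sub>Y y, h r) \<in> G" if "r \<in> L" for r using that h by (auto simp: L_def)
  have add: "((r \<oplus>\<^sub>R s) \<odot>\<^sub>Y y, h r \<oplus>\<^sub>E h s) \<in> G" if "r \<in> L" "s \<in> L" for r s
   using Ga[OF hG hG, OF that] that y by (simp add: L_def i.Y.smult_l_distr)
  have sm: "((a \<otimes>\<^sub>R r) \<odot>\<^sub>Y y, a \<odot>\<^sub>E h r) \<in> G" if "r \<in> L" "a \<in> carrier R" for a r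
   using Gs[OF that(2) hG[OF that(1)]] that y by (simp add: L_def i.Y.smult_assoc)
  have LR: "r \<in> carrier R" if "r \<in> L" for r using that by (simp add: L_def)
  have L: "submodule L R (Reg R)"
  proof (rule RR.submoduleI)
   have mem: "r \<in> L" if "r \<in> carrier R" "(r \<odot>\<^sub>Y y, e) \<in> G" for r e using that by (auto simp: L_def)
   show "L \<subseteq> carrier (Reg R)" using LR by auto
   show "\<zero>\<^bsub>Reg R\<^esub> \<in> L" using mem[of "\<zero>\<^sub>R"] G00 y by simp
   show "r \<oplus>\<^bsub>Reg R\<^esub> s \<in> L" if "r \<in> L" "s \<in> L" for r s
    using mem[OF _ add[OF that]] LR[OF that(1)] LR[OF that(2)] by simp
   show "a \<odot>\<^bsub>Reg R\<^esub> r \<in> L" if "a \<in> carrier R" "r \<in> L" for a r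
    using mem[OF _ sm[OF that(2,1)]] LR[OF that(2)] that(1) by simp
  qed
  have "h \<in> Hom R (Reg R\<lparr>carrier := L\<rparr>) E"
  proof -
   have 1: "h (r \<oplus>\<^sub>R s) = h r \<oplus>\<^sub>E h s" if "r \<in> L" "s \<in> L" for r s
    using h[OF _ add[OF that]] LR[OF that(1)] LR[OF that(2)] by simp
   have 2: "h (a \<otimes>\<^sub>R r) = a \<odot>\<^sub>E h r" if "r \<in> L" "a \<in> carrier R" for a r
    using h[OF _ sm[OF that]] LR[OF that(1)] that(2) by simp
   have 3: "h r \<in> carrier E" if "r \<in> L" for r using Gc(2)[OF hG[OF that]] .
   have 4: "h \<in> extensional L" by (simp add: h_def)
   show ?thesis using 4 by (auto simp: mod_hom_def 1 2 3 PiE_def)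
  qed
  then obtain e0 where e0: "e0 \<in> carrier E" "\<And>r. r \<in> L \<Longrightarrow> h r = r \<odot>\<^sub>E e0"
   using assms(1) L unfolding baer_def by blast
  define G' where "G' = {(n \<oplus>\<^sub>Y r \<odot>\<^sub>Y y, e \<oplus>\<^sub>E r \<odot>\<^sub>E e0) |n e r. (n, e) \<in> G \<and> r \<in> carrier R}"
  have G'I: "(n', e') \<in> G'" if "(n, e) \<in> G" "r \<in> carrier R" "n' = n \<oplus>\<^sub>Y r \<odot>\<^sub>Y y" "e' = e \<oplus>\<^sub>E r \<odot>\<^sub>E e0" for n e r n' e'
   using that unfolding G'_def by blast
  have GG': "G \<subseteq> G'"
  proof
   fix z assume "z \<in> G"
   then show "z \<in> G'" using Gc y e0 by (cases z) (auto intro!: G'I[of "fst z" "snd z" "\<zero>\<^sub>R"])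
  qed
  have "G' \<in> \<A>"
   unfolding \<A>_def
  proof (intro CollectI conjI allI impI ballI)
   show "G' \<subseteq> carrier Y \<times> carrier E" using Gc y e0 by (auto simp: G'_def)
   show "(\<lambda>w. (i w, f w)) ` carrier W \<subseteq> G'" using Gi GG' by auto
   fix z assume "(\<zero>\<^sub>Y, z) \<in> G'"
   then obtain n e r where z: "(n, e) \<in> G" "r \<in> carrier R" "\<zero>\<^sub>Y = n \<oplus>\<^sub>Y r \<odot>\<^sub>Y y" "z = e \<oplus>\<^sub>E r \<odot>\<^sub>E e0"
    by (auto simp: G'_def)
   have c: "n \<in> carrier Y" "e \<in> carrier E" using z Gc by auto
   \<comment> \<open>A relation \<open>n + r y = 0\<close> puts \<open>r\<close> into
     \<open>L\<close> with \<open>h r = - e\<close>; as also \<open>h r = r e0\<close>, the second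
     coordinate vanishes.\<close>
   have "r \<odot>\<^sub>Y y = \<ominus>\<^sub>Y n"
    using z c y i.Y.M.minus_equality[of "r \<odot>\<^sub>Y y" n] by (simp add: i.Y.M.a_comm)
   then have "(r \<odot>\<^sub>Y y, \<ominus>\<^sub>E e) \<in> G" using Gn[OF z(1)] by simp
   then have "r \<in> L" "h r = \<ominus>\<^sub>E e" using z(2) h by (auto simp: L_def)
   then show "z = \<zero>\<^sub>E" using z e0(2)[of r] c by (simp add: f.Y.M.r_neg)
  next
   fix a u e u' e' assume a: "a \<in> carrier R" and "(u, e) \<in> G'" "(u', e') \<in> G'"
   then obtain n d r n' d' r' where *: "(n, d) \<in> G" "r \<in> carrier R" "u = n \<oplus>\<^sub>Y r \<odot>\<^sub>Y y" "e = d \<oplus>\<^sub>E r \<odot>\<^sub>E e0"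
    "(n', d') \<in> G" "r' \<in> carrier R" "u' = n' \<oplus>\<^sub>Y r' \<odot>\<^sub>Y y" "e' = d' \<oplus>\<^sub>E r' \<odot>\<^sub>E e0"
    unfolding G'_def by blast
   show "(u \<oplus>\<^sub>Y a \<odot>\<^sub>Y u', e \<oplus>\<^sub>E a \<odot>\<^sub>E e') \<in> G'"
    using Gc[OF *(1)] Gc[OF *(5)] y e0(1) * a
    by (intro G'I[OF Gl[OF a *(1,5)], of "r \<oplus>\<^sub>R a \<otimes>\<^sub>R r'"])
     (auto simp: i.Y.smult_l_distr f.Y.smult_l_distr i.Y.smult_r_distr f.Y.smult_r_distr i.Y.smult_assoc f.Y.smult_assoc i.Y.M.a_ac f.Y.M.a_ac)
  qed
  then have "G' = G" using max GG' by blast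
  moreover have "(y, e0) \<in> G'" using y e0 by (intro G'I[OF G00, of "\<one>\<^sub>R"]) auto
  ultimately show ?thesis by blast
 qed
 define g where "g y = (THE e. (y, e) \<in> G)" for y
 have gI: "g y = e" if "(y, e) \<in> G" for y e using that Gf by (auto simp: g_def intro!: the_equality)
 have gG: "(y, g y) \<in> G" if "y \<in> carrier Y" for y using dom[OF that] gI by auto
 have "(\<lambda>y\<in>carrier Y. g y) \<in> Hom R Y E" using assms(3)
 proof (rule Hom_restrictI)
  fix y z assume "y \<in> carrier Y" "z \<in> carrier Y"
  then show "g (y \<oplus>\<^sub>Y z) = g y \<oplus>\<^sub>E g z" using gI[OF Ga[OF gG gG]] by blast
 next
  fix r y assume "r \<in> carrier R" "y \<in> carrier Y"
  then show "g (r \<odot>\<^sub>Y y) = r \<odot>\<^sub>E g y" using gI[OF Gs[OF _ gG]] by blast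
 qed (use Gc(2)[OF gG] in blast)
 then show ?thesis using that[of "\<lambda>y\<in>carrier Y. g y"] gI[OF Gi] by simp
qed

lemma baer_imp_injective:
 assumes "baer R E" shows "injective_module R E"
 unfolding injective_module_def
proof (intro conjI allI ballI impI)
 show "LMod R E" using assms by (simp add: baer_def)
 fix W Y :: "'a lmod" and i f
 assume *: "i \<in> Hom R W Y" "f \<in> Hom R W E" "LMod R W \<and> LMod R Y \<and> inj_on i (carrier W)"
 then obtain g where "g \<in> Hom R Y E" "\<And>x. x \<in> carrier W \<Longrightarrow> g (i x) = f x"
  using baer_extend[OF assms] by metis
 moreover from this have "compose (carrier W) g i = f"
  using *(2) by (auto simp: mod_hom_def compose_def PiE_def intro!: extensionalityI[of _ "carrier W"])
 ultimately show "\<exists>g\<in>Hom R Y E. compose (carrier W) g i = f" by blast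
qed

text \<open>Baer's criterion turns the test on the universe into extension along monomorphisms
  between modules with elements in arbitrary types, as needed whenever a construction leaves the
  universe.\<close>

lemma injective_extend:
 assumes "injective_module R E" "LMod R W" "LMod R Y" "i \<in> Hom R W Y" "inj_on i (carrier W)" "f \<in> Hom R W E"
 obtains g where "g \<in> Hom R Y E" "\<And>x. x \<in> carrier W \<Longrightarrow> g (i x) = f x"
 by (rule baer_extend[OF injective_imp_baer[OF assms(1)] assms(2-)]) (rule that)

lemma injectiveI:
 fixes E :: "('r, 'm) module"
 assumes "LMod R E"
  and "\<And>(W :: 'r lmod) (Y :: 'r lmod) i f. \<lbrakk>LMod R W; LMod R Y; i \<in> Hom R W Y; inj_on i (carrier W);
   f \<in> Hom R W E\<rbrakk> \<Longrightarrow> \<exists>g\<in>Hom R Y E. \<forall>x\<in>carrier W. g (i x) = f x"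
 shows "injective_module R E"
 unfolding injective_module_def
proof (intro conjI allI ballI impI)
 fix W Y :: "'r lmod" and i f
 assume *: "i \<in> Hom R W Y" "f \<in> Hom R W E" "LMod R W \<and> LMod R Y \<and> inj_on i (carrier W)"
 then obtain g where "g \<in> Hom R Y E" "\<And>x. x \<in> carrier W \<Longrightarrow> g (i x) = f x"
  using assms(2)[of W Y i f] by blast
 moreover from this have "compose (carrier W) g i = f"
  using *(2) by (auto simp: mod_hom_def compose_def PiE_def intro!: extensionalityI[of _ "carrier W"])
 ultimately show "\<exists>g\<in>Hom R Y E. compose (carrier W) g i = f" by blast
qed fact

lemma injective_left_module: "injective_module R E \<Longrightarrow> LMod R E"
 by (simp add: injective_module_def)

section \<open>Retracts and products of injective modules\<close>

lemma injective_retract: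
 assumes "injective_module R E" "LMod R B" "a \<in> Hom R B E" "b \<in> Hom R E B"
  and "\<And>x. x \<in> carrier B \<Longrightarrow> b (a x) = x"
 shows "injective_module R B"
proof (rule injectiveI[OF assms(2)])
 fix W Y :: "'a lmod" and i f
 assume *: "LMod R W" "LMod R Y" "i \<in> Hom R W Y" "inj_on i (carrier W)" "f \<in> Hom R W B"
 obtain g where g: "g \<in> Hom R Y E" "\<And>x. x \<in> carrier W \<Longrightarrow> g (i x) = (\<lambda>x\<in>carrier W. a (f x)) x"
  using injective_extend[OF assms(1) *(1-4) Hom_comp[OF *(1,5) assms(3)]] by metis
 show "\<exists>g\<in>Hom R Y B. \<forall>x\<in>carrier W. g (i x) = f x"
  using g(2) assms(5) Hom_closed[OF *(3)] Hom_closed[OF *(5)]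
  by (intro bexI[OF _ Hom_comp[OF *(2) g(1) assms(4)]]) auto
qed

lemma injective_pi:
 assumes "ring R" "\<And>i. i \<in> I \<Longrightarrow> injective_module R (M i)"
 shows "injective_module R (pi_module I M)"
proof (rule injectiveI)
 have lm: "LMod R (M i)" if "i \<in> I" for i using assms(2)[OF that] by (rule injective_left_module)
 show P: "LMod R (pi_module I M)" using assms(1) lm by (rule pi_left_module)
 fix W Y :: "'a lmod" and j f
 assume *: "LMod R W" "LMod R Y" "j \<in> Hom R W Y" "inj_on j (carrier W)" "f \<in> Hom R W (pi_module I M)"
 have "\<forall>i\<in>I. \<exists>g. g \<in> Hom R Y (M i) \<and> (\<forall>x\<in>carrier W. g (j x) = f x i)"
 proof
  fix i assume i: "i \<in> I"
  obtain g where g: "g \<in> Hom R Y (M i)"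
   "\<And>x. x \<in> carrier W \<Longrightarrow> g (j x) = (\<lambda>x\<in>carrier W. (\<lambda>x\<in>carrier (pi_module I M). x i) (f x)) x"
   using injective_extend[OF assms(2)[OF i] *(1-4) Hom_comp[OF *(1,5) pi_proj_hom[OF assms(1) lm i]]] by metis
  then show "\<exists>g. g \<in> Hom R Y (M i) \<and> (\<forall>x\<in>carrier W. g (j x) = f x i)"
   using Hom_closed[OF *(5)] by (intro exI[of _ g]) auto
 qed
 from bchoice[OF this] obtain g where "\<forall>i\<in>I. g i \<in> Hom R Y (M i) \<and> (\<forall>x\<in>carrier W. g i (j x) = f x i)" ..
 then have g: "g i \<in> Hom R Y (M i)" "\<And>x. x \<in> carrier W \<Longrightarrow> g i (j x) = f x i" if "i \<in> I" for i
  using that by blast+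
 have "(\<lambda>y\<in>carrier Y. \<lambda>i\<in>I. g i y) \<in> Hom R Y (pi_module I M)" using *(2)
  by (rule Hom_restrictI) (auto simp: Hom_closed[OF g(1)] Hom_add[OF g(1)] Hom_smult[OF g(1)] fun_eq_iff)
 moreover have "(\<lambda>i\<in>I. g i (j x)) = f x" if "x \<in> carrier W" for x
 proof -
  have "f x \<in> (\<Pi>\<^sub>E i\<in>I. carrier (M i))" using Hom_closed[OF *(5) that] by simp
  from PiE_arb[OF this] show ?thesis using g(2) that by (auto simp: fun_eq_iff)
 qed
 ultimately show "\<exists>g\<in>Hom R Y (pi_module I M). \<forall>x\<in>carrier W. g (j x) = f x"
  using Hom_closed[OF *(3)] by (intro bexI) auto
qed

text \<open>A non-zero left ideal of a field contains 1, and then the value at 1 is the element that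
  Baer's condition asks for.\<close>

lemma field_injective:
 assumes "field K" "LMod K B" shows "injective_module K B"
proof (rule baer_imp_injective)
 interpret K: field K by fact
 interpret B: left_module K B by fact
 interpret RR: left_module K "Reg K" using K.ring_axioms by (rule regular_left_module)
 show "baer K B" unfolding baer_def
 proof (intro conjI allI impI)
  fix L h assume L: "submodule L K (Reg K)" and h: "h \<in> Hom K (Reg K\<lparr>carrier := L\<rparr>) B"
  interpret h: lhom K "Reg K\<lparr>carrier := L\<rparr>" B h
   using h L by (intro lhomI B.left_module_axioms RR.submodule_left_module)
  note LD = RR.submoduleD[OF L]
  show "\<exists>e\<in>carrier B. \<forall>r\<in>L. h r = r \<odot>\<^sub>B e"
  proof (cases "L \<subseteq> {\<zero>\<^sub>K}")
   case True then show ?thesis using h.zero by (intro bexI[of _ "\<zero>\<^sub>B"]) auto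
  next
   case False
   then obtain r where r: "r \<in> L" "r \<noteq> \<zero>\<^sub>K" by auto
   then have "r \<in> Units K" using LD(1) K.field_Units by auto
   then have one: "\<one>\<^sub>K \<in> L" using LD(5)[of "inv\<^bsub>K\<^esub> r" r] r K.Units_inv_closed K.Units_l_inv by simp
   show ?thesis
   proof (intro bexI ballI)
    fix s assume "s \<in> L"
    then show "h s = s \<odot>\<^sub>B h \<one>\<^sub>K" using h.smult[of s "\<one>\<^sub>K"] one LD(1) by auto
   qed (use h.closed one in simp)
  qed
 qed fact
qed

text \<open>\<open>Hom_K(R, B)\<close>, where \<open>R\<close> acts by right multiplication on the
  argument. As coinduction is right adjoint to restriction from \<open>R\<close> to
  \<open>K\<close>, it produces injective modules from vector spaces.\<close>

definition coinduced :: "('k, 'x) ring_scheme \<Rightarrow> ('r, 'y) ring_scheme \<Rightarrow> ('k \<Rightarrow> 'r) \<Rightarrow> ('r, 'm) module \<Rightarrow> ('r, 'r \<Rightarrow> 'm) module" where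
 "coinduced K R \<phi> B =
   \<lparr>carrier = Hom K (restr \<phi> (Reg R)) (restr \<phi> B), monoid.mult = undefined, one = undefined,
   ring.zero = (\<lambda>b\<in>carrier R. \<zero>\<^sub>B), ring.add = (\<lambda>f g. \<lambda>b\<in>carrier R. f b \<oplus>\<^sub>B g b),
   smult = (\<lambda>a f. \<lambda>b\<in>carrier R. f (b \<otimes>\<^sub>R a))\<rparr>"

lemma coinduced_simps [simp]: "carrier (coinduced K R \<phi> B) = Hom K (restr \<phi> (Reg R)) (restr \<phi> B)"
 "\<zero>\<^bsub>coinduced K R \<phi> B\<^esub> = (\<lambda>b\<in>carrier R. \<zero>\<^sub>B)" "f \<oplus>\<^bsub>coinduced K R \<phi> B\<^esub> g = (\<lambda>b\<in>carrier R. f b \<oplus>\<^sub>B g b)"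
 "a \<odot>\<^bsub>coinduced K R \<phi> B\<^esub> f = (\<lambda>b\<in>carrier R. f (b \<otimes>\<^sub>R a))"
 by (auto simp: coinduced_def)

text \<open>The algebra is given by its structure map \<open>\<phi>\<close>, so that modules become
  vector spaces by \<open>restr\<close>, and both \<open>A\<close> and its smash product are
  instances.\<close>

locale fd_algebra = K: field K + R: ring R
 for K :: "('k, 'x) ring_scheme" and R :: "('r, 'y) ring_scheme" (structure) + fixes \<phi> :: "'k \<Rightarrow> 'r"
 assumes hom: "\<phi> \<in> ring_hom K R"
  and central: "c \<in> carrier K \<Longrightarrow> r \<in> carrier R \<Longrightarrow> \<phi> c \<otimes>\<^sub>R r = r \<otimes>\<^sub>R \<phi> c"
  and fin_dim: "fin_gen K (restr \<phi> (Reg R))"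
begin
lemma \<phi>_closed [simp, intro]: "c \<in> carrier K \<Longrightarrow> \<phi> c \<in> carrier R"
 using hom by (rule ring_hom_closed)

lemma restr_module: "LMod R B \<Longrightarrow> LMod K (restr \<phi> B)"
 using K.ring_axioms _ hom by (rule restr_left_module)

lemma fin_gen_restr: "LMod R B \<Longrightarrow> fin_gen R B \<Longrightarrow> fin_gen K (restr \<phi> B)"
 using fin_gen_restrI[OF K.ring_axioms _ hom fin_dim] .

lemma fin_genD: "LMod R B \<Longrightarrow> fin_gen K (restr \<phi> B) \<Longrightarrow> fin_gen R B"
 using fin_gen_restrD[OF K.ring_axioms _ hom] .

lemma regular: "LMod R (Reg R)"
 using R.ring_axioms by (rule regular_left_module)

lemma fin_gen_submodule:
 fixes B :: "('r, 'm) module"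
 assumes "LMod R B" "fin_gen R B" "submodule U R B"
 shows "fin_gen R (B\<lparr>carrier := U\<rparr>)"
proof -
 interpret B: left_module R B by fact
 interpret V: left_module K "restr \<phi> B" using assms(1) by (rule restr_module)
 have "submodule U K (restr \<phi> B)"
  using B.submoduleD[OF assms(3)] by (intro V.submoduleI) auto
 then have "fin_gen K (restr \<phi> B\<lparr>carrier := U\<rparr>)"
  using field_fin_gen_submodule[OF K.field_axioms restr_module[OF assms(1)] fin_gen_restr[OF assms(1,2)]] by blast
 moreover have "restr \<phi> B\<lparr>carrier := U\<rparr> = restr \<phi> (B\<lparr>carrier := U\<rparr>)" by (simp add: restr_def)
 ultimately show ?thesis using fin_genD[OF B.submodule_left_module[OF assms(3)]] by simp
qed

lemma coinduced_left_module:
 assumes "LMod R B" shows "LMod R (coinduced K R \<phi> B)"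
proof -
 interpret B: left_module R B by fact
 interpret V: left_module K "restr \<phi> B" using assms by (rule restr_module)
 interpret RR: left_module K "restr \<phi> (Reg R)" using regular by (rule restr_module)
 let ?C = "coinduced K R \<phi> B" and ?H = "Hom K (restr \<phi> (Reg R)) (restr \<phi> B)"
 have cl: "f b \<in> carrier B" if "f \<in> ?H" "b \<in> carrier R" for f b using Hom_closed[OF that(1), of b] that by simp
 have ext: "(\<lambda>b\<in>carrier R. f b) = f" if "f \<in> ?H" for f using Hom_restrict_self[OF that] by simp
 have s: "(\<lambda>b\<in>carrier R. f (b \<otimes>\<^sub>R a)) \<in> ?H" if f: "f \<in> ?H" and a: "a \<in> carrier R" for f a
 proof -
  interpret f: lhom K "restr \<phi> (Reg R)" "restr \<phi> B" f
   using f by (intro lhomI RR.left_module_axioms V.left_module_axioms)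
  have "(\<lambda>b\<in>carrier (restr \<phi> (Reg R)). f (b \<otimes>\<^sub>R a)) \<in> ?H"
   using RR.left_module_axioms
  proof (rule Hom_restrictI)
   fix x y assume "x \<in> carrier (restr \<phi> (Reg R))" "y \<in> carrier (restr \<phi> (Reg R))"
   then show "f ((x \<oplus>\<^bsub>restr \<phi> (Reg R)\<^esub> y) \<otimes>\<^sub>R a) = f (x \<otimes>\<^sub>R a) \<oplus>\<^bsub>restr \<phi> B\<^esub> f (y \<otimes>\<^sub>R a)"
    using f.add[of "x \<otimes>\<^sub>R a" "y \<otimes>\<^sub>R a"] a by (simp add: R.l_distr)
  next
   fix r x assume "r \<in> carrier K" "x \<in> carrier (restr \<phi> (Reg R))"
   then show "f ((r \<odot>\<^bsub>restr \<phi> (Reg R)\<^esub> x) \<otimes>\<^sub>R a) = r \<odot>\<^bsub>restr \<phi> B\<^esub> f (x \<otimes>\<^sub>R a)"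
    using f.smult[of r "x \<otimes>\<^sub>R a"] a by (simp add: R.m_assoc)
  qed (use cl[OF f] a in auto)
  then show ?thesis by simp
 qed
 have ag: "abelian_group ?C"
  by (rule abelian_group_cong[OF star_abelian_group[OF RR.left_module_axioms V.left_module_axioms]]) simp_all
 show ?thesis
 proof (intro left_module.intro left_module_axioms.intro ag R.ring_axioms)
  fix f assume f: "f \<in> carrier ?C"
  have "\<one>\<^sub>R \<odot>\<^bsub>?C\<^esub> f = (\<lambda>b\<in>carrier R. f b)" by (auto simp: fun_eq_iff)
  then show "\<one>\<^sub>R \<odot>\<^bsub>?C\<^esub> f = f" using ext[of f] f by simp
 next
  fix a f assume a: "a \<in> carrier R" and f: "f \<in> carrier ?C"
  interpret f: lhom K "restr \<phi> (Reg R)" "restr \<phi> B" f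
   using f by (intro lhomI RR.left_module_axioms V.left_module_axioms) simp
  show "a \<odot>\<^bsub>?C\<^esub> f \<in> carrier ?C" using s f a by simp
  fix b assume b: "b \<in> carrier R"
  have "f (x \<otimes>\<^sub>R (a \<oplus>\<^sub>R b)) = f (x \<otimes>\<^sub>R a) \<oplus>\<^sub>B f (x \<otimes>\<^sub>R b)" if "x \<in> carrier R" for x
   using f.add[of "x \<otimes>\<^sub>R a" "x \<otimes>\<^sub>R b"] a b that by (simp add: R.r_distr)
  then show "(a \<oplus>\<^sub>R b) \<odot>\<^bsub>?C\<^esub> f = a \<odot>\<^bsub>?C\<^esub> f \<oplus>\<^bsub>?C\<^esub> b \<odot>\<^bsub>?C\<^esub> f"
   by (auto simp: fun_eq_iff)
  show "(a \<otimes>\<^sub>R b) \<odot>\<^bsub>?C\<^esub> f = a \<odot>\<^bsub>?C\<^esub> (b \<odot>\<^bsub>?C\<^esub> f)"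
   using a b by (auto simp: fun_eq_iff R.m_assoc)
 next
  fix a f g assume "a \<in> carrier R" "f \<in> carrier ?C" "g \<in> carrier ?C"
  then show "a \<odot>\<^bsub>?C\<^esub> (f \<oplus>\<^bsub>?C\<^esub> g) = a \<odot>\<^bsub>?C\<^esub> f \<oplus>\<^bsub>?C\<^esub> a \<odot>\<^bsub>?C\<^esub> g"
   by (auto simp: fun_eq_iff)
 qed
qed

text \<open>By adjunction: \<open>f\<close> corresponds to the linear map
  \<open>w \<mapsto> f w \<one>\<close>, which extends to a linear map \<open>g\<close> because
  vector spaces are injective, and \<open>g\<close> corresponds to
  \<open>y \<mapsto> (b \<mapsto> g (b y))\<close>.\<close>

lemma coinduced_injective:
 assumes B: "LMod R B" shows "injective_module R (coinduced K R \<phi> B)"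
proof (rule injectiveI[OF coinduced_left_module[OF B]])
 let ?C = "coinduced K R \<phi> B"
 interpret B: left_module R B by fact
 interpret RR: left_module K "restr \<phi> (Reg R)" using regular by (rule restr_module)
 fix W Y :: "'r lmod" and i f
 assume *: "LMod R W" "LMod R Y" "i \<in> Hom R W Y" "inj_on i (carrier W)" "f \<in> Hom R W ?C"
 interpret W: left_module R W by fact
 interpret Y: left_module R Y by fact
 have fc: "f w \<in> Hom K (restr \<phi> (Reg R)) (restr \<phi> B)" if "w \<in> carrier W" for w
  using Hom_closed[OF *(5) that] by simp
 have fcl: "f w b \<in> carrier B" if "w \<in> carrier W" "b \<in> carrier R" for w b
  using Hom_closed[OF fc[OF that(1)], of b] that by simp
 have fs: "f (r \<odot>\<^sub>W w) b = f w (b \<otimes>\<^sub>R r)" if "w \<in> carrier W" "b \<in> carrier R" "r \<in> carrier R" for w b r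
  using Hom_smult[OF *(5) that(3,1)] that by simp
 have f0: "(\<lambda>w\<in>carrier (restr \<phi> W). f w \<one>\<^sub>R) \<in> Hom K (restr \<phi> W) (restr \<phi> B)"
  using restr_module[OF *(1)]
 proof (rule Hom_restrictI)
  fix c w assume c: "c \<in> carrier K" and w: "w \<in> carrier (restr \<phi> W)"
  then have "f (c \<odot>\<^bsub>restr \<phi> W\<^esub> w) \<one>\<^sub>R = f w (\<phi> c)" using fs[of w "\<one>\<^sub>R" "\<phi> c"] by simp
  also have "\<dots> = \<phi> c \<odot>\<^sub>B f w \<one>\<^sub>R"
   using Hom_smult[OF fc, of w c "\<one>\<^sub>R"] c w by simp
  finally show "f (c \<odot>\<^bsub>restr \<phi> W\<^esub> w) \<one>\<^sub>R = c \<odot>\<^bsub>restr \<phi> B\<^esub> f w \<one>\<^sub>R" by simp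
 qed (use fcl Hom_add[OF *(5)] in auto)
 obtain g where g: "g \<in> Hom K (restr \<phi> Y) (restr \<phi> B)"
  "\<And>w. w \<in> carrier (restr \<phi> W) \<Longrightarrow> g (i w) = (\<lambda>w\<in>carrier (restr \<phi> W). f w \<one>\<^sub>R) w"
  using injective_extend[OF field_injective[OF K.field_axioms restr_module[OF B]] restr_module[OF *(1)] restr_module[OF *(2)]
    restr_hom[OF hom *(3)] _ f0] *(4) by (metis restr_simps(1))
 interpret g: lhom K "restr \<phi> Y" "restr \<phi> B" g
  using g by (intro lhomI restr_module B *)
 have gc: "(\<lambda>b\<in>carrier R. g (b \<odot>\<^sub>Y y)) \<in> Hom K (restr \<phi> (Reg R)) (restr \<phi> B)" if y: "y \<in> carrier Y" for y
 proof -
  have "(\<lambda>b\<in>carrier (restr \<phi> (Reg R)). g (b \<odot>\<^sub>Y y)) \<in> Hom K (restr \<phi> (Reg R)) (restr \<phi> B)"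
   by (rule Hom_restrictI[OF RR.left_module_axioms])
    (use y g.closed g.add[simplified] g.smult[simplified] in \<open>auto simp: Y.smult_l_distr Y.smult_assoc\<close>)
  then show ?thesis by simp
 qed
 show "\<exists>g\<in>Hom R Y ?C. \<forall>x\<in>carrier W. g (i x) = f x"
 proof (intro bexI ballI)
  show "(\<lambda>y\<in>carrier Y. \<lambda>b\<in>carrier R. g (b \<odot>\<^sub>Y y)) \<in> Hom R Y ?C"
   using *(2)
   by (rule Hom_restrictI)
    (use gc g.add[simplified] in \<open>auto simp: fun_eq_iff Y.smult_r_distr Y.smult_assoc\<close>)
  fix w assume w: "w \<in> carrier W"
  have "g (b \<odot>\<^sub>Y i w) = f w b" if "b \<in> carrier R" for b
   using g(2)[of "b \<odot>\<^sub>W w"] w that Hom_smult[OF *(3) that w] fs[OF w R.one_closed that] by simp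
  then have "(\<lambda>y\<in>carrier Y. \<lambda>b\<in>carrier R. g (b \<odot>\<^sub>Y y)) (i w) = (\<lambda>b\<in>carrier R. f w b)"
   using Hom_closed[OF *(3) w] by (auto simp: fun_eq_iff)
  then show "(\<lambda>y\<in>carrier Y. \<lambda>b\<in>carrier R. g (b \<odot>\<^sub>Y y)) (i w) = f w"
   using Hom_restrict_self[OF fc[OF w]] by simp
 qed
qed

text \<open>Evaluation at a finite spanning set of the algebra embeds the coinduced module in a
  finite power of \<open>B\<close>.\<close>

lemma coinduced_fin_gen:
 assumes B: "LMod R B" "fin_gen R B" shows "fin_gen R (coinduced K R \<phi> B)"
proof (rule fin_genD[OF coinduced_left_module[OF B(1)]])
 let ?C = "coinduced K R \<phi> B"
 interpret B: left_module R B by fact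
 interpret RR: left_module K "restr \<phi> (Reg R)" using regular by (rule restr_module)
 obtain S where S: "finite S" "S \<subseteq> carrier R" "carrier R \<subseteq> lspan K (restr \<phi> (Reg R)) S"
  using fin_dim RR.fin_gen_iff by auto
 let ?P = "pi_module S (\<lambda>_. restr \<phi> B)"
 have P: "LMod K ?P" "fin_gen K ?P"
  using B by (auto intro!: pi_left_module pi_fin_gen K.ring_axioms restr_module fin_gen_restr S(1))
 have C: "LMod K (restr \<phi> ?C)" by (intro restr_module coinduced_left_module B)
 let ?r = "\<lambda>f\<in>carrier (restr \<phi> ?C). \<lambda>s\<in>S. f s"
 have fcl: "f b \<in> carrier B" if "f \<in> carrier (restr \<phi> ?C)" "b \<in> carrier R" for f b
  using Hom_closed[of f K "restr \<phi> (Reg R)" "restr \<phi> B" b] that by simp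
 have r: "?r \<in> Hom K (restr \<phi> ?C) ?P"
  using C
 proof (rule Hom_restrictI)
  fix c f assume c: "c \<in> carrier K" and f: "f \<in> carrier (restr \<phi> ?C)"
  \<comment> \<open>Scalars multiply the argument from the right but the values from the left;
    \<open>\<phi> c\<close> being central reconciles the two.\<close>
  have "f (b \<otimes>\<^sub>R \<phi> c) = \<phi> c \<odot>\<^sub>B f b" if "b \<in> carrier R" for b
   using Hom_smult[of f K "restr \<phi> (Reg R)" "restr \<phi> B" c b] f c that by (simp add: central)
  then show "(\<lambda>s\<in>S. (c \<odot>\<^bsub>restr \<phi> ?C\<^esub> f) s) = c \<odot>\<^bsub>?P\<^esub> (\<lambda>s\<in>S. f s)"
   using S(2) by (auto simp: fun_eq_iff)
 qed (use fcl S(2) in \<open>auto simp: fun_eq_iff\<close>)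
 interpret r: lhom K "restr \<phi> ?C" ?P ?r using C P(1) r by (rule lhomI)
 have "inj_on ?r (carrier (restr \<phi> ?C))"
 proof (rule inj_onI)
  fix f g assume f: "f \<in> carrier (restr \<phi> ?C)" and g: "g \<in> carrier (restr \<phi> ?C)" and eq: "?r f = ?r g"
  have eqS: "f s = g s" if "s \<in> S" for s using fun_cong[OF eq, of s] f g that by (simp split: if_splits)
  show "f = g"
   by (rule hom_eq_on_generators[OF RR.left_module_axioms restr_module[OF B(1)], of f g S]) (use f g S eqS in auto)
 qed
 then show "fin_gen K (restr \<phi> ?C)"
  by (rule field_fin_gen_inj[OF K.field_axioms C P(1) r _ P(2)])
qed

end

text \<open>The property under the choice operator of \<open>inj_presentation\<close>; once it
  holds, the chosen sequence is exact and not an arbitrary value.\<close>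

definition inj_presented :: "('r, 'x) ring_scheme \<Rightarrow> 'r lmod \<Rightarrow> bool" where
 "inj_presented R W \<longleftrightarrow> (\<exists>(E :: 'r lmod) (C :: 'r lmod) i p. injective_module R E \<and> fin_gen R E \<and> LMod R C \<and>
   short_exact R W E C i p)"

text \<open>An embedding in a finitely generated injective module of any type suffices: that module
  is copied to the universe, and the cokernel stays there because
  \<open>quotient_module_exists\<close> keeps the type.\<close>

lemma inj_presentedI:
 fixes W :: "'r lmod"
 assumes "LMod R W" "injective_module R E" "fin_gen R E" "j \<in> Hom R W E" "inj_on j (carrier W)"
 shows "inj_presented R W"
proof -
 have E: "LMod R E" using assms(2) by (rule injective_left_module)
 obtain N :: "'r lmod" and f g where N: "LMod R N" "fin_gen R N" "f \<in> Hom R E N" "g \<in> Hom R N E"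
  "\<And>x. x \<in> carrier E \<Longrightarrow> g (f x) = x" "\<And>y. y \<in> carrier N \<Longrightarrow> f (g y) = y"
  by (rule fin_gen_copy_iso[OF E assms(3)]) (rule that)
 have Ninj: "injective_module R N" using injective_retract[OF assms(2) N(1,4,3,6)] .
 define i where "i = (\<lambda>x\<in>carrier W. f (j x))"
 have i: "i \<in> Hom R W N" unfolding i_def using assms(1,4) N(3) by (rule Hom_comp)
 interpret i: lhom R W N i using assms(1) N(1) i by (rule lhomI)
 have jc: "j x \<in> carrier E" if "x \<in> carrier W" for x using assms(4) that by (rule Hom_closed)
 have inj: "inj_on i (carrier W)"
 proof (rule inj_onI)
  fix x y assume *: "x \<in> carrier W" "y \<in> carrier W" "i x = i y"
  then have "f (j x) = f (j y)" by (simp add: i_def)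
  then have "j x = j y" using N(5)[OF jc[OF *(1)]] N(5)[OF jc[OF *(2)]] by metis
  then show "x = y" using assms(5) * by (simp add: inj_on_def)
 qed
 obtain C :: "'r lmod" and p where "LMod R C" "p \<in> Hom R N C" "p ` carrier N = carrier C"
  "\<And>x. x \<in> carrier N \<Longrightarrow> p x = \<zero>\<^sub>C \<longleftrightarrow> x \<in> i ` carrier W"
  by (rule quotient_module_exists[OF N(1) i.range]) (rule that)
 moreover from this have "i ` carrier W = {y \<in> carrier N. p y = \<zero>\<^sub>C}" using i.closed by blast
 ultimately have "short_exact R W N C i p" using i inj by (simp add: short_exact_def)
 then show ?thesis using Ninj N(2) \<open>left_module R C\<close> unfolding inj_presented_def by blast
qed

text \<open>\<open>W\<close> embeds in the module coinduced from it by
  \<open>x \<mapsto> (b \<mapsto> b x)\<close>; the value at 1 recovers \<open>x\<close>.\<close>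

lemma (in fd_algebra) inj_presented:
 fixes W :: "'r lmod"
 assumes W: "LMod R W" "fin_gen R W" shows "inj_presented R W"
proof (rule inj_presentedI[OF W(1) coinduced_injective[OF W(1)] coinduced_fin_gen[OF W]])
 interpret W: left_module R W by fact
 interpret RR: left_module K "restr \<phi> (Reg R)" using regular by (rule restr_module)
 let ?j = "\<lambda>x\<in>carrier W. \<lambda>b\<in>carrier R. b \<odot>\<^sub>W x"
 have c: "(\<lambda>b\<in>carrier R. b \<odot>\<^sub>W x) \<in> Hom K (restr \<phi> (Reg R)) (restr \<phi> W)" if "x \<in> carrier W" for x
  using that by (auto simp: mod_hom_def W.smult_l_distr W.smult_assoc)
 show "?j \<in> Hom R W (coinduced K R \<phi> W)" using W(1)
  by (rule Hom_restrictI) (use c in \<open>auto simp: fun_eq_iff W.smult_r_distr W.smult_assoc\<close>)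
 show "inj_on ?j (carrier W)"
 proof (rule inj_onI)
  fix x y assume *: "x \<in> carrier W" "y \<in> carrier W" "?j x = ?j y"
  then have "(\<lambda>b\<in>carrier R. b \<odot>\<^sub>W x) \<one>\<^sub>R = (\<lambda>b\<in>carrier R. b \<odot>\<^sub>W y) \<one>\<^sub>R" by simp
  then show "x = y" using * by simp
 qed
qed

section \<open>The stable category\<close>

text \<open>The difference of \<open>f\<close> and \<open>g\<close> factors through an injective
  module. As arbitrary functions are allowed, composites and sums can be compared without
  restricting them to carriers.\<close>

definition stab_eq :: "('r, 'x) ring_scheme \<Rightarrow> 'r lmod \<Rightarrow> 'r lmod \<Rightarrow> 'r lmap \<Rightarrow>
  'r lmap \<Rightarrow> bool" where
 "stab_eq R W Y f g \<longleftrightarrow> (\<exists>(E :: 'r lmod) a b. injective_module R E \<and> a \<in> Hom R W E \<and> b \<in> Hom R E Y \<and>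
   (\<forall>x\<in>carrier W. g x = f x \<oplus>\<^sub>Y b (a x)))"

lemma stab_eqI:
 fixes E :: "'r lmod"
 assumes "injective_module R E" "a \<in> Hom R W E" "b \<in> Hom R E Y"
  and "\<And>x. x \<in> carrier W \<Longrightarrow> g x = f x \<oplus>\<^sub>Y b (a x)"
 shows "stab_eq R W Y f g"
 unfolding stab_eq_def using assms by blast

lemma stab_eq_cong:
 assumes "\<And>x. x \<in> carrier W \<Longrightarrow> f x = f' x" "\<And>x. x \<in> carrier W \<Longrightarrow> g x = g' x"
 shows "stab_eq R W Y f g \<longleftrightarrow> stab_eq R W Y f' g'"
 using assms by (simp add: stab_eq_def)

lemma stab_eq_subst:
 assumes "stab_eq R W Y f' g'" "\<And>x. x \<in> carrier W \<Longrightarrow> f x = f' x" "\<And>x. x \<in> carrier W \<Longrightarrow> g x = g' x"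
 shows "stab_eq R W Y f g"
 using assms by (simp add: stab_eq_def)

lemma stab_eq_restrict [simp]:
 "stab_eq R W Y (\<lambda>x\<in>carrier W. f x) g = stab_eq R W Y f g" "stab_eq R W Y f (\<lambda>x\<in>carrier W. g x) = stab_eq R W Y f g"
 by (simp_all add: stab_eq_def)

definition stab_iso :: "('r, 'x) ring_scheme \<Rightarrow> 'r lmod \<Rightarrow> 'r lmod \<Rightarrow> bool" where
 "stab_iso R W Y \<longleftrightarrow> (\<exists>f\<in>Hom R W Y. \<exists>g\<in>Hom R Y W.
   stab_eq R W W (\<lambda>x. g (f x)) (\<lambda>x. x) \<and> stab_eq R Y Y (\<lambda>x. f (g x)) (\<lambda>x. x))"

lemma stab_iso_sym: "stab_iso R W Y \<Longrightarrow> stab_iso R Y W"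
 unfolding stab_iso_def by blast

lemma short_exactD:
 assumes "short_exact R W Y Z f g"
 shows "f \<in> Hom R W Y" "g \<in> Hom R Y Z" "inj_on f (carrier W)" "g ` carrier Y = carrier Z"
  "\<And>w. w \<in> carrier W \<Longrightarrow> g (f w) = \<zero>\<^sub>Z"
  "\<And>y. y \<in> carrier Y \<Longrightarrow> g y = \<zero>\<^sub>Z \<Longrightarrow> \<exists>w\<in>carrier W. y = f w"
 using assms unfolding short_exact_def by blast+

text \<open>The assumption provides enough finitely generated injectives; the choice of the
  sequences formed by \<open>IE\<close>, \<open>IC\<close>, \<open>Ii\<close> and \<open>Ip\<close>
  rests on it.\<close>

locale stable_ring = ring R for R :: "('r, 'x) ring_scheme" (structure) +
 assumes pres: "LMod R (W :: 'r lmod) \<Longrightarrow> fin_gen R W \<Longrightarrow> inj_presented R W"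
begin
definition obj :: "'r lmod \<Rightarrow> bool" where "obj W \<longleftrightarrow> LMod R W \<and> fin_gen R W"

abbreviation "hm W Y \<equiv> Hom R W Y"
abbreviation "lm W \<equiv> LMod R W"
abbreviation "T0 \<equiv> stable_shift_cat R"
abbreviation "T \<equiv> stable_category R"
abbreviation "cl W Y f \<equiv> stable_class R W Y f"

section \<open>The fixed injective presentations\<close>

definition "IE W = fst (inj_presentation R W)"
definition "IC W = fst (snd (inj_presentation R W))"
definition "Ii W = fst (snd (snd (inj_presentation R W)))"
definition "Ip W = snd (snd (snd (inj_presentation R W)))"

lemma inj_presentation_eq: "inj_presentation R W = (IE W, IC W, Ii W, Ip W)"
 by (simp add: IE_def IC_def Ii_def Ip_def)

lemma cosyzygy_eq: "cosyzygy R W = IC W"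
 by (simp add: cosyzygy_def inj_presentation_eq)

lemma objD: "obj W \<Longrightarrow> lm W" "obj W \<Longrightarrow> fin_gen R W"
 by (simp_all add: obj_def)

lemma presentation:
 assumes "obj W"
 shows "injective_module R (IE W)" "fin_gen R (IE W)" "lm (IC W)" "short_exact R W (IE W) (IC W) (Ii W) (Ip W)"
proof -
 have "\<exists>z. case z of (E :: 'r lmod, C :: 'r lmod, i, p) \<Rightarrow> injective_module R E \<and> fin_gen R E \<and> LMod R C \<and> short_exact R W E C i p"
 proof -
  obtain E C :: "'r lmod" and i p where "injective_module R E" "fin_gen R E" "LMod R C" "short_exact R W E C i p"
   using pres[of W] assms unfolding inj_presented_def obj_def by blast
  then show ?thesis by (intro exI[of _ "(E, C, i, p)"]) simp
 qed
 from someI_ex[OF this] have "case inj_presentation R W of (E, C, i, p) \<Rightarrow>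
   injective_module R E \<and> fin_gen R E \<and> LMod R C \<and> short_exact R W E C i p"
  unfolding inj_presentation_def .
 then show "injective_module R (IE W)" "fin_gen R (IE W)" "lm (IC W)" "short_exact R W (IE W) (IC W) (Ii W) (Ip W)"
  by (simp_all add: inj_presentation_eq)
qed

lemma IE_obj: "obj W \<Longrightarrow> obj (IE W)"
 using presentation[of W] by (simp add: obj_def injective_module_def)

lemma IE_lm: "obj W \<Longrightarrow> lm (IE W)"
 using IE_obj objD by blast

lemma short_exact_obj: "obj Y \<Longrightarrow> lm Z \<Longrightarrow> short_exact R W Y Z f g \<Longrightarrow> obj Z"
 using left_module.fin_gen_image[of R Y Z g] short_exactD[of R W Y Z f g] unfolding obj_def by blast

lemma IC_obj: "obj W \<Longrightarrow> obj (IC W)"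
 using short_exact_obj[OF IE_obj presentation(3,4)] .

text \<open>A map through any injective module extends along the fixed embedding of \<open>W\<close>
  in \<open>IE W\<close>. With one module for all factorisations these can be added, as transitivity
  and sums require.\<close>

lemma stab_eqE:
 assumes "obj W" "lm Y" "stab_eq R W Y f g"
 obtains b where "b \<in> hm (IE W) Y" "\<And>x. x \<in> carrier W \<Longrightarrow> g x = f x \<oplus>\<^sub>Y b (Ii W x)"
proof -
 obtain E :: "'r lmod" and a b where *: "injective_module R E" "a \<in> hm W E" "b \<in> hm E Y"
  "\<forall>x\<in>carrier W. g x = f x \<oplus>\<^sub>Y b (a x)"
  using assms(3) unfolding stab_eq_def by blast
 note se = short_exactD[OF presentation(4)[OF assms(1)]]
 obtain c where c: "c \<in> hm (IE W) E" "\<And>x. x \<in> carrier W \<Longrightarrow> c (Ii W x) = a x"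
  by (rule injective_extend[OF *(1) objD(1)[OF assms(1)] IE_lm[OF assms(1)] se(1,3) *(2)]) (rule that)
 have "(\<lambda>x\<in>carrier (IE W). b (c x)) \<in> hm (IE W) Y"
  by (rule Hom_comp[OF IE_lm[OF assms(1)] c(1) *(3)])
 then show ?thesis
  by (rule that) (use * c Hom_closed[OF se(1)] in simp)
qed

section \<open>The stable relation as a congruence\<close>

lemma stab_eq_self: "obj W \<Longrightarrow> lm Y \<Longrightarrow> (\<And>x. x \<in> carrier W \<Longrightarrow> f x \<in> carrier Y) \<Longrightarrow>
  (\<And>x. x \<in> carrier W \<Longrightarrow> g x = f x) \<Longrightarrow> stab_eq R W Y f g"
proof -
 assume *: "obj W" "lm Y" and f: "\<And>x. x \<in> carrier W \<Longrightarrow> f x \<in> carrier Y" and g: "\<And>x. x \<in> carrier W \<Longrightarrow> g x = f x"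
 interpret Y: left_module R Y by fact
 note se = short_exactD[OF presentation(4)[OF *(1)]]
 show ?thesis
  by (rule stab_eqI[OF presentation(1)[OF *(1)] se(1) Hom_zero[OF IE_lm[OF *(1)] *(2)]])
   (simp add: g f Hom_closed[OF se(1)])
qed

lemma stab_eq_refl: "obj W \<Longrightarrow> lm Y \<Longrightarrow> f \<in> hm W Y \<Longrightarrow> stab_eq R W Y f f"
 by (rule stab_eq_self) (auto intro: Hom_closed)

lemma stab_eq_sym:
 assumes "obj W" "lm Y" "\<And>x. x \<in> carrier W \<Longrightarrow> f x \<in> carrier Y" "stab_eq R W Y f g"
 shows "stab_eq R W Y g f"
proof -
 interpret Y: left_module R Y by fact
 obtain b where b: "b \<in> hm (IE W) Y" "\<And>x. x \<in> carrier W \<Longrightarrow> g x = f x \<oplus>\<^sub>Y b (Ii W x)"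
  by (rule stab_eqE[OF assms(1,2,4)]) (rule that)
 note se = short_exactD[OF presentation(4)[OF assms(1)]]
 show ?thesis
 proof (rule stab_eqI[OF presentation(1)[OF assms(1)] se(1) Hom_neg[OF IE_lm[OF assms(1)] assms(2) b(1)]])
  fix x assume x: "x \<in> carrier W"
  have "b (Ii W x) \<in> carrier Y" "Ii W x \<in> carrier (IE W)" using Hom_closed[OF se(1) x] Hom_closed[OF b(1)] by auto
  then show "f x = g x \<oplus>\<^sub>Y (\<lambda>x\<in>carrier (IE W). \<ominus>\<^sub>Y b x) (Ii W x)"
   using b(2)[OF x] assms(3)[OF x] by (simp add: Y.M.a_assoc Y.M.r_neg)
 qed
qed

lemma stab_eq_trans:
 assumes "obj W" "lm Y" "\<And>x. x \<in> carrier W \<Longrightarrow> f x \<in> carrier Y" "stab_eq R W Y f g" "stab_eq R W Y g h"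
 shows "stab_eq R W Y f h"
proof -
 interpret Y: left_module R Y by fact
 obtain b where b: "b \<in> hm (IE W) Y" "\<And>x. x \<in> carrier W \<Longrightarrow> g x = f x \<oplus>\<^sub>Y b (Ii W x)"
  by (rule stab_eqE[OF assms(1,2,4)]) (rule that)
 obtain c where c: "c \<in> hm (IE W) Y" "\<And>x. x \<in> carrier W \<Longrightarrow> h x = g x \<oplus>\<^sub>Y c (Ii W x)"
  by (rule stab_eqE[OF assms(1,2,5)]) (rule that)
 note se = short_exactD[OF presentation(4)[OF assms(1)]]
 show ?thesis
 proof (rule stab_eqI[OF presentation(1)[OF assms(1)] se(1) Hom_plus[OF IE_lm[OF assms(1)] assms(2) b(1) c(1)]])
  fix x assume x: "x \<in> carrier W"
  have i: "Ii W x \<in> carrier (IE W)" by (rule Hom_closed[OF se(1) x])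
  show "h x = f x \<oplus>\<^sub>Y (\<lambda>x\<in>carrier (IE W). b x \<oplus>\<^sub>Y c x) (Ii W x)"
   using b(2)[OF x] c(2)[OF x] assms(3)[OF x] Hom_closed[OF b(1) i] Hom_closed[OF c(1) i] i
   by (simp add: Y.M.a_assoc)
 qed
qed

lemma stab_eq_comp:
 assumes "obj W" "obj Y" "lm Z" "f \<in> hm W Y" "f' \<in> hm W Y" "g \<in> hm Y Z" "g' \<in> hm Y Z"
  "stab_eq R W Y f f'" "stab_eq R Y Z g g'"
 shows "stab_eq R W Z (\<lambda>x. g (f x)) (\<lambda>x. g' (f' x))"
proof (rule stab_eq_trans[OF assms(1,3)])
 interpret Z: left_module R Z by fact
 note W = objD(1)[OF assms(1)] and Y = objD(1)[OF assms(2)]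
 show "g (f x) \<in> carrier Z" if "x \<in> carrier W" for x using Hom_closed[OF assms(6) Hom_closed[OF assms(4) that]] .
 obtain b where b: "b \<in> hm (IE W) Y" "\<And>x. x \<in> carrier W \<Longrightarrow> f' x = f x \<oplus>\<^sub>Y b (Ii W x)"
  by (rule stab_eqE[OF assms(1) Y assms(8)]) (rule that)
 note se = short_exactD[OF presentation(4)[OF assms(1)]]
 show "stab_eq R W Z (\<lambda>x. g (f x)) (\<lambda>x. g (f' x))"
 proof (rule stab_eqI[OF presentation(1)[OF assms(1)] se(1) Hom_comp[OF IE_lm[OF assms(1)] b(1) assms(6)]])
  fix x assume x: "x \<in> carrier W"
  have i: "Ii W x \<in> carrier (IE W)" by (rule Hom_closed[OF se(1) x])
  show "g (f' x) = g (f x) \<oplus>\<^sub>Z (\<lambda>x\<in>carrier (IE W). g (b x)) (Ii W x)"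
   using b(2)[OF x] i Hom_add[OF assms(6) Hom_closed[OF assms(4) x] Hom_closed[OF b(1) i]] by simp
 qed
 obtain c where c: "c \<in> hm (IE Y) Z" "\<And>x. x \<in> carrier Y \<Longrightarrow> g' x = g x \<oplus>\<^sub>Z c (Ii Y x)"
  by (rule stab_eqE[OF assms(2,3,9)]) (rule that)
 note sy = short_exactD[OF presentation(4)[OF assms(2)]]
 show "stab_eq R W Z (\<lambda>x. g (f' x)) (\<lambda>x. g' (f' x))"
 proof (rule stab_eqI[OF presentation(1)[OF assms(2)] Hom_comp[OF W assms(5) sy(1)] c(1)])
  fix x assume x: "x \<in> carrier W"
  show "g' (f' x) = g (f' x) \<oplus>\<^sub>Z c ((\<lambda>x\<in>carrier W. Ii Y (f' x)) x)"
   using c(2)[OF Hom_closed[OF assms(5) x]] x by simp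
 qed
qed

lemma stab_eq_plus:
 assumes "obj W" "lm Y" "f \<in> hm W Y" "f' \<in> hm W Y" "g \<in> hm W Y" "g' \<in> hm W Y"
  "stab_eq R W Y f f'" "stab_eq R W Y g g'"
 shows "stab_eq R W Y (\<lambda>x. f x \<oplus>\<^sub>Y g x) (\<lambda>x. f' x \<oplus>\<^sub>Y g' x)"
proof -
 interpret Y: left_module R Y by fact
 obtain b where b: "b \<in> hm (IE W) Y" "\<And>x. x \<in> carrier W \<Longrightarrow> f' x = f x \<oplus>\<^sub>Y b (Ii W x)"
  by (rule stab_eqE[OF assms(1,2,7)]) (rule that)
 obtain c where c: "c \<in> hm (IE W) Y" "\<And>x. x \<in> carrier W \<Longrightarrow> g' x = g x \<oplus>\<^sub>Y c (Ii W x)"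
  by (rule stab_eqE[OF assms(1,2,8)]) (rule that)
 note se = short_exactD[OF presentation(4)[OF assms(1)]]
 show ?thesis
 proof (rule stab_eqI[OF presentation(1)[OF assms(1)] se(1) Hom_plus[OF IE_lm[OF assms(1)] assms(2) b(1) c(1)]])
  fix x assume x: "x \<in> carrier W"
  have i: "Ii W x \<in> carrier (IE W)" by (rule Hom_closed[OF se(1) x])
  show "f' x \<oplus>\<^sub>Y g' x = f x \<oplus>\<^sub>Y g x \<oplus>\<^sub>Y (\<lambda>x\<in>carrier (IE W). b x \<oplus>\<^sub>Y c x) (Ii W x)"
   using b(2)[OF x] c(2)[OF x] i Hom_closed[OF assms(3) x] Hom_closed[OF assms(5) x]
    Hom_closed[OF b(1) i] Hom_closed[OF c(1) i]
   by (simp add: Y.M.a_ac)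
 qed
qed

text \<open>It passes from the differences in \<open>stable_class\<close> to \<open>stab_eq\<close>,
  so that equality of cosets becomes a relation between representatives.\<close>

lemma cl_iff:
 assumes "obj W" "lm Y" "f \<in> hm W Y"
 shows "g \<in> cl W Y f \<longleftrightarrow> g \<in> hm W Y \<and> stab_eq R W Y f g"
proof -
 interpret Y: left_module R Y by fact
 have "factors_injective R W Y (\<lambda>x\<in>carrier W. g x \<ominus>\<^sub>Y f x) \<longleftrightarrow> stab_eq R W Y f g" if g: "g \<in> hm W Y"
 proof
  assume "factors_injective R W Y (\<lambda>x\<in>carrier W. g x \<ominus>\<^sub>Y f x)"
  then obtain E :: "'r lmod" and a b where *: "injective_module R E" "a \<in> hm W E" "b \<in> hm E Y"
   "(\<lambda>x\<in>carrier W. g x \<ominus>\<^sub>Y f x) = compose (carrier W) b a"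
   unfolding factors_injective_def by blast
  show "stab_eq R W Y f g"
  proof (rule stab_eqI[OF *(1-3)])
   fix x assume x: "x \<in> carrier W"
   have "g x \<ominus>\<^sub>Y f x = b (a x)" using fun_cong[OF *(4), of x] x by (simp add: compose_def)
   then have "f x \<oplus>\<^sub>Y (g x \<ominus>\<^sub>Y f x) = f x \<oplus>\<^sub>Y b (a x)" by simp
   then show "g x = f x \<oplus>\<^sub>Y b (a x)"
    using Hom_closed[OF g x] Hom_closed[OF assms(3) x] by (simp add: a_minus_def Y.M.add_cancel)
  qed
 next
  assume "stab_eq R W Y f g"
  then obtain E :: "'r lmod" and a b where *: "injective_module R E" "a \<in> hm W E" "b \<in> hm E Y"
   "\<forall>x\<in>carrier W. g x = f x \<oplus>\<^sub>Y b (a x)"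
   unfolding stab_eq_def by blast
  have "g x \<ominus>\<^sub>Y f x = b (a x)" if x: "x \<in> carrier W" for x
   using *(4) x Hom_closed[OF assms(3) x] Hom_closed[OF *(3) Hom_closed[OF *(2) x]]
   by (simp add: a_minus_def Y.M.a_ac Y.M.add_cancel)
  then have "(\<lambda>x\<in>carrier W. g x \<ominus>\<^sub>Y f x) = compose (carrier W) b a"
   by (simp add: compose_def cong: restrict_cong)
  then show "factors_injective R W Y (\<lambda>x\<in>carrier W. g x \<ominus>\<^sub>Y f x)"
   unfolding factors_injective_def using *(1-3) by blast
 qed
 then show ?thesis by (auto simp: stable_class_def)
qed

lemma cl_eq_iff:
 assumes "obj W" "lm Y" "f \<in> hm W Y" "g \<in> hm W Y"
 shows "cl W Y f = cl W Y g \<longleftrightarrow> stab_eq R W Y f g"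
proof
 assume "cl W Y f = cl W Y g"
 moreover have "g \<in> cl W Y g" using assms by (simp add: cl_iff stab_eq_refl)
 ultimately have "g \<in> cl W Y f" by simp
 then show "stab_eq R W Y f g" using assms by (simp add: cl_iff)
next
 assume fg: "stab_eq R W Y f g"
 have c: "h x \<in> carrier Y" if "h \<in> hm W Y" "x \<in> carrier W" for h x using that by (rule Hom_closed)
 show "cl W Y f = cl W Y g"
 proof (rule Set.set_eqI)
  fix h
  have "stab_eq R W Y f h \<longleftrightarrow> stab_eq R W Y g h" if "h \<in> hm W Y"
   using stab_eq_trans[OF assms(1,2) c[OF assms(3)] fg, of h]
    stab_eq_trans[OF assms(1,2) c[OF assms(4)] stab_eq_sym[OF assms(1,2) c[OF assms(3)] fg], of h] by blast
  then show "h \<in> cl W Y f \<longleftrightarrow> h \<in> cl W Y g" using assms by (auto simp: cl_iff)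
 qed
qed

lemma cl_self: "obj W \<Longrightarrow> lm Y \<Longrightarrow> f \<in> hm W Y \<Longrightarrow> f \<in> cl W Y f"
 by (simp add: cl_iff stab_eq_refl)

section \<open>The operations of the stable category on representatives\<close>

lemma cat_simps:
 "Ob T = {W. obj W}" "Ob T0 = {W. obj W}" "Mor T = Mor T0" "Cmp T = Cmp T0" "Ident T = Ident T0" "Plus T = Plus T0"
 "Null T = Null T0" "Shift T = IC" "Shift T0 = IC" "Shift_mor T = Shift_mor T0"
 by (auto simp: stable_category_def stable_shift_cat_def shift_cat.defs tri_cat.defs obj_def cosyzygy_eq fun_eq_iff)

lemma Mor_iff: "u \<in> Mor T0 W Y \<longleftrightarrow> (\<exists>f\<in>hm W Y. u = cl W Y f)"
 by (auto simp: stable_shift_cat_def)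

lemma Mor_bex: "(\<exists>u\<in>Mor T0 A B. P u) \<longleftrightarrow> (\<exists>f\<in>hm A B. P (cl A B f))"
 unfolding Bex_def Mor_iff by blast

lemma Ident_eq: "Ident T0 W = cl W W (\<lambda>x\<in>carrier W. x)"
 by (simp add: stable_shift_cat_def)

lemma Null_eq: "Null T0 W Y = cl W Y (\<lambda>x\<in>carrier W. \<zero>\<^sub>Y)"
 by (simp add: stable_shift_cat_def)

text \<open>Operations on classes are defined as unions over all representatives. Independence of
  the representatives means that all members of the union agree, and then the union is their common
  value.\<close>

lemma UN_const_eq: "A \<noteq> {} \<Longrightarrow> (\<And>x. x \<in> A \<Longrightarrow> B x = C) \<Longrightarrow> (\<Union>x\<in>A. B x) = C"
 by auto

lemma Cmp_eq:
 assumes "obj W" "obj Y" "lm Z" "f \<in> hm W Y" "g \<in> hm Y Z"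
 shows "Cmp T0 W Y Z (cl Y Z g) (cl W Y f) = cl W Z (\<lambda>x\<in>carrier W. g (f x))"
proof -
 note W = objD(1)[OF assms(1)] and Y = objD(1)[OF assms(2)]
 have "cl W Z (compose (carrier W) v u) = cl W Z (\<lambda>x\<in>carrier W. g (f x))"
  if "u \<in> cl W Y f" "v \<in> cl Y Z g" for u v
 proof -
  have u: "u \<in> hm W Y" "stab_eq R W Y f u" and v: "v \<in> hm Y Z" "stab_eq R Y Z g v"
   using that assms by (simp_all add: cl_iff Y)
  have "cl W Z (\<lambda>x\<in>carrier W. g (f x)) = cl W Z (compose (carrier W) v u)"
   using Hom_comp[OF W assms(4,5)] Hom_comp[OF W u(1) v(1)]
    stab_eq_comp[OF assms(1-4) u(1) assms(5) v(1) u(2) v(2)] assms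
   by (simp add: cl_eq_iff compose_def)
  then show ?thesis by simp
 qed
 moreover have "cl W Y f \<noteq> {}" "cl Y Z g \<noteq> {}" using cl_self assms Y by blast+
 ultimately have "(\<Union>u\<in>cl W Y f. \<Union>v\<in>cl Y Z g. cl W Z (compose (carrier W) v u)) = cl W Z (\<lambda>x\<in>carrier W. g (f x))"
  by (intro UN_const_eq)
 then show ?thesis by (simp add: stable_shift_cat_def)
qed

lemma Plus_eq:
 assumes "obj W" "lm Y" "f \<in> hm W Y" "g \<in> hm W Y"
 shows "Plus T0 W Y (cl W Y f) (cl W Y g) = cl W Y (\<lambda>x\<in>carrier W. f x \<oplus>\<^sub>Y g x)"
proof -
 note W = objD(1)[OF assms(1)]
 have "cl W Y (\<lambda>x\<in>carrier W. u x \<oplus>\<^sub>Y v x) = cl W Y (\<lambda>x\<in>carrier W. f x \<oplus>\<^sub>Y g x)"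
  if "u \<in> cl W Y f" "v \<in> cl W Y g" for u v
 proof -
  have u: "u \<in> hm W Y" "stab_eq R W Y f u" and v: "v \<in> hm W Y" "stab_eq R W Y g v"
   using that assms by (simp_all add: cl_iff)
  have "cl W Y (\<lambda>x\<in>carrier W. f x \<oplus>\<^sub>Y g x) = cl W Y (\<lambda>x\<in>carrier W. u x \<oplus>\<^sub>Y v x)"
   using Hom_plus[OF W assms(2) assms(3,4)] Hom_plus[OF W assms(2) u(1) v(1)]
    stab_eq_plus[OF assms(1,2,3) u(1) assms(4) v(1) u(2) v(2)] assms
   by (simp add: cl_eq_iff)
  then show ?thesis by simp
 qed
 moreover have "cl W Y f \<noteq> {}" "cl W Y g \<noteq> {}" using cl_self assms by blast+
 ultimately have "(\<Union>u\<in>cl W Y f. \<Union>v\<in>cl W Y g. cl W Y (\<lambda>x\<in>carrier W. u x \<oplus>\<^sub>Y v x))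
   = cl W Y (\<lambda>x\<in>carrier W. f x \<oplus>\<^sub>Y g x)"
  by (intro UN_const_eq)
 then show ?thesis by (simp add: stable_shift_cat_def)
qed

lemma zero_object_iff: "zero_object T Z \<longleftrightarrow> obj Z \<and> stab_eq R Z Z (\<lambda>x. x) (\<lambda>x. \<zero>\<^sub>Z)"
proof (cases "obj Z")
 case True
 note Z = objD(1)[OF True]
 show ?thesis
  using cl_eq_iff[OF True Z Hom_id[OF Z] Hom_zero[OF Z Z]] True
  by (simp add: zero_object_def cat_simps Ident_eq Null_eq)
qed (simp add: zero_object_def cat_simps)

lemma iso_mor_iff:
 assumes "obj W" "obj Y"
 shows "iso_mor T0 W Y a \<longleftrightarrow> (\<exists>f\<in>hm W Y. a = cl W Y f \<and> (\<exists>g\<in>hm Y W.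
   stab_eq R W W (\<lambda>x. g (f x)) (\<lambda>x. x) \<and> stab_eq R Y Y (\<lambda>x. f (g x)) (\<lambda>x. x)))"
proof -
 note W = objD(1)[OF assms(1)] and Y = objD(1)[OF assms(2)]
 have *: "Cmp T0 W Y W (cl Y W g) (cl W Y f) = Ident T0 W \<longleftrightarrow> stab_eq R W W (\<lambda>x. g (f x)) (\<lambda>x. x)"
  "Cmp T0 Y W Y (cl W Y f) (cl Y W g) = Ident T0 Y \<longleftrightarrow> stab_eq R Y Y (\<lambda>x. f (g x)) (\<lambda>x. x)"
  if "f \<in> hm W Y" "g \<in> hm Y W" for f g
  using that assms W Y Hom_id[OF W] Hom_id[OF Y] Hom_comp[OF W that] Hom_comp[OF Y that(2,1)]
  by (simp_all add: Cmp_eq Ident_eq cl_eq_iff)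
 show ?thesis
  unfolding iso_mor_def Mor_bex unfolding Mor_iff by (auto simp: *) blast
qed

lemma stab_iso_iff: "obj W \<Longrightarrow> obj Y \<Longrightarrow> stab_iso R W Y \<longleftrightarrow> (\<exists>a. iso_mor T0 W Y a)"
 unfolding iso_mor_iff stab_iso_def by blast

lemma direct_sum_iff:
 "direct_sum T S W Y \<longleftrightarrow> obj S \<and> obj W \<and> obj Y \<and>
   (\<exists>i\<in>hm W S. \<exists>j\<in>hm Y S. \<exists>p\<in>hm S W. \<exists>q\<in>hm S Y.
    stab_eq R W W (\<lambda>x. p (i x)) (\<lambda>x. x) \<and> stab_eq R Y Y (\<lambda>x. q (j x)) (\<lambda>x. x) \<and>
    stab_eq R W Y (\<lambda>x. q (i x)) (\<lambda>x. \<zero>\<^sub>Y) \<and> stab_eq R Y W (\<lambda>x. p (j x)) (\<lambda>x. \<zero>\<^sub>W) \<and>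
    stab_eq R S S (\<lambda>x. i (p x) \<oplus>\<^sub>S j (q x)) (\<lambda>x. x))"
proof (cases "obj S \<and> obj W \<and> obj Y")
 case True
 then have o: "obj S" "obj W" "obj Y" by auto
 note W = objD(1)[OF o(2)] and Y = objD(1)[OF o(3)] and S = objD(1)[OF o(1)]
 have e: "(Cmp T0 W S W (cl S W p) (cl W S i) = Ident T0 W) = stab_eq R W W (\<lambda>x. p (i x)) (\<lambda>x. x)"
  "(Cmp T0 Y S Y (cl S Y q) (cl Y S j) = Ident T0 Y) = stab_eq R Y Y (\<lambda>x. q (j x)) (\<lambda>x. x)"
  "(Cmp T0 W S Y (cl S Y q) (cl W S i) = Null T0 W Y) = stab_eq R W Y (\<lambda>x. q (i x)) (\<lambda>x. \<zero>\<^sub>Y)"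
  "(Cmp T0 Y S W (cl S W p) (cl Y S j) = Null T0 Y W) = stab_eq R Y W (\<lambda>x. p (j x)) (\<lambda>x. \<zero>\<^sub>W)"
  "(Plus T0 S S (Cmp T0 S W S (cl W S i) (cl S W p)) (Cmp T0 S Y S (cl Y S j) (cl S Y q)) = Ident T0 S)
   = stab_eq R S S (\<lambda>x. i (p x) \<oplus>\<^sub>S j (q x)) (\<lambda>x. x)"
  if "i \<in> hm W S" "j \<in> hm Y S" "p \<in> hm S W" "q \<in> hm S Y" for i j p q
 proof -
  note c = Hom_comp[OF W that(1,3)] Hom_comp[OF Y that(2,4)] Hom_comp[OF W that(1,4)]
   Hom_comp[OF Y that(2,3)] Hom_comp[OF S that(3,1)] Hom_comp[OF S that(4,2)]
  note k = Hom_id[OF W] Hom_id[OF Y] Hom_id[OF S] Hom_zero[OF W Y] Hom_zero[OF Y W]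
  show "(Cmp T0 W S W (cl S W p) (cl W S i) = Ident T0 W) = stab_eq R W W (\<lambda>x. p (i x)) (\<lambda>x. x)"
   using that o W c(1) k(1) by (simp add: Cmp_eq Ident_eq cl_eq_iff)
  show "(Cmp T0 Y S Y (cl S Y q) (cl Y S j) = Ident T0 Y) = stab_eq R Y Y (\<lambda>x. q (j x)) (\<lambda>x. x)"
   using that o Y c(2) k(2) by (simp add: Cmp_eq Ident_eq cl_eq_iff)
  show "(Cmp T0 W S Y (cl S Y q) (cl W S i) = Null T0 W Y) = stab_eq R W Y (\<lambda>x. q (i x)) (\<lambda>x. \<zero>\<^sub>Y)"
   using that o Y c(3) k(4) by (simp add: Cmp_eq Null_eq cl_eq_iff)
  show "(Cmp T0 Y S W (cl S W p) (cl Y S j) = Null T0 Y W) = stab_eq R Y W (\<lambda>x. p (j x)) (\<lambda>x. \<zero>\<^sub>W)"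
   using that o W c(4) k(5) by (simp add: Cmp_eq Null_eq cl_eq_iff)
  have "Plus T0 S S (Cmp T0 S W S (cl W S i) (cl S W p)) (Cmp T0 S Y S (cl Y S j) (cl S Y q))
    = cl S S (\<lambda>x\<in>carrier S. (\<lambda>x\<in>carrier S. i (p x)) x \<oplus>\<^sub>S (\<lambda>x\<in>carrier S. j (q x)) x)"
   using that o S c(5,6) by (simp only: Cmp_eq Plus_eq)
  also have "\<dots> = Ident T0 S \<longleftrightarrow> stab_eq R S S (\<lambda>x. (\<lambda>x\<in>carrier S. i (p x)) x \<oplus>\<^sub>S (\<lambda>x\<in>carrier S. j (q x)) x) (\<lambda>x. x)"
   using cl_eq_iff[OF o(1) S Hom_plus[OF S S c(5,6)] k(3)] by (simp only: Ident_eq stab_eq_restrict)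
  also have "\<dots> \<longleftrightarrow> stab_eq R S S (\<lambda>x. i (p x) \<oplus>\<^sub>S j (q x)) (\<lambda>x. x)"
   by (rule stab_eq_cong) auto
  finally show "(Plus T0 S S (Cmp T0 S W S (cl W S i) (cl S W p)) (Cmp T0 S Y S (cl Y S j) (cl S Y q)) = Ident T0 S)
   = stab_eq R S S (\<lambda>x. i (p x) \<oplus>\<^sub>S j (q x)) (\<lambda>x. x)" .
 qed
 show ?thesis using o e unfolding direct_sum_def cat_simps Mor_bex by (simp cong: bex_cong)
qed (auto simp: direct_sum_def cat_simps)

section \<open>Closure properties of hulls\<close>

lemma closure_hull_obj:
 assumes "W \<in> closure_hull T I" shows "obj W"
 using assms
proof induction
 case (shift W) then show ?case by (simp add: cat_simps IC_obj)
qed (auto simp: cat_simps zero_object_iff direct_sum_iff)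

lemma gen_level_obj: "W \<in> gen_level T I n \<Longrightarrow> obj W"
 by (cases "(T, I, n)" rule: gen_level.cases) (auto simp: zero_object_iff closure_hull_obj)

lemma zero_module_obj:
 assumes "lm W" shows "obj (W\<lparr>carrier := {\<zero>\<^sub>W}\<rparr>)"
proof -
 interpret W: left_module R W by fact
 show ?thesis using W.zero_submodule_fin_gen W.submodule_left_module[of "{\<zero>\<^sub>W}"] by (simp add: obj_def)
qed

text \<open>In the stable category \<open>W\<close> is also a direct sum of \<open>S\<close> and a
  zero module, so closure under summands gives closure under isomorphism.\<close>

lemma hull_iso:
 assumes "W \<in> closure_hull T I" "obj S" "stab_iso R W S"
 shows "S \<in> closure_hull T I"
proof -
 have oW: "obj W" using assms(1) by (rule closure_hull_obj)
 note W = objD(1)[OF oW] and S = objD(1)[OF assms(2)]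
 interpret W: left_module R W by fact
 interpret S: left_module R S by fact
 obtain p i where pi: "p \<in> hm W S" "i \<in> hm S W" "stab_eq R W W (\<lambda>x. i (p x)) (\<lambda>x. x)" "stab_eq R S S (\<lambda>x. p (i x)) (\<lambda>x. x)"
  using assms(3) unfolding stab_iso_def by blast
 let ?Z = "W\<lparr>carrier := {\<zero>\<^sub>W}\<rparr>"
 have oZ: "obj ?Z" using W by (rule zero_module_obj)
 note Z = objD(1)[OF oZ]
 interpret p: lhom R W S p using W S pi(1) by (rule lhomI)
 interpret i: lhom R S W i using S W pi(2) by (rule lhomI)
 interpret Z: left_module R ?Z by fact
 have j: "(\<lambda>x\<in>carrier ?Z. \<zero>\<^sub>W) \<in> hm ?Z W" by (rule Hom_zero[OF Z W])
 have q: "(\<lambda>x\<in>carrier W. \<zero>\<^bsub>?Z\<^esub>) \<in> hm W ?Z" by (rule Hom_zero[OF W Z])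
 have "direct_sum T W S ?Z"
  unfolding direct_sum_iff
 proof (intro conjI bexI[OF _ pi(2)] bexI[OF _ j] bexI[OF _ pi(1)] bexI[OF _ q])
  show "stab_eq R ?Z ?Z (\<lambda>x. (\<lambda>x\<in>carrier W. \<zero>\<^bsub>?Z\<^esub>) ((\<lambda>x\<in>carrier ?Z. \<zero>\<^sub>W) x)) (\<lambda>x. x)"
   by (rule stab_eq_self[OF oZ Z]) auto
  show "stab_eq R S ?Z (\<lambda>x. (\<lambda>x\<in>carrier W. \<zero>\<^bsub>?Z\<^esub>) (i x)) (\<lambda>x. \<zero>\<^bsub>?Z\<^esub>)"
   by (rule stab_eq_self[OF assms(2) Z]) auto
  show "stab_eq R ?Z S (\<lambda>x. p ((\<lambda>x\<in>carrier ?Z. \<zero>\<^sub>W) x)) (\<lambda>x. \<zero>\<^sub>S)"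
   by (rule stab_eq_self[OF oZ S]) auto
  have "stab_eq R W W (\<lambda>x. i (p x) \<oplus>\<^sub>W (\<lambda>x\<in>carrier ?Z. \<zero>\<^sub>W) ((\<lambda>x\<in>carrier W. \<zero>\<^bsub>?Z\<^esub>) x)) (\<lambda>x. x)
   \<longleftrightarrow> stab_eq R W W (\<lambda>x. i (p x)) (\<lambda>x. x)"
   by (rule stab_eq_cong) auto
  then show "stab_eq R W W (\<lambda>x. i (p x) \<oplus>\<^sub>W (\<lambda>x\<in>carrier ?Z. \<zero>\<^sub>W) ((\<lambda>x\<in>carrier W. \<zero>\<^bsub>?Z\<^esub>) x)) (\<lambda>x. x)"
   using pi(3) by simp
 qed (use pi oW assms oZ in auto)
 then show ?thesis by (rule closure_hull.summand[OF assms(1)])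
qed

text \<open>Rule \<open>summand\<close> asks for a complement; for a retract of modules, the kernel
  of \<open>b\<close> is a complement of \<open>W\<close> in \<open>S\<close>.\<close>

lemma hull_retract:
 assumes "S \<in> closure_hull T I" "obj W" "a \<in> hm W S" "b \<in> hm S W" "\<And>x. x \<in> carrier W \<Longrightarrow> b (a x) = x"
 shows "W \<in> closure_hull T I"
proof -
 have oS: "obj S" using assms(1) by (rule closure_hull_obj)
 note S = objD(1)[OF oS] and W = objD(1)[OF assms(2)]
 interpret S: left_module R S by fact
 interpret W: left_module R W by fact
 interpret a: lhom R W S a using W S assms(3) by (rule lhomI)
 interpret b: lhom R S W b using S W assms(4) by (rule lhomI)
 define Y where "Y = S\<lparr>carrier := {x \<in> carrier S. b x = \<zero>\<^sub>W}\<rparr>"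
 have Y: "lm Y" unfolding Y_def by (rule S.submodule_left_module[OF b.kernel])
 have cY: "x \<in> carrier Y \<longleftrightarrow> x \<in> carrier S \<and> b x = \<zero>\<^sub>W" for x by (simp add: Y_def)
 have oY': "\<zero>\<^sub>Y = \<zero>\<^sub>S" by (simp add: Y_def)
 have diff: "x \<ominus>\<^sub>S a (b x) \<in> carrier Y" if "x \<in> carrier S" for x
  using that by (simp add: cY assms(5) W.M.minus_eq_zero_iff)
 have q: "(\<lambda>x\<in>carrier S. x \<ominus>\<^sub>S a (b x)) \<in> hm S Y" using S
  by (rule Hom_restrictI)
   (use diff in \<open>auto simp: Y_def a_minus_def S.M.minus_add S.M.a_ac S.smult_r_distr S.smult_neg_right\<close>)
 have j: "(\<lambda>x\<in>carrier Y. x) \<in> hm Y S"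
  using S.Hom_inclusion[OF b.kernel] by (simp add: Y_def)
 have "(\<lambda>x\<in>carrier S. x \<ominus>\<^sub>S a (b x)) ` carrier S = carrier Y"
 proof
  show "carrier Y \<subseteq> (\<lambda>x\<in>carrier S. x \<ominus>\<^sub>S a (b x)) ` carrier S"
  proof
   fix y assume y: "y \<in> carrier Y"
   then have "y \<ominus>\<^sub>S a (b y) = y"
    by (simp add: cY a_minus_def S.M.minus_equality[of "\<zero>\<^sub>S" "\<zero>\<^sub>S"])
   then show "y \<in> (\<lambda>x\<in>carrier S. x \<ominus>\<^sub>S a (b x)) ` carrier S"
    using y by (intro image_eqI[of _ _ y]) (simp_all add: cY)
  qed
 qed (use diff in auto)
 \<comment> \<open>Submodules need not be finitely generated in this generality, but this one is the
   image of \<open>S\<close> under \<open>x \<mapsto> x - a (b x)\<close>.\<close>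
 then have oY: "obj Y" using S.fin_gen_image[OF Y q] objD(2)[OF oS] Y by (simp add: obj_def)
 have "direct_sum T S W Y"
  unfolding direct_sum_iff
 proof (intro conjI bexI[OF _ assms(3)] bexI[OF _ j] bexI[OF _ assms(4)] bexI[OF _ q])
  show "stab_eq R W W (\<lambda>x. b (a x)) (\<lambda>x. x)" by (rule stab_eq_self[OF assms(2) W]) (auto simp: assms(5))
  show "stab_eq R Y Y (\<lambda>x. (\<lambda>x\<in>carrier S. x \<ominus>\<^sub>S a (b x)) ((\<lambda>x\<in>carrier Y. x) x)) (\<lambda>x. x)"
   by (rule stab_eq_self[OF oY Y])
    (simp_all add: cY a_minus_def S.M.minus_equality[of "\<zero>\<^sub>S" "\<zero>\<^sub>S"])
  show "stab_eq R W Y (\<lambda>x. (\<lambda>x\<in>carrier S. x \<ominus>\<^sub>S a (b x)) (a x)) (\<lambda>x. \<zero>\<^sub>Y)"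
   by (rule stab_eq_self[OF assms(2) Y]) (simp_all add: cY oY' assms(5) a_minus_def S.M.r_neg)
  show "stab_eq R Y W (\<lambda>x. b ((\<lambda>x\<in>carrier Y. x) x)) (\<lambda>x. \<zero>\<^sub>W)"
   by (rule stab_eq_self[OF oY W]) (simp_all add: cY)
  show "stab_eq R S S (\<lambda>x. a (b x) \<oplus>\<^sub>S (\<lambda>x\<in>carrier Y. x) ((\<lambda>x\<in>carrier S. x \<ominus>\<^sub>S a (b x)) x)) (\<lambda>x. x)"
   by (rule stab_eq_self[OF oS S]) (simp_all add: diff[unfolded a_minus_def] a_minus_def S.M.add_cancel)
 qed (use oS oY assms in auto)
 then show ?thesis by (rule closure_hull.summand[OF assms(1)])
qed

text \<open>As \<open>g\<close> fixes \<open>W\<close>, the map \<open>1 - g\<close> factors as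
  \<open>t\<close> after \<open>p\<close>. Hence \<open>1 - h\<close> equals \<open>p\<close> after
  \<open>t\<close> and factors through the injective module \<open>E\<close>.\<close>

lemma cosyzygy_endo:
 fixes W E C :: "'r lmod"
 assumes "lm E" "lm C" "lm W" "short_exact R W E C i p" "injective_module R E" "g \<in> hm E E" "h \<in> hm C C"
  and "\<And>w. w \<in> carrier W \<Longrightarrow> g (i w) = i w" "\<And>x. x \<in> carrier E \<Longrightarrow> h (p x) = p (g x)"
 shows "stab_eq R C C h (\<lambda>x. x)"
proof -
 note se = short_exactD[OF assms(4)]
 interpret E: left_module R E by fact
 interpret C: left_module R C by fact
 interpret p: lhom R E C p using assms(1,2) se(2) by (rule lhomI)
 interpret g: lhom R E E g using assms(1,1,6) by (rule lhomI)
 interpret h: lhom R C C h using assms(2,2,7) by (rule lhomI)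
 have d: "(\<lambda>x\<in>carrier E. x \<ominus>\<^sub>E g x) \<in> hm E E"
  using Hom_minus[OF assms(1,1) Hom_id[OF assms(1)] assms(6)] by (simp cong: restrict_cong)
 have z: "(\<lambda>x\<in>carrier E. x \<ominus>\<^sub>E g x) x = \<zero>\<^sub>E" if x: "x \<in> carrier E" "p x = \<zero>\<^sub>C" for x
 proof -
  obtain w where w: "w \<in> carrier W" "x = i w" using se(6)[OF x] by blast
  then show ?thesis using x assms(8)[OF w(1)] by (simp add: a_minus_def E.M.r_neg)
 qed
 obtain t where t: "t \<in> hm C E" "\<And>x. x \<in> carrier E \<Longrightarrow> t (p x) = (\<lambda>x\<in>carrier E. x \<ominus>\<^sub>E g x) x"
  by (rule Hom_factor[OF assms(1,2,1) se(2) d se(4) z]) (assumption | rule that)+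
 show ?thesis
 proof (rule stab_eqI[OF assms(5) t(1) se(2)])
  fix c assume "c \<in> carrier C"
  then obtain x where x: "x \<in> carrier E" "c = p x" using se(4) by blast
  then show "c = h c \<oplus>\<^sub>C p (t c)"
   using t(2)[OF x(1)] assms(9)[OF x(1)] by (simp add: a_minus_def C.M.add_cancel)
 qed
qed

lemma cosyzygy_map:
 fixes W E C E' C' :: "'r lmod"
 assumes "lm W" "lm E" "lm C" "lm E'" "lm C'" "short_exact R W E C i p" "short_exact R W E' C' i' p'" "injective_module R E'"
 obtains g h where "g \<in> hm E E'" "h \<in> hm C C'" "\<And>w. w \<in> carrier W \<Longrightarrow> g (i w) = i' w"
  "\<And>x. x \<in> carrier E \<Longrightarrow> h (p x) = p' (g x)"
proof -
 note se = short_exactD[OF assms(6)] and se' = short_exactD[OF assms(7)]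
 obtain g where g: "g \<in> hm E E'" "\<And>w. w \<in> carrier W \<Longrightarrow> g (i w) = i' w"
  by (rule injective_extend[OF assms(8,1,2) se(1,3) se'(1)]) (rule that)
 have z: "(\<lambda>x\<in>carrier E. p' (g x)) x = \<zero>\<^bsub>C'\<^esub>" if x: "x \<in> carrier E" "p x = \<zero>\<^sub>C" for x
 proof -
  obtain w where w: "w \<in> carrier W" "x = i w" using se(6)[OF x] by blast
  show ?thesis using g(2)[OF w(1)] se'(5)[OF w(1)] x(1) w(2) by simp
 qed
 obtain h where h: "h \<in> hm C C'" "\<And>x. x \<in> carrier E \<Longrightarrow> h (p x) = (\<lambda>x\<in>carrier E. p' (g x)) x"
  by (rule Hom_factor[OF assms(2,3,5) se(2) Hom_comp[OF assms(2) g(1) se'(2)] se(4) z]) (assumption | rule that)+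
 show ?thesis by (rule that[OF g(1) h(1)]) (simp_all add: g(2) h(2))
qed

text \<open>The identity of \<open>W\<close> extends in both directions, and the two composites are
  covered by \<open>cosyzygy_endo\<close>. A functor carries the chosen presentation of
  \<open>W\<close> to an exact sequence other than the chosen one, which makes this comparison
  necessary.\<close>

lemma cosyzygy_unique:
 fixes W E C E' C' :: "'r lmod"
 assumes "lm W" "lm C" "lm C'" "short_exact R W E C i p" "short_exact R W E' C' i' p'"
  "injective_module R E" "injective_module R E'"
 shows "stab_iso R C C'"
proof -
 have E: "lm E" "lm E'" using assms(6,7) by (auto intro: injective_left_module)
 note se = short_exactD[OF assms(4)] and se' = short_exactD[OF assms(5)]
 obtain g h where g: "g \<in> hm E E'" "h \<in> hm C C'" "\<And>w. w \<in> carrier W \<Longrightarrow> g (i w) = i' w"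
  "\<And>x. x \<in> carrier E \<Longrightarrow> h (p x) = p' (g x)"
  by (rule cosyzygy_map[OF assms(1) E(1) assms(2) E(2) assms(3,4,5,7)]) (rule that)
 obtain g' h' where g': "g' \<in> hm E' E" "h' \<in> hm C' C" "\<And>w. w \<in> carrier W \<Longrightarrow> g' (i' w) = i w"
  "\<And>x. x \<in> carrier E' \<Longrightarrow> h' (p' x) = p (g' x)"
  by (rule cosyzygy_map[OF assms(1) E(2) assms(3) E(1) assms(2,5,4,6)]) (rule that)
 note cl = Hom_closed[OF se(1)] Hom_closed[OF se(2)] Hom_closed[OF se'(1)] Hom_closed[OF se'(2)]
  Hom_closed[OF g(1)] Hom_closed[OF g'(1)]
 have "stab_eq R C C (\<lambda>x\<in>carrier C. h' (h x)) (\<lambda>x. x)"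
  by (rule cosyzygy_endo[OF E(1) assms(2,1,4,6) Hom_comp[OF E(1) g(1) g'(1)] Hom_comp[OF assms(2) g(2) g'(2)]])
   (simp_all add: g(3,4) g'(3,4) cl)
 moreover have "stab_eq R C' C' (\<lambda>x\<in>carrier C'. h (h' x)) (\<lambda>x. x)"
  by (rule cosyzygy_endo[OF E(2) assms(3,1,5,7) Hom_comp[OF E(2) g'(1) g(1)] Hom_comp[OF assms(3) g'(2) g(2)]])
   (simp_all add: g(3,4) g'(3,4) cl)
 ultimately show ?thesis unfolding stab_iso_def using g(2) g'(2) by auto
qed

text \<open>A standard triangle is to be isomorphic to itself by identities, and
  \<open>iso_triangles\<close> involves the shift of the first of them. The class of the identity
  also contains maps \<open>u = 1 + b i\<close> that do not fix \<open>W\<close>, so their lifts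
  have to be corrected.\<close>

lemma Shift_mor_Ident:
 assumes "obj W"
 shows "Shift_mor T0 W W (Ident T0 W) = Ident T0 (IC W)"
proof -
 note W = objD(1)[OF assms] and C = presentation(3)[OF assms] and E = IE_lm[OF assms] and oC = IC_obj[OF assms]
 note P = presentation[OF assms]
 note se = short_exactD[OF P(4)]
 interpret E: left_module R "IE W" by fact
 interpret C: left_module R "IC W" by fact
 interpret p: lhom R "IE W" "IC W" "Ip W" using E C se(2) by (rule lhomI)
 have lifts: "cosyzygy_lifts R W W u = {h \<in> hm (IC W) (IC W). \<exists>g\<in>hm (IE W) (IE W).
   compose (carrier W) g (Ii W) = compose (carrier W) (Ii W) u \<and>
   compose (carrier (IE W)) h (Ip W) = compose (carrier (IE W)) (Ip W) g}" for u
  by (simp add: cosyzygy_lifts_def inj_presentation_eq)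
 have 1: "cl (IC W) (IC W) h = Ident T0 (IC W)" if u: "u \<in> Ident T0 W" and h: "h \<in> cosyzygy_lifts R W W u" for u h
 proof -
  have u: "u \<in> hm W W" "stab_eq R W W (\<lambda>x. x) u"
   using u assms W Hom_id[OF W] by (simp_all add: Ident_eq cl_iff)
  obtain g where g: "h \<in> hm (IC W) (IC W)" "g \<in> hm (IE W) (IE W)" "compose (carrier W) g (Ii W) = compose (carrier W) (Ii W) u"
   "compose (carrier (IE W)) h (Ip W) = compose (carrier (IE W)) (Ip W) g"
   using h unfolding lifts by blast
  have gi: "g (Ii W w) = Ii W (u w)" if "w \<in> carrier W" for w
   using fun_cong[OF g(3), of w] that by (simp add: compose_def)
  have gp: "h (Ip W x) = Ip W (g x)" if "x \<in> carrier (IE W)" for x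
   using fun_cong[OF g(4), of x] that by (simp add: compose_def)
  obtain b where b: "b \<in> hm (IE W) W" "\<And>x. x \<in> carrier W \<Longrightarrow> u x = x \<oplus>\<^sub>W b (Ii W x)"
   by (rule stab_eqE[OF assms W u(2)]) (rule that)
  interpret g: lhom R "IE W" "IE W" g using E E g(2) by (rule lhomI)
  interpret i: lhom R W "IE W" "Ii W" using W E se(1) by (rule lhomI)
  interpret b: lhom R "IE W" W b using E W b(1) by (rule lhomI)
  \<comment> \<open>Subtracting \<open>Ii W\<close> after \<open>b\<close> makes the lift fix
    \<open>W\<close>; the correction is annihilated by \<open>Ip W\<close>, so \<open>h\<close> is
    still the induced map.\<close>
  define g' where "g' = (\<lambda>x\<in>carrier (IE W). g x \<ominus>\<^bsub>IE W\<^esub> (\<lambda>x\<in>carrier (IE W). Ii W (b x)) x)"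
  have g': "g' \<in> hm (IE W) (IE W)" unfolding g'_def by (rule Hom_minus[OF E E g(2) Hom_comp[OF E b(1) se(1)]])
  have "stab_eq R (IC W) (IC W) h (\<lambda>x. x)"
  proof (rule cosyzygy_endo[OF E C W P(4) P(1) g' g(1)])
   show "g' (Ii W w) = Ii W w" if w: "w \<in> carrier W" for w
    using gi[OF w] b(2)[OF w] w by (simp add: g'_def a_minus_def E.M.a_assoc E.M.r_neg)
   show "h (Ip W x) = Ip W (g' x)" if x: "x \<in> carrier (IE W)" for x
    using gp[OF x] x se(5)[of "b x"] by (simp add: g'_def a_minus_def C.M.minus_equality[of "\<zero>\<^bsub>IC W\<^esub>" "\<zero>\<^bsub>IC W\<^esub>"])
  qed
  then show ?thesis unfolding Ident_eq using cl_eq_iff[OF oC C g(1) Hom_id[OF C]] by simp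
 qed
 \<comment> \<open>A lift has to exist, since an empty union would not be the class of the
   identity.\<close>
 have 2: "\<exists>h. h \<in> cosyzygy_lifts R W W u" if u: "u \<in> Ident T0 W" for u
 proof -
  have u: "u \<in> hm W W" using u assms W Hom_id[OF W] by (simp add: Ident_eq cl_iff)
  obtain g where g: "g \<in> hm (IE W) (IE W)" "\<And>w. w \<in> carrier W \<Longrightarrow> g (Ii W w) = (\<lambda>w\<in>carrier W. Ii W (u w)) w"
   by (rule injective_extend[OF P(1) W E se(1,3) Hom_comp[OF W u se(1)]]) (rule that)
  have z: "(\<lambda>x\<in>carrier (IE W). Ip W (g x)) x = \<zero>\<^bsub>IC W\<^esub>" if x: "x \<in> carrier (IE W)" "Ip W x = \<zero>\<^bsub>IC W\<^esub>" for x
  proof -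
   obtain w where w: "w \<in> carrier W" "x = Ii W w" using se(6)[OF x] by blast
   show ?thesis using g(2)[OF w(1)] se(5)[OF Hom_closed[OF u w(1)]] x(1) w by simp
  qed
  obtain h where "h \<in> hm (IC W) (IC W)" "\<And>x. x \<in> carrier (IE W) \<Longrightarrow> h (Ip W x) = (\<lambda>x\<in>carrier (IE W). Ip W (g x)) x"
   by (rule Hom_factor[OF E C C se(2) Hom_comp[OF E g(1) se(2)] se(4) z]) (assumption | rule that)+
  then show ?thesis unfolding lifts using g by (intro exI[of _ h] CollectI conjI bexI[OF _ g(1)]) (simp_all add: compose_def cong: restrict_cong)
 qed
 have 3: "Ident T0 W \<noteq> {}" using cl_self[OF assms W Hom_id[OF W]] unfolding Ident_eq by blast
 have "Shift_mor T0 W W (Ident T0 W)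
   = (\<Union>u\<in>Ident T0 W. \<Union>h\<in>cosyzygy_lifts R W W u. cl (IC W) (IC W) h)"
  by (simp add: stable_shift_cat_def cosyzygy_eq)
 also have "\<dots> = Ident T0 (IC W)" by (intro UN_const_eq 3) (use 1 2 in blast)+
 finally show ?thesis .
qed

section \<open>Triangles and short exact sequences\<close>

lemma Triangles_iff: "t \<in> Triangles T \<longleftrightarrow> (case t of (W, Y, Z, u, v, w) \<Rightarrow>
  obj W \<and> obj Y \<and> obj Z \<and> u \<in> Mor T0 W Y \<and> v \<in> Mor T0 Y Z \<and> w \<in> Mor T0 Z (IC W) \<and>
  (\<exists>t'\<in>standard_triangles R. iso_triangles T0 (W, Y, Z, u, v, w) t'))"
proof -
 have "Triangles T = {(W, Y, Z, u, v, w). W \<in> Ob T0 \<and> Y \<in> Ob T0 \<and> Z \<in> Ob T0 \<and>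
       u \<in> Mor T0 W Y \<and> v \<in> Mor T0 Y Z \<and> w \<in> Mor T0 Z (cosyzygy R W) \<and>
       (\<exists>t\<in>standard_triangles R. iso_triangles T0 (W, Y, Z, u, v, w) t)}"
  by (simp add: stable_category_def shift_cat.defs tri_cat.defs)
 then show ?thesis by (cases t) (simp add: cat_simps cosyzygy_eq)
qed

lemma iso_mor_Ident: "obj W \<Longrightarrow> iso_mor T0 W W (Ident T0 W)"
proof -
 assume o: "obj W"
 note W = objD(1)[OF o]
 have "stab_eq R W W (\<lambda>x. (\<lambda>x\<in>carrier W. x) ((\<lambda>x\<in>carrier W. x) x)) (\<lambda>x. x)"
  by (rule stab_eq_self[OF o W]) auto
 then show ?thesis unfolding iso_mor_iff[OF o o] Ident_eq using Hom_id[OF W] by blast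
qed

lemma Cmp_Ident:
 assumes "obj W" "obj Y" "f \<in> hm W Y"
 shows "Cmp T0 W Y Y (Ident T0 Y) (cl W Y f) = cl W Y f" "Cmp T0 W W Y (cl W Y f) (Ident T0 W) = cl W Y f"
proof -
 note W = objD(1)[OF assms(1)] and Y = objD(1)[OF assms(2)]
 have "(\<lambda>x\<in>carrier W. (\<lambda>x\<in>carrier Y. x) (f x)) = f" "(\<lambda>x\<in>carrier W. f ((\<lambda>x\<in>carrier W. x) x)) = f"
  using Hom_restrict_self[OF assms(3)] Hom_closed[OF assms(3)] by (simp_all cong: restrict_cong)
 then show "Cmp T0 W Y Y (Ident T0 Y) (cl W Y f) = cl W Y f" "Cmp T0 W W Y (cl W Y f) (Ident T0 W) = cl W Y f"
  unfolding Ident_eq using Cmp_eq[OF assms(1,2) Y assms(3) Hom_id[OF Y]] Cmp_eq[OF assms(1,1) Y Hom_id[OF W] assms(3)]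
  by simp_all
qed

text \<open>A short exact sequence is completed to a standard triangle by extending
  \<open>Ii W\<close> along \<open>f\<close> and passing to cokernels; identities show that this
  triangle is distinguished.\<close>

lemma ext_objectsI:
 assumes "short_exact R W N Y f g" "obj W" "obj N" "obj Y" "W \<in> I" "Y \<in> J"
 shows "N \<in> ext_objects T I J"
proof -
 note W = objD(1)[OF assms(2)] and N = objD(1)[OF assms(3)] and Y = objD(1)[OF assms(4)]
 note se = short_exactD[OF assms(1)] and P = presentation[OF assms(2)]
 note sp = short_exactD[OF P(4)] and E = IE_lm[OF assms(2)]
 obtain e where e: "e \<in> hm N (IE W)" "\<And>w. w \<in> carrier W \<Longrightarrow> e (f w) = Ii W w"
  by (rule injective_extend[OF P(1) W N se(1,3) sp(1)]) (rule that)
 have z: "(\<lambda>x\<in>carrier N. Ip W (e x)) x = \<zero>\<^bsub>IC W\<^esub>" if x: "x \<in> carrier N" "g x = \<zero>\<^sub>Y" for x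
 proof -
  obtain w where w: "w \<in> carrier W" "x = f w" using se(6)[OF x] by blast
  show ?thesis using e(2)[OF w(1)] sp(5)[OF w(1)] x(1) w(2) by simp
 qed
 obtain h where h: "h \<in> hm Y (IC W)" "\<And>x. x \<in> carrier N \<Longrightarrow> h (g x) = (\<lambda>x\<in>carrier N. Ip W (e x)) x"
  by (rule Hom_factor[OF N Y P(3) se(2) Hom_comp[OF N e(1) sp(2)] se(4) z]) (assumption | rule that)+
 let ?t = "(W, N, Y, cl W N f, cl N Y g, cl Y (IC W) h)"
 have "compose (carrier W) e f = Ii W"
  using e(2) Hom_restrict_self[OF sp(1)] by (simp add: compose_def cong: restrict_cong)
 moreover have "compose (carrier N) (Ip W) e = compose (carrier N) h g"
  using h(2) by (simp add: compose_def cong: restrict_cong)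
 ultimately have "?t \<in> standard_triangles R"
  unfolding standard_triangles_def inj_presentation_eq cosyzygy_eq cat_simps
  using assms(1-4) h(1) e(1) by auto
 moreover have "iso_triangles T0 ?t ?t"
  unfolding iso_triangles.simps
  using iso_mor_Ident[OF assms(2)] iso_mor_Ident[OF assms(3)] iso_mor_Ident[OF assms(4)]
   Cmp_Ident[OF assms(2,3) se(1)] Cmp_Ident[OF assms(3,4) se(2)] Cmp_Ident[OF assms(4) IC_obj[OF assms(2)] h(1)]
   Shift_mor_Ident[OF assms(2)]
  by (intro exI[of _ "Ident T0 W"] exI[of _ "Ident T0 N"] exI[of _ "Ident T0 Y"]) (simp add: cat_simps)
 moreover have "cl W N f \<in> Mor T0 W N" "cl N Y g \<in> Mor T0 N Y" "cl Y (IC W) h \<in> Mor T0 Y (IC W)"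
  unfolding Mor_iff using se(1,2) h(1) by blast+
 ultimately have "?t \<in> Triangles T" unfolding Triangles_iff prod.case using assms(2-4) by blast
 then show ?thesis unfolding ext_objects_def cat_simps using assms(3,5,6) by blast
qed

text \<open>Levels of generation depend only on the objects of triangles. The morphisms of the
  triangle are therefore forgotten, and only a short exact sequence with isomorphic terms is
  kept.\<close>

lemma ext_objectsE:
 assumes "N \<in> ext_objects T I J"
 obtains W W' N' Y Y' f g where "short_exact R W' N' Y' f g" "obj W'" "obj N'" "obj Y'" "W \<in> I" "Y \<in> J" "obj N"
  "stab_iso R W W'" "stab_iso R N N'" "stab_iso R Y Y'"
proof -
 obtain W Y u v w where *: "obj N" "W \<in> I" "Y \<in> J" "(W, N, Y, u, v, w) \<in> Triangles T"
  using assms unfolding ext_objects_def cat_simps by blast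
 then obtain t where t: "obj W" "obj Y" "t \<in> standard_triangles R" "iso_triangles T0 (W, N, Y, u, v, w) t"
  unfolding Triangles_iff by auto
 from t(3) obtain W' N' Y' u' v' w' f g where s: "t = (W', N', Y', u', v', w')" "obj W'" "obj N'" "obj Y'"
  "short_exact R W' N' Y' f g"
  unfolding standard_triangles_def cat_simps by auto
 from t(4) have "stab_iso R W W'" "stab_iso R N N'" "stab_iso R Y Y'"
  unfolding s(1) iso_triangles.simps using s(2-4) t(1,2) *(1) stab_iso_iff by blast+
 then show ?thesis using that[OF s(5,2-4) *(2,3,1)] by blast
qed

text \<open>Every level from 1 on is a hull and so inherits closure under isomorphisms and
  retracts.\<close>

lemma gen_level_Suc_hull: "\<exists>J. gen_level T I (Suc n) = closure_hull T J"
 by (cases n) auto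

lemma gen_level_iso: "W \<in> gen_level T I (Suc n) \<Longrightarrow> obj S \<Longrightarrow> stab_iso R W S \<Longrightarrow> S \<in> gen_level T I (Suc n)"
 using gen_level_Suc_hull[of I n] hull_iso by metis

lemma gen_level_retract:
 assumes "S \<in> gen_level T I (Suc n)" "obj W" "a \<in> hm W S" "b \<in> hm S W" "\<And>x. x \<in> carrier W \<Longrightarrow> b (a x) = x"
 shows "W \<in> gen_level T I (Suc n)"
 using gen_level_Suc_hull[of I n] hull_retract[of S _ W a b] assms by auto

end

section \<open>Exact functors between stable categories\<close>

text \<open>The functor is given on modules of arbitrary type; its values are then copied to the universe of modules.\<close>

locale exact_functor = R: stable_ring R + S: stable_ring S
 for R :: "('r, 'x) ring_scheme" and S :: "('s, 'y) ring_scheme" +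
 fixes N :: "'r lmod \<Rightarrow> ('s, 'n) module"
  and Nm :: "'r lmod \<Rightarrow> 'r lmap \<Rightarrow> 'n \<Rightarrow> 'n"
 assumes N_lm: "R.obj W \<Longrightarrow> LMod S (N W)"
  and N_fg: "R.obj W \<Longrightarrow> fin_gen S (N W)"
  and N_inj: "R.obj W \<Longrightarrow> injective_module R W \<Longrightarrow> injective_module S (N W)"
  and Nm_hom: "R.obj W \<Longrightarrow> R.obj Y \<Longrightarrow> f \<in> Hom R W Y \<Longrightarrow> Nm W f \<in> Hom S (N W) (N Y)"
  and Nm_id: "R.obj W \<Longrightarrow> v \<in> carrier (N W) \<Longrightarrow> Nm W (\<lambda>x\<in>carrier W. x) v = v"
  and Nm_comp: "\<lbrakk>R.obj W; R.obj Y; R.obj Z; f \<in> Hom R W Y; g \<in> Hom R Y Z; v \<in> carrier (N W)\<rbrakk>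
    \<Longrightarrow> Nm W (\<lambda>x\<in>carrier W. g (f x)) v = Nm Y g (Nm W f v)"
  and Nm_add: "\<lbrakk>R.obj W; R.obj Y; f \<in> Hom R W Y; g \<in> Hom R W Y; v \<in> carrier (N W)\<rbrakk>
    \<Longrightarrow> Nm W (\<lambda>x\<in>carrier W. f x \<oplus>\<^sub>Y g x) v = Nm W f v \<oplus>\<^bsub>N Y\<^esub> Nm W g v"
  and Nm_exact: "\<lbrakk>R.obj W; R.obj Y; R.obj Z; short_exact R W Y Z f g\<rbrakk>
    \<Longrightarrow> short_exact S (N W) (N Y) (N Z) (Nm W f) (Nm Y g)"
begin
text \<open>\<open>Fo W\<close> is the copy of \<open>N W\<close> in the universe, and
  \<open>Fe W\<close> and \<open>Fd W\<close> are the mutually inverse isomorphisms to it and from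
  it.\<close>

definition "copy W = (SOME (P :: 's lmod, e, d). LMod S P \<and> fin_gen S P \<and> e \<in> Hom S (N W) P \<and> d \<in> Hom S P (N W) \<and>
  (\<forall>x\<in>carrier (N W). d (e x) = x) \<and> (\<forall>y\<in>carrier P. e (d y) = y))"

definition Fo :: "'r lmod \<Rightarrow> 's lmod" where "Fo W = fst (copy W)"
definition "Fe W = fst (snd (copy W))"
definition "Fd W = snd (snd (copy W))"

definition "Fm W Y f = (\<lambda>x\<in>carrier (Fo W). Fe Y (Nm W f (Fd W x)))"

lemma copy:
 assumes "R.obj W"
 shows "S.obj (Fo W)" "Fe W \<in> Hom S (N W) (Fo W)" "Fd W \<in> Hom S (Fo W) (N W)"
  "\<And>x. x \<in> carrier (N W) \<Longrightarrow> Fd W (Fe W x) = x" "\<And>y. y \<in> carrier (Fo W) \<Longrightarrow> Fe W (Fd W y) = y"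
proof -
 have "\<exists>z. case z of (P :: 's lmod, e, d) \<Rightarrow> LMod S P \<and> fin_gen S P \<and> e \<in> Hom S (N W) P \<and> d \<in> Hom S P (N W) \<and>
  (\<forall>x\<in>carrier (N W). d (e x) = x) \<and> (\<forall>y\<in>carrier P. e (d y) = y)"
 proof -
  obtain P :: "'s lmod" and e d where "LMod S P" "fin_gen S P" "e \<in> Hom S (N W) P" "d \<in> Hom S P (N W)"
   "\<And>x. x \<in> carrier (N W) \<Longrightarrow> d (e x) = x" "\<And>y. y \<in> carrier P \<Longrightarrow> e (d y) = y"
   by (rule fin_gen_copy_iso[OF N_lm[OF assms] N_fg[OF assms]]) (rule that)
  then show ?thesis by (intro exI[of _ "(P, e, d)"]) simp
 qed
 from someI_ex[OF this] have "case copy W of (P :: 's lmod, e, d) \<Rightarrow> LMod S P \<and> fin_gen S P \<and> e \<in> Hom S (N W) P \<and> d \<in> Hom S P (N W) \<and>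
  (\<forall>x\<in>carrier (N W). d (e x) = x) \<and> (\<forall>y\<in>carrier P. e (d y) = y)"
  unfolding copy_def .
 then have "LMod S (Fo W) \<and> fin_gen S (Fo W) \<and> Fe W \<in> Hom S (N W) (Fo W) \<and> Fd W \<in> Hom S (Fo W) (N W) \<and>
  (\<forall>x\<in>carrier (N W). Fd W (Fe W x) = x) \<and> (\<forall>y\<in>carrier (Fo W). Fe W (Fd W y) = y)"
  by (simp add: Fo_def Fe_def Fd_def case_prod_beta)
 then show "S.obj (Fo W)" "Fe W \<in> Hom S (N W) (Fo W)" "Fd W \<in> Hom S (Fo W) (N W)"
  "\<And>x. x \<in> carrier (N W) \<Longrightarrow> Fd W (Fe W x) = x" "\<And>y. y \<in> carrier (Fo W) \<Longrightarrow> Fe W (Fd W y) = y"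
  by (auto simp: S.obj_def)
qed

lemma Fo_lm: "R.obj W \<Longrightarrow> LMod S (Fo W)"
 using copy(1) S.objD(1) by blast

lemma Fe_closed: "R.obj W \<Longrightarrow> x \<in> carrier (N W) \<Longrightarrow> Fe W x \<in> carrier (Fo W)"
 using copy(2) by (rule Hom_closed)

lemma Fd_closed: "R.obj W \<Longrightarrow> x \<in> carrier (Fo W) \<Longrightarrow> Fd W x \<in> carrier (N W)"
 using copy(3) by (rule Hom_closed)

lemma Nm_closed: "R.obj W \<Longrightarrow> R.obj Y \<Longrightarrow> f \<in> Hom R W Y \<Longrightarrow> x \<in> carrier (N W) \<Longrightarrow> Nm W f x \<in> carrier (N Y)"
 using Nm_hom by (rule Hom_closed)

lemma Fo_inj: "R.obj W \<Longrightarrow> injective_module R W \<Longrightarrow> injective_module S (Fo W)"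
 using injective_retract[OF N_inj Fo_lm copy(3) copy(2) copy(5)] by blast

lemma Fm_hom:
 assumes "R.obj W" "R.obj Y" "f \<in> Hom R W Y"
 shows "Fm W Y f \<in> Hom S (Fo W) (Fo Y)"
 using Hom_comp[OF Fo_lm[OF assms(1)] Hom_comp[OF Fo_lm[OF assms(1)] copy(3)[OF assms(1)] Nm_hom[OF assms]] copy(2)[OF assms(2)]]
 by (simp add: Fm_def cong: restrict_cong)

lemma Fm_id: "R.obj W \<Longrightarrow> v \<in> carrier (Fo W) \<Longrightarrow> Fm W W (\<lambda>x\<in>carrier W. x) v = v"
 by (simp add: Fm_def Nm_id Fd_closed copy)

lemma Fm_comp: "\<lbrakk>R.obj W; R.obj Y; R.obj Z; f \<in> Hom R W Y; g \<in> Hom R Y Z; v \<in> carrier (Fo W)\<rbrakk>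
    \<Longrightarrow> Fm W Z (\<lambda>x\<in>carrier W. g (f x)) v = Fm Y Z g (Fm W Y f v)"
 by (simp add: Fm_def Nm_comp Fd_closed copy Fe_closed Nm_closed)

lemma Fm_add:
 assumes "R.obj W" "R.obj Y" "f \<in> Hom R W Y" "g \<in> Hom R W Y" "v \<in> carrier (Fo W)"
 shows "Fm W Y (\<lambda>x\<in>carrier W. f x \<oplus>\<^sub>Y g x) v = Fm W Y f v \<oplus>\<^bsub>Fo Y\<^esub> Fm W Y g v"
 using assms Hom_add[OF copy(2)[OF assms(2)] Nm_closed[OF assms(1,2,3)] Nm_closed[OF assms(1,2,4)]]
 by (simp add: Fm_def Nm_add Fd_closed)

lemma Fm_zero:
 assumes "R.obj W" "R.obj Y" "v \<in> carrier (Fo W)"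
 shows "Fm W Y (\<lambda>x\<in>carrier W. \<zero>\<^sub>Y) v = \<zero>\<^bsub>Fo Y\<^esub>"
proof -
 note W = R.objD(1)[OF assms(1)] and Y = R.objD(1)[OF assms(2)]
 interpret Y: left_module R Y by fact
 interpret FY: left_module S "Fo Y" using assms(2) by (rule Fo_lm)
 note z = Hom_zero[OF W Y]
 have "(\<lambda>x\<in>carrier W. (\<lambda>x\<in>carrier W. \<zero>\<^sub>Y) x \<oplus>\<^sub>Y (\<lambda>x\<in>carrier W. \<zero>\<^sub>Y) x) = (\<lambda>x\<in>carrier W. \<zero>\<^sub>Y)"
  by (simp cong: restrict_cong)
 then have "Fm W Y (\<lambda>x\<in>carrier W. \<zero>\<^sub>Y) v = Fm W Y (\<lambda>x\<in>carrier W. \<zero>\<^sub>Y) v \<oplus>\<^bsub>Fo Y\<^esub> Fm W Y (\<lambda>x\<in>carrier W. \<zero>\<^sub>Y) v"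
  using Fm_add[OF assms(1,2) z z assms(3)] by simp
 then show ?thesis
  using Hom_closed[OF Fm_hom[OF assms(1,2) z] assms(3)] FY.M.add.l_cancel_one' by metis
qed

lemma Fm_exact:
 assumes "R.obj W" "R.obj Y" "R.obj Z" "short_exact R W Y Z f g"
 shows "short_exact S (Fo W) (Fo Y) (Fo Z) (Fm W Y f) (Fm Y Z g)"
proof -
 note f = short_exactD(1)[OF assms(4)] and g = short_exactD(2)[OF assms(4)]
 have "short_exact S (N W) (N Y) (N Z) (Nm W f) (Nm Y g)" using assms by (rule Nm_exact)
 note se = short_exactD[OF this]
 note c = Fe_closed[OF assms(1)] Fe_closed[OF assms(2)] Fe_closed[OF assms(3)] Fd_closed[OF assms(1)] Fd_closed[OF assms(2)]
  Fd_closed[OF assms(3)] Nm_closed[OF assms(1,2) f] Nm_closed[OF assms(2,3) g]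
 note ed = copy(4,5)[OF assms(1)] copy(4,5)[OF assms(2)] copy(4,5)[OF assms(3)]
 interpret eZ: lhom S "N Z" "Fo Z" "Fe Z" using N_lm[OF assms(3)] Fo_lm[OF assms(3)] copy(2)[OF assms(3)] by (rule lhomI)
 interpret dZ: lhom S "Fo Z" "N Z" "Fd Z" using Fo_lm[OF assms(3)] N_lm[OF assms(3)] copy(3)[OF assms(3)] by (rule lhomI)
 show ?thesis
  unfolding short_exact_def
 proof (intro conjI equalityI subsetI)
  show "Fm W Y f \<in> Hom S (Fo W) (Fo Y)" "Fm Y Z g \<in> Hom S (Fo Y) (Fo Z)"
   using assms f g by (auto intro: Fm_hom)
  show "inj_on (Fm W Y f) (carrier (Fo W))"
  proof (rule inj_onI)
   fix x y assume x: "x \<in> carrier (Fo W)" and y: "y \<in> carrier (Fo W)" and "Fm W Y f x = Fm W Y f y"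
   then have "Fe Y (Nm W f (Fd W x)) = Fe Y (Nm W f (Fd W y))" by (simp add: Fm_def)
   then have "Nm W f (Fd W x) = Nm W f (Fd W y)" using ed(3)[OF c(7)[OF c(4)[OF x]]] ed(3)[OF c(7)[OF c(4)[OF y]]] by metis
   then have "Fd W x = Fd W y" by (rule inj_onD[OF se(3) _ c(4)[OF x] c(4)[OF y]])
   then show "x = y" using ed(2)[OF x] ed(2)[OF y] by metis
  qed
 next
  fix y assume "y \<in> Fm W Y f ` carrier (Fo W)"
  then obtain x where x: "x \<in> carrier (Fo W)" "y = Fe Y (Nm W f (Fd W x))" by (auto simp: Fm_def)
  then show "y \<in> {y \<in> carrier (Fo Y). Fm Y Z g y = \<zero>\<^bsub>Fo Z\<^esub>}"
   using se(5)[OF c(4)[OF x(1)]] by (simp add: Fm_def c ed)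
 next
  fix y assume "y \<in> {y \<in> carrier (Fo Y). Fm Y Z g y = \<zero>\<^bsub>Fo Z\<^esub>}"
  then have "y \<in> carrier (Fo Y)" "Fm Y Z g y = \<zero>\<^bsub>Fo Z\<^esub>" by simp_all
  then have y: "y \<in> carrier (Fo Y)" "Fe Z (Nm Y g (Fd Y y)) = \<zero>\<^bsub>Fo Z\<^esub>" by (simp_all add: Fm_def)
  then have "Nm Y g (Fd Y y) = \<zero>\<^bsub>N Z\<^esub>" using ed(5)[OF c(8)[OF c(5)[OF y(1)]]] by simp
  then obtain w where w: "w \<in> carrier (N W)" "Fd Y y = Nm W f w" using se(6)[OF c(5)[OF y(1)]] by blast
  then have "y = Fm W Y f (Fe W w)" using ed(4)[OF y(1)] by (simp add: Fm_def c ed)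
  then show "y \<in> Fm W Y f ` carrier (Fo W)" using c(1)[OF w(1)] by blast
 next
  fix z assume "z \<in> Fm Y Z g ` carrier (Fo Y)" then show "z \<in> carrier (Fo Z)" by (auto simp: Fm_def c)
 next
  fix z assume z: "z \<in> carrier (Fo Z)"
  then have "Fd Z z \<in> Nm Y g ` carrier (N Y)" unfolding se(4) by (rule c(6))
  then obtain y where y: "y \<in> carrier (N Y)" "Fd Z z = Nm Y g y" by (rule imageE) (rule that)
  then have "z = Fm Y Z g (Fe Y y)" using ed(6)[OF z] by (simp add: Fm_def c ed)
  then show "z \<in> Fm Y Z g ` carrier (Fo Y)" using c(2)[OF y(1)] by blast
 qed
qed

text \<open>The injective module in a stable equality need not be finitely generated, while the
  functor is controlled only on objects; so the factorisation is first moved to \<open>IE W\<close>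
  by \<open>stab_eqE\<close>.\<close>

lemma Fm_stab:
 assumes "R.obj W" "R.obj Y" "f \<in> Hom R W Y" "g \<in> Hom R W Y" "stab_eq R W Y f g"
 shows "stab_eq S (Fo W) (Fo Y) (Fm W Y f) (Fm W Y g)"
proof -
 note W = R.objD(1)[OF assms(1)] and Y = R.objD(1)[OF assms(2)]
 obtain b where b: "b \<in> Hom R (R.IE W) Y" "\<And>x. x \<in> carrier W \<Longrightarrow> g x = f x \<oplus>\<^sub>Y b (R.Ii W x)"
  by (rule R.stab_eqE[OF assms(1) Y assms(5)]) (rule that)
 note E = R.IE_obj[OF assms(1)] and P = R.presentation[OF assms(1)]
 note i = short_exactD(1)[OF P(4)]
 have "g = (\<lambda>x\<in>carrier W. g x)" using Hom_restrict_self[OF assms(4)] by simp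
 also have "\<dots> = (\<lambda>x\<in>carrier W. f x \<oplus>\<^sub>Y (\<lambda>x\<in>carrier W. b (R.Ii W x)) x)"
  by (simp add: b(2) cong: restrict_cong)
 finally have g: "g = (\<lambda>x\<in>carrier W. f x \<oplus>\<^sub>Y (\<lambda>x\<in>carrier W. b (R.Ii W x)) x)" .
 show ?thesis
 proof (rule stab_eqI[OF Fo_inj[OF E P(1)] Fm_hom[OF assms(1) E i] Fm_hom[OF E assms(2) b(1)]])
  fix x assume x: "x \<in> carrier (Fo W)"
  have "Fm W Y g x = Fm W Y f x \<oplus>\<^bsub>Fo Y\<^esub> Fm W Y (\<lambda>x\<in>carrier W. b (R.Ii W x)) x"
   using Fm_add[OF assms(1-3) Hom_comp[OF W i b(1)] x] arg_cong[OF g, of "\<lambda>g. Fm W Y g x"] by simp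
  then show "Fm W Y g x = Fm W Y f x \<oplus>\<^bsub>Fo Y\<^esub> Fm (R.IE W) Y b (Fm W (R.IE W) (R.Ii W) x)"
   using Fm_comp[OF assms(1) E assms(2) i b(1) x] by simp
 qed
qed

lemma Fm_stab_id:
 assumes "R.obj W" "R.obj Y" "f \<in> Hom R W Y" "g \<in> Hom R Y W" "stab_eq R W W (\<lambda>x. g (f x)) (\<lambda>x. x)"
 shows "stab_eq S (Fo W) (Fo W) (\<lambda>x. Fm Y W g (Fm W Y f x)) (\<lambda>x. x)"
proof -
 note W = R.objD(1)[OF assms(1)]
 have "stab_eq S (Fo W) (Fo W) (Fm W W (\<lambda>x\<in>carrier W. g (f x))) (Fm W W (\<lambda>x\<in>carrier W. x))"
  using assms by (intro Fm_stab Hom_comp[OF W] Hom_id[OF W]) simp_all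
 then show ?thesis
  by (rule stab_eq_subst) (simp_all add: Fm_comp[OF assms(1,2,1,3,4)] Fm_id[OF assms(1)])
qed

lemma Fm_stab_zero:
 assumes "R.obj W" "R.obj Y" "R.obj Z" "f \<in> Hom R W Y" "g \<in> Hom R Y Z" "stab_eq R W Z (\<lambda>x. g (f x)) (\<lambda>x. \<zero>\<^sub>Z)"
 shows "stab_eq S (Fo W) (Fo Z) (\<lambda>x. Fm Y Z g (Fm W Y f x)) (\<lambda>x. \<zero>\<^bsub>Fo Z\<^esub>)"
proof -
 note W = R.objD(1)[OF assms(1)] and Z = R.objD(1)[OF assms(3)]
 have "stab_eq S (Fo W) (Fo Z) (Fm W Z (\<lambda>x\<in>carrier W. g (f x))) (Fm W Z (\<lambda>x\<in>carrier W. \<zero>\<^sub>Z))"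
  using assms by (intro Fm_stab Hom_comp[OF W] Hom_zero[OF W Z]) simp_all
 then show ?thesis
  by (rule stab_eq_subst) (simp_all add: Fm_comp[OF assms(1-5)] Fm_zero[OF assms(1,3)])
qed

lemma Fo_stab_iso:
 assumes "R.obj W" "R.obj Y" "stab_iso R W Y"
 shows "stab_iso S (Fo W) (Fo Y)"
proof -
 obtain f g where fg: "f \<in> Hom R W Y" "g \<in> Hom R Y W" "stab_eq R W W (\<lambda>x. g (f x)) (\<lambda>x. x)"
  "stab_eq R Y Y (\<lambda>x. f (g x)) (\<lambda>x. x)"
  using assms(3) unfolding stab_iso_def by blast
 show ?thesis
  unfolding stab_iso_def
  using Fm_hom[OF assms(1,2) fg(1)] Fm_hom[OF assms(2,1) fg(2)] Fm_stab_id[OF assms(1,2) fg(1,2,3)] Fm_stab_id[OF assms(2,1) fg(2,1,4)]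
  by blast
qed

section \<open>Images of hulls and of levels of generation\<close>

lemma Fo_zero_object:
 assumes "zero_object R.T Z" shows "zero_object S.T (Fo Z)"
proof -
 have o: "R.obj Z" and e: "stab_eq R Z Z (\<lambda>x. x) (\<lambda>x. \<zero>\<^sub>Z)" using assms by (auto simp: R.zero_object_iff)
 note Z = R.objD(1)[OF o]
 have "stab_eq S (Fo Z) (Fo Z) (Fm Z Z (\<lambda>x\<in>carrier Z. x)) (Fm Z Z (\<lambda>x\<in>carrier Z. \<zero>\<^sub>Z))"
  using o e by (intro Fm_stab Hom_id[OF Z] Hom_zero[OF Z Z]) simp_all
 then have "stab_eq S (Fo Z) (Fo Z) (\<lambda>x. x) (\<lambda>x. \<zero>\<^bsub>Fo Z\<^esub>)"
  by (rule stab_eq_subst) (simp_all add: Fm_id[OF o] Fm_zero[OF o o])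
 then show ?thesis using copy(1)[OF o] by (simp add: S.zero_object_iff)
qed

lemma Fo_direct_sum:
 assumes "direct_sum R.T A W Y" shows "direct_sum S.T (Fo A) (Fo W) (Fo Y)"
proof -
 have o: "R.obj A" "R.obj W" "R.obj Y" using assms by (auto simp: R.direct_sum_iff)
 note A = R.objD(1)[OF o(1)]
 obtain i j p q where h: "i \<in> Hom R W A" "j \<in> Hom R Y A" "p \<in> Hom R A W" "q \<in> Hom R A Y"
  and e: "stab_eq R W W (\<lambda>x. p (i x)) (\<lambda>x. x)" "stab_eq R Y Y (\<lambda>x. q (j x)) (\<lambda>x. x)"
    "stab_eq R W Y (\<lambda>x. q (i x)) (\<lambda>x. \<zero>\<^sub>Y)" "stab_eq R Y W (\<lambda>x. p (j x)) (\<lambda>x. \<zero>\<^sub>W)"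
    "stab_eq R A A (\<lambda>x. i (p x) \<oplus>\<^sub>A j (q x)) (\<lambda>x. x)"
  using assms unfolding R.direct_sum_iff by blast
 have "stab_eq S (Fo A) (Fo A) (\<lambda>x. Fm W A i (Fm A W p x) \<oplus>\<^bsub>Fo A\<^esub> Fm Y A j (Fm A Y q x)) (\<lambda>x. x)"
 proof -
  note c = Hom_comp[OF A h(3,1)] Hom_comp[OF A h(4,2)]
  let ?s = "\<lambda>x\<in>carrier A. (\<lambda>x\<in>carrier A. i (p x)) x \<oplus>\<^sub>A (\<lambda>x\<in>carrier A. j (q x)) x"
  have "?s = (\<lambda>x\<in>carrier A. i (p x) \<oplus>\<^sub>A j (q x))" by (simp cong: restrict_cong)
  then have "stab_eq R A A ?s (\<lambda>x\<in>carrier A. x)" using e(5) by simp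
  then have *: "stab_eq S (Fo A) (Fo A) (Fm A A ?s) (Fm A A (\<lambda>x\<in>carrier A. x))"
   by (rule Fm_stab[OF o(1,1) Hom_plus[OF A A c] Hom_id[OF A]])
  have "Fm A A ?s x = Fm W A i (Fm A W p x) \<oplus>\<^bsub>Fo A\<^esub> Fm Y A j (Fm A Y q x)" if "x \<in> carrier (Fo A)" for x
   using Fm_add[OF o(1,1) c that] Fm_comp[OF o(1,2,1) h(3,1) that] Fm_comp[OF o(1,3,1) h(4,2) that] by simp
  from stab_eq_subst[OF * this[symmetric] Fm_id[OF o(1), symmetric]] show ?thesis .
 qed
 then show ?thesis
  unfolding S.direct_sum_iff
  using copy(1)[OF o(1)] copy(1)[OF o(2)] copy(1)[OF o(3)] Fm_hom[OF o(2,1) h(1)] Fm_hom[OF o(3,1) h(2)]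
   Fm_hom[OF o(1,2) h(3)] Fm_hom[OF o(1,3) h(4)] Fm_stab_id[OF o(2,1) h(1,3) e(1)] Fm_stab_id[OF o(3,1) h(2,4) e(2)]
   Fm_stab_zero[OF o(2,1,3) h(1,4) e(3)] Fm_stab_zero[OF o(3,1,2) h(2,3) e(4)]
  by blast
qed

text \<open>The functor takes the chosen presentation of \<open>W\<close> to an exact sequence with
  injective middle term, whose cokernel agrees with the chosen cosyzygy up to stable
  isomorphism.\<close>

lemma Fo_cosyzygy:
 assumes "R.obj W" shows "stab_iso S (S.IC (Fo W)) (Fo (R.IC W))"
proof -
 note P = R.presentation[OF assms] and P' = S.presentation[OF copy(1)[OF assms]]
 note o = R.IE_obj[OF assms] R.IC_obj[OF assms]
 show ?thesis
  by (rule S.cosyzygy_unique[OF Fo_lm[OF assms] P'(3) Fo_lm[OF o(2)] P'(4) Fm_exact[OF assms o P(4)] P'(1) Fo_inj[OF o(1) P(1)]])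
qed

text \<open>Each rule of the hull is preserved, the two shift rules by means of
  \<open>Fo_cosyzygy\<close>. The set \<open>I\<close> is kept general because, in the induction
  over levels, it is a set of extensions.\<close>

lemma hull_map:
 assumes "W \<in> closure_hull R.T I" "\<And>V. V \<in> I \<Longrightarrow> R.obj V \<Longrightarrow> Fo V \<in> closure_hull S.T J"
 shows "Fo W \<in> closure_hull S.T J"
 using assms(1)
proof induction
 case (base W) then show ?case using assms(2) by (simp add: R.cat_simps)
next
 case (zero Z) then show ?case by (intro closure_hull.zero Fo_zero_object)
next
 case (sum W Y A) then show ?case by (intro closure_hull.sum[OF sum.IH] Fo_direct_sum)
next
 case (summand A W Y) then show ?case by (intro closure_hull.summand[OF summand.IH Fo_direct_sum[OF summand.hyps(2)]])
next
 case (shift W)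
 have o: "R.obj W" using shift.hyps by (rule R.closure_hull_obj)
 have "S.IC (Fo W) \<in> closure_hull S.T J" using closure_hull.shift[OF shift.IH] by (simp add: S.cat_simps)
 from S.hull_iso[OF this copy(1)[OF R.IC_obj[OF o]] Fo_cosyzygy[OF o]] show ?case by (simp add: R.cat_simps)
next
 case (unshift W)
 have o: "R.obj W" using unshift.hyps by (simp add: R.cat_simps)
 have "Fo (R.IC W) \<in> closure_hull S.T J" using unshift.IH by (simp add: R.cat_simps)
 from S.hull_iso[OF this S.IC_obj[OF copy(1)[OF o]] stab_iso_sym[OF Fo_cosyzygy[OF o]]]
 have "Shift S.T (Fo W) \<in> closure_hull S.T J" by (simp add: S.cat_simps)
 then show ?case by (rule closure_hull.unshift) (simp add: S.cat_simps copy(1)[OF o])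
qed

lemma hull_map_singleton:
 assumes "W \<in> closure_hull R.T {M}" "R.obj M"
 shows "Fo W \<in> closure_hull S.T {Fo M}"
 using assms(1)
proof (rule hull_map)
 fix V assume "V \<in> {M}"
 then show "Fo V \<in> closure_hull S.T {Fo M}"
  using copy(1)[OF assms(2)] by (intro closure_hull.base) (auto simp: S.cat_simps)
qed

text \<open>Triangles are not transported. The extension is replaced by a short exact sequence with
  isomorphic terms, to which \<open>Fm_exact\<close> applies, and \<open>Fo_stab_iso\<close> returns
  to the original object.\<close>

theorem gen_level_map:
 assumes "R.obj M" "W \<in> gen_level R.T {M} (Suc n)"
 shows "Fo W \<in> gen_level S.T {Fo M} (Suc n)"
 using assms(2)
proof (induction n arbitrary: W)
 case 0 then show ?case using hull_map_singleton[OF _ assms(1)] by simp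
next
 case (Suc n)
 have *: "W \<in> closure_hull R.T (ext_objects R.T (gen_level R.T {M} (Suc n)) (closure_hull R.T {M}))"
  using Suc.prems by simp
 let ?J = "ext_objects S.T (gen_level S.T {Fo M} (Suc n)) (closure_hull S.T {Fo M})"
 have "Fo W \<in> closure_hull S.T ?J"
  using *
 proof (rule hull_map)
  fix V assume "V \<in> ext_objects R.T (gen_level R.T {M} (Suc n)) (closure_hull R.T {M})"
  then obtain W W' N' Y Y' f g where e: "short_exact R W' N' Y' f g" "R.obj W'" "R.obj N'" "R.obj Y'"
   "W \<in> gen_level R.T {M} (Suc n)" "Y \<in> closure_hull R.T {M}" "R.obj V"
   "stab_iso R W W'" "stab_iso R V N'" "stab_iso R Y Y'"
   by (rule R.ext_objectsE)
  have W': "Fo W' \<in> gen_level S.T {Fo M} (Suc n)" by (rule Suc.IH[OF R.gen_level_iso[OF e(5,2,8)]])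
  have Y': "Fo Y' \<in> closure_hull S.T {Fo M}" by (rule hull_map_singleton[OF R.hull_iso[OF e(6,4,10)] assms(1)])
  have "Fo N' \<in> ?J"
   by (rule S.ext_objectsI[OF Fm_exact[OF e(2,3,4,1)] copy(1)[OF e(2)] copy(1)[OF e(3)] copy(1)[OF e(4)] W' Y'])
  then have "Fo N' \<in> closure_hull S.T ?J" using copy(1)[OF e(3)] by (intro closure_hull.base) (simp_all add: S.cat_simps)
  then show "Fo V \<in> closure_hull S.T ?J"
   by (rule S.hull_iso[OF _ copy(1)[OF e(7)] stab_iso_sym[OF Fo_stab_iso[OF e(7,3,9)]]])
 qed
 then show ?case by simp
qed

end

section \<open>Smash products\<close>

locale graded_alg = K: field K + A: ring A + grp: group G
 for K :: "('k, 'x) ring_scheme" and A :: "('k, 'a) module" and G :: "('g, 'y) monoid_scheme" +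
 fixes Gr :: "'g \<Rightarrow> 'a set"
 assumes graded: "graded_algebra K A G Gr"
begin
lemmas finite_group = graded_algebra.finite_group[OF graded]
lemmas subspace = graded_algebra.subspace[OF graded]
lemmas direct = graded_algebra.direct[OF graded]
lemmas mult_graded = graded_algebra.mult_graded[OF graded]

lemma k_alg: "k_algebra K A"
 using graded by (simp add: graded_algebra_def)

lemma k_mod: "module K A"
 using k_alg by (simp add: k_algebra_def)

lemmas submoduleE = module.submoduleE[OF k_mod]
lemmas smult_closed = module.smult_closed[OF k_mod]
lemmas smult_assoc1 = module.smult_assoc1[OF k_mod]
lemmas smult_l_distr = module.smult_l_distr[OF k_mod]
lemmas smult_one = module.smult_one[OF k_mod]
lemmas smult_assoc_left = k_algebra.smult_assoc_left[OF k_alg]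
lemmas smult_assoc_right = k_algebra.smult_assoc_right[OF k_alg]

abbreviation "G0 \<equiv> carrier G"
abbreviation quotient (infixl "\<div>" 70) where "g \<div> h \<equiv> g \<otimes>\<^sub>G inv\<^bsub>G\<^esub> h"
abbreviation "cmp \<equiv> component G A Gr"
abbreviation "smash \<equiv> smash_product G A Gr"

section \<open>Homogeneous components\<close>

lemma component_PiE: "a \<in> carrier A \<Longrightarrow> cmp a \<in> (\<Pi>\<^sub>E g\<in>G0. Gr g)"
 and component_sum: "a \<in> carrier A \<Longrightarrow> finsum A (cmp a) G0 = a"
proof -
 assume "a \<in> carrier A"
 from theI'[OF direct[OF this]] show "cmp a \<in> (\<Pi>\<^sub>E g\<in>G0. Gr g)" "finsum A (cmp a) G0 = a"
  unfolding component_def by simp_all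
qed

lemma component_eqI:
 assumes "a \<in> carrier A" "\<And>g. g \<in> G0 \<Longrightarrow> c g \<in> Gr g" "a = finsum A c G0" "g \<in> G0"
 shows "cmp a g = c g"
proof -
 have Gr: "x \<in> carrier A" if "g \<in> G0" "x \<in> Gr g" for g x
  using subspace[OF that(1)] that(2) submoduleE(1) by blast
 have "a = finsum A (\<lambda>g\<in>G0. c g) G0"
  unfolding assms(3) using assms(2) Gr by (intro A.finsum_cong') auto
 moreover have "(\<lambda>g\<in>G0. c g) \<in> (\<Pi>\<^sub>E g\<in>G0. Gr g)" using assms(2) by auto
 ultimately have "cmp a = (\<lambda>g\<in>G0. c g)"
  using direct[OF assms(1)] unfolding component_def by (intro the1_equality) auto
 then show ?thesis using assms(4) by simp
qed

lemma Gr_closed: "g \<in> G0 \<Longrightarrow> x \<in> Gr g \<Longrightarrow> x \<in> carrier A"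
 using subspace submoduleE(1) by blast

lemma Gr_zero: "g \<in> G0 \<Longrightarrow> \<zero>\<^sub>A \<in> Gr g"
 using subgroup.one_closed[OF submodule.axioms(1)[OF subspace]] by simp

lemma Gr_add: "g \<in> G0 \<Longrightarrow> x \<in> Gr g \<Longrightarrow> y \<in> Gr g \<Longrightarrow> x \<oplus>\<^sub>A y \<in> Gr g"
 using submoduleE(5)[OF subspace] .

lemma Gr_smult: "g \<in> G0 \<Longrightarrow> c \<in> carrier K \<Longrightarrow> x \<in> Gr g \<Longrightarrow> c \<odot>\<^sub>A x \<in> Gr g"
 using submoduleE(4)[OF subspace] .

lemma cmp_Gr: "a \<in> carrier A \<Longrightarrow> g \<in> G0 \<Longrightarrow> cmp a g \<in> Gr g"
 using component_PiE by auto

lemma cmp_closed [simp]: "a \<in> carrier A \<Longrightarrow> g \<in> G0 \<Longrightarrow> cmp a g \<in> carrier A"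
 using cmp_Gr Gr_closed by blast

lemma cmp_add:
 assumes "a \<in> carrier A" "b \<in> carrier A" "g \<in> G0"
 shows "cmp (a \<oplus>\<^sub>A b) g = cmp a g \<oplus>\<^sub>A cmp b g"
proof (rule component_eqI)
 show "a \<oplus>\<^sub>A b = finsum A (\<lambda>g. cmp a g \<oplus>\<^sub>A cmp b g) G0"
  using assms component_sum by (subst A.finsum_addf) (auto simp: Pi_iff)
qed (use assms in \<open>auto intro: Gr_add cmp_Gr\<close>)

lemma cmp_homog:
 assumes "k \<in> G0" "a \<in> Gr k" "g \<in> G0"
 shows "cmp a g = (if g = k then a else \<zero>\<^sub>A)"
proof (rule component_eqI)
 have "finsum A (\<lambda>g. if k = g then a else \<zero>\<^sub>A) G0 = a"
  using assms finite_group Gr_closed by (subst A.finsum_singleton) auto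
 then show "a = finsum A (\<lambda>g. if g = k then a else \<zero>\<^sub>A) G0" by (simp add: eq_commute[of k])
qed (use assms Gr_closed Gr_zero in auto)

lemma cmp_zero [simp]: "g \<in> G0 \<Longrightarrow> cmp \<zero>\<^sub>A g = \<zero>\<^sub>A"
 using cmp_homog[of g "\<zero>\<^sub>A" g] Gr_zero by simp

lemma cmp_finsum:
 assumes "finite I" "f \<in> I \<rightarrow> carrier A" "g \<in> G0"
 shows "cmp (finsum A f I) g = finsum A (\<lambda>i. cmp (f i) g) I"
 using assms(1,2)
proof (induction rule: finite_induct)
 case (insert i I)
 then have "f i \<in> carrier A" "f \<in> I \<rightarrow> carrier A" "finsum A f I \<in> carrier A" "(\<lambda>i. cmp (f i) g) \<in> I \<rightarrow> carrier A"
  using assms(3) by (auto simp: Pi_iff)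
 then show ?case using insert assms(3) by (simp add: cmp_add)
qed (use assms in simp)

lemma quot_cancel:
 assumes "x \<in> G0" "y \<in> G0" "h \<in> G0"
 shows "h \<div> x = h \<div> y \<longleftrightarrow> x = y"
proof
 assume "h \<div> x = h \<div> y"
 then have "inv\<^bsub>G\<^esub> h \<otimes>\<^sub>G (h \<div> x) = inv\<^bsub>G\<^esub> h \<otimes>\<^sub>G (h \<div> y)" by (rule arg_cong)
 then have "inv\<^bsub>G\<^esub> x = inv\<^bsub>G\<^esub> y" using assms by (simp add: grp.m_assoc[symmetric])
 then have "inv\<^bsub>G\<^esub> (inv\<^bsub>G\<^esub> x) = inv\<^bsub>G\<^esub> (inv\<^bsub>G\<^esub> y)" by (rule arg_cong)
 then show "x = y" using assms by simp
qed simp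

text \<open>Both \<open>g \<mapsto> g \<div> h\<close> and \<open>g \<mapsto> h \<div> g\<close>
  permute the group.\<close>

lemma sum_shift:
 assumes "abelian_group M" "h \<in> G0" "f \<in> G0 \<rightarrow> carrier M"
 shows "finsum M (\<lambda>g. f (g \<div> h)) G0 = finsum M f G0" "finsum M (\<lambda>g. f (h \<div> g)) G0 = finsum M f G0"
proof -
 interpret M: abelian_group M by fact
 have "(\<lambda>g. g \<div> h) ` G0 = G0"
 proof
  show "G0 \<subseteq> (\<lambda>g. g \<div> h) ` G0"
  proof
   fix x assume "x \<in> G0"
   then show "x \<in> (\<lambda>g. g \<div> h) ` G0"
    using assms(2) by (intro image_eqI[of _ _ "x \<otimes>\<^sub>G h"]) (auto simp: grp.m_assoc)
  qed
 qed (use assms(2) in auto)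
 moreover have "inj_on (\<lambda>g. g \<div> h) G0" using assms(2) by (auto simp: inj_on_def)
 ultimately show "finsum M (\<lambda>g. f (g \<div> h)) G0 = finsum M f G0"
  using M.finsum_reindex[of f "\<lambda>g. g \<div> h" G0] assms(3) by simp
 have "(\<lambda>g. h \<div> g) ` G0 = G0"
 proof
  show "G0 \<subseteq> (\<lambda>g. h \<div> g) ` G0"
  proof
   fix x assume "x \<in> G0"
   then show "x \<in> (\<lambda>g. h \<div> g) ` G0"
    using assms(2) by (intro image_eqI[of _ _ "inv\<^bsub>G\<^esub> x \<otimes>\<^sub>G h"]) (auto simp: grp.inv_mult_group simp flip: grp.m_assoc)
  qed
 qed (use assms(2) in auto)
 moreover have "inj_on (\<lambda>g. h \<div> g) G0"
 proof (rule inj_onI)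
  fix x y assume "x \<in> G0" "y \<in> G0" "h \<div> x = h \<div> y"
  then show "x = y" using quot_cancel[of x y h] assms(2) by simp
 qed
 ultimately show "finsum M (\<lambda>g. f (h \<div> g)) G0 = finsum M f G0"
  using M.finsum_reindex[of f "\<lambda>g. h \<div> g" G0] assms(3) by simp
qed

lemma sum_cmp_shift:
 assumes "a \<in> carrier A" "h \<in> G0"
 shows "finsum A (\<lambda>g. cmp a (g \<div> h)) G0 = a" "finsum A (\<lambda>g. cmp a (h \<div> g)) G0 = a"
 using sum_shift[OF A.abelian_group_axioms assms(2), of "cmp a"] component_sum assms by simp_all

text \<open>Multiplication by \<open>b\<close> shifts degrees by \<open>t\<close> on the right, so
  what arrives in degree \<open>s\<close> comes from degree \<open>s \<div> t\<close>.\<close>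

lemma cmp_mult_homog:
 assumes "a \<in> carrier A" "t \<in> G0" "b \<in> Gr t" "s \<in> G0"
 shows "cmp (a \<otimes>\<^sub>A b) s = cmp a (s \<div> t) \<otimes>\<^sub>A b"
proof (rule component_eqI)
 have b: "b \<in> carrier A" using assms Gr_closed by blast
 have "a \<otimes>\<^sub>A b = finsum A (\<lambda>g. cmp a (g \<div> t)) G0 \<otimes>\<^sub>A b" using sum_cmp_shift(1)[OF assms(1,2)] by simp
 also have "\<dots> = finsum A (\<lambda>g. cmp a (g \<div> t) \<otimes>\<^sub>A b) G0"
  using assms b finite_group by (intro A.finsum_ldistr) auto
 finally show "a \<otimes>\<^sub>A b = finsum A (\<lambda>g. cmp a (g \<div> t) \<otimes>\<^sub>A b) G0" .
 show "cmp a (g \<div> t) \<otimes>\<^sub>A b \<in> Gr g" if "g \<in> G0" for g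
  using mult_graded[OF _ assms(2) cmp_Gr[OF assms(1)] assms(3), of "g \<div> t"] that assms(2) by (simp add: grp.m_assoc)
qed (use assms Gr_closed in auto)

text \<open>The component \<open>e\<close> of 1 in degree \<open>\<one>\<^sub>G\<close> fixes all
  homogeneous elements from the left, as seen by comparing degrees. Hence it fixes 1, which is a sum
  of such elements, and equals it.\<close>

lemma one_Gr: "\<one>\<^sub>A \<in> Gr \<one>\<^sub>G"
proof -
 define e where "e = cmp \<one>\<^sub>A \<one>\<^sub>G"
 have e: "e \<in> Gr \<one>\<^sub>G" "e \<in> carrier A" by (simp_all add: e_def cmp_Gr)
 have h: "e \<otimes>\<^sub>A b = b" if "t \<in> G0" "b \<in> Gr t" for b t
  using cmp_mult_homog[of "\<one>\<^sub>A" t b t] cmp_homog[OF that that(1)] that Gr_closed[OF that] by (simp add: e_def)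
 have "finsum A (cmp \<one>\<^sub>A) G0 = finsum A (\<lambda>g. e \<otimes>\<^sub>A cmp \<one>\<^sub>A g) G0"
  using h cmp_Gr[of "\<one>\<^sub>A"] e by (intro A.finsum_cong') auto
 then have "\<one>\<^sub>A = finsum A (\<lambda>g. e \<otimes>\<^sub>A cmp \<one>\<^sub>A g) G0"
  using component_sum[of "\<one>\<^sub>A"] by simp
 also have "\<dots> = e \<otimes>\<^sub>A finsum A (cmp \<one>\<^sub>A) G0"
  using e finite_group by (intro A.finsum_rdistr[symmetric]) auto
 also have "\<dots> = e" using component_sum[of "\<one>\<^sub>A"] e by simp
 finally show ?thesis using e by simp
qed

lemma cmp_one: "g \<in> G0 \<Longrightarrow> cmp \<one>\<^sub>A g = (if g = \<one>\<^sub>G then \<one>\<^sub>A else \<zero>\<^sub>A)"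
 using cmp_homog[OF _ one_Gr] by simp

lemma quot_eq_one: "g \<in> G0 \<Longrightarrow> h \<in> G0 \<Longrightarrow> g \<div> h = \<one>\<^sub>G \<longleftrightarrow> g = h"
 using grp.inv_equality[of g "inv\<^bsub>G\<^esub> h"] by auto

lemma quot_quot: "g \<in> G0 \<Longrightarrow> h \<in> G0 \<Longrightarrow> k \<in> G0 \<Longrightarrow>
  g \<div> h \<div> (k \<div> h) = g \<div> k"
 by (simp add: grp.inv_mult_group grp.m_assoc) (simp add: grp.m_assoc[symmetric])

section \<open>The ring structure of the smash product\<close>

lemma smash_simps [simp]:
 "carrier smash = G0 \<rightarrow>\<^sub>E carrier A" "\<one>\<^bsub>smash\<^esub> = (\<lambda>g\<in>G0. \<one>\<^sub>A)" "\<zero>\<^bsub>smash\<^esub> = (\<lambda>g\<in>G0. \<zero>\<^sub>A)"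
 "u \<oplus>\<^bsub>smash\<^esub> v = (\<lambda>g\<in>G0. u g \<oplus>\<^sub>A v g)"
 "u \<otimes>\<^bsub>smash\<^esub> v = (\<lambda>h\<in>G0. finsum A (\<lambda>g. u g \<otimes>\<^sub>A cmp (v h) (g \<div> h)) G0)"
 "c \<odot>\<^bsub>smash\<^esub> u = (\<lambda>g\<in>G0. c \<odot>\<^sub>A u g)"
 by (simp_all add: smash_product_def)

lemma smash_abelian_group: "abelian_group smash"
proof (rule abelian_group_cong)
 show "abelian_group (pi_module G0 (\<lambda>_. Reg A))"
  using pi_left_module[of A G0 "\<lambda>_. Reg A", OF A.ring_axioms regular_left_module[OF A.ring_axioms]] by (simp add: left_module_def)
qed simp_all

lemma smash_app [simp]: "u \<in> G0 \<rightarrow>\<^sub>E carrier A \<Longrightarrow> g \<in> G0 \<Longrightarrow> u g \<in> carrier A"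
 by auto

text \<open>With \<open>cmp (u h) (g \<div> h)\<close> as the entry of \<open>u\<close> in row
  \<open>g\<close> and column \<open>h\<close>, the smash product is the ring of matrices over
  \<open>A\<close> whose entries have degree \<open>g \<div> h\<close>. This is the formula for the
  entries of a product.\<close>

lemma cmp_smash_mult:
 assumes "u \<in> G0 \<rightarrow>\<^sub>E carrier A" "a \<in> carrier A" "g \<in> G0" "h \<in> G0"
 shows "cmp (finsum A (\<lambda>k. u k \<otimes>\<^sub>A cmp a (k \<div> h)) G0) (g \<div> h)
  = finsum A (\<lambda>k. cmp (u k) (g \<div> k) \<otimes>\<^sub>A cmp a (k \<div> h)) G0"
proof -
 have "cmp (finsum A (\<lambda>k. u k \<otimes>\<^sub>A cmp a (k \<div> h)) G0) (g \<div> h)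
  = finsum A (\<lambda>k. cmp (u k \<otimes>\<^sub>A cmp a (k \<div> h)) (g \<div> h)) G0"
  using assms finite_group by (intro cmp_finsum) auto
 also have "\<dots> = finsum A (\<lambda>k. cmp (u k) (g \<div> k) \<otimes>\<^sub>A cmp a (k \<div> h)) G0"
  using assms by (intro A.finsum_cong') (auto simp: cmp_mult_homog[OF _ _ cmp_Gr] quot_quot)
 finally show ?thesis .
qed

text \<open>In terms of matrices, associativity is the exchange of two summations after
  \<open>cmp_smash_mult\<close>.\<close>

lemma smash_ring: "ring smash"
proof (rule ringI)
 show "abelian_group smash" by (rule smash_abelian_group)
 show "monoid smash"
 proof (rule monoidI)
  fix u v assume u: "u \<in> carrier smash" and v: "v \<in> carrier smash"
  then show "u \<otimes>\<^bsub>smash\<^esub> v \<in> carrier smash" by (auto intro!: A.finsum_closed)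
  fix w assume w: "w \<in> carrier smash"
  have "finsum A (\<lambda>g. finsum A (\<lambda>k. u k \<otimes>\<^sub>A cmp (v g) (k \<div> g)) G0 \<otimes>\<^sub>A cmp (w h) (g \<div> h)) G0
   = finsum A (\<lambda>k. u k \<otimes>\<^sub>A cmp (finsum A (\<lambda>g. v g \<otimes>\<^sub>A cmp (w h) (g \<div> h)) G0) (k \<div> h)) G0"
   (is "?l = ?r") if h: "h \<in> G0" for h
  proof -
   have "?l = finsum A (\<lambda>g. finsum A (\<lambda>k. u k \<otimes>\<^sub>A cmp (v g) (k \<div> g) \<otimes>\<^sub>A cmp (w h) (g \<div> h)) G0) G0"
    using u v w h finite_group by (intro A.finsum_cong' refl A.finsum_ldistr) (auto intro!: A.finsum_closed)
   also have "\<dots> = finsum A (\<lambda>k. finsum A (\<lambda>g. u k \<otimes>\<^sub>A cmp (v g) (k \<div> g) \<otimes>\<^sub>A cmp (w h) (g \<div> h)) G0) G0"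
    using u v w h finite_group by (intro abelian_group_finsum_swap A.abelian_group_axioms) auto
   also have "\<dots> = finsum A (\<lambda>k. u k \<otimes>\<^sub>A finsum A (\<lambda>g. cmp (v g) (k \<div> g) \<otimes>\<^sub>A cmp (w h) (g \<div> h)) G0) G0"
   proof (rule A.finsum_cong'[OF refl])
    show "(\<lambda>k. u k \<otimes>\<^sub>A finsum A (\<lambda>g. cmp (v g) (k \<div> g) \<otimes>\<^sub>A cmp (w h) (g \<div> h)) G0) \<in> G0 \<rightarrow> carrier A"
     using u v w h by (auto intro!: A.finsum_closed A.m_closed)
    fix k assume k: "k \<in> G0"
    have "u k \<otimes>\<^sub>A finsum A (\<lambda>g. cmp (v g) (k \<div> g) \<otimes>\<^sub>A cmp (w h) (g \<div> h)) G0
     = finsum A (\<lambda>g. u k \<otimes>\<^sub>A (cmp (v g) (k \<div> g) \<otimes>\<^sub>A cmp (w h) (g \<div> h))) G0"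
     using u v w h k finite_group by (intro A.finsum_rdistr) auto
    also have "\<dots> = finsum A (\<lambda>g. u k \<otimes>\<^sub>A cmp (v g) (k \<div> g) \<otimes>\<^sub>A cmp (w h) (g \<div> h)) G0"
     using u v w h k by (intro A.finsum_cong' refl) (auto simp: A.m_assoc)
    finally show "finsum A (\<lambda>g. u k \<otimes>\<^sub>A cmp (v g) (k \<div> g) \<otimes>\<^sub>A cmp (w h) (g \<div> h)) G0
     = u k \<otimes>\<^sub>A finsum A (\<lambda>g. cmp (v g) (k \<div> g) \<otimes>\<^sub>A cmp (w h) (g \<div> h)) G0" by simp
   qed
   also have "\<dots> = ?r"
    using u v w h by (intro A.finsum_cong' refl) (auto simp: cmp_smash_mult intro!: A.finsum_closed A.m_closed)
   finally show ?thesis .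
  qed
  note 1 = this
  have 2: "u \<otimes>\<^bsub>smash\<^esub> v \<otimes>\<^bsub>smash\<^esub> w = (\<lambda>h\<in>G0. finsum A (\<lambda>g. finsum A (\<lambda>k. u k \<otimes>\<^sub>A cmp (v g) (k \<div> g)) G0 \<otimes>\<^sub>A cmp (w h) (g \<div> h)) G0)"
   using u v w by (auto simp: fun_eq_iff intro!: A.finsum_cong' A.finsum_closed A.m_closed)
  have 3: "u \<otimes>\<^bsub>smash\<^esub> (v \<otimes>\<^bsub>smash\<^esub> w) = (\<lambda>h\<in>G0. finsum A (\<lambda>k. u k \<otimes>\<^sub>A cmp (finsum A (\<lambda>g. v g \<otimes>\<^sub>A cmp (w h) (g \<div> h)) G0) (k \<div> h)) G0)"
   by (simp cong: restrict_cong)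
  show "u \<otimes>\<^bsub>smash\<^esub> v \<otimes>\<^bsub>smash\<^esub> w = u \<otimes>\<^bsub>smash\<^esub> (v \<otimes>\<^bsub>smash\<^esub> w)"
   unfolding 2 3 by (rule restrict_ext) (rule 1)
 next
  fix u assume u: "u \<in> carrier smash"
  then have ext: "u = (\<lambda>h\<in>G0. u h)" by (simp add: PiE_def extensional_restrict)
  have "finsum A (\<lambda>g. (\<lambda>g\<in>G0. \<one>\<^sub>A) g \<otimes>\<^sub>A cmp (u h) (g \<div> h)) G0 = u h" if h: "h \<in> G0" for h
  proof -
   have "finsum A (\<lambda>g. (\<lambda>g\<in>G0. \<one>\<^sub>A) g \<otimes>\<^sub>A cmp (u h) (g \<div> h)) G0
    = finsum A (\<lambda>g. cmp (u h) (g \<div> h)) G0"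
    using u h by (intro A.finsum_cong' refl) auto
   then show ?thesis using sum_cmp_shift(1)[of "u h" h] u h by simp
  qed
  then have "\<one>\<^bsub>smash\<^esub> \<otimes>\<^bsub>smash\<^esub> u = (\<lambda>h\<in>G0. u h)" unfolding smash_simps by (rule restrict_ext)
  then show "\<one>\<^bsub>smash\<^esub> \<otimes>\<^bsub>smash\<^esub> u = u" using ext by simp
  have "finsum A (\<lambda>g. u g \<otimes>\<^sub>A cmp \<one>\<^sub>A (g \<div> h)) G0 = u h" if h: "h \<in> G0" for h
  proof -
   have "finsum A (\<lambda>g. u g \<otimes>\<^sub>A cmp \<one>\<^sub>A (g \<div> h)) G0 = finsum A (\<lambda>g. if h = g then u g else \<zero>\<^sub>A) G0"
    using u h by (intro A.finsum_cong' refl) (auto simp: cmp_one quot_eq_one)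
   then show ?thesis using u h finite_group by (simp add: A.finsum_singleton[of h G0 u] Pi_iff)
  qed
  then have "u \<otimes>\<^bsub>smash\<^esub> \<one>\<^bsub>smash\<^esub> = (\<lambda>h\<in>G0. u h)" by (auto simp: fun_eq_iff)
  then show "u \<otimes>\<^bsub>smash\<^esub> \<one>\<^bsub>smash\<^esub> = u" using ext by simp
 qed auto
 fix u v w assume u: "u \<in> carrier smash" and v: "v \<in> carrier smash" and w: "w \<in> carrier smash"
 have "finsum A (\<lambda>g. (\<lambda>g\<in>G0. u g \<oplus>\<^sub>A v g) g \<otimes>\<^sub>A cmp (w h) (g \<div> h)) G0
  = finsum A (\<lambda>g. u g \<otimes>\<^sub>A cmp (w h) (g \<div> h)) G0 \<oplus>\<^sub>A finsum A (\<lambda>g. v g \<otimes>\<^sub>A cmp (w h) (g \<div> h)) G0"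
  if "h \<in> G0" for h
  using u v w that by (subst A.finsum_addf[symmetric]) (auto simp: A.l_distr simp del: A.finsum_addf intro!: A.finsum_cong')
 then show "(u \<oplus>\<^bsub>smash\<^esub> v) \<otimes>\<^bsub>smash\<^esub> w = u \<otimes>\<^bsub>smash\<^esub> w \<oplus>\<^bsub>smash\<^esub> v \<otimes>\<^bsub>smash\<^esub> w"
  by (auto simp: fun_eq_iff cong: A.finsum_cong)
 have "finsum A (\<lambda>g. w g \<otimes>\<^sub>A cmp (u h \<oplus>\<^sub>A v h) (g \<div> h)) G0
  = finsum A (\<lambda>g. w g \<otimes>\<^sub>A cmp (u h) (g \<div> h)) G0 \<oplus>\<^sub>A finsum A (\<lambda>g. w g \<otimes>\<^sub>A cmp (v h) (g \<div> h)) G0"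
  if "h \<in> G0" for h
  using u v w that by (subst A.finsum_addf[symmetric]) (auto simp: A.r_distr cmp_add simp del: A.finsum_addf intro!: A.finsum_cong')
 then show "w \<otimes>\<^bsub>smash\<^esub> (u \<oplus>\<^bsub>smash\<^esub> v) = w \<otimes>\<^bsub>smash\<^esub> u \<oplus>\<^bsub>smash\<^esub> w \<otimes>\<^bsub>smash\<^esub> v"
  by (auto simp: fun_eq_iff)
qed

text \<open>The embedding of \<open>A\<close> as multiples of the identity, that is, as constant
  functions; \<open>pr g\<close> below is the idempotent \<open>p_g\<close>.\<close>

definition \<eta> :: "'a \<Rightarrow> 'g \<Rightarrow> 'a" where "\<eta> a = (\<lambda>g\<in>G0. a)"

definition pr :: "'g \<Rightarrow> 'g \<Rightarrow> 'a" where "pr g = (\<lambda>h\<in>G0. if h = g then \<one>\<^sub>A else \<zero>\<^sub>A)"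

lemma \<eta>_closed [simp]: "a \<in> carrier A \<Longrightarrow> \<eta> a \<in> G0 \<rightarrow>\<^sub>E carrier A"
 by (simp add: \<eta>_def)

lemma pr_closed [simp]: "pr g \<in> G0 \<rightarrow>\<^sub>E carrier A"
 by (auto simp: pr_def)

lemma \<eta>_mult:
 assumes "a \<in> carrier A" "u \<in> G0 \<rightarrow>\<^sub>E carrier A" shows "\<eta> a \<otimes>\<^bsub>smash\<^esub> u = (\<lambda>h\<in>G0. a \<otimes>\<^sub>A u h)"
proof -
 have "finsum A (\<lambda>g. \<eta> a g \<otimes>\<^sub>A cmp (u h) (g \<div> h)) G0 = a \<otimes>\<^sub>A u h" if h: "h \<in> G0" for h
 proof -
  have "finsum A (\<lambda>g. \<eta> a g \<otimes>\<^sub>A cmp (u h) (g \<div> h)) G0 = finsum A (\<lambda>g. a \<otimes>\<^sub>A cmp (u h) (g \<div> h)) G0"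
   using assms h by (intro A.finsum_cong' refl) (auto simp: \<eta>_def)
  also have "\<dots> = a \<otimes>\<^sub>A finsum A (\<lambda>g. cmp (u h) (g \<div> h)) G0"
   using assms h finite_group by (intro A.finsum_rdistr[symmetric]) auto
  finally show ?thesis using sum_cmp_shift(1)[of "u h" h] assms h by simp
 qed
 then show ?thesis by (auto simp: fun_eq_iff)
qed

lemma \<eta>_hom: "\<eta> \<in> ring_hom A smash"
proof (rule ring_hom_memI)
 fix a b assume "a \<in> carrier A" "b \<in> carrier A"
 then have "\<eta> a \<otimes>\<^bsub>smash\<^esub> \<eta> b = \<eta> (a \<otimes>\<^sub>A b)" by (subst \<eta>_mult) (auto simp: \<eta>_def fun_eq_iff)
 then show "\<eta> (a \<otimes>\<^sub>A b) = \<eta> a \<otimes>\<^bsub>smash\<^esub> \<eta> b" by simp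
qed (auto simp: \<eta>_def fun_eq_iff)

lemma pr_mult:
 assumes "g \<in> G0" "u \<in> G0 \<rightarrow>\<^sub>E carrier A" shows "pr g \<otimes>\<^bsub>smash\<^esub> u = (\<lambda>h\<in>G0. cmp (u h) (g \<div> h))"
proof -
 have "finsum A (\<lambda>k. pr g k \<otimes>\<^sub>A cmp (u h) (k \<div> h)) G0 = cmp (u h) (g \<div> h)" if h: "h \<in> G0" for h
 proof -
  have "finsum A (\<lambda>k. pr g k \<otimes>\<^sub>A cmp (u h) (k \<div> h)) G0
   = finsum A (\<lambda>k. if g = k then cmp (u h) (k \<div> h) else \<zero>\<^sub>A) G0"
   using assms h by (intro A.finsum_cong' refl) (auto simp: pr_def)
  also have "\<dots> = cmp (u h) (g \<div> h)"
   using assms h finite_group by (intro A.finsum_singleton) auto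
  finally show ?thesis .
 qed
 then show ?thesis by (auto simp: fun_eq_iff)
qed

lemma mult_pr:
 assumes "g \<in> G0" "u \<in> G0 \<rightarrow>\<^sub>E carrier A" shows "u \<otimes>\<^bsub>smash\<^esub> pr g = (\<lambda>h\<in>G0. if h = g then u h else \<zero>\<^sub>A)"
proof -
 have "finsum A (\<lambda>k. u k \<otimes>\<^sub>A cmp (pr g h) (k \<div> h)) G0 = (if h = g then u h else \<zero>\<^sub>A)" if h: "h \<in> G0" for h
 proof -
  have "finsum A (\<lambda>k. u k \<otimes>\<^sub>A cmp (pr g h) (k \<div> h)) G0
   = finsum A (\<lambda>k. if h = k then (if h = g then u k else \<zero>\<^sub>A) else \<zero>\<^sub>A) G0"
   using assms h by (intro A.finsum_cong' refl) (auto simp: pr_def cmp_one quot_eq_one)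
  also have "\<dots> = (if h = g then u h else \<zero>\<^sub>A)"
   using assms h finite_group by (intro A.finsum_singleton) auto
  finally show ?thesis .
 qed
 then show ?thesis by (auto simp: fun_eq_iff)
qed

lemma smash_finsum:
 assumes "finite I" "f \<in> I \<rightarrow> carrier smash" "g \<in> G0"
 shows "finsum smash f I g = finsum A (\<lambda>i. f i g) I"
 using assms(1,2)
proof (induction rule: finite_induct)
 case empty
 interpret B: abelian_group smash by (rule smash_abelian_group)
 show ?case using B.finsum_empty[of f] assms(3) by simp
next
 case (insert i I)
 interpret B: abelian_group smash by (rule smash_abelian_group)
 have "f \<in> I \<rightarrow> carrier smash" "f i \<in> carrier smash" "(\<lambda>i. f i g) \<in> I \<rightarrow> carrier A" "f i g \<in> carrier A"
  using insert.prems assms(3) by (auto simp: Pi_iff)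
 then show ?case using insert assms(3) B.finsum_insert[of I i f] by simp
qed

lemma smash_eqI: "u \<in> carrier smash \<Longrightarrow> v \<in> carrier smash \<Longrightarrow> (\<And>g. g \<in> G0 \<Longrightarrow> u g = v g) \<Longrightarrow> u = v"
 by (auto intro: PiE_ext)

lemma pr_idem: "g \<in> G0 \<Longrightarrow> pr g \<otimes>\<^bsub>smash\<^esub> pr g = pr g"
 using mult_pr[of g "pr g"] by (auto simp: pr_def fun_eq_iff)

lemma pr_sum: "finsum smash pr G0 = \<one>\<^bsub>smash\<^esub>"
proof (rule smash_eqI)
 interpret B: ring smash by (rule smash_ring)
 show "finsum smash pr G0 \<in> carrier smash" by (rule B.finsum_closed) simp
 fix h assume h: "h \<in> G0"
 have "finsum A (\<lambda>g. pr g h) G0 = finsum A (\<lambda>g. if h = g then \<one>\<^sub>A else \<zero>\<^sub>A) G0"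
  using h by (intro A.finsum_cong') (auto simp: pr_def)
 then show "finsum smash pr G0 h = \<one>\<^bsub>smash\<^esub> h"
  using h finite_group by (simp add: smash_finsum A.finsum_singleton[of h G0 "\<lambda>_. \<one>\<^sub>A"])
qed simp

text \<open>Row \<open>g\<close> of the matrix \<open>u\<close>, expanded by the idempotents with
  homogeneous coefficients. The linearity of \<open>adjR_hom\<close> rests on it, and that of
  \<open>adjL_hom\<close> on the expansion of a column in \<open>mult_pr_expand\<close>.\<close>

lemma pr_mult_expand:
 assumes "g \<in> G0" "u \<in> G0 \<rightarrow>\<^sub>E carrier A"
 shows "pr g \<otimes>\<^bsub>smash\<^esub> u = finsum smash (\<lambda>h. \<eta> (cmp (u h) (g \<div> h)) \<otimes>\<^bsub>smash\<^esub> pr h) G0"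
proof (rule smash_eqI)
 interpret B: ring smash by (rule smash_ring)
 have c: "(\<lambda>h. \<eta> (cmp (u h) (g \<div> h)) \<otimes>\<^bsub>smash\<^esub> pr h) \<in> G0 \<rightarrow> carrier smash"
  using assms by (intro Pi_I B.m_closed) auto
 then show "finsum smash (\<lambda>h. \<eta> (cmp (u h) (g \<div> h)) \<otimes>\<^bsub>smash\<^esub> pr h) G0 \<in> carrier smash" by (rule B.finsum_closed)
 show "pr g \<otimes>\<^bsub>smash\<^esub> u \<in> carrier smash" using assms by (intro B.m_closed) auto
 fix l assume l: "l \<in> G0"
 have "finsum smash (\<lambda>h. \<eta> (cmp (u h) (g \<div> h)) \<otimes>\<^bsub>smash\<^esub> pr h) G0 l
  = finsum A (\<lambda>h. (\<eta> (cmp (u h) (g \<div> h)) \<otimes>\<^bsub>smash\<^esub> pr h) l) G0"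
  using c l finite_group by (intro smash_finsum)
 also have "\<dots> = finsum A (\<lambda>h. if l = h then cmp (u h) (g \<div> h) else \<zero>\<^sub>A) G0"
  using assms l by (intro A.finsum_cong') (auto simp: \<eta>_mult pr_def simp del: smash_simps(5))
 also have "\<dots> = cmp (u l) (g \<div> l)"
  using assms l finite_group by (intro A.finsum_singleton) auto
 finally show "(pr g \<otimes>\<^bsub>smash\<^esub> u) l = finsum smash (\<lambda>h. \<eta> (cmp (u h) (g \<div> h)) \<otimes>\<^bsub>smash\<^esub> pr h) G0 l"
  using pr_mult[OF assms] l by simp
qed

lemma mult_pr_expand:
 assumes "h \<in> G0" "u \<in> G0 \<rightarrow>\<^sub>E carrier A"
 shows "u \<otimes>\<^bsub>smash\<^esub> pr h = finsum smash (\<lambda>g. pr g \<otimes>\<^bsub>smash\<^esub> \<eta> (cmp (u h) (g \<div> h))) G0"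
proof (rule smash_eqI)
 interpret B: ring smash by (rule smash_ring)
 have c: "(\<lambda>g. pr g \<otimes>\<^bsub>smash\<^esub> \<eta> (cmp (u h) (g \<div> h))) \<in> G0 \<rightarrow> carrier smash"
  using assms by (intro Pi_I B.m_closed) auto
 then show "finsum smash (\<lambda>g. pr g \<otimes>\<^bsub>smash\<^esub> \<eta> (cmp (u h) (g \<div> h))) G0 \<in> carrier smash" by (rule B.finsum_closed)
 show "u \<otimes>\<^bsub>smash\<^esub> pr h \<in> carrier smash" using assms by (intro B.m_closed) auto
 fix l assume l: "l \<in> G0"
 have uh: "u h \<in> carrier A" using assms by auto
 have "finsum smash (\<lambda>g. pr g \<otimes>\<^bsub>smash\<^esub> \<eta> (cmp (u h) (g \<div> h))) G0 l
  = finsum A (\<lambda>g. (pr g \<otimes>\<^bsub>smash\<^esub> \<eta> (cmp (u h) (g \<div> h))) l) G0"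
  using c l finite_group by (intro smash_finsum)
 also have "\<dots> = finsum A (\<lambda>g. if l = h then cmp (u h) (g \<div> h) else \<zero>\<^sub>A) G0"
 proof (rule A.finsum_cong'[OF refl])
  fix g assume g: "g \<in> G0"
  have "(pr g \<otimes>\<^bsub>smash\<^esub> \<eta> (cmp (u h) (g \<div> h))) l = cmp (cmp (u h) (g \<div> h)) (g \<div> l)"
   using g l uh assms by (subst pr_mult) (auto simp: \<eta>_def)
  \<comment> \<open>A homogeneous element of degree \<open>g \<div> h\<close> has no component of
    degree \<open>g \<div> l\<close> unless the degrees agree, that is, unless
    \<open>l = h\<close>.\<close>
  also have "\<dots> = (if g \<div> l = g \<div> h then cmp (u h) (g \<div> h) else \<zero>\<^sub>A)"
   using g l uh assms(1) by (intro cmp_homog cmp_Gr) auto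
  also have "g \<div> l = g \<div> h \<longleftrightarrow> l = h"
   using quot_cancel[OF l assms(1) g] .
  finally show "(pr g \<otimes>\<^bsub>smash\<^esub> \<eta> (cmp (u h) (g \<div> h))) l = (if l = h then cmp (u h) (g \<div> h) else \<zero>\<^sub>A)" .
 qed (use uh assms in auto)
 also have "\<dots> = (if l = h then u h else \<zero>\<^sub>A)" using sum_cmp_shift(1)[OF uh assms(1)] by (cases "l = h") auto
 finally show "(u \<otimes>\<^bsub>smash\<^esub> pr h) l = finsum smash (\<lambda>g. pr g \<otimes>\<^bsub>smash\<^esub> \<eta> (cmp (u h) (g \<div> h))) G0 l"
  using mult_pr[OF assms] l by simp
qed

section \<open>The ground field inside both algebras\<close>

definition kA :: "'k \<Rightarrow> 'a" where "kA c = c \<odot>\<^sub>A \<one>\<^sub>A"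
definition kB :: "'k \<Rightarrow> 'g \<Rightarrow> 'a" where "kB c = \<eta> (kA c)"

lemma kA_Gr: "c \<in> carrier K \<Longrightarrow> kA c \<in> Gr \<one>\<^sub>G"
 unfolding kA_def by (rule Gr_smult[OF _ _ one_Gr]) auto

lemma kA_closed [simp]: "c \<in> carrier K \<Longrightarrow> kA c \<in> carrier A"
 using kA_Gr Gr_closed by blast

lemma kA_mult: "c \<in> carrier K \<Longrightarrow> a \<in> carrier A \<Longrightarrow> kA c \<otimes>\<^sub>A a = c \<odot>\<^sub>A a"
 "c \<in> carrier K \<Longrightarrow> a \<in> carrier A \<Longrightarrow> a \<otimes>\<^sub>A kA c = c \<odot>\<^sub>A a"
 unfolding kA_def by (simp_all add: smult_assoc_left smult_assoc_right)

lemma kA_hom: "kA \<in> ring_hom K A"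
proof (rule ring_hom_memI)
 fix c d assume cd: "c \<in> carrier K" "d \<in> carrier K"
 then have "kA c \<otimes>\<^sub>A kA d = c \<odot>\<^sub>A kA d" using kA_closed[of d] by (simp only: kA_mult)
 then show "kA (c \<otimes>\<^sub>K d) = kA c \<otimes>\<^sub>A kA d"
  using smult_assoc1[OF cd A.one_closed] by (simp add: kA_def)
qed (simp_all add: kA_def smult_l_distr smult_closed smult_one)

lemma kB_hom: "kB \<in> ring_hom K smash"
 using ring_hom_trans[OF kA_hom \<eta>_hom] by (simp add: kB_def[abs_def] comp_def)

lemma kB_mult: "c \<in> carrier K \<Longrightarrow> u \<in> G0 \<rightarrow>\<^sub>E carrier A \<Longrightarrow> kB c \<otimes>\<^bsub>smash\<^esub> u = (\<lambda>h\<in>G0. c \<odot>\<^sub>A u h)"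
 unfolding kB_def by (subst \<eta>_mult) (auto simp: kA_mult fun_eq_iff)

text \<open>Scalars have degree \<open>\<one>\<^sub>G\<close> and hence commute with the
  idempotents; compared with \<open>kB_mult\<close>, this shows that the ground field is
  central.\<close>

lemma mult_kB:
 assumes "c \<in> carrier K" "u \<in> G0 \<rightarrow>\<^sub>E carrier A" shows "u \<otimes>\<^bsub>smash\<^esub> kB c = (\<lambda>h\<in>G0. c \<odot>\<^sub>A u h)"
proof -
 have "finsum A (\<lambda>k. u k \<otimes>\<^sub>A cmp (kB c h) (k \<div> h)) G0 = c \<odot>\<^sub>A u h" if h: "h \<in> G0" for h
 proof -
  have "finsum A (\<lambda>k. u k \<otimes>\<^sub>A cmp (kB c h) (k \<div> h)) G0
   = finsum A (\<lambda>k. if h = k then c \<odot>\<^sub>A u k else \<zero>\<^sub>A) G0"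
   using assms h
   by (intro A.finsum_cong' refl) (auto simp: smult_closed kB_def \<eta>_def cmp_homog[OF _ kA_Gr] quot_eq_one kA_mult)
  also have "\<dots> = c \<odot>\<^sub>A u h"
   using assms h finite_group by (intro A.finsum_singleton) (auto simp: smult_closed)
  finally show ?thesis .
 qed
 then show ?thesis by (auto simp: fun_eq_iff)
qed

text \<open>The induced module: as a graded module, it has the given module in every degree.\<close>

definition hmod :: "('a, 'm) module \<Rightarrow> ('g \<Rightarrow> 'a, 'g \<Rightarrow> 'm) module" where
 "hmod M = \<lparr>carrier = G0 \<rightarrow>\<^sub>E carrier M, monoid.mult = undefined, one = undefined,
   ring.zero = (\<lambda>g\<in>G0. \<zero>\<^sub>M), ring.add = (\<lambda>v w. \<lambda>g\<in>G0. v g \<oplus>\<^sub>M w g),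
   smult = (\<lambda>u v. \<lambda>g\<in>G0. finsum M (\<lambda>h. cmp (u h) (g \<div> h) \<odot>\<^sub>M v h) G0)\<rparr>"

lemma hmod_simps [simp]: "carrier (hmod M) = G0 \<rightarrow>\<^sub>E carrier M" "\<zero>\<^bsub>hmod M\<^esub> = (\<lambda>g\<in>G0. \<zero>\<^sub>M)"
 "v \<oplus>\<^bsub>hmod M\<^esub> w = (\<lambda>g\<in>G0. v g \<oplus>\<^sub>M w g)"
 "u \<odot>\<^bsub>hmod M\<^esub> v = (\<lambda>g\<in>G0. finsum M (\<lambda>h. cmp (u h) (g \<div> h) \<odot>\<^sub>M v h) G0)"
 by (simp_all add: hmod_def)

text \<open>The smash product acts on functions as matrices act on columns, the entry in row
  \<open>g\<close> and column \<open>h\<close> being \<open>cmp (u h) (g \<div> h)\<close>.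
  Associativity is again \<open>cmp_smash_mult\<close> with an exchange of sums.\<close>

lemma hmod_left_module:
 assumes "LMod A M" shows "LMod smash (hmod M)"
proof -
 interpret M: left_module A M by fact
 have ag: "abelian_group (hmod M)"
 proof (rule abelian_group_cong)
  show "abelian_group (pi_module G0 (\<lambda>_. M))"
   using pi_left_module[of A G0 "\<lambda>_. M", OF A.ring_axioms assms] by (simp add: left_module_def)
 qed simp_all
 have s: "cmp (u h) (g \<div> h) \<odot>\<^sub>M v h \<in> carrier M"
  if "u \<in> G0 \<rightarrow>\<^sub>E carrier A" "v \<in> G0 \<rightarrow>\<^sub>E carrier M" "g \<in> G0" "h \<in> G0" for u v g h
  using that by (intro M.smult_closed cmp_closed) auto
 show ?thesis
 proof (intro left_module.intro left_module_axioms.intro smash_ring ag)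
  fix v assume v: "v \<in> carrier (hmod M)"
  have vc: "v h \<in> carrier M" if "h \<in> G0" for h using v that by auto
  have "finsum M (\<lambda>h. cmp ((\<lambda>g\<in>G0. \<one>\<^sub>A) h) (g \<div> h) \<odot>\<^sub>M v h) G0 = v g" if g: "g \<in> G0" for g
  proof -
   have "finsum M (\<lambda>h. cmp ((\<lambda>g\<in>G0. \<one>\<^sub>A) h) (g \<div> h) \<odot>\<^sub>M v h) G0 = finsum M (\<lambda>h. if g = h then v h else \<zero>\<^sub>M) G0"
    using g vc by (intro M.M.finsum_cong' refl) (auto simp: cmp_one quot_eq_one)
   then show ?thesis using g finite_group vc by (simp add: M.M.finsum_singleton[of g G0 v] Pi_iff)
  qed
  then have "\<one>\<^bsub>smash\<^esub> \<odot>\<^bsub>hmod M\<^esub> v = (\<lambda>g\<in>G0. v g)" unfolding smash_simps hmod_simps by (rule restrict_ext)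
  then show "\<one>\<^bsub>smash\<^esub> \<odot>\<^bsub>hmod M\<^esub> v = v" using v by (simp add: PiE_def extensional_restrict)
 next
  fix u v assume u: "u \<in> carrier smash" and v: "v \<in> carrier (hmod M)"
  have vc: "v h \<in> carrier M" if "h \<in> G0" for h using v that by auto
  show "u \<odot>\<^bsub>hmod M\<^esub> v \<in> carrier (hmod M)" using u v s by (auto intro!: M.M.finsum_closed)
  fix w assume w: "w \<in> carrier smash"
  have "finsum M (\<lambda>h. cmp ((\<lambda>g\<in>G0. u g \<oplus>\<^sub>A w g) h) (g \<div> h) \<odot>\<^sub>M v h) G0
   = finsum M (\<lambda>h. cmp (u h) (g \<div> h) \<odot>\<^sub>M v h) G0 \<oplus>\<^sub>M finsum M (\<lambda>h. cmp (w h) (g \<div> h) \<odot>\<^sub>M v h) G0"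
   if "g \<in> G0" for g
   using u v w that s by (subst M.M.finsum_addf[symmetric]) (auto simp: cmp_add M.smult_l_distr vc simp del: M.M.finsum_addf intro!: M.M.finsum_cong')
  then show "(u \<oplus>\<^bsub>smash\<^esub> w) \<odot>\<^bsub>hmod M\<^esub> v = u \<odot>\<^bsub>hmod M\<^esub> v \<oplus>\<^bsub>hmod M\<^esub> w \<odot>\<^bsub>hmod M\<^esub> v"
   by (auto simp: fun_eq_iff cong: M.M.finsum_cong)
  have "finsum M (\<lambda>h. cmp (finsum A (\<lambda>k. u k \<otimes>\<^sub>A cmp (w h) (k \<div> h)) G0) (g \<div> h) \<odot>\<^sub>M v h) G0
   = finsum M (\<lambda>k. cmp (u k) (g \<div> k) \<odot>\<^sub>M finsum M (\<lambda>h. cmp (w h) (k \<div> h) \<odot>\<^sub>M v h) G0) G0"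
   (is "?l = ?r") if g: "g \<in> G0" for g
  proof -
   let ?t = "\<lambda>h k. cmp (u k) (g \<div> k) \<odot>\<^sub>M (cmp (w h) (k \<div> h) \<odot>\<^sub>M v h)"
   have t: "?t h k \<in> carrier M" if "h \<in> G0" "k \<in> G0" for h k
    using u v w g that by (intro M.smult_closed cmp_closed s) auto
   have "?l = finsum M (\<lambda>h. finsum M (?t h) G0) G0"
   proof (rule M.M.finsum_cong'[OF refl])
    fix h assume h: "h \<in> G0"
    have "cmp (finsum A (\<lambda>k. u k \<otimes>\<^sub>A cmp (w h) (k \<div> h)) G0) (g \<div> h) \<odot>\<^sub>M v h
     = finsum A (\<lambda>k. cmp (u k) (g \<div> k) \<otimes>\<^sub>A cmp (w h) (k \<div> h)) G0 \<odot>\<^sub>M v h"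
     using u v w g h by (subst cmp_smash_mult) auto
    also have "\<dots> = finsum M (\<lambda>k. (cmp (u k) (g \<div> k) \<otimes>\<^sub>A cmp (w h) (k \<div> h)) \<odot>\<^sub>M v h) G0"
     using u v w g h finite_group by (intro M.finsum_smult) auto
    also have "\<dots> = finsum M (?t h) G0"
    proof (rule M.M.finsum_cong'[OF refl])
     fix k assume k: "k \<in> G0"
     have "cmp (u k) (g \<div> k) \<in> carrier A" "cmp (w h) (k \<div> h) \<in> carrier A" "v h \<in> carrier M"
      using u v w g h k by auto
     then show "cmp (u k) (g \<div> k) \<otimes>\<^sub>A cmp (w h) (k \<div> h) \<odot>\<^sub>M v h = ?t h k"
      by (rule M.smult_assoc)
    qed (use t h in auto)
    finally show "cmp (finsum A (\<lambda>k. u k \<otimes>\<^sub>A cmp (w h) (k \<div> h)) G0) (g \<div> h) \<odot>\<^sub>M v h = finsum M (?t h) G0" .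
   qed (use t in \<open>auto intro!: M.M.finsum_closed\<close>)
   also have "\<dots> = finsum M (\<lambda>k. finsum M (\<lambda>h. ?t h k) G0) G0"
    using t finite_group by (intro abelian_group_finsum_swap M.M.abelian_group_axioms) auto
   also have "\<dots> = ?r"
   proof (rule M.M.finsum_cong'[OF refl])
    fix k assume k: "k \<in> G0"
    show "finsum M (\<lambda>h. ?t h k) G0 = cmp (u k) (g \<div> k) \<odot>\<^sub>M finsum M (\<lambda>h. cmp (w h) (k \<div> h) \<odot>\<^sub>M v h) G0"
     using u v w g k s finite_group by (intro M.smult_finsum[symmetric]) auto
   qed (use u v w g s in \<open>auto intro!: M.M.finsum_closed M.smult_closed\<close>)
   finally show ?thesis .
  qed
  note 1 = this
  have 2: "(u \<otimes>\<^bsub>smash\<^esub> w) \<odot>\<^bsub>hmod M\<^esub> v = (\<lambda>g\<in>G0. finsum M (\<lambda>h. cmp (finsum A (\<lambda>k. u k \<otimes>\<^sub>A cmp (w h) (k \<div> h)) G0) (g \<div> h) \<odot>\<^sub>M v h) G0)"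
   using u w by (auto simp: fun_eq_iff vc intro!: M.M.finsum_cong' M.smult_closed cmp_closed A.finsum_closed)
  have 3: "u \<odot>\<^bsub>hmod M\<^esub> (w \<odot>\<^bsub>hmod M\<^esub> v) = (\<lambda>g\<in>G0. finsum M (\<lambda>k. cmp (u k) (g \<div> k) \<odot>\<^sub>M finsum M (\<lambda>h. cmp (w h) (k \<div> h) \<odot>\<^sub>M v h) G0) G0)"
   using u w by (auto simp: fun_eq_iff vc intro!: M.M.finsum_cong' M.smult_closed M.M.finsum_closed)
  show "(u \<otimes>\<^bsub>smash\<^esub> w) \<odot>\<^bsub>hmod M\<^esub> v = u \<odot>\<^bsub>hmod M\<^esub> (w \<odot>\<^bsub>hmod M\<^esub> v)"
   unfolding 2 3 by (rule restrict_ext) (rule 1)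
 next
  fix u v w assume u: "u \<in> carrier smash" and v: "v \<in> carrier (hmod M)" and w: "w \<in> carrier (hmod M)"
  have "finsum M (\<lambda>h. cmp (u h) (g \<div> h) \<odot>\<^sub>M (\<lambda>g\<in>G0. v g \<oplus>\<^sub>M w g) h) G0
   = finsum M (\<lambda>h. cmp (u h) (g \<div> h) \<odot>\<^sub>M v h) G0 \<oplus>\<^sub>M finsum M (\<lambda>h. cmp (u h) (g \<div> h) \<odot>\<^sub>M w h) G0"
   if g: "g \<in> G0" for g
  proof -
   have "cmp (u h) (g \<div> h) \<odot>\<^sub>M (v h \<oplus>\<^sub>M w h)
    = cmp (u h) (g \<div> h) \<odot>\<^sub>M v h \<oplus>\<^sub>M cmp (u h) (g \<div> h) \<odot>\<^sub>M w h" if "h \<in> G0" for h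
    using u v w g that by (intro M.smult_r_distr) auto
   then show ?thesis
    using u v w g s by (subst M.M.finsum_addf[symmetric]) (auto simp del: M.M.finsum_addf intro!: M.M.finsum_cong')
  qed
  then show "u \<odot>\<^bsub>hmod M\<^esub> (v \<oplus>\<^bsub>hmod M\<^esub> w) = u \<odot>\<^bsub>hmod M\<^esub> v \<oplus>\<^bsub>hmod M\<^esub> u \<odot>\<^bsub>hmod M\<^esub> w"
   by (auto simp: fun_eq_iff cong: M.M.finsum_cong)
 qed
qed

end

lemma graded_algI: "graded_algebra K A G Gr \<Longrightarrow> graded_alg K A G Gr"
 by (intro graded_alg.intro graded_alg_axioms.intro) (simp_all add: graded_algebra_def k_algebra_def)

text \<open>\<open>restr\<close> changes the record over which a sum is formed, though not the
  additive group.\<close>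

lemma finsum_restr:
 assumes "abelian_group M" "abelian_group (restr \<phi> M)" "finite I" "u \<in> I \<rightarrow> carrier M"
 shows "finsum (restr \<phi> M) u I = finsum M u I"
proof -
 interpret M: abelian_group M by fact
 interpret N: abelian_group "restr \<phi> M" by fact
 show ?thesis using assms(3,4)
 proof (induction rule: finite_induct)
  case (insert i I)
  then show ?case using N.finsum_insert[of I i u] by (simp add: Pi_iff)
 qed simp
qed

lemma fin_gen_identity:
 assumes "LMod R M" "LMod R N" "fin_gen R M" "carrier N = carrier M"
  and "\<And>x y. x \<in> carrier M \<Longrightarrow> y \<in> carrier M \<Longrightarrow> x \<oplus>\<^sub>N y = x \<oplus>\<^sub>M y"
  and "\<And>r x. r \<in> carrier R \<Longrightarrow> x \<in> carrier M \<Longrightarrow> r \<odot>\<^sub>N x = r \<odot>\<^sub>M x"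
 shows "fin_gen R N"
proof (rule left_module.fin_gen_image[OF assms(1,2) _ _ assms(3)])
 show "(\<lambda>x\<in>carrier M. x) \<in> Hom R M N" using assms(1) by (rule Hom_restrictI) (simp_all add: assms(4-6))
qed (simp add: assms(4))

lemma (in exact_functor) tri_dim_le:
 assumes "\<And>Y. S.obj Y \<Longrightarrow> \<exists>W. R.obj W \<and> (\<exists>a\<in>Hom S Y (Fo W). \<exists>b\<in>Hom S (Fo W) Y. \<forall>x\<in>carrier Y. b (a x) = x)"
 shows "tri_dim (stable_category S) \<le> tri_dim (stable_category R)"
 unfolding tri_dim_def
\<comment> \<open>Every number that is admissible for \<open>R\<close> with generator
  \<open>M\<close> is admissible for \<open>S\<close> with generator \<open>Fo M\<close>.\<close>
proof (rule Inf_superset_mono, rule subsetI)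
 fix d assume "d \<in> {enat n |n. \<exists>M\<in>Ob R.T. gen_level R.T {M} (n + 1) = Ob R.T}"
 then obtain n M where d: "d = enat n" "R.obj M" "gen_level R.T {M} (Suc n) = {W. R.obj W}"
  by (auto simp: R.cat_simps)
 have "gen_level S.T {Fo M} (Suc n) = {W. S.obj W}"
 proof (intro equalityI subsetI CollectI)
  fix Y assume "Y \<in> gen_level S.T {Fo M} (Suc n)" then show "S.obj Y" by (rule S.gen_level_obj)
 next
  fix Y assume "Y \<in> {W. S.obj W}"
  then have Y: "S.obj Y" by simp
  obtain W a b where W: "R.obj W" "a \<in> Hom S Y (Fo W)" "b \<in> Hom S (Fo W) Y" "\<forall>x\<in>carrier Y. b (a x) = x"
   using assms[OF Y] by blast
  have "W \<in> gen_level R.T {M} (Suc n)" using W(1) unfolding d(3) by simp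
  then have "Fo W \<in> gen_level S.T {Fo M} (Suc n)" by (rule gen_level_map[OF d(2)])
  then show "Y \<in> gen_level S.T {Fo M} (Suc n)"
   by (rule S.gen_level_retract[OF _ Y W(2,3)]) (use W(4) in blast)
 qed
 then show "d \<in> {enat n |n. \<exists>M\<in>Ob S.T. gen_level S.T {M} (n + 1) = Ob S.T}"
  using d(1) copy(1)[OF d(2)] by (auto simp: S.cat_simps)
qed

lemma (in fd_algebra) stable_ring: "stable_ring R"
 by (intro stable_ring.intro stable_ring_axioms.intro R.ring_axioms inj_presented)

section \<open>Finite dimensional graded algebras\<close>

locale fd_graded_alg = graded_alg K A G Gr
 for K :: "('k, 'x) ring_scheme" and A :: "('k, 'a) module" and G :: "('g, 'y) monoid_scheme"
  and Gr :: "'g \<Rightarrow> 'a set" +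
 assumes fin_gen_K: "fin_gen K A"
begin
lemma left_module_KA: "LMod K A"
proof -
 interpret module K A by (rule k_mod)
 show ?thesis
  by (intro left_module.intro left_module_axioms.intro K.ring_axioms A.abelian_group_axioms)
   (simp_all add: smult_closed smult_l_distr smult_r_distr smult_assoc1)
qed

lemma fd_A: "fd_algebra K A kA"
proof (intro fd_algebra.intro fd_algebra_axioms.intro K.field_axioms A.ring_axioms kA_hom)
 show "kA c \<otimes>\<^sub>A r = r \<otimes>\<^sub>A kA c" if "c \<in> carrier K" "r \<in> carrier A" for c r
  using that by (simp add: kA_mult)
 show "fin_gen K (restr kA (Reg A))"
  using left_module_KA restr_left_module[OF K.ring_axioms regular_left_module[OF A.ring_axioms] kA_hom] fin_gen_K
  by (rule fin_gen_identity) (simp_all add: kA_mult)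
qed

sublocale fA: fd_algebra K A kA by (rule fd_A)

text \<open>As a vector space, \<open>hmod M\<close> is a finite power of \<open>M\<close>: scalars
  have degree \<open>\<one>\<^sub>G\<close> and act on every coordinate separately.\<close>

lemma restr_hmod_fin_gen:
 assumes "LMod A M" "fin_gen A M" "LMod K (restr kB (hmod M))"
 shows "fin_gen K (restr kB (hmod M))"
proof -
 interpret M: left_module A M by fact
 have P: "LMod K (pi_module G0 (\<lambda>_. restr kA M))"
  by (intro pi_left_module K.ring_axioms fA.restr_module assms(1))
 have F: "fin_gen K (pi_module G0 (\<lambda>_. restr kA M))"
  by (intro pi_fin_gen K.ring_axioms fA.restr_module fA.fin_gen_restr assms finite_group)
 show ?thesis
  using P assms(3) F
 proof (rule fin_gen_identity)
  fix c v assume c: "c \<in> carrier K" and "v \<in> carrier (pi_module G0 (\<lambda>_. restr kA M))"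
  then have v: "v h \<in> carrier M" if "h \<in> G0" for h using that by auto
  have "finsum M (\<lambda>h. cmp (kB c h) (g \<div> h) \<odot>\<^sub>M v h) G0 = kA c \<odot>\<^sub>M v g" if g: "g \<in> G0" for g
  proof -
   have "finsum M (\<lambda>h. cmp (kB c h) (g \<div> h) \<odot>\<^sub>M v h) G0 = finsum M (\<lambda>h. if g = h then kA c \<odot>\<^sub>M v h else \<zero>\<^sub>M) G0"
    using v c g by (intro M.M.finsum_cong' refl) (auto simp: kB_def \<eta>_def cmp_homog[OF _ kA_Gr] quot_eq_one)
   then show ?thesis using v c g finite_group by (simp add: M.M.finsum_singleton[of g G0 "\<lambda>h. kA c \<odot>\<^sub>M v h"] Pi_iff)
  qed
  then show "c \<odot>\<^bsub>restr kB (hmod M)\<^esub> v = c \<odot>\<^bsub>pi_module G0 (\<lambda>_. restr kA M)\<^esub> v"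
   by (auto simp: fun_eq_iff)
 qed simp_all
qed

lemma fd_smash: "fd_algebra K smash kB"
proof (intro fd_algebra.intro fd_algebra_axioms.intro K.field_axioms smash_ring kB_hom)
 show "kB c \<otimes>\<^bsub>smash\<^esub> r = r \<otimes>\<^bsub>smash\<^esub> kB c" if "c \<in> carrier K" "r \<in> carrier smash" for c r
  using that kB_mult[of c r] mult_kB[of c r] by (simp del: smash_simps(5))
 have P: "LMod K (pi_module G0 (\<lambda>_. restr kA (Reg A)))"
  by (intro pi_left_module K.ring_axioms fA.restr_module fA.regular)
 have F: "fin_gen K (pi_module G0 (\<lambda>_. restr kA (Reg A)))"
  by (intro pi_fin_gen K.ring_axioms fA.restr_module fA.regular fA.fin_dim finite_group)
 show "fin_gen K (restr kB (Reg smash))"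
  using P restr_left_module[OF K.ring_axioms regular_left_module[OF smash_ring] kB_hom] F
  by (rule fin_gen_identity) (auto simp: kB_mult kA_mult fun_eq_iff simp del: smash_simps(5))
qed

sublocale fB: fd_algebra K smash kB by (rule fd_smash)

sublocale sA: stable_ring A by (rule fA.stable_ring)
sublocale sB: stable_ring smash by (rule fB.stable_ring)

lemma restr_\<eta>_module: "LMod smash V \<Longrightarrow> LMod A (restr \<eta> V)"
 using restr_left_module[OF A.ring_axioms _ \<eta>_hom] .

lemma restr_restr: "restr kA (restr \<eta> V) = restr kB V"
 by (simp add: restr_def kB_def)

lemma restr_\<eta>_fin_gen: "LMod smash V \<Longrightarrow> fin_gen smash V \<Longrightarrow> fin_gen A (restr \<eta> V)"
 by (rule fA.fin_genD[OF restr_\<eta>_module]) (simp_all add: restr_restr fB.fin_gen_restr)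

lemma hmod_fin_gen: "LMod A M \<Longrightarrow> fin_gen A M \<Longrightarrow> fin_gen smash (hmod M)"
 using fB.fin_genD[OF hmod_left_module restr_hmod_fin_gen[OF _ _ fB.restr_module[OF hmod_left_module]]] .

lemma hmod_pr:
 assumes "LMod A M" "g \<in> G0" "k \<in> G0" "v \<in> carrier (hmod M)"
 shows "(pr g \<odot>\<^bsub>hmod M\<^esub> v) k = (if k = g then v g else \<zero>\<^sub>M)"
proof -
 interpret M: left_module A M by fact
 have v: "v h \<in> carrier M" if "h \<in> G0" for h using assms(4) that by auto
 have "finsum M (\<lambda>h. cmp (pr g h) (k \<div> h) \<odot>\<^sub>M v h) G0 = finsum M (\<lambda>h. if k = h then (if h = g then v h else \<zero>\<^sub>M) else \<zero>\<^sub>M) G0"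
  using v assms(2,3) by (intro M.M.finsum_cong' refl) (auto simp: pr_def cmp_one quot_eq_one)
 also have "\<dots> = (if k = g then v k else \<zero>\<^sub>M)"
  using v assms(3) finite_group by (intro M.M.finsum_singleton) auto
 finally show ?thesis using assms(3) by simp
qed

text \<open>Over all \<open>h\<close>, the coefficients \<open>cmp a (g \<div> h)\<close> add up to
  \<open>a\<close>; so the diagonal copy of \<open>M\<close> in \<open>hmod M\<close> is stable
  under \<open>A\<close>.\<close>

lemma hmod_const:
 assumes "LMod A M" "a \<in> carrier A" "x \<in> carrier M"
 shows "\<eta> a \<odot>\<^bsub>hmod M\<^esub> (\<lambda>g\<in>G0. x) = (\<lambda>g\<in>G0. a \<odot>\<^sub>M x)"
proof -
 interpret M: left_module A M by fact
 have "finsum M (\<lambda>h. cmp (\<eta> a h) (g \<div> h) \<odot>\<^sub>M (\<lambda>g\<in>G0. x) h) G0 = a \<odot>\<^sub>M x" if g: "g \<in> G0" for g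
 proof -
  have "finsum M (\<lambda>h. cmp (\<eta> a h) (g \<div> h) \<odot>\<^sub>M (\<lambda>g\<in>G0. x) h) G0 = finsum M (\<lambda>h. cmp a (g \<div> h) \<odot>\<^sub>M x) G0"
   using assms g by (intro M.M.finsum_cong' refl) (auto simp: \<eta>_def)
  also have "\<dots> = finsum A (\<lambda>h. cmp a (g \<div> h)) G0 \<odot>\<^sub>M x"
   using assms g finite_group by (intro M.finsum_smult[symmetric]) auto
  finally show ?thesis using sum_cmp_shift(2)[OF assms(2) g] by simp
 qed
 then show ?thesis unfolding hmod_simps by (rule restrict_ext)
qed

section \<open>Induction, restriction and their adjunctions\<close>

lemma hmap_hom:
 assumes "LMod A M" "LMod A N" "f \<in> Hom A M N"
 shows "(\<lambda>v\<in>carrier (hmod M). \<lambda>g\<in>G0. f (v g)) \<in> Hom smash (hmod M) (hmod N)"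
 using hmod_left_module[OF assms(1)]
proof (rule Hom_restrictI)
 interpret f: lhom A M N f using assms by (rule lhomI)
 fix u v assume u: "u \<in> carrier smash" and v: "v \<in> carrier (hmod M)"
 have vc: "v h \<in> carrier M" if "h \<in> G0" for h using v that by auto
 have "f (finsum M (\<lambda>h. cmp (u h) (g \<div> h) \<odot>\<^sub>M v h) G0)
  = finsum N (\<lambda>h. cmp (u h) (g \<div> h) \<odot>\<^sub>N (\<lambda>g\<in>G0. f (v g)) h) G0" if g: "g \<in> G0" for g
 proof -
  have "f (finsum M (\<lambda>h. cmp (u h) (g \<div> h) \<odot>\<^sub>M v h) G0)
   = finsum N (\<lambda>h. f (cmp (u h) (g \<div> h) \<odot>\<^sub>M v h)) G0"
   using u vc g finite_group by (intro f.finsum) auto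
  also have "\<dots> = finsum N (\<lambda>h. cmp (u h) (g \<div> h) \<odot>\<^sub>N (\<lambda>g\<in>G0. f (v g)) h) G0"
   using u vc g by (intro f.Y.M.finsum_cong' refl) auto
  finally show ?thesis .
 qed
 then show "(\<lambda>g\<in>G0. f ((u \<odot>\<^bsub>hmod M\<^esub> v) g)) = u \<odot>\<^bsub>hmod N\<^esub> (\<lambda>g\<in>G0. f (v g))"
  unfolding hmod_simps by (intro restrict_ext) simp
qed (auto simp: fun_eq_iff PiE_iff intro!: Hom_add[OF assms(3)] Hom_closed[OF assms(3)])

text \<open>The adjunction with \<open>hmod\<close> on the left: a map on \<open>M\<close> extends
  to functions by placing the value at \<open>g\<close> with the idempotent
  \<open>pr g\<close>.\<close>

lemma adjL_hom:
 assumes "LMod A M" "LMod smash V" "f \<in> Hom A M (restr \<eta> V)"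
 shows "(\<lambda>v\<in>carrier (hmod M). finsum V (\<lambda>g. pr g \<odot>\<^sub>V f (v g)) G0) \<in> Hom smash (hmod M) V"
 using hmod_left_module[OF assms(1)]
proof (rule Hom_restrictI)
 interpret M: left_module A M by fact
 interpret V: left_module smash V by fact
 interpret RV: left_module A "restr \<eta> V" using assms(2) by (rule restr_\<eta>_module)
 interpret f: lhom A M "restr \<eta> V" f using assms(1) RV.left_module_axioms assms(3) by (rule lhomI)
 have fc: "f x \<in> carrier V" if "x \<in> carrier M" for x using f.closed[OF that] by simp
 have pc: "pr g \<in> carrier smash" for g by simp
 have ec: "\<eta> a \<in> carrier smash" if "a \<in> carrier A" for a using that by simp
 fix v assume v: "v \<in> carrier (hmod M)"
 have vc: "v h \<in> carrier M" if "h \<in> G0" for h using v that by auto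
 have pv: "pr g \<odot>\<^sub>V f (v g) \<in> carrier V" if "g \<in> G0" for g
  by (rule V.smult_closed[OF pc fc[OF vc[OF that]]])
 show "finsum V (\<lambda>g. pr g \<odot>\<^sub>V f (v g)) G0 \<in> carrier V" using pv by (intro V.M.finsum_closed) auto
 {
  fix w assume w: "w \<in> carrier (hmod M)"
  have wc: "w h \<in> carrier M" if "h \<in> G0" for h using w that by auto
  have pw: "pr g \<odot>\<^sub>V f (w g) \<in> carrier V" if "g \<in> G0" for g
   by (rule V.smult_closed[OF pc fc[OF wc[OF that]]])
  have "pr g \<odot>\<^sub>V f ((v \<oplus>\<^bsub>hmod M\<^esub> w) g) = pr g \<odot>\<^sub>V f (v g) \<oplus>\<^sub>V pr g \<odot>\<^sub>V f (w g)" if "g \<in> G0" for g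
   using V.smult_r_distr[OF pc fc[OF vc[OF that]] fc[OF wc[OF that]], of g] f.add[OF vc[OF that] wc[OF that]] that by simp
  then have "finsum V (\<lambda>g. pr g \<odot>\<^sub>V f ((v \<oplus>\<^bsub>hmod M\<^esub> w) g)) G0 = finsum V (\<lambda>g. pr g \<odot>\<^sub>V f (v g) \<oplus>\<^sub>V pr g \<odot>\<^sub>V f (w g)) G0"
   using pv pw by (intro V.M.finsum_cong' refl) auto
  then show "finsum V (\<lambda>g. pr g \<odot>\<^sub>V f ((v \<oplus>\<^bsub>hmod M\<^esub> w) g)) G0
   = finsum V (\<lambda>g. pr g \<odot>\<^sub>V f (v g)) G0 \<oplus>\<^sub>V finsum V (\<lambda>g. pr g \<odot>\<^sub>V f (w g)) G0"
   using pv pw by (simp add: V.M.finsum_addf)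
 }
 fix u assume u: "u \<in> carrier smash"
 let ?c = "\<lambda>g h. cmp (u h) (g \<div> h)"
 have cc: "?c g h \<in> carrier A" if "g \<in> G0" "h \<in> G0" for g h using u that by auto
 \<comment> \<open>Both sides of the linearity equation are the double sum of \<open>?t g h\<close>:
   summing over \<open>h\<close> first gives the image of \<open>u \<odot> v\<close>, and summing
   over \<open>g\<close> first gives \<open>u \<odot>\<close> the image of \<open>v\<close>, by
   \<open>mult_pr_expand\<close>.\<close>
 let ?t = "\<lambda>g h. (pr g \<otimes>\<^bsub>smash\<^esub> \<eta> (?c g h)) \<odot>\<^sub>V f (v h)"
 have tc: "?t g h \<in> carrier V" if "g \<in> G0" "h \<in> G0" for g h
  using that by (intro V.smult_closed fB.R.m_closed pc ec cc fc vc)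
 have 1: "pr g \<odot>\<^sub>V f ((u \<odot>\<^bsub>hmod M\<^esub> v) g) = finsum V (?t g) G0" if g: "g \<in> G0" for g
 proof -
  have "f ((u \<odot>\<^bsub>hmod M\<^esub> v) g) = f (finsum M (\<lambda>h. ?c g h \<odot>\<^sub>M v h) G0)" using g by simp
  also have "\<dots> = finsum (restr \<eta> V) (\<lambda>h. f (?c g h \<odot>\<^sub>M v h)) G0"
   using g cc vc finite_group by (intro f.finsum) auto
  also have "\<dots> = finsum V (\<lambda>h. f (?c g h \<odot>\<^sub>M v h)) G0"
   using g cc vc finite_group fc by (intro finsum_restr V.M.abelian_group_axioms RV.M.abelian_group_axioms) auto
  also have "\<dots> = finsum V (\<lambda>h. \<eta> (?c g h) \<odot>\<^sub>V f (v h)) G0"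
   using f.smult[OF cc[OF g] vc] V.smult_closed[OF ec[OF cc[OF g]] fc[OF vc]] by (intro V.M.finsum_cong' refl) auto
  finally have "pr g \<odot>\<^sub>V f ((u \<odot>\<^bsub>hmod M\<^esub> v) g) = pr g \<odot>\<^sub>V finsum V (\<lambda>h. \<eta> (?c g h) \<odot>\<^sub>V f (v h)) G0" by simp
  also have "\<dots> = finsum V (\<lambda>h. pr g \<odot>\<^sub>V (\<eta> (?c g h) \<odot>\<^sub>V f (v h))) G0"
   using V.smult_closed[OF ec[OF cc[OF g]] fc[OF vc]] finite_group pc by (intro V.smult_finsum) auto
  also have "\<dots> = finsum V (?t g) G0"
   using V.smult_assoc[OF pc ec[OF cc[OF g]] fc[OF vc]] tc[OF g] by (intro V.M.finsum_cong' refl) auto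
  finally show ?thesis .
 qed
 have "finsum V (\<lambda>g. pr g \<odot>\<^sub>V f ((u \<odot>\<^bsub>hmod M\<^esub> v) g)) G0 = finsum V (\<lambda>g. finsum V (?t g) G0) G0"
  using tc 1 by (intro V.M.finsum_cong' refl) (auto intro!: V.M.finsum_closed simp del: hmod_simps)
 also have "\<dots> = finsum V (\<lambda>h. finsum V (\<lambda>g. ?t g h) G0) G0"
  using tc finite_group by (intro abelian_group_finsum_swap V.M.abelian_group_axioms) auto
 also have "\<dots> = finsum V (\<lambda>h. u \<odot>\<^sub>V (pr h \<odot>\<^sub>V f (v h))) G0"
 proof (rule V.M.finsum_cong'[OF refl])
  show "(\<lambda>h. u \<odot>\<^sub>V (pr h \<odot>\<^sub>V f (v h))) \<in> G0 \<rightarrow> carrier V" using V.smult_closed[OF u pv] by auto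
  fix h assume h: "h \<in> G0"
  have "u \<odot>\<^sub>V (pr h \<odot>\<^sub>V f (v h)) = (u \<otimes>\<^bsub>smash\<^esub> pr h) \<odot>\<^sub>V f (v h)"
   by (rule V.smult_assoc[OF u pc fc[OF vc[OF h]], symmetric])
  also have "\<dots> = finsum smash (\<lambda>g. pr g \<otimes>\<^bsub>smash\<^esub> \<eta> (?c g h)) G0 \<odot>\<^sub>V f (v h)"
   using mult_pr_expand[OF h] u by (simp del: smash_simps(5))
  also have "\<dots> = finsum V (\<lambda>g. ?t g h) G0"
   using fB.R.m_closed[OF pc ec[OF cc[OF _ h]]] fc[OF vc[OF h]] finite_group by (intro V.finsum_smult) auto
  finally show "finsum V (\<lambda>g. ?t g h) G0 = u \<odot>\<^sub>V (pr h \<odot>\<^sub>V f (v h))" by simp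
 qed
 also have "\<dots> = u \<odot>\<^sub>V finsum V (\<lambda>g. pr g \<odot>\<^sub>V f (v g)) G0"
  using pv u finite_group by (intro V.smult_finsum[symmetric]) auto
 finally show "finsum V (\<lambda>g. pr g \<odot>\<^sub>V f ((u \<odot>\<^bsub>hmod M\<^esub> v) g)) G0 = u \<odot>\<^sub>V finsum V (\<lambda>g. pr g \<odot>\<^sub>V f (v g)) G0" .
qed

text \<open>The adjunction with \<open>hmod\<close> on the right: the idempotents cut
  \<open>V\<close> into pieces, and \<open>f\<close> sends the piece of \<open>pr g\<close> to the
  coordinate \<open>g\<close>.\<close>

lemma adjR_hom:
 assumes "LMod A M" "LMod smash V" "f \<in> Hom A (restr \<eta> V) M"
 shows "(\<lambda>v\<in>carrier V. \<lambda>g\<in>G0. f (pr g \<odot>\<^sub>V v)) \<in> Hom smash V (hmod M)"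
 using assms(2)
proof (rule Hom_restrictI)
 interpret M: left_module A M by fact
 interpret V: left_module smash V by fact
 interpret RV: left_module A "restr \<eta> V" using assms(2) by (rule restr_\<eta>_module)
 interpret f: lhom A "restr \<eta> V" M f using RV.left_module_axioms assms(1) assms(3) by (rule lhomI)
 have fc: "f x \<in> carrier M" if "x \<in> carrier V" for x using f.closed[of x] that by simp
 have pc: "pr g \<in> carrier smash" for g by simp
 have ec: "\<eta> a \<in> carrier smash" if "a \<in> carrier A" for a using that by simp
 fix v assume v: "v \<in> carrier V"
 have pv: "pr g \<odot>\<^sub>V v \<in> carrier V" for g by (rule V.smult_closed[OF pc v])
 show "(\<lambda>g\<in>G0. f (pr g \<odot>\<^sub>V v)) \<in> carrier (hmod M)" using fc[OF pv] by simp
 {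
  fix w assume w: "w \<in> carrier V"
  have "f (pr g \<odot>\<^sub>V (v \<oplus>\<^sub>V w)) = f (pr g \<odot>\<^sub>V v) \<oplus>\<^sub>M f (pr g \<odot>\<^sub>V w)" for g
   using V.smult_r_distr[OF pc v w, of g] f.add[of "pr g \<odot>\<^sub>V v" "pr g \<odot>\<^sub>V w"] pv V.smult_closed[OF pc w, of g] by simp
  then show "(\<lambda>g\<in>G0. f (pr g \<odot>\<^sub>V (v \<oplus>\<^sub>V w))) = (\<lambda>g\<in>G0. f (pr g \<odot>\<^sub>V v)) \<oplus>\<^bsub>hmod M\<^esub> (\<lambda>g\<in>G0. f (pr g \<odot>\<^sub>V w))"
   by (auto simp: fun_eq_iff)
 }
 fix u assume u: "u \<in> carrier smash"
 let ?c = "\<lambda>g h. cmp (u h) (g \<div> h)"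
 have cc: "?c g h \<in> carrier A" if "g \<in> G0" "h \<in> G0" for g h using u that by auto
 have "f (pr g \<odot>\<^sub>V (u \<odot>\<^sub>V v)) = finsum M (\<lambda>h. ?c g h \<odot>\<^sub>M (\<lambda>g\<in>G0. f (pr g \<odot>\<^sub>V v)) h) G0" if g: "g \<in> G0" for g
 proof -
  have ev: "\<eta> (?c g h) \<odot>\<^sub>V (pr h \<odot>\<^sub>V v) \<in> carrier V" if "h \<in> G0" for h
   by (rule V.smult_closed[OF ec[OF cc[OF g that]] pv])
  have "pr g \<odot>\<^sub>V (u \<odot>\<^sub>V v) = (pr g \<otimes>\<^bsub>smash\<^esub> u) \<odot>\<^sub>V v" by (rule V.smult_assoc[OF pc u v, symmetric])
  also have "\<dots> = finsum smash (\<lambda>h. \<eta> (?c g h) \<otimes>\<^bsub>smash\<^esub> pr h) G0 \<odot>\<^sub>V v"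
   using pr_mult_expand[OF g] u by (simp del: smash_simps(5))
  also have "\<dots> = finsum V (\<lambda>h. (\<eta> (?c g h) \<otimes>\<^bsub>smash\<^esub> pr h) \<odot>\<^sub>V v) G0"
   using fB.R.m_closed[OF ec[OF cc[OF g]] pc] v finite_group by (intro V.finsum_smult) auto
  also have "\<dots> = finsum V (\<lambda>h. \<eta> (?c g h) \<odot>\<^sub>V (pr h \<odot>\<^sub>V v)) G0"
   using V.smult_assoc[OF ec[OF cc[OF g]] pc v] ev by (intro V.M.finsum_cong' refl) auto
  also have "\<dots> = finsum (restr \<eta> V) (\<lambda>h. \<eta> (?c g h) \<odot>\<^sub>V (pr h \<odot>\<^sub>V v)) G0"
   using ev finite_group by (intro finsum_restr[symmetric] V.M.abelian_group_axioms RV.M.abelian_group_axioms) auto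
  finally have "f (pr g \<odot>\<^sub>V (u \<odot>\<^sub>V v)) = f (finsum (restr \<eta> V) (\<lambda>h. \<eta> (?c g h) \<odot>\<^sub>V (pr h \<odot>\<^sub>V v)) G0)" by simp
  also have "\<dots> = finsum M (\<lambda>h. f (\<eta> (?c g h) \<odot>\<^sub>V (pr h \<odot>\<^sub>V v))) G0"
   using ev finite_group by (intro f.finsum) auto
  also have "\<dots> = finsum M (\<lambda>h. ?c g h \<odot>\<^sub>M (\<lambda>g\<in>G0. f (pr g \<odot>\<^sub>V v)) h) G0"
   using f.smult[OF cc[OF g], simplified, OF _ pv] M.smult_closed[OF cc[OF g] fc[OF pv]] by (intro M.M.finsum_cong' refl) auto
  finally show ?thesis .
 qed
 then show "(\<lambda>g\<in>G0. f (pr g \<odot>\<^sub>V (u \<odot>\<^sub>V v))) = u \<odot>\<^bsub>hmod M\<^esub> (\<lambda>g\<in>G0. f (pr g \<odot>\<^sub>V v))"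
  unfolding hmod_simps by (rule restrict_ext)
qed

lemma sum_pr_pr:
 assumes "LMod smash V" "v \<in> carrier V"
 shows "finsum V (\<lambda>g. pr g \<odot>\<^sub>V (pr g \<odot>\<^sub>V v)) G0 = v" "finsum V (\<lambda>g. pr g \<odot>\<^sub>V v) G0 = v"
proof -
 interpret V: left_module smash V by fact
 have pc: "pr g \<in> carrier smash" for g by simp
 have pv: "pr g \<odot>\<^sub>V v \<in> carrier V" for g by (rule V.smult_closed[OF pc assms(2)])
 have "finsum V (\<lambda>g. pr g \<odot>\<^sub>V v) G0 = finsum smash pr G0 \<odot>\<^sub>V v"
  using pc assms(2) finite_group by (intro V.finsum_smult[symmetric]) auto
 then show s: "finsum V (\<lambda>g. pr g \<odot>\<^sub>V v) G0 = v" using V.smult_one[OF assms(2)] by (simp only: pr_sum)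
 have "pr g \<odot>\<^sub>V (pr g \<odot>\<^sub>V v) = pr g \<odot>\<^sub>V v" if "g \<in> G0" for g
  using V.smult_assoc[OF pc pc assms(2), of g g] pr_idem[OF that] by simp
 then show "finsum V (\<lambda>g. pr g \<odot>\<^sub>V (pr g \<odot>\<^sub>V v)) G0 = v"
  using s pv V.M.finsum_cong'[of G0 G0 "\<lambda>g. pr g \<odot>\<^sub>V v" "\<lambda>g. pr g \<odot>\<^sub>V (pr g \<odot>\<^sub>V v)"] by simp
qed

text \<open>A right adjoint of the exact restriction functor preserves injectives. Summing the
  coordinates of \<open>f\<close> gives an \<open>A\<close>-linear map to \<open>M\<close>; it
  extends, and \<open>adjR_hom\<close> turns the extension into one of \<open>f\<close>.\<close>

lemma hmod_injective:
 assumes "injective_module A M" shows "injective_module smash (hmod M)"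
proof (rule injectiveI)
 have M: "LMod A M" using assms by (rule injective_left_module)
 then show "LMod smash (hmod M)" by (rule hmod_left_module)
 interpret M: left_module A M by fact
 fix W Y :: "('g \<Rightarrow> 'a) lmod" and i f
 assume W: "LMod smash W" and Y: "LMod smash Y" and i: "i \<in> Hom smash W Y" "inj_on i (carrier W)"
  and f: "f \<in> Hom smash W (hmod M)"
 have fc: "f w g \<in> carrier M" if "w \<in> carrier W" "g \<in> G0" for w g using Hom_closed[OF f that(1)] that(2) by auto
 have e: "(\<lambda>v\<in>carrier (restr \<eta> W). finsum M (f v) G0) \<in> Hom A (restr \<eta> W) M"
  using restr_\<eta>_module[OF W]
 proof (rule Hom_restrictI)
  fix v w assume "v \<in> carrier (restr \<eta> W)" "w \<in> carrier (restr \<eta> W)"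
  then have v: "v \<in> carrier W" and w: "w \<in> carrier W" by simp_all
  have "finsum M (f (v \<oplus>\<^sub>W w)) G0 = finsum M (\<lambda>g. f v g \<oplus>\<^sub>M f w g) G0"
   using fc[OF v] fc[OF w] Hom_add[OF f v w] by (intro M.M.finsum_cong' refl) auto
  then show "finsum M (f (v \<oplus>\<^bsub>restr \<eta> W\<^esub> w)) G0 = finsum M (f v) G0 \<oplus>\<^sub>M finsum M (f w) G0"
   using fc[OF v] fc[OF w] by (simp add: M.M.finsum_addf Pi_iff)
 next
  fix a w assume a: "a \<in> carrier A" and "w \<in> carrier (restr \<eta> W)"
  then have w: "w \<in> carrier W" by simp
  have "f (\<eta> a \<odot>\<^sub>W w) = \<eta> a \<odot>\<^bsub>hmod M\<^esub> f w" using Hom_smult[OF f _ w, of "\<eta> a"] a by simp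
  then have "finsum M (f (\<eta> a \<odot>\<^sub>W w)) G0 = finsum M (\<lambda>g. finsum M (\<lambda>h. cmp a (g \<div> h) \<odot>\<^sub>M f w h) G0) G0"
   using a fc[OF w] by (intro M.M.finsum_cong' refl) (auto simp: \<eta>_def intro!: M.M.finsum_closed M.M.finsum_cong')
  also have "\<dots> = finsum M (\<lambda>h. finsum M (\<lambda>g. cmp a (g \<div> h) \<odot>\<^sub>M f w h) G0) G0"
   using a fc[OF w] finite_group by (intro abelian_group_finsum_swap M.M.abelian_group_axioms) auto
  also have "\<dots> = finsum M (\<lambda>h. a \<odot>\<^sub>M f w h) G0"
  proof (rule M.M.finsum_cong'[OF refl])
   fix h assume h: "h \<in> G0"
   have "finsum M (\<lambda>g. cmp a (g \<div> h) \<odot>\<^sub>M f w h) G0 = finsum A (\<lambda>g. cmp a (g \<div> h)) G0 \<odot>\<^sub>M f w h"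
    using a fc[OF w h] h finite_group by (intro M.finsum_smult[symmetric]) auto
   then show "finsum M (\<lambda>g. cmp a (g \<div> h) \<odot>\<^sub>M f w h) G0 = a \<odot>\<^sub>M f w h"
    using sum_cmp_shift(1)[OF a h] by simp
  qed (use a fc[OF w] in auto)
  also have "\<dots> = a \<odot>\<^sub>M finsum M (f w) G0"
   using a fc[OF w] finite_group by (intro M.smult_finsum[symmetric]) auto
  finally show "finsum M (f (a \<odot>\<^bsub>restr \<eta> W\<^esub> w)) G0 = a \<odot>\<^sub>M finsum M (f w) G0" by simp
 qed (use fc in \<open>auto intro!: M.M.finsum_closed\<close>)
 have i': "i \<in> Hom A (restr \<eta> W) (restr \<eta> Y)" "inj_on i (carrier (restr \<eta> W))" using restr_hom[OF \<eta>_hom i(1)] i(2) by simp_all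
 obtain \<psi> where p: "\<psi> \<in> Hom A (restr \<eta> Y) M"
  "\<And>w. w \<in> carrier (restr \<eta> W) \<Longrightarrow> \<psi> (i w) = (\<lambda>v\<in>carrier (restr \<eta> W). finsum M (f v) G0) w"
  by (rule injective_extend[OF assms restr_\<eta>_module[OF W] restr_\<eta>_module[OF Y] i' e]) (rule that)
 interpret W: left_module smash W by fact
 have pc: "pr g \<in> carrier smash" for g by simp
 show "\<exists>g\<in>Hom smash Y (hmod M). \<forall>x\<in>carrier W. g (i x) = f x"
 proof (intro bexI[OF _ adjR_hom[OF M Y p(1)]] ballI)
  fix w assume w: "w \<in> carrier W"
  have "\<psi> (pr g \<odot>\<^sub>Y i w) = f w g" if g: "g \<in> G0" for g
  proof -
   have "\<psi> (pr g \<odot>\<^sub>Y i w) = \<psi> (i (pr g \<odot>\<^sub>W w))" using Hom_smult[OF i(1) pc w] by simp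
   also have "\<dots> = finsum M (f (pr g \<odot>\<^sub>W w)) G0" using p(2) W.smult_closed[OF pc w] by simp
   \<comment> \<open>The idempotent leaves only the coordinate \<open>g\<close>, so the sum of the
     coordinates is \<open>f w g\<close>.\<close>
   also have "f (pr g \<odot>\<^sub>W w) = pr g \<odot>\<^bsub>hmod M\<^esub> f w" by (rule Hom_smult[OF f pc w])
   also have "finsum M (pr g \<odot>\<^bsub>hmod M\<^esub> f w) G0 = finsum M (\<lambda>k. if g = k then f w k else \<zero>\<^sub>M) G0"
    using hmod_pr[OF M g _ Hom_closed[OF f w]] fc[OF w] by (intro M.M.finsum_cong' refl) (auto simp del: hmod_simps)
   also have "\<dots> = f w g" using fc[OF w] g finite_group by (intro M.M.finsum_singleton) auto
   finally show ?thesis .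
  qed
  then have "(\<lambda>v\<in>carrier Y. \<lambda>g\<in>G0. \<psi> (pr g \<odot>\<^sub>Y v)) (i w) = (\<lambda>g\<in>G0. f w g)"
   using Hom_closed[OF i(1) w] by (auto simp: fun_eq_iff)
  also have "\<dots> = f w" using Hom_closed[OF f w] by (simp add: PiE_def extensional_restrict)
  finally show "(\<lambda>v\<in>carrier Y. \<lambda>g\<in>G0. \<psi> (pr g \<odot>\<^sub>Y v)) (i w) = f w" .
 qed
qed

lemma const_hom:
 assumes "LMod A M"
 shows "(\<lambda>x\<in>carrier M. \<lambda>g\<in>G0. x) \<in> Hom A M (restr \<eta> (hmod M))"
 using assms by (rule Hom_restrictI) (auto simp: hmod_const[OF assms] fun_eq_iff simp del: hmod_simps(4))

text \<open>Restriction is in turn right adjoint to the exact functor \<open>hmod\<close>: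
  \<open>f\<close> becomes a map on \<open>hmod W\<close>, is extended along the map induced by
  \<open>i\<close>, and the extension is evaluated at constant functions.\<close>

lemma restr_\<eta>_injective:
 assumes "injective_module smash V" shows "injective_module A (restr \<eta> V)"
proof (rule injectiveI)
 have V: "LMod smash V" using assms by (rule injective_left_module)
 then show "LMod A (restr \<eta> V)" by (rule restr_\<eta>_module)
 fix W Y :: "'a lmod" and i f
 assume W: "LMod A W" and Y: "LMod A Y" and i: "i \<in> Hom A W Y" "inj_on i (carrier W)"
  and f: "f \<in> Hom A W (restr \<eta> V)"
 let ?i = "\<lambda>v\<in>carrier (hmod W). \<lambda>g\<in>G0. i (v g)"
 interpret Y: left_module A Y by fact
 have inj: "inj_on ?i (carrier (hmod W))"
 proof (rule inj_onI)
  fix v w assume v: "v \<in> carrier (hmod W)" and w: "w \<in> carrier (hmod W)" and eq: "?i v = ?i w"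
  show "v = w"
  proof (rule PiE_ext[of _ G0 "\<lambda>_. carrier W"])
   fix g assume g: "g \<in> G0"
   then have "i (v g) = i (w g)" using fun_cong[OF eq, of g] v w by simp
   then show "v g = w g" by (rule inj_onD[OF i(2)]) (use v w g in auto)
  qed (use v w in auto)
 qed
 obtain \<phi> where p: "\<phi> \<in> Hom smash (hmod Y) V"
  "\<And>v. v \<in> carrier (hmod W) \<Longrightarrow> \<phi> (?i v) = (\<lambda>v\<in>carrier (hmod W). finsum V (\<lambda>g. pr g \<odot>\<^sub>V f (v g)) G0) v"
  by (rule injective_extend[OF assms hmod_left_module[OF W] hmod_left_module[OF Y] hmap_hom[OF W Y i(1)] inj adjL_hom[OF W V f]])
   (rule that)
 note e = Hom_comp[OF Y const_hom[OF Y] restr_hom[OF \<eta>_hom p(1)]]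
 show "\<exists>g\<in>Hom A Y (restr \<eta> V). \<forall>x\<in>carrier W. g (i x) = f x"
 proof (intro bexI[OF _ e] ballI)
  fix w assume w: "w \<in> carrier W"
  have fw: "f w \<in> carrier V" using Hom_closed[OF f w] by simp
  have "(\<lambda>g\<in>G0. i w) = ?i (\<lambda>g\<in>G0. w)" using w by (auto simp: fun_eq_iff)
  then have "\<phi> (\<lambda>g\<in>G0. i w) = finsum V (\<lambda>g. pr g \<odot>\<^sub>V f ((\<lambda>g\<in>G0. w) g)) G0" using p(2)[of "\<lambda>g\<in>G0. w"] w by simp
  also have "\<dots> = finsum V (\<lambda>g. pr g \<odot>\<^sub>V f w) G0"
  proof -
   interpret V: left_module smash V by fact
   have "pr g \<odot>\<^sub>V f w \<in> carrier V" for g by (rule V.smult_closed[OF _ fw]) simp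
   then show ?thesis by (intro V.M.finsum_cong') auto
  qed
  also have "\<dots> = f w" by (rule sum_pr_pr(2)[OF V fw])
  finally show "(\<lambda>y\<in>carrier Y. \<phi> ((\<lambda>x\<in>carrier Y. \<lambda>g\<in>G0. x) y)) (i w) = f w" using Hom_closed[OF i(1) w] by simp
 qed
qed

section \<open>The two exact functors and the inequalities of dimensions\<close>

sublocale F: exact_functor smash A "restr \<eta>" "\<lambda>_ f. f"
proof (intro exact_functor.intro exact_functor_axioms.intro sA.stable_ring_axioms sB.stable_ring_axioms)
 fix W Y Z :: "('g \<Rightarrow> 'a) lmod" and f g
 show "sB.obj W \<Longrightarrow> sA.lm (restr \<eta> W)" by (intro restr_\<eta>_module sB.objD)
 show "sB.obj W \<Longrightarrow> fin_gen A (restr \<eta> W)" by (intro restr_\<eta>_fin_gen sB.objD)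
 show "sB.obj W \<Longrightarrow> injective_module smash W \<Longrightarrow> injective_module A (restr \<eta> W)" by (intro restr_\<eta>_injective)
 show "f \<in> Hom smash W Y \<Longrightarrow> f \<in> Hom A (restr \<eta> W) (restr \<eta> Y)" by (rule restr_hom[OF \<eta>_hom])
 show "short_exact smash W Y Z f g \<Longrightarrow> short_exact A (restr \<eta> W) (restr \<eta> Y) (restr \<eta> Z) f g"
  unfolding short_exact_def using restr_hom[OF \<eta>_hom, of f W Y] restr_hom[OF \<eta>_hom, of g Y Z] by simp
qed simp_all

text \<open>All conditions are checked coordinatewise; for exactness, preimages are chosen
  separately in each coordinate.\<close>

sublocale H: exact_functor A smash hmod "\<lambda>W f. \<lambda>v\<in>carrier (hmod W). \<lambda>g\<in>G0. f (v g)"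
proof (intro exact_functor.intro exact_functor_axioms.intro sA.stable_ring_axioms sB.stable_ring_axioms)
 fix W Y Z :: "'a lmod" and f g v
 show "sA.obj W \<Longrightarrow> sB.lm (hmod W)" by (intro hmod_left_module sA.objD)
 show "sA.obj W \<Longrightarrow> fin_gen smash (hmod W)" by (intro hmod_fin_gen sA.objD)
 show "sA.obj W \<Longrightarrow> injective_module A W \<Longrightarrow> injective_module smash (hmod W)" by (intro hmod_injective)
 show "sA.obj W \<Longrightarrow> sA.obj Y \<Longrightarrow> f \<in> Hom A W Y \<Longrightarrow> (\<lambda>v\<in>carrier (hmod W). \<lambda>g\<in>G0. f (v g)) \<in> Hom smash (hmod W) (hmod Y)"
  by (intro hmap_hom sA.objD)
 show "sA.obj W \<Longrightarrow> v \<in> carrier (hmod W) \<Longrightarrow> (\<lambda>v\<in>carrier (hmod W). \<lambda>g\<in>G0. (\<lambda>x\<in>carrier W. x) (v g)) v = v"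
 proof -
  assume v: "v \<in> carrier (hmod W)"
  then have "(\<lambda>g\<in>G0. (\<lambda>x\<in>carrier W. x) (v g)) = (\<lambda>g\<in>G0. v g)" by (auto simp: fun_eq_iff PiE_mem)
  then show ?thesis using v by (simp add: PiE_def extensional_restrict)
 qed
 show "\<lbrakk>sA.obj W; sA.obj Y; sA.obj Z; f \<in> Hom A W Y; g \<in> Hom A Y Z; v \<in> carrier (hmod W)\<rbrakk>
  \<Longrightarrow> (\<lambda>v\<in>carrier (hmod W). \<lambda>h\<in>G0. (\<lambda>x\<in>carrier W. g (f x)) (v h)) v
   = (\<lambda>v\<in>carrier (hmod Y). \<lambda>h\<in>G0. g (v h)) ((\<lambda>v\<in>carrier (hmod W). \<lambda>h\<in>G0. f (v h)) v)"
 proof -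
  assume f: "f \<in> Hom A W Y" and v: "v \<in> carrier (hmod W)"
  have vc: "v h \<in> carrier W" if "h \<in> G0" for h using v that by auto
  have "(\<lambda>h\<in>G0. f (v h)) \<in> carrier (hmod Y)" using Hom_closed[OF f vc] by simp
  then show ?thesis using v by (auto simp: fun_eq_iff vc)
 qed
 show "\<lbrakk>sA.obj W; sA.obj Y; f \<in> Hom A W Y; g \<in> Hom A W Y; v \<in> carrier (hmod W)\<rbrakk>
  \<Longrightarrow> (\<lambda>v\<in>carrier (hmod W). \<lambda>h\<in>G0. (\<lambda>x\<in>carrier W. f x \<oplus>\<^sub>Y g x) (v h)) v
   = (\<lambda>v\<in>carrier (hmod W). \<lambda>h\<in>G0. f (v h)) v \<oplus>\<^bsub>hmod Y\<^esub> (\<lambda>v\<in>carrier (hmod W). \<lambda>h\<in>G0. g (v h)) v"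
  by (auto simp: fun_eq_iff PiE_mem)
 assume o: "sA.obj W" "sA.obj Y" "sA.obj Z" and ex: "short_exact A W Y Z f g"
 note lm = sA.objD(1)[OF o(1)] sA.objD(1)[OF o(2)] sA.objD(1)[OF o(3)] and se = short_exactD[OF ex]
 let ?f = "\<lambda>v\<in>carrier (hmod W). \<lambda>h\<in>G0. f (v h)" and ?g = "\<lambda>v\<in>carrier (hmod Y). \<lambda>h\<in>G0. g (v h)"
 show "short_exact smash (hmod W) (hmod Y) (hmod Z) ?f ?g"
  unfolding short_exact_def
 proof (intro conjI)
  show "?f \<in> Hom smash (hmod W) (hmod Y)" by (rule hmap_hom[OF lm(1,2) se(1)])
  show "?g \<in> Hom smash (hmod Y) (hmod Z)" by (rule hmap_hom[OF lm(2,3) se(2)])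
  show "inj_on ?f (carrier (hmod W))"
  proof (rule inj_onI)
   fix v w assume v: "v \<in> carrier (hmod W)" and w: "w \<in> carrier (hmod W)" and eq: "?f v = ?f w"
   show "v = w"
   proof (rule PiE_ext[of _ G0 "\<lambda>_. carrier W"])
    fix g assume g: "g \<in> G0"
    then have "f (v g) = f (w g)" using fun_cong[OF eq, of g] v w by simp
    then show "v g = w g" by (rule inj_onD[OF se(3)]) (use v w g in auto)
   qed (use v w in auto)
  qed
  show "?f ` carrier (hmod W) = {y \<in> carrier (hmod Y). ?g y = \<zero>\<^bsub>hmod Z\<^esub>}"
  proof (intro equalityI subsetI)
   fix y assume "y \<in> ?f ` carrier (hmod W)"
   then obtain v where v: "v \<in> carrier (hmod W)" "y = (\<lambda>h\<in>G0. f (v h))" by auto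
   have "v h \<in> carrier W" if "h \<in> G0" for h using v that by auto
   then show "y \<in> {y \<in> carrier (hmod Y). ?g y = \<zero>\<^bsub>hmod Z\<^esub>}"
    using v(2) se(5) Hom_closed[OF se(1)] by (auto simp: fun_eq_iff)
  next
   fix y assume "y \<in> {y \<in> carrier (hmod Y). ?g y = \<zero>\<^bsub>hmod Z\<^esub>}"
   then have y: "y \<in> carrier (hmod Y)" "?g y = \<zero>\<^bsub>hmod Z\<^esub>" by blast+
   have "\<exists>w\<in>carrier W. y h = f w" if h: "h \<in> G0" for h
    using fun_cong[OF y(2), of h] y(1) h by (intro se(6)) auto
   then have "\<forall>h\<in>G0. \<exists>w. w \<in> carrier W \<and> y h = f w" by blast
   from bchoice[OF this] obtain w where w: "\<forall>h\<in>G0. w h \<in> carrier W \<and> y h = f (w h)" ..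
   have "y = ?f (\<lambda>h\<in>G0. w h)"
    by (rule PiE_ext[of _ G0 "\<lambda>_. carrier Y"]) (use y w Hom_closed[OF se(1)] in auto)
   moreover have "(\<lambda>h\<in>G0. w h) \<in> carrier (hmod W)" using w by auto
   ultimately show "y \<in> ?f ` carrier (hmod W)" by blast
  qed
  show "?g ` carrier (hmod Y) = carrier (hmod Z)"
  proof (intro equalityI subsetI)
   fix z assume "z \<in> ?g ` carrier (hmod Y)"
   then show "z \<in> carrier (hmod Z)" by (auto intro!: Hom_closed[OF se(2)])
  next
   fix z assume z: "z \<in> carrier (hmod Z)"
   have "\<exists>y. y \<in> carrier Y \<and> z h = g y" if h: "h \<in> G0" for h
   proof -
    have "z h \<in> g ` carrier Y" unfolding se(4) using z h by auto
    then show ?thesis by auto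
   qed
   then have "\<forall>h\<in>G0. \<exists>y. y \<in> carrier Y \<and> z h = g y" by blast
   from bchoice[OF this] obtain y where y: "\<forall>h\<in>G0. y h \<in> carrier Y \<and> z h = g (y h)" ..
   have "z = ?g (\<lambda>h\<in>G0. y h)"
    by (rule PiE_ext[of _ G0 "\<lambda>_. carrier Z"]) (use z y Hom_closed[OF se(2)] in auto)
   moreover have "(\<lambda>h\<in>G0. y h) \<in> carrier (hmod Y)" using y by auto
   ultimately show "z \<in> ?g ` carrier (hmod Y)" by blast
  qed
 qed
qed

theorem tri_dim_smash_le: "tri_dim (stable_category smash) \<le> tri_dim (stable_category A)"
proof (rule H.tri_dim_le)
 fix V :: "('g \<Rightarrow> 'a) lmod" assume o: "sB.obj V"
 note V = sB.objD(1)[OF o] and oF = F.copy(1)[OF o]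
 note U = sA.objD(1)[OF oF]
 let ?U = "F.Fo V"
 interpret V: left_module smash V by fact
 \<comment> \<open>Up to the copies, \<open>a\<close> and \<open>b\<close> are
   \<open>adjR_hom\<close> and \<open>adjL_hom\<close> of the identity; their composite sends
   \<open>v\<close> to the sum of the \<open>pr g \<odot> (pr g \<odot> v)\<close>.\<close>
 define a where "a = (\<lambda>v\<in>carrier V. H.Fe ?U ((\<lambda>v\<in>carrier V. \<lambda>g\<in>G0. F.Fe V (pr g \<odot>\<^sub>V v)) v))"
 define b where "b = (\<lambda>v\<in>carrier (H.Fo ?U). (\<lambda>v\<in>carrier (hmod ?U). finsum V (\<lambda>g. pr g \<odot>\<^sub>V F.Fd V (v g)) G0) (H.Fd ?U v))"
 have a: "a \<in> Hom smash V (H.Fo ?U)" unfolding a_def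
  by (rule Hom_comp[OF V adjR_hom[OF U V F.copy(2)[OF o]] H.copy(2)[OF oF]])
 have b: "b \<in> Hom smash (H.Fo ?U) V" unfolding b_def
  by (rule Hom_comp[OF H.Fo_lm[OF oF] H.copy(3)[OF oF] adjL_hom[OF U V F.copy(3)[OF o]]])
 have "b (a v) = v" if v: "v \<in> carrier V" for v
 proof -
  have pv: "pr g \<odot>\<^sub>V v \<in> carrier V" for g by (rule V.smult_closed[OF _ v]) simp
  have ppv: "pr g \<odot>\<^sub>V (pr g \<odot>\<^sub>V v) \<in> carrier V" for g by (rule V.smult_closed[OF _ pv]) simp
  let ?w = "\<lambda>g\<in>G0. F.Fe V (pr g \<odot>\<^sub>V v)"
  have w: "?w \<in> carrier (hmod ?U)" using F.Fe_closed[OF o] pv by simp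
  have "b (a v) = finsum V (\<lambda>g. pr g \<odot>\<^sub>V F.Fd V (?w g)) G0"
   using v w H.Fe_closed[OF oF w] H.copy(4)[OF oF w] by (simp add: a_def b_def del: hmod_simps)
  also have "\<dots> = finsum V (\<lambda>g. pr g \<odot>\<^sub>V (pr g \<odot>\<^sub>V v)) G0"
   using ppv pv F.copy(4)[OF o] by (intro V.M.finsum_cong' refl) auto
  also have "\<dots> = v" by (rule sum_pr_pr(1)[OF V v])
  finally show ?thesis .
 qed
 then show "\<exists>W. sA.obj W \<and> (\<exists>a\<in>Hom smash V (H.Fo W). \<exists>b\<in>Hom smash (H.Fo W) V. \<forall>x\<in>carrier V. b (a x) = x)"
  using oF a b by blast
qed

text \<open>A separating family splits the embedding of a module into its induced module.\<close>

lemma separable_retraction: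
 assumes "separably_graded G A Gr"
 obtains x where "x \<in> G0 \<rightarrow> carrier A" "\<And>M :: 'a lmod. LMod A M \<Longrightarrow> (\<lambda>v\<in>carrier (hmod M). finsum M (\<lambda>g. x g \<odot>\<^sub>M v g) G0) \<in> Hom A (restr \<eta> (hmod M)) M"
  "\<And>(M :: 'a lmod) v. LMod A M \<Longrightarrow> v \<in> carrier M \<Longrightarrow> finsum M (\<lambda>g. x g \<odot>\<^sub>M v) G0 = v"
proof -
 obtain x where x: "\<forall>g\<in>G0. x g \<in> Gr \<one>\<^sub>G" "finsum A x G0 = \<one>\<^sub>A"
  "\<forall>g\<in>G0. \<forall>h\<in>G0. \<forall>r\<in>Gr h. r \<otimes>\<^sub>A x g = x (h \<otimes>\<^sub>G g) \<otimes>\<^sub>A r"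
  using assms unfolding separably_graded_def by blast
 have xc: "x g \<in> carrier A" if "g \<in> G0" for g using x(1) that Gr_closed by blast
 show ?thesis
 proof (rule that)
  show "x \<in> G0 \<rightarrow> carrier A" using xc by auto
  fix M :: "'a lmod" assume M: "LMod A M"
  then interpret M: left_module A M .
  show "finsum M (\<lambda>g. x g \<odot>\<^sub>M v) G0 = v" if v: "v \<in> carrier M" for v
   using M.finsum_smult[OF finite_group v, of x] xc x(2) v by (simp add: Pi_iff)
  have xv: "x g \<odot>\<^sub>M v g \<in> carrier M" if "g \<in> G0" "v \<in> carrier (hmod M)" for v g
   using that xc[OF that(1)] by auto
  have "(\<lambda>v\<in>carrier (restr \<eta> (hmod M)). finsum M (\<lambda>g. x g \<odot>\<^sub>M v g) G0) \<in> Hom A (restr \<eta> (hmod M)) M"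
   using restr_\<eta>_module[OF hmod_left_module[OF M]]
  proof (rule Hom_restrictI)
   fix v assume "v \<in> carrier (restr \<eta> (hmod M))"
   then have v: "v \<in> carrier (hmod M)" by simp
   have vc: "v h \<in> carrier M" if "h \<in> G0" for h using v that by auto
   show "finsum M (\<lambda>g. x g \<odot>\<^sub>M v g) G0 \<in> carrier M" using xv v by (intro M.M.finsum_closed) auto
   {
    fix w assume "w \<in> carrier (restr \<eta> (hmod M))"
    then have w: "w \<in> carrier (hmod M)" by simp
    have wc: "w h \<in> carrier M" if "h \<in> G0" for h using w that by auto
    have "finsum M (\<lambda>g. x g \<odot>\<^sub>M (v \<oplus>\<^bsub>restr \<eta> (hmod M)\<^esub> w) g) G0 = finsum M (\<lambda>g. x g \<odot>\<^sub>M v g \<oplus>\<^sub>M x g \<odot>\<^sub>M w g) G0"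
     using xc vc wc by (intro M.M.finsum_cong' refl) (auto simp: M.smult_r_distr)
    then show "finsum M (\<lambda>g. x g \<odot>\<^sub>M (v \<oplus>\<^bsub>restr \<eta> (hmod M)\<^esub> w) g) G0
     = finsum M (\<lambda>g. x g \<odot>\<^sub>M v g) G0 \<oplus>\<^sub>M finsum M (\<lambda>g. x g \<odot>\<^sub>M w g) G0"
     using xc vc wc by (simp add: M.M.finsum_addf Pi_iff)
   }
   fix a assume a: "a \<in> carrier A"
   let ?t = "\<lambda>g h. (cmp a (g \<div> h) \<otimes>\<^sub>A x h) \<odot>\<^sub>M v h"
   have tc: "?t g h \<in> carrier M" if "g \<in> G0" "h \<in> G0" for g h using a xc[OF that(2)] vc[OF that(2)] that by auto
   have "finsum M (\<lambda>g. x g \<odot>\<^sub>M (a \<odot>\<^bsub>restr \<eta> (hmod M)\<^esub> v) g) G0 = finsum M (\<lambda>g. finsum M (?t g) G0) G0"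
   proof (rule M.M.finsum_cong'[OF refl])
    fix g assume g: "g \<in> G0"
    have "x g \<odot>\<^sub>M (a \<odot>\<^bsub>restr \<eta> (hmod M)\<^esub> v) g = x g \<odot>\<^sub>M finsum M (\<lambda>h. cmp a (g \<div> h) \<odot>\<^sub>M v h) G0"
    proof -
     have "(a \<odot>\<^bsub>restr \<eta> (hmod M)\<^esub> v) g = finsum M (\<lambda>h. cmp (\<eta> a h) (g \<div> h) \<odot>\<^sub>M v h) G0" using g by simp
     also have "\<dots> = finsum M (\<lambda>h. cmp a (g \<div> h) \<odot>\<^sub>M v h) G0"
      using a g vc by (intro M.M.finsum_cong' refl) (auto simp: \<eta>_def)
     finally show ?thesis by simp
    qed
    also have "\<dots> = finsum M (\<lambda>h. x g \<odot>\<^sub>M (cmp a (g \<div> h) \<odot>\<^sub>M v h)) G0"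
     using a g vc xc finite_group by (intro M.smult_finsum) auto
    also have "\<dots> = finsum M (?t g) G0"
    proof (rule M.M.finsum_cong'[OF refl])
     fix h assume h: "h \<in> G0"
     \<comment> \<open>The commutation rule of the separating family, in degree
       \<open>g \<div> h\<close>, moves its member across the component of \<open>a\<close> and
       changes the index from \<open>g\<close> to \<open>h\<close>.\<close>
     have "cmp a (g \<div> h) \<otimes>\<^sub>A x h = x (g \<div> h \<otimes>\<^sub>G h) \<otimes>\<^sub>A cmp a (g \<div> h)"
      using x(3) h g cmp_Gr[OF a, of "g \<div> h"] by simp
     also have "g \<div> h \<otimes>\<^sub>G h = g" using g h by (simp add: grp.m_assoc)
     finally show "x g \<odot>\<^sub>M (cmp a (g \<div> h) \<odot>\<^sub>M v h) = ?t g h"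
      using M.smult_assoc[of "x g" "cmp a (g \<div> h)" "v h"] a g h xc vc by simp
    qed (use tc g in auto)
    finally show "x g \<odot>\<^sub>M (a \<odot>\<^bsub>restr \<eta> (hmod M)\<^esub> v) g = finsum M (?t g) G0" .
   qed (use tc in \<open>auto intro!: M.M.finsum_closed\<close>)
   also have "\<dots> = finsum M (\<lambda>h. finsum M (\<lambda>g. ?t g h) G0) G0"
    using tc finite_group by (intro abelian_group_finsum_swap M.M.abelian_group_axioms) auto
   also have "\<dots> = finsum M (\<lambda>h. a \<odot>\<^sub>M (x h \<odot>\<^sub>M v h)) G0"
   proof (rule M.M.finsum_cong'[OF refl])
    fix h assume h: "h \<in> G0"
    have "finsum M (\<lambda>g. ?t g h) G0 = finsum M (\<lambda>g. cmp a (g \<div> h) \<odot>\<^sub>M (x h \<odot>\<^sub>M v h)) G0"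
     using a h xc[OF h] vc[OF h] by (intro M.M.finsum_cong' refl) (auto simp: M.smult_assoc)
    also have "\<dots> = finsum A (\<lambda>g. cmp a (g \<div> h)) G0 \<odot>\<^sub>M (x h \<odot>\<^sub>M v h)"
     using a h xc[OF h] vc[OF h] finite_group by (intro M.finsum_smult[symmetric]) auto
    finally show "finsum M (\<lambda>g. ?t g h) G0 = a \<odot>\<^sub>M (x h \<odot>\<^sub>M v h)" using sum_cmp_shift(1)[OF a h] by simp
   qed (use a xc vc in auto)
   also have "\<dots> = a \<odot>\<^sub>M finsum M (\<lambda>g. x g \<odot>\<^sub>M v g) G0"
    using a xc vc finite_group by (intro M.smult_finsum[symmetric]) auto
   finally show "finsum M (\<lambda>g. x g \<odot>\<^sub>M (a \<odot>\<^bsub>restr \<eta> (hmod M)\<^esub> v) g) G0 = a \<odot>\<^sub>M finsum M (\<lambda>g. x g \<odot>\<^sub>M v g) G0" .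
  qed
  then show "(\<lambda>v\<in>carrier (hmod M). finsum M (\<lambda>g. x g \<odot>\<^sub>M v g) G0) \<in> Hom A (restr \<eta> (hmod M)) M" by simp
 qed
qed

theorem tri_dim_smash_ge:
 assumes "separably_graded G A Gr"
 shows "tri_dim (stable_category A) \<le> tri_dim (stable_category smash)"
proof (rule F.tri_dim_le)
 fix M :: "'a lmod" assume o: "sA.obj M"
 note M = sA.objD(1)[OF o] and oH = H.copy(1)[OF o]
 note U = sB.objD(1)[OF oH]
 let ?U = "H.Fo M"
 interpret M: left_module A M by fact
 obtain x where x0: "x \<in> G0 \<rightarrow> carrier A" "\<And>M :: 'a lmod. LMod A M \<Longrightarrow> (\<lambda>v\<in>carrier (hmod M). finsum M (\<lambda>g. x g \<odot>\<^sub>M v g) G0) \<in> Hom A (restr \<eta> (hmod M)) M"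
  "\<And>(M :: 'a lmod) v. LMod A M \<Longrightarrow> v \<in> carrier M \<Longrightarrow> finsum M (\<lambda>g. x g \<odot>\<^sub>M v) G0 = v"
  by (rule separable_retraction[OF assms]) (rule that)
 note x = x0(1) x0(2)[OF M] x0(3)[OF M]
 let ?c = "\<lambda>x\<in>carrier M. \<lambda>g\<in>G0. x" and ?r = "\<lambda>v\<in>carrier (hmod M). finsum M (\<lambda>g. x g \<odot>\<^sub>M v g) G0"
 have e: "H.Fe M \<in> Hom A (restr \<eta> (hmod M)) (restr \<eta> ?U)" "H.Fd M \<in> Hom A (restr \<eta> ?U) (restr \<eta> (hmod M))"
  using H.copy(2,3)[OF o] by (auto intro: restr_hom[OF \<eta>_hom])
 \<comment> \<open>Up to the copies, \<open>a\<close> sends \<open>v\<close> to the constant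
   function \<open>v\<close>, and \<open>b\<close> is the sum weighted by the separating family,
   whose total weight is 1.\<close>
 define a where "a = (\<lambda>v\<in>carrier M. F.Fe ?U ((\<lambda>v\<in>carrier M. H.Fe M (?c v)) v))"
 define b where "b = (\<lambda>v\<in>carrier (F.Fo ?U). ?r ((\<lambda>v\<in>carrier (F.Fo ?U). H.Fd M (F.Fd ?U v)) v))"
 have a: "a \<in> Hom A M (F.Fo ?U)" unfolding a_def
  by (rule Hom_comp[OF M Hom_comp[OF M const_hom[OF M] e(1)] F.copy(2)[OF oH]])
 have b: "b \<in> Hom A (F.Fo ?U) M" unfolding b_def
  by (rule Hom_comp[OF F.Fo_lm[OF oH] Hom_comp[OF F.Fo_lm[OF oH] F.copy(3)[OF oH] e(2)] x(2)])
 have "b (a v) = v" if v: "v \<in> carrier M" for v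
 proof -
  have c: "(\<lambda>g\<in>G0. v) \<in> carrier (hmod M)" using v by simp
  have h: "H.Fe M (\<lambda>g\<in>G0. v) \<in> carrier (restr \<eta> ?U)" using H.Fe_closed[OF o c] by simp
  have "b (a v) = finsum M (\<lambda>g. x g \<odot>\<^sub>M (\<lambda>g\<in>G0. v) g) G0"
   using v c F.Fe_closed[OF oH h] F.copy(4)[OF oH h] H.copy(4)[OF o c] by (simp add: a_def b_def del: hmod_simps)
  also have "\<dots> = finsum M (\<lambda>g. x g \<odot>\<^sub>M v) G0" using v x(1) by (intro M.M.finsum_cong' refl) auto
  also have "\<dots> = v" using x(3) v by blast
  finally show ?thesis .
 qed
 then show "\<exists>W. sB.obj W \<and> (\<exists>a\<in>Hom A M (F.Fo W). \<exists>b\<in>Hom A (F.Fo W) M. \<forall>x\<in>carrier M. b (a x) = x)"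
  using oH a b by blast
qed

text \<open>As an \<open>A\<close>-module the smash product is a power of \<open>A\<close>, hence
  injective. So is the module induced from it, and the idempotents make the smash product a retract
  of that module.\<close>

lemma smash_self_injective:
 assumes "self_injective A" shows "self_injective smash"
proof -
 let ?V = "Reg smash" and ?P = "pi_module G0 (\<lambda>_. Reg A)"
 have V: "LMod smash ?V" using smash_ring by (rule regular_left_module)
 note RV = restr_\<eta>_module[OF V]
 interpret V: left_module smash ?V by fact
 have P: "injective_module A ?P"
  using assms by (intro injective_pi A.ring_axioms) (simp add: self_injective_def)
 have i1: "(\<lambda>x\<in>carrier (restr \<eta> ?V). x) \<in> Hom A (restr \<eta> ?V) ?P"
  using RV by (rule Hom_restrictI) (auto simp: \<eta>_mult fun_eq_iff simp del: smash_simps(5))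
 have i2: "(\<lambda>x\<in>carrier ?P. x) \<in> Hom A ?P (restr \<eta> ?V)"
  using injective_left_module[OF P] by (rule Hom_restrictI) (auto simp: \<eta>_mult fun_eq_iff simp del: smash_simps(5))
 have "injective_module A (restr \<eta> ?V)"
  using P RV i1 i2 by (rule injective_retract) simp
 then have inj: "injective_module smash (hmod (restr \<eta> ?V))" by (rule hmod_injective)
 note id = Hom_id[OF RV]
 let ?i = "\<lambda>x\<in>carrier (restr \<eta> ?V). x"
 have "injective_module smash ?V"
  using inj V adjR_hom[OF RV V id] adjL_hom[OF RV V id]
 proof (rule injective_retract)
  fix v assume v: "v \<in> carrier ?V"
  have pv: "pr g \<odot>\<^bsub>?V\<^esub> v \<in> carrier ?V" for g by (rule V.smult_closed[OF _ v]) simp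
  have ppv: "pr g \<odot>\<^bsub>?V\<^esub> (pr g \<odot>\<^bsub>?V\<^esub> v) \<in> carrier ?V" for g by (rule V.smult_closed[OF _ pv]) simp
  let ?w = "\<lambda>g\<in>G0. ?i (pr g \<odot>\<^bsub>?V\<^esub> v)"
  have w: "?w \<in> carrier (hmod (restr \<eta> ?V))" using pv by (simp only: hmod_simps restr_simps) simp
  have "(\<lambda>v\<in>carrier (hmod (restr \<eta> ?V)). finsum ?V (\<lambda>g. pr g \<odot>\<^bsub>?V\<^esub> ?i (v g)) G0)
    ((\<lambda>v\<in>carrier ?V. \<lambda>g\<in>G0. ?i (pr g \<odot>\<^bsub>?V\<^esub> v)) v) = finsum ?V (\<lambda>g. pr g \<odot>\<^bsub>?V\<^esub> ?i (?w g)) G0"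
   using v w by (simp only: restrict_apply')
  also have "\<dots> = finsum ?V (\<lambda>g. pr g \<odot>\<^bsub>?V\<^esub> (pr g \<odot>\<^bsub>?V\<^esub> v)) G0"
  proof (rule V.M.finsum_cong'[OF refl])
   show "(\<lambda>g. pr g \<odot>\<^bsub>?V\<^esub> (pr g \<odot>\<^bsub>?V\<^esub> v)) \<in> G0 \<rightarrow> carrier ?V" using ppv by blast
   fix g assume g: "g \<in> G0"
   have "pr g \<odot>\<^bsub>?V\<^esub> v \<in> carrier (restr \<eta> ?V)" using pv by (simp only: restr_simps)
   then show "pr g \<odot>\<^bsub>?V\<^esub> ?i (?w g) = pr g \<odot>\<^bsub>?V\<^esub> (pr g \<odot>\<^bsub>?V\<^esub> v)" using g by (simp only: restrict_apply')
  qed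
  also have "\<dots> = v" by (rule sum_pr_pr(1)[OF V v])
  finally show "(\<lambda>v\<in>carrier (hmod (restr \<eta> ?V)). finsum ?V (\<lambda>g. pr g \<odot>\<^bsub>?V\<^esub> ?i (v g)) G0)
    ((\<lambda>v\<in>carrier ?V. \<lambda>g\<in>G0. ?i (pr g \<odot>\<^bsub>?V\<^esub> v)) v) = v" .
 qed
 then show ?thesis by (simp add: self_injective_def)
qed

end

section \<open>Free modules and comparison of syzygies\<close>

definition free_module :: "('r, 'x) ring_scheme \<Rightarrow> nat \<Rightarrow> ('r, nat \<Rightarrow> 'r) module" ("Free") where
 "Free R n = pi_module {..<n} (\<lambda>_. Reg R)"

abbreviation "basis R n i \<equiv> pi_inj {..<n} (\<lambda>_. Reg R) i \<one>\<^sub>R"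

lemma free_simps [simp]: "carrier (Free R n) = {..<n} \<rightarrow>\<^sub>E carrier R"
 "\<zero>\<^bsub>Free R n\<^esub> = (\<lambda>i\<in>{..<n}. \<zero>\<^sub>R)" "x \<oplus>\<^bsub>Free R n\<^esub> y = (\<lambda>i\<in>{..<n}. x i \<oplus>\<^sub>R y i)"
 "r \<odot>\<^bsub>Free R n\<^esub> x = (\<lambda>i\<in>{..<n}. r \<otimes>\<^sub>R x i)"
 by (simp_all add: free_module_def)

lemma free_left_module: "ring R \<Longrightarrow> LMod R (Free R n)"
 unfolding free_module_def by (intro pi_left_module regular_left_module)

lemma free_fin_gen: "ring R \<Longrightarrow> fin_gen R (Free R n)"
 unfolding free_module_def by (intro pi_fin_gen regular_left_module regular_fin_gen finite_lessThan)

lemma basis_closed: assumes "ring R" shows "basis R n i \<in> carrier (Free R n)"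
proof -
 interpret ring R by fact
 have "(if j = i then \<one>\<^sub>R else \<zero>\<^sub>R) \<in> carrier R" for j by simp
 then show ?thesis unfolding free_simps pi_inj_def regular_simps by (simp only: restrict_PiE_iff) blast
qed

lemma free_decomp:
 assumes "ring R" "x \<in> carrier (Free R n)"
 shows "x = finsum (Free R n) (\<lambda>i. x i \<odot>\<^bsub>Free R n\<^esub> basis R n i) {..<n}"
proof -
 interpret ring R by fact
 interpret F: left_module R "Free R n" using assms(1) by (rule free_left_module)
 have "x = finsum (Free R n) (\<lambda>i. pi_inj {..<n} (\<lambda>_. Reg R) i (x i)) {..<n}"
  unfolding free_module_def by (rule pi_decomp[OF assms(1) regular_left_module[OF assms(1)] finite_lessThan assms(2)[unfolded free_module_def]])
 also have "\<dots> = finsum (Free R n) (\<lambda>i. x i \<odot>\<^bsub>Free R n\<^esub> basis R n i) {..<n}"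
 proof (rule F.M.finsum_cong'[OF refl])
  show "(\<lambda>i. x i \<odot>\<^bsub>Free R n\<^esub> basis R n i) \<in> {..<n} \<rightarrow> carrier (Free R n)"
   using assms(2) basis_closed[OF assms(1)] by (intro Pi_I F.smult_closed) auto
  fix i assume "i \<in> {..<n}"
  then have "x i \<in> carrier R" using assms(2) by auto
  then show "pi_inj {..<n} (\<lambda>_. Reg R) i (x i) = x i \<odot>\<^bsub>Free R n\<^esub> basis R n i"
   by (auto simp: pi_inj_def fun_eq_iff)
 qed
 finally show ?thesis .
qed

lemma free_hom_eval:
 assumes "ring R" "LMod R Z" "f \<in> Hom R (Free R n) Z" "x \<in> carrier (Free R n)"
 shows "f x = finsum Z (\<lambda>i. x i \<odot>\<^sub>Z f (basis R n i)) {..<n}"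
proof -
 interpret F: left_module R "Free R n" using assms(1) by (rule free_left_module)
 interpret f: lhom R "Free R n" Z f using F.left_module_axioms assms(2,3) by (rule lhomI)
 note b = basis_closed[OF assms(1), of n]
 have xc: "x i \<in> carrier R" if "i \<in> {..<n}" for i using assms(4) that by auto
 have "f x = f (finsum (Free R n) (\<lambda>i. x i \<odot>\<^bsub>Free R n\<^esub> basis R n i) {..<n})"
  using free_decomp[OF assms(1,4)] by simp
 also have "\<dots> = finsum Z (\<lambda>i. f (x i \<odot>\<^bsub>Free R n\<^esub> basis R n i)) {..<n}"
  using F.smult_closed[OF xc b] by (intro f.finsum) (auto simp del: free_simps)
 also have "\<dots> = finsum Z (\<lambda>i. x i \<odot>\<^sub>Z f (basis R n i)) {..<n}"
  using f.smult[OF xc b] f.Y.smult_closed[OF xc f.closed[OF b]] by (intro f.Y.M.finsum_cong' refl) (auto simp del: free_simps)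
 finally show ?thesis .
qed

lemma free_hom:
 assumes "ring R" "LMod R Y" "y \<in> {..<n} \<rightarrow> carrier Y"
 shows "(\<lambda>x\<in>carrier (Free R n). finsum Y (\<lambda>i. x i \<odot>\<^sub>Y y i) {..<n}) \<in> Hom R (Free R n) Y"
 using free_left_module[OF assms(1)]
proof (rule Hom_restrictI)
 interpret Y: left_module R Y by fact
 have yc: "y i \<in> carrier Y" if "i < n" for i using assms(3) that by auto
 fix x assume x: "x \<in> carrier (Free R n)"
 have xc: "x i \<in> carrier R" if "i < n" for i using x that by auto
 show "finsum Y (\<lambda>i. x i \<odot>\<^sub>Y y i) {..<n} \<in> carrier Y" using xc yc by (intro Y.M.finsum_closed) auto
 {
  fix z assume z: "z \<in> carrier (Free R n)"
  have zc: "z i \<in> carrier R" if "i < n" for i using z that by auto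
  have "finsum Y (\<lambda>i. (x \<oplus>\<^bsub>Free R n\<^esub> z) i \<odot>\<^sub>Y y i) {..<n} = finsum Y (\<lambda>i. x i \<odot>\<^sub>Y y i \<oplus>\<^sub>Y z i \<odot>\<^sub>Y y i) {..<n}"
   using xc yc zc by (intro Y.M.finsum_cong' refl) (auto simp: Y.smult_l_distr)
  then show "finsum Y (\<lambda>i. (x \<oplus>\<^bsub>Free R n\<^esub> z) i \<odot>\<^sub>Y y i) {..<n}
   = finsum Y (\<lambda>i. x i \<odot>\<^sub>Y y i) {..<n} \<oplus>\<^sub>Y finsum Y (\<lambda>i. z i \<odot>\<^sub>Y y i) {..<n}"
   using xc yc zc by (simp add: Y.M.finsum_addf Pi_iff)
 }
 fix r assume r: "r \<in> carrier R"
 have "finsum Y (\<lambda>i. (r \<odot>\<^bsub>Free R n\<^esub> x) i \<odot>\<^sub>Y y i) {..<n} = finsum Y (\<lambda>i. r \<odot>\<^sub>Y (x i \<odot>\<^sub>Y y i)) {..<n}"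
  using xc yc r by (intro Y.M.finsum_cong' refl) (auto simp: Y.smult_assoc)
 also have "\<dots> = r \<odot>\<^sub>Y finsum Y (\<lambda>i. x i \<odot>\<^sub>Y y i) {..<n}"
  using xc yc r by (intro Y.smult_finsum[symmetric]) auto
 finally show "finsum Y (\<lambda>i. (r \<odot>\<^bsub>Free R n\<^esub> x) i \<odot>\<^sub>Y y i) {..<n} = r \<odot>\<^sub>Y finsum Y (\<lambda>i. x i \<odot>\<^sub>Y y i) {..<n}" .
qed

text \<open>Preimages of the basis are chosen, which works for \<open>Y\<close> of any type and
  size; compare \<open>projective_lift\<close>.\<close>

lemma free_lift:
 assumes "ring R" "LMod R Y" "LMod R Z" "p \<in> Hom R Y Z" "p ` carrier Y = carrier Z"
  "f \<in> Hom R (Free R n) Z"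
 obtains g where "g \<in> Hom R (Free R n) Y" "\<And>x. x \<in> carrier (Free R n) \<Longrightarrow> p (g x) = f x"
proof -
 interpret p: lhom R Y Z p using assms(2-4) by (rule lhomI)
 note b = basis_closed[OF assms(1), of n]
 have "\<forall>i. \<exists>y. y \<in> carrier Y \<and> p y = f (basis R n i)"
 proof
  fix i
  have "f (basis R n i) \<in> p ` carrier Y" unfolding assms(5) using Hom_closed[OF assms(6) b] .
  then show "\<exists>y. y \<in> carrier Y \<and> p y = f (basis R n i)" by auto
 qed
 from choice[OF this] obtain y where y: "\<forall>i. y i \<in> carrier Y \<and> p (y i) = f (basis R n i)" ..
 show ?thesis
 proof (rule that[OF free_hom[OF assms(1,2)]])
  show "y \<in> {..<n} \<rightarrow> carrier Y" using y by auto
  fix x assume x: "x \<in> carrier (Free R n)"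
  have xc: "x i \<in> carrier R" if "i \<in> {..<n}" for i using x that by auto
  have "p (finsum Y (\<lambda>i. x i \<odot>\<^sub>Y y i) {..<n}) = finsum Z (\<lambda>i. p (x i \<odot>\<^sub>Y y i)) {..<n}"
   using xc y by (intro p.finsum) auto
  also have "\<dots> = finsum Z (\<lambda>i. x i \<odot>\<^sub>Z f (basis R n i)) {..<n}"
   using xc y Hom_closed[OF assms(6) b] by (intro p.Y.M.finsum_cong' refl) auto
  also have "\<dots> = f x" by (rule free_hom_eval[OF assms(1,3,6) x, symmetric])
  finally show "p ((\<lambda>x\<in>carrier (Free R n). finsum Y (\<lambda>i. x i \<odot>\<^sub>Y y i) {..<n}) x) = f x" using x by simp
 qed
qed

lemma free_cover:
 assumes "LMod R M" "fin_gen R M"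
 obtains n p where "p \<in> Hom R (Free R n) M" "p ` carrier (Free R n) = carrier M"
proof -
 interpret M: left_module R M by fact
 obtain S where S: "finite S" "S \<subseteq> carrier M" "carrier M \<subseteq> lspan R M S" using assms(2) M.fin_gen_iff by auto
 obtain n :: nat and e where e: "S = e ` {i. i < n}" using finite_imp_nat_seg_image_inj_on[OF S(1)] by auto
 let ?p = "\<lambda>x\<in>carrier (Free R n). finsum M (\<lambda>i. x i \<odot>\<^sub>M e i) {..<n}"
 have ec: "e \<in> {..<n} \<rightarrow> carrier M" using S(2) e by auto
 have p: "?p \<in> Hom R (Free R n) M" by (rule free_hom[OF M.R.ring_axioms assms(1) ec])
 note F = free_left_module[OF M.R.ring_axioms, of n]
 interpret p: lhom R "Free R n" M ?p using F assms(1) p by (rule lhomI)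
 have "e i \<in> ?p ` carrier (Free R n)" if i: "i < n" for i
 proof -
  have "?p (basis R n i) = finsum M (\<lambda>j. basis R n i j \<odot>\<^sub>M e j) {..<n}" using basis_closed[OF M.R.ring_axioms] by (simp only: restrict_apply')
  also have "\<dots> = finsum M (\<lambda>j. if i = j then e j else \<zero>\<^sub>M) {..<n}"
   using ec M.smult_zero_left by (intro M.M.finsum_cong' refl) (auto simp: pi_inj_def Pi_iff)
  also have "\<dots> = e i" using i by (intro M.M.finsum_singleton[OF _ finite_lessThan ec]) simp
  finally show ?thesis by (rule image_eqI[OF sym basis_closed[OF M.R.ring_axioms]])
 qed
 then have "S \<subseteq> ?p ` carrier (Free R n)" using e by auto
 then have "lspan R M S \<subseteq> ?p ` carrier (Free R n)" by (rule M.lspan_subset_submodule[OF p.range])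
 then have "?p ` carrier (Free R n) = carrier M" using S(3) p.closed by blast
 then show ?thesis using p that by blast
qed

text \<open>Projectivity is tested on the universe, so \<open>Y\<close> and \<open>Z\<close> are
  replaced by copies there; this is the reason for \<open>Y\<close> to be finitely generated. The
  projective module \<open>Q\<close> may be of any size.\<close>

lemma projective_lift:
 fixes Q :: "('r, 'q) module"
 assumes "projective_module R Q" "LMod R Y" "fin_gen R Y" "LMod R Z" "p \<in> Hom R Y Z" "p ` carrier Y = carrier Z"
  "f \<in> Hom R Q Z"
 obtains g where "g \<in> Hom R Q Y" "\<And>x. x \<in> carrier Q \<Longrightarrow> p (g x) = f x"
proof -
 have Q: "LMod R Q" using assms(1) by (simp add: projective_module_def)
 have Zf: "fin_gen R Z" by (rule left_module.fin_gen_image[OF assms(2,4,5,6,3)])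
 obtain Y' :: "'r lmod" and eY dY where Y': "LMod R Y'" "fin_gen R Y'" "eY \<in> Hom R Y Y'" "dY \<in> Hom R Y' Y"
  "\<And>x. x \<in> carrier Y \<Longrightarrow> dY (eY x) = x" "\<And>y. y \<in> carrier Y' \<Longrightarrow> eY (dY y) = y"
  by (rule fin_gen_copy_iso[OF assms(2,3)]) (rule that)
 obtain Z' :: "'r lmod" and eZ dZ where Z': "LMod R Z'" "fin_gen R Z'" "eZ \<in> Hom R Z Z'" "dZ \<in> Hom R Z' Z"
  "\<And>x. x \<in> carrier Z \<Longrightarrow> dZ (eZ x) = x" "\<And>y. y \<in> carrier Z' \<Longrightarrow> eZ (dZ y) = y"
  by (rule fin_gen_copy_iso[OF assms(4) Zf]) (rule that)
 define p' where "p' = (\<lambda>y\<in>carrier Y'. eZ ((\<lambda>y\<in>carrier Y'. p (dY y)) y))"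
 have p': "p' \<in> Hom R Y' Z'" unfolding p'_def by (rule Hom_comp[OF Y'(1) Hom_comp[OF Y'(1,4) assms(5)] Z'(3)])
 have "z \<in> p' ` carrier Y'" if z: "z \<in> carrier Z'" for z
 proof -
  have "dZ z \<in> p ` carrier Y" unfolding assms(6) by (rule Hom_closed[OF Z'(4) z])
  then obtain y where y: "y \<in> carrier Y" "dZ z = p y" by blast
  have "p' (eY y) = z" using y Y'(5)[OF y(1)] Hom_closed[OF Y'(3) y(1)] Z'(6)[OF z] by (simp add: p'_def)
  then show ?thesis using Hom_closed[OF Y'(3) y(1)] by blast
 qed
 then have "p' ` carrier Y' = carrier Z'" using Hom_closed[OF p'] by blast
 then obtain g where g: "g \<in> Hom R Q Y'" "compose (carrier Q) p' g = (\<lambda>x\<in>carrier Q. eZ (f x))"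
  using assms(1) p' Hom_comp[OF Q assms(7) Z'(3)] Y'(1) Z'(1) unfolding projective_module_def by meson
 show ?thesis
 proof (rule that[OF Hom_comp[OF Q g(1) Y'(4)]])
  fix x assume x: "x \<in> carrier Q"
  note gx = Hom_closed[OF g(1) x]
  have "p' (g x) = eZ (f x)" using fun_cong[OF g(2), of x] x by (simp add: compose_def)
  then have "eZ (p (dY (g x))) = eZ (f x)" using gx by (simp add: p'_def)
  then have "dZ (eZ (p (dY (g x)))) = dZ (eZ (f x))" by simp
  then have "p (dY (g x)) = f x"
   using Z'(5)[OF Hom_closed[OF assms(5) Hom_closed[OF Y'(4) gx]]] Z'(5)[OF Hom_closed[OF assms(7) x]] by simp
  then show "p ((\<lambda>x\<in>carrier Q. dY (g x)) x) = f x" using x by simp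
 qed
qed

text \<open>The universal property of a kernel. As \<open>i\<close> is injective, the chosen
  preimages are unique, and therefore they depend linearly on \<open>w\<close>.\<close>

lemma Hom_into_kernel:
 assumes "LMod R W" "LMod R Z" "LMod R Y" "i \<in> Hom R Z Y" "inj_on i (carrier Z)" "f \<in> Hom R W Y"
  and "\<And>w. w \<in> carrier W \<Longrightarrow> \<exists>z\<in>carrier Z. f w = i z"
 obtains h where "h \<in> Hom R W Z" "\<And>w. w \<in> carrier W \<Longrightarrow> i (h w) = f w"
proof -
 interpret W: left_module R W by fact
 interpret i: lhom R Z Y i using assms(2-4) by (rule lhomI)
 have "\<forall>w\<in>carrier W. \<exists>z. z \<in> carrier Z \<and> f w = i z" using assms(7) by blast
 from bchoice[OF this] obtain h where "\<forall>w\<in>carrier W. h w \<in> carrier Z \<and> f w = i (h w)" ..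
 then have h: "h w \<in> carrier Z" "i (h w) = f w" if "w \<in> carrier W" for w using that by simp_all
 have u: "z = z'" if "z \<in> carrier Z" "z' \<in> carrier Z" "i z = i z'" for z z' using inj_onD[OF assms(5) that(3,1,2)] .
 have "(\<lambda>w\<in>carrier W. h w) \<in> Hom R W Z" using assms(1)
 proof (rule Hom_restrictI)
  fix x y assume x: "x \<in> carrier W" and y: "y \<in> carrier W"
  show "h (x \<oplus>\<^sub>W y) = h x \<oplus>\<^sub>Z h y" by (rule u) (simp_all add: h x y Hom_add[OF assms(6) x y])
 next
  fix r x assume r: "r \<in> carrier R" and x: "x \<in> carrier W"
  show "h (r \<odot>\<^sub>W x) = r \<odot>\<^sub>Z h x" by (rule u) (simp_all add: h r x Hom_smult[OF assms(6) r x])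
 qed (use h in blast)
 then show ?thesis by (rule that) (simp add: h(2))
qed

text \<open>\<open>N\<close> is a retract of \<open>N'\<close> up to maps which factor through a free module of finite rank.\<close>

definition free_retract :: "('r, 'x) ring_scheme \<Rightarrow> ('r, 'm, 'y) module_scheme \<Rightarrow> ('r, 'n, 'z) module_scheme \<Rightarrow> bool" where
 "free_retract R N N' \<longleftrightarrow> (\<exists>\<alpha>\<in>Hom R N N'. \<exists>\<beta>\<in>Hom R N' N. \<exists>n. \<exists>s\<in>Hom R N (Free R n). \<exists>t\<in>Hom R (Free R n) N.
   \<forall>x\<in>carrier N. x = \<beta> (\<alpha> x) \<oplus>\<^sub>N t (s x))"

lemma free_retract_iso:
 assumes "LMod R N" "LMod R N'" "\<alpha> \<in> Hom R N N'" "\<beta> \<in> Hom R N' N" "\<And>x. x \<in> carrier N \<Longrightarrow> \<beta> (\<alpha> x) = x"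
 shows "free_retract R N N'"
proof -
 interpret N: left_module R N by fact
 note F = free_left_module[OF N.R.ring_axioms, of 0]
 interpret F: left_module R "Free R 0" by fact
 show ?thesis unfolding free_retract_def
 proof (intro bexI[OF _ assms(3)] bexI[OF _ assms(4)] exI[of _ 0] bexI[OF _ Hom_zero[OF assms(1) F]] bexI[OF _ Hom_zero[OF F assms(1)]] ballI)
  fix x assume "x \<in> carrier N"
  then show "x = \<beta> (\<alpha> x) \<oplus>\<^sub>N (\<lambda>x\<in>carrier (Free R 0). \<zero>\<^sub>N) ((\<lambda>x\<in>carrier N. \<zero>\<^bsub>Free R 0\<^esub>) x)"
   using assms(5) F.M.zero_closed by (simp del: free_simps)
 qed
qed

text \<open>A weak form of Schanuel's lemma. The map \<open>\<alpha>\<close> lifts to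
  \<open>a\<close> because the cover of \<open>N\<close> is free, and \<open>\<beta>\<close> lifts
  to \<open>b\<close> because \<open>Q\<close> is projective; both restrict to the kernels. Up to a
  correction, \<open>1 - b a\<close> maps into the kernel \<open>Z\<close>, so the identity of
  \<open>Z\<close> is the composite of the restrictions plus a map through
  \<open>Free R n\<close>.\<close>

lemma free_retract_syzygy:
 fixes Z' Q N' :: "'r lmod"
 assumes "ring R" "LMod R Z" "LMod R N" "short_exact R Z (Free R n) N \<iota> p"
  and "LMod R Z'" "LMod R N'" "projective_module R Q" "short_exact R Z' Q N' \<iota>' p'"
  and "free_retract R N N'"
 shows "free_retract R Z Z'"
proof -
 let ?P = "Free R n"
 have P: "LMod R ?P" "fin_gen R ?P" using assms(1) by (rule free_left_module, rule free_fin_gen)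
 have Q: "LMod R Q" using assms(7) by (simp add: projective_module_def)
 note se = short_exactD[OF assms(4)] and se' = short_exactD[OF assms(8)]
 interpret P: left_module R ?P by fact
 interpret Z: left_module R Z by fact
 interpret N: left_module R N by fact
 interpret p: lhom R ?P N p using P(1) assms(3) se(2) by (rule lhomI)
 interpret i: lhom R Z ?P \<iota> using assms(2) P(1) se(1) by (rule lhomI)
 obtain \<alpha> \<beta> k s0 t0 where *: "\<alpha> \<in> Hom R N N'" "\<beta> \<in> Hom R N' N" "s0 \<in> Hom R N (Free R k)" "t0 \<in> Hom R (Free R k) N"
  "\<forall>x\<in>carrier N. x = \<beta> (\<alpha> x) \<oplus>\<^sub>N t0 (s0 x)"
  using assms(9) unfolding free_retract_def by blast
 \<comment> \<open>The part of the identity of \<open>N\<close> that passes through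
   \<open>Free R k\<close> is lifted to the cover as well; it is the correction.\<close>
 obtain l where l: "l \<in> Hom R (Free R k) ?P" "\<And>x. x \<in> carrier (Free R k) \<Longrightarrow> p (l x) = t0 x"
  by (rule free_lift[OF assms(1) P(1) assms(3) se(2,4) *(4)]) (rule that)
 obtain a where a: "a \<in> Hom R ?P Q" "\<And>x. x \<in> carrier ?P \<Longrightarrow> p' (a x) = (\<lambda>x\<in>carrier ?P. \<alpha> (p x)) x"
  by (rule free_lift[OF assms(1) Q assms(6) se'(2,4) Hom_comp[OF P(1) se(2) *(1)]]) (rule that)
 obtain b where b: "b \<in> Hom R Q ?P" "\<And>x. x \<in> carrier Q \<Longrightarrow> p (b x) = (\<lambda>x\<in>carrier Q. \<beta> (p' x)) x"
  by (rule projective_lift[OF assms(7) P assms(3) se(2,4) Hom_comp[OF Q se'(2) *(2)]]) (rule that)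
 note ac = Hom_closed[OF a(1)] and bc = Hom_closed[OF b(1)] and lc = Hom_closed[OF l(1)] and sc = Hom_closed[OF *(3)]
 note ic' = Hom_closed[OF se'(1)] and \<alpha>c = Hom_closed[OF *(1)] and \<beta>c = Hom_closed[OF *(2)]
 have ai: "\<exists>z'\<in>carrier Z'. (\<lambda>z\<in>carrier Z. a (\<iota> z)) z = \<iota>' z'" if z: "z \<in> carrier Z" for z
 proof -
  have "p' (a (\<iota> z)) = \<alpha> (p (\<iota> z))" using a(2)[OF i.closed[OF z]] i.closed[OF z] by (simp del: free_simps)
  also have "\<dots> = \<zero>\<^bsub>N'\<^esub>" using se(5)[OF z] lhom.zero[OF lhomI[OF assms(3,6) *(1)]] by simp
  finally show ?thesis using se'(6)[OF ac[OF i.closed[OF z]]] z by simp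
 qed
 obtain \<alpha>' where \<alpha>': "\<alpha>' \<in> Hom R Z Z'" "\<And>z. z \<in> carrier Z \<Longrightarrow> \<iota>' (\<alpha>' z) = (\<lambda>z\<in>carrier Z. a (\<iota> z)) z"
  by (rule Hom_into_kernel[OF assms(2,5) Q se'(1,3) Hom_comp[OF assms(2) se(1) a(1)] ai]) (assumption | rule that)+
 have bi: "\<exists>z\<in>carrier Z. (\<lambda>z\<in>carrier Z'. b (\<iota>' z)) z' = \<iota> z" if z: "z' \<in> carrier Z'" for z'
 proof -
  have "p (b (\<iota>' z')) = \<beta> (p' (\<iota>' z'))" using b(2)[OF ic'[OF z]] ic'[OF z] by simp
  also have "\<dots> = \<zero>\<^sub>N" using se'(5)[OF z] lhom.zero[OF lhomI[OF assms(6,3) *(2)]] by simp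
  finally show ?thesis using se(6)[OF bc[OF ic'[OF z]]] z by simp
 qed
 obtain \<beta>' where \<beta>': "\<beta>' \<in> Hom R Z' Z" "\<And>z. z \<in> carrier Z' \<Longrightarrow> \<iota> (\<beta>' z) = (\<lambda>z\<in>carrier Z'. b (\<iota>' z)) z"
  by (rule Hom_into_kernel[OF assms(5,2) P(1) se(1,3) Hom_comp[OF assms(5) se'(1) b(1)] bi]) (assumption | rule that)+
 define u where "u = (\<lambda>y\<in>carrier ?P. (\<lambda>y\<in>carrier ?P. (\<lambda>y\<in>carrier ?P. y) y \<ominus>\<^bsub>?P\<^esub> (\<lambda>y\<in>carrier ?P. b (a y)) y) y
   \<ominus>\<^bsub>?P\<^esub> (\<lambda>y\<in>carrier ?P. l ((\<lambda>y\<in>carrier ?P. s0 (p y)) y)) y)"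
 have u: "u \<in> Hom R ?P ?P" unfolding u_def
  by (intro Hom_minus Hom_id P(1) Hom_comp[OF P(1) a(1) b(1)] Hom_comp[OF P(1) Hom_comp[OF P(1) se(2) *(3)] l(1)])
 have ue: "u y = (y \<ominus>\<^bsub>?P\<^esub> b (a y)) \<ominus>\<^bsub>?P\<^esub> l (s0 (p y))" if "y \<in> carrier ?P" for y
  using that by (simp add: u_def del: free_simps)
 \<comment> \<open>By the equation of \<open>free_retract\<close> for \<open>N\<close>, the image of
   \<open>u\<close> is annihilated by \<open>p\<close>.\<close>
 have uk: "\<exists>z\<in>carrier Z. u y = \<iota> z" if y: "y \<in> carrier ?P" for y
 proof -
  have c: "b (a y) \<in> carrier ?P" "l (s0 (p y)) \<in> carrier ?P" by (intro bc ac y, intro lc sc p.closed y)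
  have pb: "p (b (a y)) = \<beta> (\<alpha> (p y))" using b(2)[OF ac[OF y]] a(2)[OF y] y ac[OF y] by (simp del: free_simps)
  have pl: "p (l (s0 (p y))) = t0 (s0 (p y))" by (rule l(2)[OF sc[OF p.closed[OF y]]])
  have "p (u y) = (p y \<ominus>\<^sub>N p (b (a y))) \<ominus>\<^sub>N p (l (s0 (p y)))" using y c by (simp add: ue del: free_simps)
  also have "\<dots> = \<zero>\<^sub>N"
  proof -
   have eq: "p y = p (b (a y)) \<oplus>\<^sub>N p (l (s0 (p y)))" unfolding pb pl using *(5) p.closed[OF y] by blast
   have "(u \<oplus>\<^sub>N v) \<ominus>\<^sub>N u \<ominus>\<^sub>N v = \<zero>\<^sub>N" if "u \<in> carrier N" "v \<in> carrier N" for u v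
    using that by (simp add: a_minus_def N.M.a_assoc N.M.minus_add[symmetric]) (metis N.M.a_closed N.M.a_inv_closed N.M.a_assoc N.M.minus_add N.M.r_neg)
   from this[OF p.closed[OF c(1)] p.closed[OF c(2)]] show ?thesis by (subst eq)
  qed
  finally show ?thesis using se(6)[OF Hom_closed[OF u y]] by simp
 qed
 obtain t where t: "t \<in> Hom R ?P Z" "\<And>y. y \<in> carrier ?P \<Longrightarrow> \<iota> (t y) = u y"
  by (rule Hom_into_kernel[OF P(1) assms(2) P(1) se(1,3) u uk]) (assumption | rule that)+
 show ?thesis unfolding free_retract_def
 proof (intro bexI[OF _ \<alpha>'(1)] bexI[OF _ \<beta>'(1)] exI[of _ n] bexI[OF _ se(1)] bexI[OF _ t(1)] ballI)
  fix z assume z: "z \<in> carrier Z"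
  note iz = i.closed[OF z] and az = Hom_closed[OF \<alpha>'(1) z]
  have ba: "\<iota> (\<beta>' (\<alpha>' z)) = b (a (\<iota> z))" using \<beta>'(2)[OF az] \<alpha>'(2)[OF z] z az by simp
  \<comment> \<open>On the kernel the correction vanishes, because it passes through
    \<open>p\<close>.\<close>
  have "l (s0 (p (\<iota> z))) = \<zero>\<^bsub>?P\<^esub>"
   using se(5)[OF z] lhom.zero[OF lhomI[OF assms(3) free_left_module[OF assms(1)] *(3)]]
    lhom.zero[OF lhomI[OF free_left_module[OF assms(1)] P(1) l(1)]] by simp
  then have "\<iota> (t (\<iota> z)) = \<iota> z \<ominus>\<^bsub>?P\<^esub> b (a (\<iota> z))"
   using t(2)[OF iz] ue[OF iz] iz bc[OF ac[OF iz]] by (simp add: a_minus_def P.M.minus_equality[of "\<zero>\<^bsub>?P\<^esub>" "\<zero>\<^bsub>?P\<^esub>"] del: free_simps)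
  then have "\<iota> (\<beta>' (\<alpha>' z) \<oplus>\<^sub>Z t (\<iota> z)) = \<iota> z"
   using Hom_closed[OF \<beta>'(1) az] Hom_closed[OF t(1) iz] iz bc[OF ac[OF iz]]
   by (simp add: ba a_minus_def P.M.add_cancel del: free_simps)
  then show "z = \<beta>' (\<alpha>' z) \<oplus>\<^sub>Z t (\<iota> z)"
   using inj_onD[OF se(3) _ _ z] Hom_closed[OF \<beta>'(1) az] Hom_closed[OF t(1) iz] by (metis Z.M.a_closed)
 qed
qed

text \<open>The bijection \<open>d\<close> makes \<open>N'\<close> projective. The identity of
  \<open>N\<close> is then a sum of a map through \<open>Q\<close> and one through a free module,
  and both lift along \<open>p\<close>.\<close>

lemma free_retract_section:
 fixes Q N' :: "'r lmod"
 assumes "ring R" "LMod R N" "LMod R N'" "projective_module R Q" "d \<in> Hom R Q N'" "bij_betw d (carrier Q) (carrier N')"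
  and "free_retract R N N'" "p \<in> Hom R (Free R n) N" "p ` carrier (Free R n) = carrier N"
 obtains \<sigma> where "\<sigma> \<in> Hom R N (Free R n)" "\<And>x. x \<in> carrier N \<Longrightarrow> p (\<sigma> x) = x"
proof -
 let ?P = "Free R n"
 have P: "LMod R ?P" "fin_gen R ?P" using assms(1) by (rule free_left_module, rule free_fin_gen)
 have Q: "LMod R Q" using assms(4) by (simp add: projective_module_def)
 interpret p: lhom R ?P N p using P(1) assms(2,8) by (rule lhomI)
 obtain \<alpha> \<beta> k s0 t0 where *: "\<alpha> \<in> Hom R N N'" "\<beta> \<in> Hom R N' N" "s0 \<in> Hom R N (Free R k)" "t0 \<in> Hom R (Free R k) N"
  "\<forall>x\<in>carrier N. x = \<beta> (\<alpha> x) \<oplus>\<^sub>N t0 (s0 x)"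
  using assms(7) unfolding free_retract_def by blast
 obtain l where l: "l \<in> Hom R (Free R k) ?P" "\<And>x. x \<in> carrier (Free R k) \<Longrightarrow> p (l x) = t0 x"
  by (rule free_lift[OF assms(1) P(1) assms(2,8,9) *(4)]) (rule that)
 obtain b where b: "b \<in> Hom R Q ?P" "\<And>x. x \<in> carrier Q \<Longrightarrow> p (b x) = (\<lambda>x\<in>carrier Q. \<beta> (d x)) x"
  by (rule projective_lift[OF assms(4) P assms(2,8,9) Hom_comp[OF Q assms(5) *(2)]]) (rule that)
 obtain d' where d': "d' \<in> Hom R N' Q" "\<And>x. x \<in> carrier Q \<Longrightarrow> d' (d x) = x" "\<And>y. y \<in> carrier N' \<Longrightarrow> d (d' y) = y"
  by (rule Hom_inv[OF Q assms(3,5,6)]) (rule that)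
 note h1 = Hom_comp[OF assms(2) Hom_comp[OF assms(2) *(1) d'(1)] b(1)] and h2 = Hom_comp[OF assms(2) *(3) l(1)]
 show ?thesis
 proof (rule that[OF Hom_plus[OF assms(2) P(1) h1 h2]])
  fix x assume x: "x \<in> carrier N"
  note ax = Hom_closed[OF *(1) x]
  note dx = Hom_closed[OF d'(1) ax] and sx = Hom_closed[OF *(3) x]
  have "p (b (d' (\<alpha> x)) \<oplus>\<^bsub>?P\<^esub> l (s0 x)) = p (b (d' (\<alpha> x))) \<oplus>\<^sub>N p (l (s0 x))"
   using Hom_closed[OF b(1) dx] Hom_closed[OF l(1) sx] by (rule p.add)
  also have "\<dots> = \<beta> (\<alpha> x) \<oplus>\<^sub>N t0 (s0 x)" using b(2)[OF dx] l(2)[OF sx] d'(3)[OF ax] dx by simp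
  also have "\<dots> = x" using *(5) x by simp
  finally show "p ((\<lambda>x\<in>carrier N. (\<lambda>x\<in>carrier N. b ((\<lambda>x\<in>carrier N. d' (\<alpha> x)) x)) x \<oplus>\<^bsub>?P\<^esub> (\<lambda>x\<in>carrier N. l (s0 x)) x) x) = x"
   using x by (simp del: free_simps)
 qed
qed

text \<open>\<open>Z\<close> lists the syzygies. In \<open>proj_resolution_le\<close> the resolved
  module has index 0, so the projective modules obtained here are shifted by one. The last condition
  says that \<open>Z n\<close> is itself projective.\<close>

lemma resolution_syzygies:
 fixes N :: "'r lmod"
 assumes "LMod R N" "proj_resolution_le R N n"
 obtains Z Q :: "nat \<Rightarrow> 'r lmod" and \<iota> d where "Z 0 = N" "\<And>i. LMod R (Z i)" "\<And>i. projective_module R (Q i)"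
  "\<And>i. short_exact R (Z (Suc i)) (Q i) (Z i) (\<iota> i) (d i)" "bij_betw (d n) (carrier (Q n)) (carrier (Z n))"
proof -
 obtain Q :: "nat \<Rightarrow> 'r lmod" and d where H: "Q 0 = N \<and> (\<forall>i. projective_module R (Q (Suc i))) \<and>
  (\<forall>i>n. carrier (Q (Suc i)) = {\<zero>\<^bsub>Q (Suc i)\<^esub>}) \<and> (\<forall>i. d i \<in> Hom R (Q (Suc i)) (Q i)) \<and>
  d 0 ` carrier (Q 1) = carrier N \<and>
  (\<forall>i. d (Suc i) ` carrier (Q (Suc (Suc i))) = {x \<in> carrier (Q (Suc i)). d i x = \<zero>\<^bsub>Q i\<^esub>})"
  using assms(2) unfolding proj_resolution_le_def by (elim exE) (rule that)
 note H2 = H[THEN conjunct2] note H4 = H2[THEN conjunct2, THEN conjunct2]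
 note * = H[THEN conjunct1] H2[THEN conjunct1, rule_format] H2[THEN conjunct2, THEN conjunct1, rule_format]
  H4[THEN conjunct1, rule_format] H4[THEN conjunct2, THEN conjunct1] H4[THEN conjunct2, THEN conjunct2, rule_format]
 have lm: "LMod R (Q i)" for i
  using assms(1) *(1) *(2)[of "i - 1"] by (cases i) (simp_all add: projective_module_def)
 define Z where "Z i = (case i of 0 \<Rightarrow> N | Suc j \<Rightarrow> (Q i)\<lparr>carrier := {x \<in> carrier (Q i). d j x = \<zero>\<^bsub>Q j\<^esub>}\<rparr>)" for i
 have dl: "lhom R (Q (Suc i)) (Q i) (d i)" for i using lm lm *(4) by (rule lhomI)
 have Zlm: "LMod R (Z i)" for i
 proof (cases i)
  case 0 then show ?thesis using assms(1) by (simp add: Z_def)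
 next
  case (Suc j)
  then show ?thesis using left_module.submodule_left_module[OF lm lhom.kernel[OF dl]] by (simp add: Z_def)
 qed
 have im: "d i ` carrier (Q (Suc i)) = carrier (Z i)" for i
  using *(5,6) by (cases i) (simp_all add: Z_def)
 have zero: "\<zero>\<^bsub>Z i\<^esub> = \<zero>\<^bsub>Q i\<^esub>" for i using *(1) by (cases i) (simp_all add: Z_def)
 have dh: "d i \<in> Hom R (Q (Suc i)) (Z i)" for i
 proof -
  have "d i x \<in> carrier (Z i)" if "x \<in> carrier (Q (Suc i))" for x using im that by blast
  then have "d i \<in> carrier (Q (Suc i)) \<rightarrow>\<^sub>E carrier (Z i)" using *(4)[of i] by (auto simp: mod_hom_def PiE_def)
  moreover have "x \<oplus>\<^bsub>Z i\<^esub> y = x \<oplus>\<^bsub>Q i\<^esub> y" "r \<odot>\<^bsub>Z i\<^esub> x = r \<odot>\<^bsub>Q i\<^esub> x" for x y r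
   using *(1) by (cases i; simp add: Z_def)+
  ultimately show ?thesis using *(4)[of i] by (simp add: mod_hom_def)
 qed
 have cZ: "carrier (Z (Suc i)) = {x \<in> carrier (Q (Suc i)). d i x = \<zero>\<^bsub>Q i\<^esub>}" for i by (simp add: Z_def)
 have inc: "(\<lambda>x\<in>carrier (Z (Suc i)). x) \<in> Hom R (Z (Suc i)) (Q (Suc i))" for i
  using left_module.Hom_inclusion[OF lm lhom.kernel[OF dl]] by (simp add: Z_def)
 have se: "short_exact R (Z (Suc i)) (Q (Suc i)) (Z i) (\<lambda>x\<in>carrier (Z (Suc i)). x) (d i)" for i
  unfolding short_exact_def
 proof (intro conjI inc dh im)
  show "inj_on (\<lambda>x\<in>carrier (Z (Suc i)). x) (carrier (Z (Suc i)))" by (auto intro: inj_onI)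
  have "(\<lambda>x\<in>carrier (Z (Suc i)). x) ` carrier (Z (Suc i)) = carrier (Z (Suc i))" by simp
  then show "(\<lambda>x\<in>carrier (Z (Suc i)). x) ` carrier (Z (Suc i)) = {y \<in> carrier (Q (Suc i)). d i y = \<zero>\<^bsub>Z i\<^esub>}"
   unfolding cZ zero .
 qed
 \<comment> \<open>The kernel of \<open>d n\<close> is the image of the first term that
   vanishes.\<close>
 have "inj_on (d n) (carrier (Q (Suc n)))"
 proof (rule lhom.inj_onI[OF dl])
  fix x assume "x \<in> carrier (Q (Suc n))" "d n x = \<zero>\<^bsub>Q n\<^esub>"
  then have "x \<in> d (Suc n) ` carrier (Q (Suc (Suc n)))" unfolding *(6) by simp
  then show "x = \<zero>\<^bsub>Q (Suc n)\<^esub>" using *(3)[of "Suc n"] lhom.zero[OF dl[of "Suc n"]] by simp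
 qed
 then have "bij_betw (d n) (carrier (Q (Suc n))) (carrier (Z n))" using im by (simp add: bij_betw_def)
 moreover have "Z 0 = N" by (simp add: Z_def)
 ultimately show ?thesis using that[of Z "\<lambda>i. Q (Suc i)" "\<lambda>i. \<lambda>x\<in>carrier (Z (Suc i)). x" d] Zlm *(2) se by blast
qed

lemma gl_dim_resolution:
 fixes N :: "'r lmod"
 assumes "gl_dim R \<le> enat n" "LMod R N"
 shows "proj_resolution_le R N n"
proof -
 have "proj_dim R N \<le> gl_dim R" unfolding gl_dim_def using assms(2) by (intro SUP_upper) simp
 then have le: "proj_dim R N \<le> enat n" using assms(1) by simp
 let ?S = "{enat m |m. proj_resolution_le R N m}"
 \<comment> \<open>A finite infimum in \<open>enat\<close> comes from a non-empty set, and there it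
   is attained.\<close>
 have "?S \<noteq> {}" using le by (auto simp: proj_dim_def Inf_enat_def split: if_splits)
 then have "Inf ?S \<in> ?S" unfolding Inf_enat_def by (auto intro: LeastI)
 then obtain m where m: "m \<le> n" "proj_resolution_le R N m" using le unfolding proj_dim_def by auto
 \<comment> \<open>A resolution of length \<open>m\<close> also counts as one of length
   \<open>n\<close>, since fewer terms are then required to vanish.\<close>
 have imp: "(\<forall>i>m. P i) \<longrightarrow> (\<forall>i>n. P i)" for P using m(1) by auto
 show ?thesis using m(2) unfolding proj_resolution_le_def by (elim ex_forward conj_forward) (use imp in blast)+
qed

section \<open>Modules over endomorphism rings\<close>

lemma End_simps [simp]: "carrier (End_ring R M) = Hom R M M" "\<one>\<^bsub>End_ring R M\<^esub> = (\<lambda>x\<in>carrier M. x)"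
 "\<zero>\<^bsub>End_ring R M\<^esub> = (\<lambda>x\<in>carrier M. \<zero>\<^sub>M)" "f \<otimes>\<^bsub>End_ring R M\<^esub> g = (\<lambda>x\<in>carrier M. f (g x))"
 "f \<oplus>\<^bsub>End_ring R M\<^esub> g = (\<lambda>x\<in>carrier M. f x \<oplus>\<^sub>M g x)"
 by (simp_all add: End_ring_def compose_def)

lemma End_ring_ring:
 fixes M :: "('r, 'm) module"
 assumes "LMod R M" shows "ring (End_ring R M)"
proof (rule ringI)
 interpret M: left_module R M by fact
 have c: "f x \<in> carrier M" if "f \<in> Hom R M M" "x \<in> carrier M" for f x using that by (rule Hom_closed)
 show "abelian_group (End_ring R M)"
  by (rule abelian_group_cong[OF star_abelian_group[OF assms assms]]) simp_all
 show "monoid (End_ring R M)"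
 proof (rule monoidI)
  fix f g h assume *: "f \<in> carrier (End_ring R M)" "g \<in> carrier (End_ring R M)" "h \<in> carrier (End_ring R M)"
  then show "f \<otimes>\<^bsub>End_ring R M\<^esub> g \<otimes>\<^bsub>End_ring R M\<^esub> h = f \<otimes>\<^bsub>End_ring R M\<^esub> (g \<otimes>\<^bsub>End_ring R M\<^esub> h)"
   using c[of h] by (auto simp: fun_eq_iff)
 next
  fix f assume "f \<in> carrier (End_ring R M)"
  then have f: "f \<in> Hom R M M" by simp
  have "\<one>\<^bsub>End_ring R M\<^esub> \<otimes>\<^bsub>End_ring R M\<^esub> f = (\<lambda>x\<in>carrier M. f x)" "f \<otimes>\<^bsub>End_ring R M\<^esub> \<one>\<^bsub>End_ring R M\<^esub> = (\<lambda>x\<in>carrier M. f x)"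
   using c[OF f] by (auto simp: fun_eq_iff)
  then show "\<one>\<^bsub>End_ring R M\<^esub> \<otimes>\<^bsub>End_ring R M\<^esub> f = f" "f \<otimes>\<^bsub>End_ring R M\<^esub> \<one>\<^bsub>End_ring R M\<^esub> = f"
   using Hom_restrict_self[OF f] by simp_all
 qed (use Hom_comp[OF assms] Hom_id[OF assms] in simp_all)
 fix f g h assume *: "f \<in> carrier (End_ring R M)" "g \<in> carrier (End_ring R M)" "h \<in> carrier (End_ring R M)"
 then show "(f \<oplus>\<^bsub>End_ring R M\<^esub> g) \<otimes>\<^bsub>End_ring R M\<^esub> h = f \<otimes>\<^bsub>End_ring R M\<^esub> h \<oplus>\<^bsub>End_ring R M\<^esub> g \<otimes>\<^bsub>End_ring R M\<^esub> h"
  using c[of h] by (auto simp: fun_eq_iff)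
 have h: "h \<in> Hom R M M" using * by simp
 show "h \<otimes>\<^bsub>End_ring R M\<^esub> (f \<oplus>\<^bsub>End_ring R M\<^esub> g) = h \<otimes>\<^bsub>End_ring R M\<^esub> f \<oplus>\<^bsub>End_ring R M\<^esub> h \<otimes>\<^bsub>End_ring R M\<^esub> g"
  using c[of f] c[of g] * by (auto simp: fun_eq_iff Hom_add[OF h])
qed

lemma star_left_module:
 assumes "LMod R C" "LMod R M"
 shows "LMod (End_ring R M) (star R M C)"
proof (rule left_module.intro[OF End_ring_ring[OF assms(2)] star_abelian_group[OF assms]], rule left_module_axioms.intro)
 interpret M: left_module R M by fact
 have c: "f x \<in> carrier M" if "f \<in> carrier (star R M C)" "x \<in> carrier C" for f x using that Hom_closed[of f R C M x] by simp
 fix f assume f: "f \<in> carrier (star R M C)"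
 have "\<one>\<^bsub>End_ring R M\<^esub> \<odot>\<^bsub>star R M C\<^esub> f = (\<lambda>x\<in>carrier C. f x)" using c[OF f] by (auto simp: fun_eq_iff)
 then show "\<one>\<^bsub>End_ring R M\<^esub> \<odot>\<^bsub>star R M C\<^esub> f = f" using Hom_restrict_self[of f R C M] f by simp
next
 interpret M: left_module R M by fact
 have c: "f x \<in> carrier M" if "f \<in> carrier (star R M C)" "x \<in> carrier C" for f x using that Hom_closed[of f R C M x] by simp
 fix a f assume a: "a \<in> carrier (End_ring R M)" and f: "f \<in> carrier (star R M C)"
 have a': "a \<in> Hom R M M" using a by simp
 show "a \<odot>\<^bsub>star R M C\<^esub> f \<in> carrier (star R M C)" using a f Hom_comp[OF assms(1), of f M a M] by simp
 { fix b assume "b \<in> carrier (End_ring R M)"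
  show "(a \<oplus>\<^bsub>End_ring R M\<^esub> b) \<odot>\<^bsub>star R M C\<^esub> f = a \<odot>\<^bsub>star R M C\<^esub> f \<oplus>\<^bsub>star R M C\<^esub> b \<odot>\<^bsub>star R M C\<^esub> f"
   "(a \<otimes>\<^bsub>End_ring R M\<^esub> b) \<odot>\<^bsub>star R M C\<^esub> f = a \<odot>\<^bsub>star R M C\<^esub> (b \<odot>\<^bsub>star R M C\<^esub> f)"
   using c[OF f] by (auto simp: fun_eq_iff) }
 fix g assume g: "g \<in> carrier (star R M C)"
 show "a \<odot>\<^bsub>star R M C\<^esub> (f \<oplus>\<^bsub>star R M C\<^esub> g) = a \<odot>\<^bsub>star R M C\<^esub> f \<oplus>\<^bsub>star R M C\<^esub> a \<odot>\<^bsub>star R M C\<^esub> g"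
  using c[OF f] c[OF g] by (auto simp: fun_eq_iff Hom_add[OF a'])
qed

text \<open>\<open>Hom(C, M)\<close> is finite dimensional, since evaluation at generators of
  \<open>C\<close> embeds it in a power of \<open>M\<close>. Central scalars act on \<open>M\<close>
  by endomorphisms, so generators over the field generate over \<open>End_ring R M\<close>.\<close>

lemma (in fd_algebra) star_fin_gen:
 assumes M: "LMod R M" "fin_gen R M" and C: "LMod R C" "fin_gen R C"
 shows "fin_gen (End_ring R M) (star R M C)"
proof -
 let ?G = "End_ring R M" and ?\<psi> = "\<lambda>c. \<lambda>x\<in>carrier M. \<phi> c \<odot>\<^sub>M x"
 interpret M: left_module R M by fact
 interpret C: left_module R C by fact
 have c1: "\<phi> c \<odot>\<^sub>M (r \<odot>\<^sub>M x) = r \<odot>\<^sub>M (\<phi> c \<odot>\<^sub>M x)" if "c \<in> carrier K" "r \<in> carrier R" "x \<in> carrier M" for c r x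
  using that central[of c r] M.smult_assoc[of "\<phi> c" r x] M.smult_assoc[of r "\<phi> c" x] by simp
 have h: "?\<psi> c \<in> Hom R M M" if "c \<in> carrier K" for c
  using M(1) by (rule Hom_restrictI) (use that c1 in \<open>auto simp: M.smult_r_distr\<close>)
 note rh = ring_hom_mult[OF hom] ring_hom_add[OF hom] ring_hom_one[OF hom]
 have \<psi>: "?\<psi> \<in> ring_hom K ?G"
  by (rule ring_hom_memI) (auto simp: h fun_eq_iff rh M.smult_assoc M.smult_l_distr)
 have S: "LMod ?G (star R M C)" by (rule star_left_module[OF C(1) M(1)])
 have RS: "LMod K (restr ?\<psi> (star R M C))" by (rule restr_left_module[OF K.ring_axioms S \<psi>])
 obtain T where T: "finite T" "T \<subseteq> carrier C" "carrier C \<subseteq> lspan R C T" using C(2) C.fin_gen_iff by auto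
 let ?P = "pi_module T (\<lambda>_. restr \<phi> M)"
 have P: "LMod K ?P" "fin_gen K ?P"
  using M by (auto intro!: pi_left_module pi_fin_gen K.ring_axioms restr_module fin_gen_restr T(1))
 let ?r = "\<lambda>f\<in>carrier (restr ?\<psi> (star R M C)). \<lambda>t\<in>T. f t"
 have cl: "f x \<in> carrier M" if "f \<in> Hom R C M" "x \<in> carrier C" for f x using that by (rule Hom_closed)
 have r: "?r \<in> Hom K (restr ?\<psi> (star R M C)) ?P"
  using RS by (rule Hom_restrictI) (use T(2) cl in \<open>auto simp: fun_eq_iff subsetD\<close>)
 have "inj_on ?r (carrier (restr ?\<psi> (star R M C)))"
 proof (rule inj_onI)
  fix f g assume f: "f \<in> carrier (restr ?\<psi> (star R M C))" and g: "g \<in> carrier (restr ?\<psi> (star R M C))" and eq: "?r f = ?r g"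
  have f': "f \<in> Hom R C M" and g': "g \<in> Hom R C M" using f g by simp_all
  have eqT: "f t = g t" if "t \<in> T" for t using fun_cong[OF eq, of t] f g that by (simp split: if_splits)
  show "f = g" by (rule hom_eq_on_generators[OF C(1) M(1) f' g' T(2,3) eqT])
 qed
 then have "fin_gen K (restr ?\<psi> (star R M C))"
  by (rule field_fin_gen_inj[OF K.field_axioms RS P(1) r _ P(2)])
 then show ?thesis by (rule fin_gen_restrD[OF K.ring_axioms S \<psi>])
qed

section \<open>Summands and biproducts\<close>

lemma (in left_module) summand_projection:
 assumes "submodule N R M" "submodule N' R M" "N \<inter> N' = {\<zero>\<^sub>M}" "N <+>\<^bsub>M\<^esub> N' = carrier M"
 obtains p where "p \<in> Hom R M (M\<lparr>carrier := N\<rparr>)" "\<And>x. x \<in> N \<Longrightarrow> p x = x"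
proof -
 note N = submoduleD[OF assms(1)] and N' = submoduleD[OF assms(2)]
 have "\<exists>a. a \<in> N \<and> x \<ominus>\<^sub>M a \<in> N'" if x: "x \<in> carrier M" for x
 proof -
  have "x \<in> N <+>\<^bsub>M\<^esub> N'" using x assms(4) by simp
  then obtain a b where ab: "a \<in> N" "b \<in> N'" "x = a \<oplus>\<^sub>M b" unfolding set_add_def set_mult_def by auto
  have c: "a \<in> carrier M" "b \<in> carrier M" using ab N(1) N'(1) by auto
  have "x \<ominus>\<^sub>M a = b" using c unfolding ab(3) by (simp add: a_minus_def M.add_cancel M.a_assoc)
  then show ?thesis using ab by auto
 qed
 then have "\<forall>x\<in>carrier M. \<exists>a. a \<in> N \<and> x \<ominus>\<^sub>M a \<in> N'" by blast
 from bchoice[OF this] obtain p where "\<forall>x\<in>carrier M. p x \<in> N \<and> x \<ominus>\<^sub>M p x \<in> N'" ..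
 then have p: "p x \<in> N" "x \<ominus>\<^sub>M p x \<in> N'" "p x \<in> carrier M" if "x \<in> carrier M" for x using that N(1) by auto
 have u: "a = a'" if "a \<in> N" "a' \<in> N" "x \<in> carrier M" "x \<ominus>\<^sub>M a \<in> N'" "x \<ominus>\<^sub>M a' \<in> N'" for a a' x
 proof -
  have c: "a \<in> carrier M" "a' \<in> carrier M" using that N(1) by auto
  have "(x \<ominus>\<^sub>M a') \<ominus>\<^sub>M (x \<ominus>\<^sub>M a) = a \<ominus>\<^sub>M a'"
   using c that(3) by (simp add: a_minus_def M.minus_add M.a_ac M.add_cancel)
  then have "a \<ominus>\<^sub>M a' \<in> N \<inter> N'" using N'(6)[OF that(5,4)] N(6)[OF that(1,2)] by simp
  then show ?thesis using c M.minus_eq_zero_iff unfolding assms(3) by simp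
 qed
 show ?thesis
 proof (rule that[of "\<lambda>x\<in>carrier M. p x"])
  show "(\<lambda>x\<in>carrier M. p x) \<in> Hom R M (M\<lparr>carrier := N\<rparr>)" using left_module_axioms
  proof (rule Hom_restrictI)
   fix x y assume x: "x \<in> carrier M" and y: "y \<in> carrier M"
   have "(x \<oplus>\<^sub>M y) \<ominus>\<^sub>M (p x \<oplus>\<^sub>M p y) = (x \<ominus>\<^sub>M p x) \<oplus>\<^sub>M (y \<ominus>\<^sub>M p y)"
    using x y p by (simp add: a_minus_def M.minus_add M.a_ac)
   then have "p (x \<oplus>\<^sub>M y) = p x \<oplus>\<^sub>M p y"
    using x y p N(3) N'(3)[OF p(2)[OF x] p(2)[OF y]] by (intro u[of _ _ "x \<oplus>\<^sub>M y"]) simp_all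
   then show "p (x \<oplus>\<^sub>M y) = p x \<oplus>\<^bsub>M\<lparr>carrier := N\<rparr>\<^esub> p y" by simp
  next
   fix r x assume r: "r \<in> carrier R" and x: "x \<in> carrier M"
   have "r \<odot>\<^sub>M x \<ominus>\<^sub>M r \<odot>\<^sub>M p x = r \<odot>\<^sub>M (x \<ominus>\<^sub>M p x)"
    using r x p by (simp add: a_minus_def smult_r_distr smult_neg_right)
   then have "p (r \<odot>\<^sub>M x) = r \<odot>\<^sub>M p x"
    using r x p N(5) N'(5)[OF r p(2)[OF x]] by (intro u[of _ _ "r \<odot>\<^sub>M x"]) simp_all
   then show "p (r \<odot>\<^sub>M x) = r \<odot>\<^bsub>M\<lparr>carrier := N\<rparr>\<^esub> p x" by simp
  qed (use p in simp)
  fix x assume x: "x \<in> N"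
  then have xc: "x \<in> carrier M" using N(1) by auto
  have "p x = x" using x xc N'(2) p[OF xc] by (intro u[of _ _ x]) (simp_all add: a_minus_def M.r_neg)
  then show "(\<lambda>x\<in>carrier M. p x) x = x" using xc by simp
 qed
qed

text \<open>The form in which membership in \<open>add M\<close> is used: a retract of a power of
  \<open>M\<close>, with explicit maps.\<close>

lemma in_addE:
 fixes M :: "('r, 'm) module" and W :: "('r, 'n, 'z) module_scheme"
 assumes "LMod R M" "in_add R W M"
 obtains n :: nat and u v where "u \<in> Hom R W (pi_module {..<n} (\<lambda>_. M))" "v \<in> Hom R (pi_module {..<n} (\<lambda>_. M)) W"
  "\<And>w. w \<in> carrier W \<Longrightarrow> v (u w) = w"
proof -
 obtain n N where W: "LMod R W" and N: "direct_summand R N (module_power M n)"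
  and iso: "mod_iso R W (module_power M n\<lparr>carrier := N\<rparr>)"
  using assms(2) unfolding in_add_def by blast
 let ?P = "pi_module {..<n} (\<lambda>_. M)"
 let ?Q = "?P\<lparr>carrier := N\<rparr>"
 interpret M: left_module R M by fact
 interpret P: left_module R ?P by (intro pi_left_module M.R.ring_axioms assms(1))
 obtain N' where N': "submodule N R ?P" "submodule N' R ?P" "N \<inter> N' = {\<zero>\<^bsub>?P\<^esub>}" "N <+>\<^bsub>?P\<^esub> N' = carrier ?P"
  using N unfolding direct_summand_def module_power_eq by blast
 obtain f where f: "f \<in> Hom R W ?Q" "bij_betw f (carrier W) (carrier ?Q)"
  using iso unfolding mod_iso_def module_power_eq by blast
 have Q: "LMod R ?Q" by (rule P.submodule_left_module[OF N'(1)])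
 obtain p where p: "p \<in> Hom R ?P ?Q" "\<And>x. x \<in> N \<Longrightarrow> p x = x"
  by (rule P.summand_projection[OF N']) (rule that)
 obtain g where g: "g \<in> Hom R ?Q W" "\<And>x. x \<in> carrier W \<Longrightarrow> g (f x) = x" "\<And>y. y \<in> carrier ?Q \<Longrightarrow> f (g y) = y"
  by (rule Hom_inv[OF W Q f]) (rule that)
 show ?thesis
 proof (rule that[OF Hom_comp[OF W f(1) P.Hom_inclusion[OF N'(1)]] Hom_comp[OF P.left_module_axioms p(1) g(1)]])
  fix w assume w: "w \<in> carrier W"
  have fN: "f w \<in> N" using Hom_closed[OF f(1) w] by simp
  then have "f w \<in> carrier ?P" using P.submoduleD(1)[OF N'(1)] by blast
  then show "(\<lambda>x\<in>carrier ?P. g (p x)) ((\<lambda>w\<in>carrier W. (\<lambda>x\<in>N. x) (f w)) w) = w"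
   using w fN p(2) g(2) by (simp del: pi_module_simps)
 qed
qed

lemma pi_sum_hom:
 assumes "ring R" "\<And>i. i \<in> I \<Longrightarrow> LMod R (M i)" "LMod R W" "finite I" "\<And>i. i \<in> I \<Longrightarrow> f i \<in> Hom R (M i) W"
 shows "(\<lambda>x\<in>carrier (pi_module I M). finsum W (\<lambda>i. f i (x i)) I) \<in> Hom R (pi_module I M) W"
proof -
 interpret W: left_module R W by fact
 have P: "LMod R (pi_module I M)" by (rule pi_left_module[OF assms(1,2)])
 have "(\<lambda>x\<in>carrier (pi_module I M). f i ((\<lambda>x\<in>carrier (pi_module I M). x i) x)) \<in> Hom R (pi_module I M) W" if "i \<in> I" for i
  by (rule Hom_comp[OF P pi_proj_hom[OF assms(1,2) that] assms(5)[OF that]])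
 from Hom_finsum[OF P assms(3,4) this]
 have "(\<lambda>x\<in>carrier (pi_module I M). finsum W (\<lambda>i. (\<lambda>x\<in>carrier (pi_module I M). f i ((\<lambda>x\<in>carrier (pi_module I M). x i) x)) x) I)
  \<in> Hom R (pi_module I M) W" .
 also have "(\<lambda>x\<in>carrier (pi_module I M). finsum W (\<lambda>i. (\<lambda>x\<in>carrier (pi_module I M). f i ((\<lambda>x\<in>carrier (pi_module I M). x i) x)) x) I)
  = (\<lambda>x\<in>carrier (pi_module I M). finsum W (\<lambda>i. f i (x i)) I)"
  by (simp cong: restrict_cong)
 finally show ?thesis .
qed

lemma pi_hom_eq:
 assumes "ring R" "\<And>i. i \<in> I \<Longrightarrow> LMod R (M i)" "finite I" "LMod R W" "h \<in> Hom R (pi_module I M) W"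
  and "x \<in> carrier (pi_module I M)"
 shows "h x = finsum W (\<lambda>i. h (pi_inj I M i (x i))) I"
proof -
 have P: "LMod R (pi_module I M)" by (rule pi_left_module[OF assms(1,2)])
 interpret h: lhom R "pi_module I M" W h using P assms(4,5) by (rule lhomI)
 have "pi_inj I M i (x i) \<in> carrier (pi_module I M)" if "i \<in> I" for i
 proof -
  have "x i \<in> carrier (M i)" using assms(6) that by auto
  with Hom_closed[OF pi_inj_hom[of R I M i, OF assms(1,2) that] this] show ?thesis by simp
 qed
 then have "(\<lambda>i. pi_inj I M i (x i)) \<in> I \<rightarrow> carrier (pi_module I M)" by blast
 from h.finsum[OF assms(3) this] show ?thesis using pi_decomp[OF assms(1,2,3,6)] by simp
qed

lemma pi_tuple_hom:
 assumes "LMod R W" "\<And>i. i \<in> I \<Longrightarrow> f i \<in> Hom R W (M i)"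
 shows "(\<lambda>w\<in>carrier W. \<lambda>i\<in>I. f i w) \<in> Hom R W (pi_module I M)"
 using assms(1)
proof (rule Hom_restrictI)
 fix x y assume x: "x \<in> carrier W" and y: "y \<in> carrier W"
 show "(\<lambda>i\<in>I. f i (x \<oplus>\<^sub>W y)) = (\<lambda>i\<in>I. f i x) \<oplus>\<^bsub>pi_module I M\<^esub> (\<lambda>i\<in>I. f i y)"
  using Hom_add[OF assms(2) x y] by (auto simp: fun_eq_iff)
next
 fix r x assume r: "r \<in> carrier R" and x: "x \<in> carrier W"
 show "(\<lambda>i\<in>I. f i (r \<odot>\<^sub>W x)) = r \<odot>\<^bsub>pi_module I M\<^esub> (\<lambda>i\<in>I. f i x)"
  using Hom_smult[OF assms(2) r x] by (auto simp: fun_eq_iff)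
next
 fix x assume x: "x \<in> carrier W"
 show "(\<lambda>i\<in>I. f i x) \<in> carrier (pi_module I M)" using Hom_closed[OF assms(2) x] by auto
qed

section \<open>Finite direct sums in the stable category\<close>

context stable_ring
begin
lemma biproduct:
 assumes "obj W" "obj Y"
 obtains S i j p q where "obj S" "i \<in> hm W S" "j \<in> hm Y S" "p \<in> hm S W" "q \<in> hm S Y"
  "\<And>x. x \<in> carrier W \<Longrightarrow> p (i x) = x" "\<And>y. y \<in> carrier Y \<Longrightarrow> q (j y) = y"
  "\<And>x. x \<in> carrier W \<Longrightarrow> q (i x) = \<zero>\<^sub>Y" "\<And>y. y \<in> carrier Y \<Longrightarrow> p (j y) = \<zero>\<^sub>W"
  "\<And>s. s \<in> carrier S \<Longrightarrow> s = i (p s) \<oplus>\<^sub>S j (q s)"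
proof -
 \<comment> \<open>Indexing the two modules by \<open>bool\<close> makes their direct sum a case of
   \<open>pi_module\<close>, which is then copied to the universe.\<close>
 define N where "N b = (if b then W else Y)" for b
 let ?P = "pi_module UNIV N"
 have N [simp]: "N True = W" "N False = Y" by (simp_all add: N_def)
 have NO: "lm (N b)" "fin_gen R (N b)" for b using assms by (cases b; simp add: obj_def)+
 have P: "lm ?P" by (intro pi_left_module ring_axioms NO)
 have Pf: "fin_gen R ?P" by (intro pi_fin_gen ring_axioms NO) simp
 obtain S :: "'r lmod" and e d where S: "lm S" "fin_gen R S" "e \<in> Hom R ?P S" "d \<in> Hom R S ?P"
  "\<And>x. x \<in> carrier ?P \<Longrightarrow> d (e x) = x" "\<And>y. y \<in> carrier S \<Longrightarrow> e (d y) = y"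
  by (rule fin_gen_copy_iso[OF P Pf]) (rule that)
 define i where "i b = (\<lambda>x\<in>carrier (N b). e ((\<lambda>x\<in>carrier (N b). pi_inj UNIV N b x) x))" for b
 define p where "p b = (\<lambda>s\<in>carrier S. (\<lambda>x\<in>carrier ?P. x b) (d s))" for b
 have ih: "(\<lambda>x\<in>carrier (N b). pi_inj UNIV N b x) \<in> Hom R (N b) ?P" for b by (rule pi_inj_hom[OF ring_axioms NO(1)]) simp
 have ph: "(\<lambda>x\<in>carrier ?P. x b) \<in> Hom R ?P (N b)" for b by (rule pi_proj_hom[OF ring_axioms NO(1)]) simp
 have i: "i b \<in> hm (N b) S" for b unfolding i_def by (rule Hom_comp[OF NO(1) ih S(3)])
 have p: "p b \<in> hm S (N b)" for b unfolding p_def by (rule Hom_comp[OF S(1,4) ph])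
 have ic: "pi_inj UNIV N b x \<in> carrier ?P" if "x \<in> carrier (N b)" for b x using Hom_closed[OF ih that] that by simp
 have ie: "i b x = e (pi_inj UNIV N b x)" if "x \<in> carrier (N b)" for b x using that by (simp add: i_def)
 have pe: "p b s = d s b" if "s \<in> carrier S" for b s using that Hom_closed[OF S(4) that] by (simp add: p_def)
 have pi: "p c (i b x) = (if c = b then x else \<zero>\<^bsub>N c\<^esub>)" if "x \<in> carrier (N b)" for b c x
  using pe[OF Hom_closed[OF i that]] S(5)[OF ic[OF that]] by (simp add: ie[OF that] pi_inj_def)
 show ?thesis
 proof (rule that[of S "i True" "i False" "p True" "p False"])
  fix s assume s: "s \<in> carrier S"
  interpret e: lhom R ?P S e using P S(1,3) by (rule lhomI)
  have ds: "d s b \<in> carrier (N b)" for b using Hom_closed[OF S(4) s] by auto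
  have dW: "d s True \<in> carrier W" and dY: "d s False \<in> carrier Y" using ds[of True] ds[of False] by simp_all
  interpret W: left_module R W using assms by (simp add: obj_def)
  interpret Y: left_module R Y using assms by (simp add: obj_def)
  have "d s b = (pi_inj UNIV N True (d s True) \<oplus>\<^bsub>?P\<^esub> pi_inj UNIV N False (d s False)) b" for b
   using dW dY by (cases b) (simp_all add: pi_inj_def)
  then have "d s = pi_inj UNIV N True (d s True) \<oplus>\<^bsub>?P\<^esub> pi_inj UNIV N False (d s False)" by blast
  then have "e (d s) = i True (p True s) \<oplus>\<^sub>S i False (p False s)"
   using ie[OF ds, of True] ie[OF ds, of False] e.add[OF ic[OF ds[of True]] ic[OF ds[of False]]]
   by (simp add: pe[OF s] del: pi_module_simps)
  then show "s = i True (p True s) \<oplus>\<^sub>S i False (p False s)" using S(6)[OF s] by simp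
 qed (use i[of True] i[of False] p[of True] p[of False] pi[of _ True] pi[of _ False] S(1,2) in \<open>simp_all add: obj_def\<close>)
qed

text \<open>The hypotheses describe \<open>W\<close> as a retract of the power of \<open>M\<close>
  with exponent \<open>r\<close>. Rule \<open>sum\<close> adds two objects only, so the power is
  built by induction, together with maps whose composite is the partial sum.\<close>

lemma hull_sum:
 fixes r :: nat
 assumes "obj M" "obj W" "\<And>i. i < r \<Longrightarrow> a i \<in> hm W M" "\<And>i. i < r \<Longrightarrow> b i \<in> hm M W"
  "\<And>w. w \<in> carrier W \<Longrightarrow> w = finsum W (\<lambda>i. b i (a i w)) {..<r}"
 shows "W \<in> closure_hull T {M}"
proof -
 have W: "lm W" and M: "lm M" using assms(1,2) by (simp_all add: obj_def)
 interpret W: left_module R W by fact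
 have "\<exists>S\<in>closure_hull T {M}. \<exists>\<alpha>\<in>hm W S. \<exists>\<beta>\<in>hm S W. \<forall>w\<in>carrier W. \<beta> (\<alpha> w) = finsum W (\<lambda>i. b i (a i w)) {..<k}" if "k \<le> r" for k
  using that
 proof (induction k)
  case 0
  let ?Z = "W\<lparr>carrier := {\<zero>\<^sub>W}\<rparr>"
  have Z: "obj ?Z" by (rule zero_module_obj[OF W])
  then interpret Z: left_module R ?Z by (simp add: obj_def)
  have "zero_object T ?Z" unfolding zero_object_iff using Z by (intro conjI stab_eq_self) (simp_all add: obj_def)
  then have "?Z \<in> closure_hull T {M}" by (rule closure_hull.zero)
  then show ?case
   using Hom_zero[OF W Z.left_module_axioms] Hom_zero[OF Z.left_module_axioms W]
   by (intro bexI[of _ ?Z] bexI[of _ "\<lambda>x\<in>carrier W. \<zero>\<^bsub>?Z\<^esub>"] bexI[of _ "\<lambda>x\<in>carrier ?Z. \<zero>\<^sub>W"]) simp_all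
 next
  case (Suc k)
  then obtain S \<alpha> \<beta> where S: "S \<in> closure_hull T {M}" "\<alpha> \<in> hm W S" "\<beta> \<in> hm S W"
   "\<forall>w\<in>carrier W. \<beta> (\<alpha> w) = finsum W (\<lambda>i. b i (a i w)) {..<k}" by auto
  have So: "obj S" and Sl: "lm S" using closure_hull_obj[OF S(1)] by (simp_all add: obj_def)
  have ak: "a i \<in> hm W M" "b i \<in> hm M W" if "i < Suc k" for i using Suc.prems assms(3,4) that by auto
  obtain U i j p q where U: "obj U" "i \<in> hm S U" "j \<in> hm M U" "p \<in> hm U S" "q \<in> hm U M"
   "\<And>x. x \<in> carrier S \<Longrightarrow> p (i x) = x" "\<And>y. y \<in> carrier M \<Longrightarrow> q (j y) = y"
   "\<And>x. x \<in> carrier S \<Longrightarrow> q (i x) = \<zero>\<^sub>M" "\<And>y. y \<in> carrier M \<Longrightarrow> p (j y) = \<zero>\<^sub>S"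
   "\<And>s. s \<in> carrier U \<Longrightarrow> s = i (p s) \<oplus>\<^sub>U j (q s)"
   by (rule biproduct[OF So assms(1)]) (rule that)
  have Ul: "lm U" using U(1) by (simp add: obj_def)
  interpret U: left_module R U by (rule Ul)
  have c: "i x \<in> carrier U" if "x \<in> carrier S" for x using Hom_closed[OF U(2) that] .
  have c': "j x \<in> carrier U" if "x \<in> carrier M" for x using Hom_closed[OF U(3) that] .
  have cp: "p x \<in> carrier S" "q x \<in> carrier M" if "x \<in> carrier U" for x using Hom_closed[OF U(4) that] Hom_closed[OF U(5) that] .
  have ds: "direct_sum T U S M" unfolding direct_sum_iff
  proof (intro conjI bexI[OF _ U(2)] bexI[OF _ U(3)] bexI[OF _ U(4)] bexI[OF _ U(5)] So assms(1) U(1) stab_eq_self Sl M Ul)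
  qed (simp_all add: U(6-9) U(10)[symmetric] c c' cp abelian_monoid.zero_closed[OF left_module.axioms(2)[OF M, THEN abelian_group.axioms(1)]] abelian_monoid.zero_closed[OF left_module.axioms(2)[OF Sl, THEN abelian_group.axioms(1)]])
  have "M \<in> closure_hull T {M}" by (rule closure_hull.base) (simp_all add: cat_simps assms(1))
  from closure_hull.sum[OF S(1) this ds] have UT: "U \<in> closure_hull T {M}" .
  let ?\<alpha> = "\<lambda>w\<in>carrier W. (\<lambda>w\<in>carrier W. i (\<alpha> w)) w \<oplus>\<^sub>U (\<lambda>w\<in>carrier W. j (a k w)) w"
  let ?\<beta> = "\<lambda>u\<in>carrier U. (\<lambda>u\<in>carrier U. \<beta> (p u)) u \<oplus>\<^sub>W (\<lambda>u\<in>carrier U. b k (q u)) u"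
  have \<alpha>: "?\<alpha> \<in> hm W U" by (intro Hom_plus Hom_comp[OF W S(2) U(2)] Hom_comp[OF W ak(1) U(3)] W Ul) simp
  have \<beta>: "?\<beta> \<in> hm U W" by (intro Hom_plus Hom_comp[OF Ul U(4) S(3)] Hom_comp[OF Ul U(5) ak(2)] W Ul) simp
  have "?\<beta> (?\<alpha> w) = finsum W (\<lambda>i. b i (a i w)) {..<Suc k}" if w: "w \<in> carrier W" for w
  proof -
   note aw = Hom_closed[OF S(2) w] and kw = Hom_closed[OF ak(1)[of k, OF lessI] w]
   interpret p: lhom R U S p using Ul Sl U(4) by (rule lhomI)
   interpret q: lhom R U M q using Ul M U(5) by (rule lhomI)
   interpret M: left_module R M by (rule M)
   interpret S: left_module R S by (rule Sl)
   have 1: "p (i (\<alpha> w) \<oplus>\<^sub>U j (a k w)) = \<alpha> w" "q (i (\<alpha> w) \<oplus>\<^sub>U j (a k w)) = a k w"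
    using aw kw c c' by (simp_all add: U(6-9))
   have bc: "(\<lambda>i. b i (a i w)) \<in> {..<Suc k} \<rightarrow> carrier W" using Hom_closed[OF ak(2) Hom_closed[OF ak(1) w]] by auto
   have "?\<beta> (?\<alpha> w) = \<beta> (\<alpha> w) \<oplus>\<^sub>W b k (a k w)" using w aw kw c c' by (simp add: 1)
   also have "\<dots> = finsum W (\<lambda>i. b i (a i w)) {..<Suc k}"
    using S(4) w bc by (simp add: lessThan_Suc W.M.a_comm W.M.finsum_insert Pi_iff)
   finally show ?thesis .
  qed
  with UT \<alpha> \<beta> show ?case by blast
 qed
 from this[OF order_refl] obtain S \<alpha> \<beta> where "S \<in> closure_hull T {M}" "\<alpha> \<in> hm W S" "\<beta> \<in> hm S W"
  "\<forall>w\<in>carrier W. \<beta> (\<alpha> w) = finsum W (\<lambda>i. b i (a i w)) {..<r}" by blast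
 then show ?thesis using assms(5) by (intro hull_retract[of S _ W \<alpha> \<beta>] assms(2)) simp_all
qed

end

lemma pi_sum_inj:
 assumes "LMod R W" "finite I" "i \<in> I" "\<And>j. j \<in> I \<Longrightarrow> f j \<in> Hom R (M j) W" "\<And>j. j \<in> I \<Longrightarrow> LMod R (M j)" "m \<in> carrier (M i)"
 shows "finsum W (\<lambda>j. f j (pi_inj I M i m j)) I = f i m"
proof -
 interpret W: left_module R W by fact
 have f0: "f j \<zero>\<^bsub>M j\<^esub> = \<zero>\<^sub>W" if "j \<in> I" for j using lhom.zero[OF lhomI[OF assms(5)[OF that] assms(1) assms(4)[OF that]]] .
 have fm: "f i m \<in> carrier W" using Hom_closed[OF assms(4)[OF assms(3)] assms(6)] .
 have "finsum W (\<lambda>j. f j (pi_inj I M i m j)) I = finsum W (\<lambda>j. if i = j then f i m else \<zero>\<^sub>W) I"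
  using f0 fm by (intro W.M.finsum_cong' refl) (auto simp: pi_inj_def)
 also have "\<dots> = f i m" using fm by (intro W.M.finsum_singleton[OF assms(3,2)]) auto
 finally show ?thesis .
qed

lemma regular_hom:
 assumes "LMod R W" "x \<in> carrier W"
 shows "(\<lambda>r\<in>carrier (Reg R). r \<odot>\<^sub>W x) \<in> Hom R (Reg R) W"
proof -
 interpret W: left_module R W by fact
 show ?thesis using regular_left_module[OF W.R.ring_axioms]
  by (rule Hom_restrictI) (use assms(2) in \<open>auto simp: W.smult_l_distr W.smult_assoc\<close>)
qed

section \<open>Generator-cogenerators over self-injective algebras\<close>

text \<open>\<open>smult_eq\<close> connects the scalar multiplication in the record of the algebra,
  which occurs in \<open>dual_module\<close>, with the structure map that turns modules into vector
  spaces.\<close>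

locale self_injective_algebra = fd_algebra K R \<phi>
 for K :: "('k, 'x) ring_scheme" and R :: "('k, 'r) module" (structure) and \<phi> :: "'k \<Rightarrow> 'r" +
 fixes M :: "'r lmod"
 assumes smult_eq: "c \<in> carrier K \<Longrightarrow> r \<in> carrier R \<Longrightarrow> c \<odot>\<^sub>R r = \<phi> c \<otimes>\<^sub>R r"
  and self_inj: "self_injective R"
  and gen_cogen: "generator_cogenerator K R M"
begin
sublocale S: stable_ring R by (rule stable_ring)

lemma M_lm: "LMod R M" and M_fin_gen: "fin_gen R M" and M_obj: "S.obj M"
 using gen_cogen by (auto simp: generator_cogenerator_def S.obj_def)

sublocale MM: left_module R M by (rule M_lm)

text \<open>If \<open>W\<close> is the kernel of a free cover \<open>P\<close> of \<open>C1\<close>, then \<open>C \<oplus> P\<close> is an extension of \<open>D\<close> by \<open>W\<close>; in the stable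
 category, this is the triangle of the given sequence, rotated.\<close>

lemma rotate:
 assumes "short_exact R C D C1 i q" "S.obj C" "S.obj D" "S.obj C1"
  and "D \<in> closure_hull S.T {M}" "C1 \<in> gen_level S.T {M} (Suc k)"
 shows "C \<in> gen_level S.T {M} (Suc (Suc k))"
proof -
 note se = short_exactD[OF assms(1)]
 note C = S.objD(1)[OF assms(2)] and D = S.objD(1)[OF assms(3)] and C1 = S.objD(1)[OF assms(4)]
 obtain n p0 where p0: "p0 \<in> Hom R (Free R n) C1" "p0 ` carrier (Free R n) = carrier C1"
  by (rule free_cover[OF S.objD[OF assms(4)]]) (rule that)
 let ?F = "Free R n"
 have F: "LMod R ?F" "fin_gen R ?F" by (rule free_left_module[OF R.ring_axioms], rule free_fin_gen[OF R.ring_axioms])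
 obtain P :: "'r lmod" and e d where P: "LMod R P" "fin_gen R P" "e \<in> Hom R ?F P" "d \<in> Hom R P ?F"
  "\<And>x. x \<in> carrier ?F \<Longrightarrow> d (e x) = x" "\<And>y. y \<in> carrier P \<Longrightarrow> e (d y) = y"
  by (rule fin_gen_copy_iso[OF F]) (rule that)
 \<comment> \<open>Self-injectivity enters here: free modules of finite rank are injective, so
   \<open>C1\<close> is a cosyzygy of the kernel \<open>?W\<close>.\<close>
 have Fi: "injective_module R ?F" unfolding free_module_def
  by (rule injective_pi[OF R.ring_axioms]) (rule self_inj[unfolded self_injective_def])
 have Pi: "injective_module R P" by (rule injective_retract[OF Fi P(1,4,3)]) (rule P(6))
 define p where "p = (\<lambda>y\<in>carrier P. p0 (d y))"
 have p: "p \<in> Hom R P C1" unfolding p_def by (rule Hom_comp[OF P(1,4) p0(1)])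
 have ps: "p ` carrier P = carrier C1"
 proof (intro equalityI subsetI)
  fix x assume "x \<in> carrier C1"
  then obtain y where y: "y \<in> carrier ?F" "x = p0 y" using p0(2) by blast
  show "x \<in> p ` carrier P"
   using y Hom_closed[OF P(3) y(1)] P(5)[OF y(1)] by (intro image_eqI[of _ _ "e y"]) (simp_all add: p_def del: free_simps)
 qed (use Hom_closed[OF p] in blast)
 let ?N = "{x \<in> carrier P. p x = \<zero>\<^bsub>C1\<^esub>}"
 let ?W = "P\<lparr>carrier := ?N\<rparr>"
 interpret p: lhom R P C1 p using P(1) C1 p by (rule lhomI)
 have W: "LMod R ?W" by (rule p.W.submodule_left_module[OF p.kernel])
 have Wo: "S.obj ?W" using W fin_gen_submodule[OF P(1,2) p.kernel] by (simp add: S.obj_def)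
 have inc: "(\<lambda>x\<in>?N. x) \<in> Hom R ?W P" by (rule p.W.Hom_inclusion[OF p.kernel])
 have seW: "short_exact R ?W P C1 (\<lambda>x\<in>?N. x) p"
  unfolding short_exact_def using inc p ps by (auto simp: inj_on_def)
 have iso: "stab_iso R C1 (S.IC ?W)"
  by (rule S.cosyzygy_unique[OF W C1 S.presentation(3)[OF Wo] seW S.presentation(4)[OF Wo] Pi S.presentation(1)[OF Wo]])
 have "S.IC ?W \<in> gen_level S.T {M} (Suc k)" by (rule S.gen_level_iso[OF assms(6) S.IC_obj[OF Wo] iso])
 moreover obtain J where J: "gen_level S.T {M} (Suc k) = closure_hull S.T J" using S.gen_level_Suc_hull by blast
 ultimately have sh: "Shift S.T ?W \<in> closure_hull S.T J" by (simp add: S.cat_simps)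
 \<comment> \<open>Closure under the inverse of the shift brings \<open>?W\<close> to the level of
   \<open>C1\<close>.\<close>
 have "?W \<in> Ob S.T" using Wo by (simp add: S.cat_simps)
 from closure_hull.unshift[OF sh this] have Wg: "?W \<in> gen_level S.T {M} (Suc k)" unfolding J .
 \<comment> \<open>The cover of \<open>C1\<close> is lifted along \<open>q\<close>. Then
   \<open>C \<oplus> P\<close> maps onto \<open>D\<close> by \<open>i\<close> and \<open>l\<close>,
   with kernel isomorphic to \<open>?W\<close>.\<close>
 obtain l0 where l0: "l0 \<in> Hom R ?F D" "\<And>x. x \<in> carrier ?F \<Longrightarrow> q (l0 x) = p0 x"
  by (rule free_lift[OF R.ring_axioms D C1 se(2,4) p0(1)]) (rule that)
 define l where "l = (\<lambda>y\<in>carrier P. l0 (d y))"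
 have l: "l \<in> Hom R P D" unfolding l_def by (rule Hom_comp[OF P(1,4) l0(1)])
 have ql: "q (l y) = p y" if "y \<in> carrier P" for y
  using that l0(2)[OF Hom_closed[OF P(4) that]] by (simp add: l_def p_def)
 interpret l: lhom R P D l using P(1) D l by (rule lhomI)
 interpret q: lhom R D C1 q using D C1 se(2) by (rule lhomI)
 interpret i: lhom R C D i using C D se(1) by (rule lhomI)
 obtain E i1 i2 p1 p2 where E: "S.obj E" "i1 \<in> Hom R C E" "i2 \<in> Hom R P E" "p1 \<in> Hom R E C" "p2 \<in> Hom R E P"
  "\<And>x. x \<in> carrier C \<Longrightarrow> p1 (i1 x) = x" "\<And>y. y \<in> carrier P \<Longrightarrow> p2 (i2 y) = y"
  "\<And>x. x \<in> carrier C \<Longrightarrow> p2 (i1 x) = \<zero>\<^sub>P" "\<And>y. y \<in> carrier P \<Longrightarrow> p1 (i2 y) = \<zero>\<^sub>C"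
  "\<And>s. s \<in> carrier E \<Longrightarrow> s = i1 (p1 s) \<oplus>\<^sub>E i2 (p2 s)"
  by (rule S.biproduct[OF assms(2), of P]) (use P in \<open>simp add: S.obj_def\<close>, rule that)
 have El: "LMod R E" by (rule S.objD(1)[OF E(1)])
 interpret p1: lhom R E C p1 using El C E(4) by (rule lhomI)
 interpret p2: lhom R E P p2 using El P(1) E(5) by (rule lhomI)
 interpret i1: lhom R C E i1 using C El E(2) by (rule lhomI)
 interpret i2: lhom R P E i2 using P(1) El E(3) by (rule lhomI)
 define g where "g = (\<lambda>x\<in>carrier E. (\<lambda>x\<in>carrier E. i (p1 x)) x \<oplus>\<^sub>D (\<lambda>x\<in>carrier E. l (p2 x)) x)"
 have g: "g \<in> Hom R E D" unfolding g_def
  by (rule Hom_plus[OF El D Hom_comp[OF El E(4) se(1)] Hom_comp[OF El E(5) l]])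
 have ge: "g x = i (p1 x) \<oplus>\<^sub>D l (p2 x)" if "x \<in> carrier E" for x using that by (simp add: g_def)
 have gs: "g (i1 c \<oplus>\<^sub>E i2 y) = i c \<oplus>\<^sub>D l y" if "c \<in> carrier C" "y \<in> carrier P" for c y
  using that by (simp add: ge E(6-9))
 have lN: "(\<lambda>w\<in>carrier ?W. l ((\<lambda>x\<in>?N. x) w)) \<in> Hom R ?W D" by (rule Hom_comp[OF W inc l])
 have ker: "\<exists>c\<in>carrier C. (\<lambda>w\<in>carrier ?W. \<ominus>\<^sub>D ((\<lambda>w\<in>carrier ?W. l ((\<lambda>x\<in>?N. x) w)) w)) w = i c" if "w \<in> carrier ?W" for w
 proof -
  have "w \<in> carrier P" "p w = \<zero>\<^bsub>C1\<^esub>" using that by simp_all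
  then have "q (\<ominus>\<^sub>D l w) = \<zero>\<^bsub>C1\<^esub>" by (simp add: ql p.Y.M.minus_equality[of "\<zero>\<^bsub>C1\<^esub>" "\<zero>\<^bsub>C1\<^esub>"])
  then show ?thesis using se(6)[of "\<ominus>\<^sub>D l w"] that by simp
 qed
 \<comment> \<open>For \<open>w\<close> in \<open>?W\<close>, \<open>l w\<close> lies in the kernel
   of \<open>q\<close>, hence in the image of \<open>C\<close>; with this sign
   \<open>i (\<chi> w) + l w\<close> vanishes.\<close>
 obtain \<chi> where \<chi>: "\<chi> \<in> Hom R ?W C" "\<And>w. w \<in> carrier ?W \<Longrightarrow> i (\<chi> w) = (\<lambda>w\<in>carrier ?W. \<ominus>\<^sub>D ((\<lambda>w\<in>carrier ?W. l ((\<lambda>x\<in>?N. x) w)) w)) w"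
  by (rule Hom_into_kernel[OF W C D se(1,3) Hom_neg[OF W D lN] ker]) (assumption | rule that)+
 have \<chi>e: "\<chi> w \<in> carrier C" "i (\<chi> w) = \<ominus>\<^sub>D l w" if "w \<in> carrier P" "p w = \<zero>\<^bsub>C1\<^esub>" for w
  using \<chi>(2)[of w] Hom_closed[OF \<chi>(1), of w] that by simp_all
 define f where "f = (\<lambda>w\<in>carrier ?W. (\<lambda>w\<in>carrier ?W. i1 (\<chi> w)) w \<oplus>\<^sub>E (\<lambda>w\<in>carrier ?W. i2 ((\<lambda>x\<in>?N. x) w)) w)"
 have f: "f \<in> Hom R ?W E" unfolding f_def
  by (rule Hom_plus[OF W El Hom_comp[OF W \<chi>(1) E(2)] Hom_comp[OF W inc E(3)]])
 have fe: "f w = i1 (\<chi> w) \<oplus>\<^sub>E i2 w" if "w \<in> carrier P" "p w = \<zero>\<^bsub>C1\<^esub>" for w using that by (simp add: f_def)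
 have "short_exact R ?W E D f g" unfolding short_exact_def
 proof (intro conjI f g)
  have "p2 (f w) = w" if "w \<in> carrier P" "p w = \<zero>\<^bsub>C1\<^esub>" for w using \<chi>e[OF that] that by (simp add: fe E(7,8))
  then show "inj_on f (carrier ?W)" by (intro inj_on_inverseI[of _ p2]) simp
  show "f ` carrier ?W = {x \<in> carrier E. g x = \<zero>\<^sub>D}"
  proof (intro equalityI subsetI)
   fix x assume "x \<in> f ` carrier ?W"
   then obtain w where w: "w \<in> carrier P" "p w = \<zero>\<^bsub>C1\<^esub>" "x = f w" by auto
   show "x \<in> {x \<in> carrier E. g x = \<zero>\<^sub>D}"
    using w(1) \<chi>e[OF w(1,2)] by (simp add: w(3) fe[OF w(1,2)] gs l.Y.M.l_neg)
  next
   fix x assume "x \<in> {x \<in> carrier E. g x = \<zero>\<^sub>D}"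
   then have x: "x \<in> carrier E" "i (p1 x) \<oplus>\<^sub>D l (p2 x) = \<zero>\<^sub>D" using ge[of x] by simp_all
   have "q (i (p1 x) \<oplus>\<^sub>D l (p2 x)) = p (p2 x)" using x(1) by (simp add: se(5) ql)
   then have w: "p (p2 x) = \<zero>\<^bsub>C1\<^esub>" "p2 x \<in> carrier P" using x by simp_all
   have "i (p1 x) = \<ominus>\<^sub>D l (p2 x)" using x by (intro l.Y.M.minus_equality[symmetric]) simp_all
   then have "i (\<chi> (p2 x)) = i (p1 x)" using \<chi>e[OF w(2,1)] by simp
   from inj_onD[OF se(3) this] have "\<chi> (p2 x) = p1 x" using \<chi>e[OF w(2,1)] x(1) by simp
   then have "f (p2 x) = x" using fe[OF w(2,1)] E(10)[OF x(1), symmetric] by simp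
   then show "x \<in> f ` carrier ?W" using w by (intro image_eqI[of _ _ "p2 x"]) simp_all
  qed
  show "g ` carrier E = carrier D"
  proof (intro equalityI subsetI)
   fix x assume x: "x \<in> carrier D"
   then have "q x \<in> p ` carrier P" using ps q.closed by blast
   then obtain y where y: "y \<in> carrier P" "q x = p y" by blast
   have "q (x \<ominus>\<^sub>D l y) = \<zero>\<^bsub>C1\<^esub>" using x y by (simp add: ql a_minus_def p.Y.M.r_neg)
   then obtain c where c: "c \<in> carrier C" "x \<ominus>\<^sub>D l y = i c" using se(6)[of "x \<ominus>\<^sub>D l y"] x y by auto
   have "g (i1 c \<oplus>\<^sub>E i2 y) = x" using c(1) x y by (simp add: gs c(2)[symmetric] a_minus_def l.Y.M.a_assoc l.Y.M.l_neg)
   then show "x \<in> g ` carrier E" using c(1) y(1) by (intro image_eqI[of _ _ "i1 c \<oplus>\<^sub>E i2 y"]) simp_all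
  qed (use Hom_closed[OF g] in blast)
 qed
 \<comment> \<open>The middle term is an extension of \<open>D\<close> by \<open>?W\<close> and lies
   one level higher; \<open>C\<close> is a retract of it.\<close>
 from S.ext_objectsI[OF this Wo E(1) assms(3) Wg assms(5)]
 have "E \<in> gen_level S.T {M} (Suc (Suc k))" using E(1) by (simp add: closure_hull.base S.cat_simps)
 then show ?thesis by (rule S.gen_level_retract[OF _ assms(2) E(2,4,6)])
qed

text \<open>The ring is a retract of a power of \<open>M\<close>, and each generator
  \<open>s\<close> of \<open>W\<close> is the image of 1 under \<open>r \<mapsto> r s\<close>; so
  \<open>s\<close> is a sum of values of homomorphisms from \<open>M\<close>.\<close>

lemma generator:
 assumes "LMod R W" "fin_gen R W"
 obtains n :: nat and f where "\<And>i. f i \<in> Hom R M W"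
  "\<And>w. w \<in> carrier W \<Longrightarrow> \<exists>m\<in>carrier (pi_module {..<n} (\<lambda>_. M)). w = finsum W (\<lambda>i. f i (m i)) {..<n}"
proof -
 interpret W: left_module R W by fact
 have "in_add R (Reg R) M" using gen_cogen by (simp add: generator_cogenerator_def)
 then obtain k :: nat and u v where uv: "u \<in> Hom R (Reg R) (pi_module {..<k} (\<lambda>_. M))"
  "v \<in> Hom R (pi_module {..<k} (\<lambda>_. M)) (Reg R)" "\<And>w. w \<in> carrier (Reg R) \<Longrightarrow> v (u w) = w"
  by (rule in_addE[OF M_lm]) (rule that)
 let ?P = "pi_module {..<k} (\<lambda>_. M)"
 have P: "LMod R ?P" by (intro pi_left_module R.ring_axioms M_lm)
 obtain T where T: "finite T" "T \<subseteq> carrier W" "carrier W \<subseteq> lspan R W T" using assms(2) W.fin_gen_iff by auto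
 define h where "h s = (\<lambda>x\<in>carrier ?P. (\<lambda>r\<in>carrier (Reg R). r \<odot>\<^sub>W s) (v x))" for s
 have h: "h s \<in> Hom R ?P W" if "s \<in> carrier W" for s
  unfolding h_def by (rule Hom_comp[OF P uv(2) regular_hom[OF assms(1) that]])
 \<comment> \<open>The components of these maps for the finitely many \<open>s\<close>. The zero map
   is included as the value of \<open>f\<close> at indices from \<open>n\<close> on.\<close>
 define F where "F = insert (\<lambda>m\<in>carrier M. \<zero>\<^sub>W)
  ((\<lambda>(i, s). \<lambda>m\<in>carrier M. h s ((\<lambda>m\<in>carrier M. pi_inj {..<k} (\<lambda>_. M) i m) m)) ` ({..<k} \<times> T))"
 have F: "finite F" unfolding F_def using T(1) by simp
 have Fh: "f \<in> Hom R M W" if "f \<in> F" for f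
 proof -
  have "(\<lambda>m\<in>carrier M. h s ((\<lambda>m\<in>carrier M. pi_inj {..<k} (\<lambda>_. M) i m) m)) \<in> Hom R M W" if "i < k" "s \<in> T" for i s
   by (rule Hom_comp[OF M_lm pi_inj_hom[of R "{..<k}" "\<lambda>_. M", OF R.ring_axioms M_lm] h]) (use that T(2) in auto)
  then show ?thesis using that Hom_zero[OF M_lm assms(1)] unfolding F_def by auto
 qed
 obtain n :: nat and e where e: "F = e ` {i. i < n}" using finite_imp_nat_seg_image_inj_on[OF F] by auto
 have z: "(\<lambda>m\<in>carrier M. \<zero>\<^sub>W) \<in> F" by (simp add: F_def)
 define f where "f i = (if i < n then e i else (\<lambda>m\<in>carrier M. \<zero>\<^sub>W))" for i
 have f: "f i \<in> Hom R M W" for i using Fh[OF z] Fh[of "e i"] e by (auto simp: f_def)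
 let ?Q = "pi_module {..<n} (\<lambda>_. M)"
 have Q: "LMod R ?Q" by (intro pi_left_module R.ring_axioms M_lm)
 let ?\<Phi> = "\<lambda>x\<in>carrier ?Q. finsum W (\<lambda>i. f i (x i)) {..<n}"
 have \<Phi>: "?\<Phi> \<in> Hom R ?Q W" by (intro pi_sum_hom R.ring_axioms M_lm assms(1) f finite_lessThan)
 note range = lhom.range[OF lhomI[OF Q assms(1) \<Phi>]]
 have img: "g m \<in> ?\<Phi> ` carrier ?Q" if g: "g \<in> F" "m \<in> carrier M" for g m
 proof -
  obtain i where i: "i < n" "g = f i" using g(1) e by (auto simp: f_def)
  let ?x = "pi_inj {..<n} (\<lambda>_. M) i m"
  have x: "?x \<in> carrier ?Q"
   using Hom_closed[OF pi_inj_hom[of R "{..<n}" "\<lambda>_. M" i, OF R.ring_axioms M_lm] g(2)] i g(2) by simp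
  then have "?\<Phi> ?x = g m"
   using pi_sum_inj[of R W "{..<n}" i f "\<lambda>_. M" m, OF assms(1) finite_lessThan _ f M_lm g(2)] i by (simp del: pi_module_simps)
  then show ?thesis by (rule image_eqI[OF sym x])
 qed
 have "s \<in> ?\<Phi> ` carrier ?Q" if s: "s \<in> T" for s
 proof -
  have sc: "s \<in> carrier W" using T(2) s by blast
  have u1: "u \<one>\<^sub>R \<in> carrier ?P" using Hom_closed[OF uv(1), of "\<one>\<^sub>R"] by simp
  have "v (u \<one>\<^sub>R) = \<one>\<^sub>R" using uv(3)[of "\<one>\<^sub>R"] by simp
  then have "s = h s (u \<one>\<^sub>R)" using u1 sc by (simp add: h_def del: pi_module_simps)
  also have "\<dots> = finsum W (\<lambda>i. h s (pi_inj {..<k} (\<lambda>_. M) i (u \<one>\<^sub>R i))) {..<k}"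
   by (rule pi_hom_eq[OF R.ring_axioms M_lm finite_lessThan assms(1) h[OF sc] u1])
  also have "\<dots> \<in> ?\<Phi> ` carrier ?Q"
  proof (rule W.finsum_in_submodule[OF range finite_lessThan], rule Pi_I)
   fix i assume i: "i \<in> {..<k}"
   then have ui: "u \<one>\<^sub>R i \<in> carrier M" using u1 by auto
   have "(\<lambda>m\<in>carrier M. h s ((\<lambda>m\<in>carrier M. pi_inj {..<k} (\<lambda>_. M) i m) m)) \<in> F" unfolding F_def using i s by auto
   from img[OF this ui] show "h s (pi_inj {..<k} (\<lambda>_. M) i (u \<one>\<^sub>R i)) \<in> ?\<Phi> ` carrier ?Q" using ui by (simp only: restrict_apply')
  qed
  finally show ?thesis .
 qed
 then have "lspan R W T \<subseteq> ?\<Phi> ` carrier ?Q" by (intro W.lspan_subset_submodule[OF range]) blast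
 then have "carrier W \<subseteq> ?\<Phi> ` carrier ?Q" using T(3) by blast
 then have "\<exists>m\<in>carrier ?Q. w = finsum W (\<lambda>i. f i (m i)) {..<n}" if "w \<in> carrier W" for w
  using that by (auto simp del: pi_module_simps)
 with f show ?thesis by (rule that)
qed

text \<open>A linear form \<open>g\<close> with \<open>g x = 1\<close> gives the homomorphism
  \<open>w \<mapsto> (b \<mapsto> g (b w))\<close> to the dual of the algebra, non-zero at
  \<open>x\<close>. The dual is a retract of a power of \<open>M\<close>, so some coordinate in that
  power is non-zero.\<close>

lemma cogenerator:
 fixes W :: "('r, 'w) module"
 assumes "LMod R W" "x \<in> carrier W" "x \<noteq> \<zero>\<^sub>W"
 obtains f where "f \<in> Hom R W M" "f x \<noteq> \<zero>\<^sub>M"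
proof -
 interpret W: left_module R W by fact
 have KW: "LMod K (restr \<phi> W)" by (rule restr_module[OF assms(1)])
 interpret KW: left_module K "restr \<phi> W" by (rule KW)
 let ?KK = "Reg K" and ?D = "dual_module K R"
 have KK: "LMod K ?KK" by (rule regular_left_module[OF K.ring_axioms])
 have add: "in_add R ?D M" using gen_cogen by (simp add: generator_cogenerator_def)
 then have D: "LMod R ?D" by (simp add: in_add_def)
 obtain k :: nat and u v where uv: "u \<in> Hom R ?D (pi_module {..<k} (\<lambda>_. M))"
  "v \<in> Hom R (pi_module {..<k} (\<lambda>_. M)) ?D" "\<And>w. w \<in> carrier ?D \<Longrightarrow> v (u w) = w"
  by (rule in_addE[OF M_lm add]) (rule that)
 let ?P = "pi_module {..<k} (\<lambda>_. M)"
 have P: "LMod R ?P" by (intro pi_left_module R.ring_axioms M_lm)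
 \<comment> \<open>The form extends the identity of the field along its embedding
   \<open>c \<mapsto> c x\<close>, every module over a field being injective.\<close>
 let ?j = "\<lambda>c\<in>carrier ?KK. c \<odot>\<^bsub>restr \<phi> W\<^esub> x"
 have j: "?j \<in> Hom K ?KK (restr \<phi> W)" by (rule regular_hom[OF KW]) (simp add: assms(2))
 have ji: "inj_on ?j (carrier ?KK)"
 proof (rule lhom.inj_onI[OF lhomI[OF KK KW j]])
  fix c assume c: "c \<in> carrier ?KK" "?j c = \<zero>\<^bsub>restr \<phi> W\<^esub>"
  show "c = \<zero>\<^bsub>?KK\<^esub>"
  proof (rule ccontr)
   assume "c \<noteq> \<zero>\<^bsub>?KK\<^esub>"
   then have cu: "c \<in> Units K" using c by (simp add: K.field_Units)
   have "x = (inv\<^bsub>K\<^esub> c \<otimes>\<^sub>K c) \<odot>\<^bsub>restr \<phi> W\<^esub> x"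
    unfolding K.Units_l_inv[OF cu] by (rule KW.smult_one[symmetric]) (simp add: assms(2))
   also have "\<dots> = inv\<^bsub>K\<^esub> c \<odot>\<^bsub>restr \<phi> W\<^esub> (c \<odot>\<^bsub>restr \<phi> W\<^esub> x)"
    using c assms(2) by (intro KW.smult_assoc K.Units_inv_closed cu) simp_all
   also have "\<dots> = \<zero>\<^bsub>restr \<phi> W\<^esub>"
    using c(2) KW.smult_zero_right[OF K.Units_inv_closed[OF cu]] by (simp only: restrict_apply' c(1))
   finally show False using assms(3) by simp
  qed
 qed
 obtain g where g: "g \<in> Hom K (restr \<phi> W) ?KK" "\<And>c. c \<in> carrier ?KK \<Longrightarrow> g (?j c) = (\<lambda>c\<in>carrier ?KK. c) c"
  by (rule injective_extend[OF field_injective[OF K.field_axioms KK] KK KW j ji Hom_id[OF KK]]) (assumption | rule that)+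
 have gx: "g x = \<one>\<^sub>K" using g(2)[of "\<one>\<^sub>K"] KW.smult_one[of x] assms(2) by simp
 have g_add: "g (y \<oplus>\<^sub>W z) = g y \<oplus>\<^sub>K g z" if "y \<in> carrier W" "z \<in> carrier W" for y z
  using Hom_add[OF g(1), of y z] that by simp
 have g_smult: "g (\<phi> c \<odot>\<^sub>W y) = c \<otimes>\<^sub>K g y" if "c \<in> carrier K" "y \<in> carrier W" for c y
  using Hom_smult[OF g(1), of c y] that by simp
 have gc: "g y \<in> carrier K" if "y \<in> carrier W" for y using Hom_closed[OF g(1), of y] that by simp
 let ?t = "\<lambda>w\<in>carrier W. \<lambda>b\<in>carrier R. g (b \<odot>\<^sub>W w)"
 have t: "?t \<in> Hom R W ?D" using assms(1)
 proof (rule Hom_restrictI)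
  fix w assume w: "w \<in> carrier W"
  have "c \<odot>\<^sub>R b \<in> carrier R" "g ((c \<odot>\<^sub>R b) \<odot>\<^sub>W w) = c \<otimes>\<^sub>K g (b \<odot>\<^sub>W w)" if "c \<in> carrier K" "b \<in> carrier R" for c b
   using that w g_smult[of c "b \<odot>\<^sub>W w"] by (simp_all add: smult_eq W.smult_assoc)
  then show "(\<lambda>b\<in>carrier R. g (b \<odot>\<^sub>W w)) \<in> carrier ?D"
   using w gc by (auto simp: dual_module_def mod_hom_def W.smult_l_distr g_add)
 next
  fix w y assume w: "w \<in> carrier W" and y: "y \<in> carrier W"
  show "(\<lambda>b\<in>carrier R. g (b \<odot>\<^sub>W (w \<oplus>\<^sub>W y))) = (\<lambda>b\<in>carrier R. g (b \<odot>\<^sub>W w)) \<oplus>\<^bsub>?D\<^esub> (\<lambda>b\<in>carrier R. g (b \<odot>\<^sub>W y))"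
   using w y by (auto simp: dual_module_def fun_eq_iff W.smult_r_distr g_add)
 next
  fix r w assume r: "r \<in> carrier R" and w: "w \<in> carrier W"
  show "(\<lambda>b\<in>carrier R. g (b \<odot>\<^sub>W (r \<odot>\<^sub>W w))) = r \<odot>\<^bsub>?D\<^esub> (\<lambda>b\<in>carrier R. g (b \<odot>\<^sub>W w))"
   using r w by (auto simp: dual_module_def fun_eq_iff W.smult_assoc)
 qed
 have tx: "?t x \<noteq> \<zero>\<^bsub>?D\<^esub>"
 proof
  assume "?t x = \<zero>\<^bsub>?D\<^esub>"
  then have "?t x \<one>\<^sub>R = \<zero>\<^sub>K" by (simp add: dual_module_def)
  then show False using assms(2) gx by simp
 qed
 note tc = Hom_closed[OF t assms(2)]
 note uc = Hom_closed[OF uv(1) tc]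
 have nz: "u (?t x) \<noteq> \<zero>\<^bsub>?P\<^esub>" using tx uv(3)[OF tc] lhom.zero[OF lhomI[OF P D uv(2)]] by metis
 have "y = \<zero>\<^bsub>?P\<^esub>" if "y \<in> carrier ?P" "\<forall>i\<in>{..<k}. y i = \<zero>\<^sub>M" for y
  using that by (auto simp: fun_eq_iff PiE_def extensional_def)
 with nz uc obtain i where i: "i \<in> {..<k}" "u (?t x) i \<noteq> \<zero>\<^sub>M" by blast
 show ?thesis
 proof (rule that[OF Hom_comp[OF assms(1) Hom_comp[OF assms(1) t uv(1)] pi_proj_hom[of R "{..<k}" "\<lambda>_. M" i, OF R.ring_axioms M_lm i(1)]]])
  show "(\<lambda>w\<in>carrier W. (\<lambda>x\<in>carrier ?P. x i) ((\<lambda>w\<in>carrier W. u (?t w)) w)) x \<noteq> \<zero>\<^sub>M"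
   using i(2) uc assms(2) by (simp del: pi_module_simps)
 qed
qed

lemma separates:
 fixes W :: "('r, 'w) module"
 assumes "LMod R W" "x \<in> carrier W" "y \<in> carrier W" "\<And>f. f \<in> Hom R W M \<Longrightarrow> f x = f y"
 shows "x = y"
proof (rule ccontr)
 interpret W: left_module R W by fact
 assume "x \<noteq> y"
 then have "x \<ominus>\<^sub>W y \<noteq> \<zero>\<^sub>W" using assms(2,3) W.M.minus_eq_zero_iff by simp
 then obtain f where f: "f \<in> Hom R W M" "f (x \<ominus>\<^sub>W y) \<noteq> \<zero>\<^sub>M"
  by (rule cogenerator[OF assms(1) W.M.minus_closed[OF assms(2,3)]]) (rule that)
 interpret f: lhom R W M f using assms(1) M_lm f(1) by (rule lhomI)
 show False using f(2) assms(2,3) assms(4)[OF f(1)] by (simp add: a_minus_def MM.M.r_neg)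
qed

section \<open>\<open>Hom(-, M)\<close> and free modules over the endomorphism ring\<close>

abbreviation "\<Gamma> \<equiv> End_ring R M"
abbreviation "Mp r \<equiv> pi_module {..<r::nat} (\<lambda>_. M)"
abbreviation "mi r i m \<equiv> pi_inj {..<r::nat} (\<lambda>_. M) i m"

lemma \<Gamma>_ring: "ring \<Gamma>" by (rule End_ring_ring[OF M_lm])

lemma Mp_lm: "LMod R (Mp r)" and Mp_fin_gen: "fin_gen R (Mp r)"
 by (intro pi_left_module R.ring_axioms M_lm, intro pi_fin_gen R.ring_axioms M_lm M_fin_gen finite_lessThan)

lemma star_lm: "LMod R C \<Longrightarrow> LMod \<Gamma> (star R M C)" by (rule star_left_module[OF _ M_lm])

lemma mi_hom: "i < r \<Longrightarrow> (\<lambda>m\<in>carrier M. mi r i m) \<in> Hom R M (Mp r)"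
 by (rule pi_inj_hom[of R "{..<r}" "\<lambda>_. M" i, OF R.ring_axioms M_lm]) simp

lemma mi_closed: "i < r \<Longrightarrow> m \<in> carrier M \<Longrightarrow> mi r i m \<in> carrier (Mp r)"
 using Hom_closed[OF mi_hom[of i r], of m] by simp

lemma Mp_hom_eq: "LMod R W \<Longrightarrow> h \<in> Hom R (Mp r) W \<Longrightarrow> x \<in> carrier (Mp r) \<Longrightarrow> h x = finsum W (\<lambda>i. h (mi r i (x i))) {..<r}"
 by (rule pi_hom_eq[OF R.ring_axioms M_lm finite_lessThan])

lemma star_finsum:
 assumes "LMod R C" "finite I" "F \<in> I \<rightarrow> Hom R C M" "c \<in> carrier C"
 shows "finsum (star R M C) F I c = finsum M (\<lambda>i. F i c) I"
proof -
 interpret st: left_module \<Gamma> "star R M C" by (rule star_lm[OF assms(1)])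
 show ?thesis using assms(2,3)
 proof (induction I)
  case empty then show ?case using assms(4) by simp
 next
  case (insert i I)
  then have "F i \<in> Hom R C M" "F \<in> I \<rightarrow> Hom R C M" by auto
  moreover from this have "F i c \<in> carrier M" "(\<lambda>i. F i c) \<in> I \<rightarrow> carrier M" using Hom_closed[OF _ assms(4)] by auto
  ultimately show ?case using insert assms(4) by simp
 qed
qed

lemma regular_finsum:
 assumes "finite I" "F \<in> I \<rightarrow> Hom R M M" "m \<in> carrier M"
 shows "finsum (Reg \<Gamma>) F I m = finsum M (\<lambda>i. F i m) I"
proof -
 \<comment> \<open>The two records have the same additive structure, and \<open>finsum\<close>
   refers to nothing else.\<close>
 have "finsum (Reg \<Gamma>) F I = finsum (star R M M) F I"
  by (simp add: finsum_def regular_module_def star_def End_ring_def)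
 then show ?thesis using star_finsum[OF M_lm assms] by simp
qed

text \<open>The map \<open>M\<^sup>r \<rightarrow> M\<close> with components \<open>\<gamma> i\<close>; thus \<open>Hom(M\<^sup>r, M)\<close> is the free \<open>\<Gamma>\<close>-module of rank \<open>r\<close>.\<close>

definition "pair r \<gamma> = (\<lambda>x\<in>carrier (Mp r). finsum M (\<lambda>i. \<gamma> i (x i)) {..<r})"

lemma free_app: "\<gamma> \<in> carrier (Free \<Gamma> r) \<Longrightarrow> i < r \<Longrightarrow> \<gamma> i \<in> Hom R M M" by auto

lemma pair_hom: "\<gamma> \<in> carrier (Free \<Gamma> r) \<Longrightarrow> pair r \<gamma> \<in> Hom R (Mp r) M"
 unfolding pair_def by (rule pi_sum_hom[OF R.ring_axioms M_lm M_lm finite_lessThan]) (rule free_app, auto)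

lemma pair_mi:
 assumes "\<gamma> \<in> carrier (Free \<Gamma> r)" "i < r" "m \<in> carrier M"
 shows "pair r \<gamma> (mi r i m) = \<gamma> i m"
proof -
 have "pair r \<gamma> (mi r i m) = finsum M (\<lambda>j. \<gamma> j (mi r i m j)) {..<r}"
  using mi_closed[OF assms(2,3)] by (simp only: pair_def restrict_apply')
 also have "\<dots> = \<gamma> i m"
  using assms(2) free_app[OF assms(1)] by (intro pi_sum_inj[where M = "\<lambda>_. M"] M_lm finite_lessThan assms(3)) (auto intro: M_lm)
 finally show ?thesis .
qed

lemma app_closed:
 assumes "\<gamma> \<in> carrier (Free \<Gamma> r)" "x \<in> carrier (Mp r)" "i < r"
 shows "\<gamma> i (x i) \<in> carrier M"
proof (rule Hom_closed[OF free_app[OF assms(1,3)]])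
 show "x i \<in> carrier M" using assms(2,3) by auto
qed

lemma pair_add:
 assumes "\<gamma> \<in> carrier (Free \<Gamma> r)" "\<delta> \<in> carrier (Free \<Gamma> r)" "x \<in> carrier (Mp r)"
 shows "pair r (\<gamma> \<oplus>\<^bsub>Free \<Gamma> r\<^esub> \<delta>) x = pair r \<gamma> x \<oplus>\<^sub>M pair r \<delta> x"
proof -
 have "finsum M (\<lambda>i. (\<gamma> \<oplus>\<^bsub>Free \<Gamma> r\<^esub> \<delta>) i (x i)) {..<r} = finsum M (\<lambda>i. \<gamma> i (x i) \<oplus>\<^sub>M \<delta> i (x i)) {..<r}"
  using app_closed[OF assms(1,3)] app_closed[OF assms(2,3)] assms(3) by (intro MM.M.finsum_cong' refl) auto
 also have "\<dots> = finsum M (\<lambda>i. \<gamma> i (x i)) {..<r} \<oplus>\<^sub>M finsum M (\<lambda>i. \<delta> i (x i)) {..<r}"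
  using app_closed[OF assms(1,3)] app_closed[OF assms(2,3)] by (intro MM.M.finsum_addf) auto
 finally show ?thesis using assms(3) by (simp add: pair_def)
qed

lemma pair_smult:
 assumes "a \<in> Hom R M M" "\<gamma> \<in> carrier (Free \<Gamma> r)" "x \<in> carrier (Mp r)"
 shows "pair r (a \<odot>\<^bsub>Free \<Gamma> r\<^esub> \<gamma>) x = a (pair r \<gamma> x)"
proof -
 interpret a: lhom R M M a using M_lm M_lm assms(1) by (rule lhomI)
 have "finsum M (\<lambda>i. (a \<odot>\<^bsub>Free \<Gamma> r\<^esub> \<gamma>) i (x i)) {..<r} = finsum M (\<lambda>i. a (\<gamma> i (x i))) {..<r}"
  using app_closed[OF assms(2,3)] assms(3) by (intro MM.M.finsum_cong' refl) auto
 also have "\<dots> = a (finsum M (\<lambda>i. \<gamma> i (x i)) {..<r})"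
  using app_closed[OF assms(2,3)] by (intro a.finsum[symmetric] finite_lessThan) auto
 finally show ?thesis using assms(3) by (simp add: pair_def)
qed

lemma pair_comp_hom:
 assumes "k \<in> Hom R M (Mp r)"
 shows "(\<lambda>\<gamma>\<in>carrier (Free \<Gamma> r). \<lambda>m\<in>carrier M. pair r \<gamma> (k m)) \<in> Hom \<Gamma> (Free \<Gamma> r) (Reg \<Gamma>)"
 using free_left_module[OF \<Gamma>_ring]
proof (rule Hom_restrictI)
 note kc = Hom_closed[OF assms]
 show "(\<lambda>m\<in>carrier M. pair r \<gamma> (k m)) \<in> carrier (Reg \<Gamma>)" if "\<gamma> \<in> carrier (Free \<Gamma> r)" for \<gamma>
  using Hom_comp[OF M_lm assms pair_hom[OF that]] by simp
 show "(\<lambda>m\<in>carrier M. pair r (\<gamma> \<oplus>\<^bsub>Free \<Gamma> r\<^esub> \<delta>) (k m))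
  = (\<lambda>m\<in>carrier M. pair r \<gamma> (k m)) \<oplus>\<^bsub>Reg \<Gamma>\<^esub> (\<lambda>m\<in>carrier M. pair r \<delta> (k m))"
  if "\<gamma> \<in> carrier (Free \<Gamma> r)" "\<delta> \<in> carrier (Free \<Gamma> r)" for \<gamma> \<delta>
  using pair_add[OF that kc] by (simp del: free_simps cong: restrict_cong)
 show "(\<lambda>m\<in>carrier M. pair r (a \<odot>\<^bsub>Free \<Gamma> r\<^esub> \<gamma>) (k m)) = a \<odot>\<^bsub>Reg \<Gamma>\<^esub> (\<lambda>m\<in>carrier M. pair r \<gamma> (k m))"
  if "a \<in> carrier \<Gamma>" "\<gamma> \<in> carrier (Free \<Gamma> r)" for a \<gamma>
  using pair_smult[OF _ that(2) kc, of a] that(1) by (simp del: free_simps cong: restrict_cong)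
qed

text \<open>A map on a free module is determined by the images of the basis. When
  \<open>pair\<close> identifies the free module with \<open>Hom(M^r, M)\<close>, it becomes
  composition with the map from \<open>C\<close> to \<open>M^r\<close> that has those images as
  components.\<close>

lemma star_eval:
 assumes "LMod R C" "p \<in> Hom \<Gamma> (Free \<Gamma> r) (star R M C)" "\<gamma> \<in> carrier (Free \<Gamma> r)" "c \<in> carrier C"
 shows "(\<lambda>i\<in>{..<r}. p (basis \<Gamma> r i) c) \<in> carrier (Mp r)" "p \<gamma> c = pair r \<gamma> (\<lambda>i\<in>{..<r}. p (basis \<Gamma> r i) c)"
proof -
 have f: "p (basis \<Gamma> r i) \<in> Hom R C M" for i using Hom_closed[OF assms(2) basis_closed[OF \<Gamma>_ring]] by simp
 show y: "(\<lambda>i\<in>{..<r}. p (basis \<Gamma> r i) c) \<in> carrier (Mp r)" using Hom_closed[OF f assms(4)] by auto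
 have g: "\<gamma> i \<in> Hom R M M" if "i < r" for i using free_app[OF assms(3) that] .
 have gf: "\<gamma> i \<odot>\<^bsub>star R M C\<^esub> p (basis \<Gamma> r i) \<in> Hom R C M" if "i < r" for i
  using Hom_comp[OF assms(1) f[of i] g[OF that]] by (simp del: free_simps)
 have gc: "\<gamma> i (p (basis \<Gamma> r i) c) \<in> carrier M" if "i < r" for i using Hom_closed[OF g[OF that] Hom_closed[OF f assms(4)]] .
 have "p \<gamma> c = finsum (star R M C) (\<lambda>i. \<gamma> i \<odot>\<^bsub>star R M C\<^esub> p (basis \<Gamma> r i)) {..<r} c"
  using free_hom_eval[OF \<Gamma>_ring star_lm[OF assms(1)] assms(2,3)] by (rule fun_cong)
 also have "\<dots> = finsum M (\<lambda>i. (\<gamma> i \<odot>\<^bsub>star R M C\<^esub> p (basis \<Gamma> r i)) c) {..<r}"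
  using gf by (intro star_finsum[OF assms(1) finite_lessThan _ assms(4)]) (simp del: star_simps)
 also have "\<dots> = finsum M (\<lambda>i. \<gamma> i ((\<lambda>i\<in>{..<r}. p (basis \<Gamma> r i) c) i)) {..<r}"
  using gc assms(4) by (intro MM.M.finsum_cong' refl) auto
 also have "\<dots> = pair r \<gamma> (\<lambda>i\<in>{..<r}. p (basis \<Gamma> r i) c)" unfolding pair_def using y by (simp only: restrict_apply')
 finally show "p \<gamma> c = pair r \<gamma> (\<lambda>i\<in>{..<r}. p (basis \<Gamma> r i) c)" .
qed

text \<open>\<open>Hom(q, M)\<close> in coordinates: the restrictions of \<open>g\<close> after
  \<open>q\<close> to the \<open>r\<close> summands of \<open>M^r\<close>.\<close>

abbreviation "iota r q C1 \<equiv> (\<lambda>g\<in>Hom R C1 M. \<lambda>i\<in>{..<r}. \<lambda>m\<in>carrier M. g (q (mi r i m)))"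

lemma pair_iota:
 assumes "LMod R C1" "q \<in> Hom R (Mp r) C1" and g: "g \<in> Hom R C1 M" and x: "x \<in> carrier (Mp r)"
 shows "pair r (iota r q C1 g) x = g (q x)"
proof -
 have xi: "x i \<in> carrier M" if "i < r" for i using x that by auto
 have qm: "q (mi r i m) \<in> carrier C1" if "i < r" "m \<in> carrier M" for i m by (rule Hom_closed[OF assms(2) mi_closed[OF that]])
 have "g (q x) = (\<lambda>x\<in>carrier (Mp r). g (q x)) x" using x by (simp only: restrict_apply')
 also have "\<dots> = finsum M (\<lambda>i. (\<lambda>x\<in>carrier (Mp r). g (q x)) (mi r i (x i))) {..<r}"
  by (rule Mp_hom_eq[OF M_lm Hom_comp[OF Mp_lm assms(2) g] x])
 also have "\<dots> = finsum M (\<lambda>i. iota r q C1 g i (x i)) {..<r}"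
  using xi mi_closed[OF _ xi] g Hom_closed[OF g qm[OF _ xi]] by (intro MM.M.finsum_cong' refl) (auto simp del: pi_module_simps)
 finally show ?thesis using x by (simp only: pair_def restrict_apply')
qed

text \<open>Left exactness of \<open>Hom(-, M)\<close>: \<open>pair r \<gamma>\<close> factors
  through \<open>q\<close> iff it vanishes on the kernel of \<open>q\<close>, and by condition
  \<open>ker\<close> the kernel of \<open>\<Psi>\<close> consists of precisely these
  \<open>\<gamma>\<close>.\<close>

lemma star_short_exact:
 assumes "LMod R C1" "q \<in> Hom R (Mp r) C1" "q ` carrier (Mp r) = carrier C1"
  and "\<Psi> \<in> Hom \<Gamma> (Free \<Gamma> r) N" "\<Psi> ` carrier (Free \<Gamma> r) = carrier N"
  and ker: "\<And>\<gamma>. \<gamma> \<in> carrier (Free \<Gamma> r) \<Longrightarrow>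
   \<Psi> \<gamma> = \<zero>\<^sub>N \<longleftrightarrow> (\<forall>x\<in>carrier (Mp r). q x = \<zero>\<^bsub>C1\<^esub> \<longrightarrow> pair r \<gamma> x = \<zero>\<^sub>M)"
 shows "short_exact \<Gamma> (star R M C1) (Free \<Gamma> r) N (iota r q C1) \<Psi>"
proof -
 let ?F = "\<lambda>i. \<lambda>g\<in>carrier (star R M C1). \<lambda>m\<in>carrier M. g (q (mi r i m))"
 have qm: "q (mi r i m) \<in> carrier C1" if "i < r" "m \<in> carrier M" for i m by (rule Hom_closed[OF assms(2) mi_closed[OF that]])
 have gh: "(\<lambda>m\<in>carrier M. g (q (mi r i m))) \<in> Hom R M M" if "i < r" "g \<in> Hom R C1 M" for i g
  using Hom_comp[OF M_lm Hom_comp[OF M_lm mi_hom[OF that(1)] assms(2)] that(2)] by (simp cong: restrict_cong)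
 have F: "?F i \<in> Hom \<Gamma> (star R M C1) (Reg \<Gamma>)" if i: "i \<in> {..<r}" for i
  using star_lm[OF assms(1)]
  by (rule Hom_restrictI) (use i gh qm in \<open>auto simp: fun_eq_iff\<close>)
 have "(\<lambda>g\<in>carrier (star R M C1). \<lambda>i\<in>{..<r}. ?F i g) \<in> Hom \<Gamma> (star R M C1) (Free \<Gamma> r)"
  unfolding free_module_def by (rule pi_tuple_hom[OF star_lm[OF assms(1)] F])
 then have \<iota>: "iota r q C1 \<in> Hom \<Gamma> (star R M C1) (Free \<Gamma> r)" by (simp cong: restrict_cong)
 note key = pair_iota[OF assms(1,2)]
 note \<iota>c = Hom_closed[OF \<iota>, unfolded star_simps]
 show ?thesis unfolding short_exact_def
 proof (intro conjI \<iota> assms(4,5))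
  show "inj_on (iota r q C1) (carrier (star R M C1))"
  proof (rule inj_onI)
   fix g g' assume "g \<in> carrier (star R M C1)" "g' \<in> carrier (star R M C1)" and eq: "iota r q C1 g = iota r q C1 g'"
   then have g: "g \<in> Hom R C1 M" "g' \<in> Hom R C1 M" by simp_all
   have "g (q x) = g' (q x)" if "x \<in> carrier (Mp r)" for x using key[OF g(1) that] key[OF g(2) that] eq by (simp only:)
   moreover have "\<exists>x\<in>carrier (Mp r). z = q x" if "z \<in> carrier C1" for z using that assms(3) by blast
   ultimately have "g z = g' z" if "z \<in> carrier C1" for z using that by metis
   then show "g = g'" by (rule Hom_eqI[OF g])
  qed
  show "iota r q C1 ` carrier (star R M C1) = {y \<in> carrier (Free \<Gamma> r). \<Psi> y = \<zero>\<^sub>N}"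
  proof (intro equalityI subsetI)
   fix \<gamma> assume "\<gamma> \<in> iota r q C1 ` carrier (star R M C1)"
   then obtain g where g: "g \<in> Hom R C1 M" "\<gamma> = iota r q C1 g" unfolding star_simps by blast
   have gc: "\<gamma> \<in> carrier (Free \<Gamma> r)" unfolding g(2) by (rule \<iota>c[OF g(1)])
   have "pair r \<gamma> x = \<zero>\<^sub>M" if "x \<in> carrier (Mp r)" "q x = \<zero>\<^bsub>C1\<^esub>" for x
    unfolding g(2) key[OF g(1) that(1)] that(2) by (rule lhom.zero[OF lhomI[OF assms(1) M_lm g(1)]])
   then have "\<Psi> \<gamma> = \<zero>\<^sub>N" unfolding ker[OF gc] by blast
   then show "\<gamma> \<in> {y \<in> carrier (Free \<Gamma> r). \<Psi> y = \<zero>\<^sub>N}" using gc by (intro CollectI conjI)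
  next
   fix \<gamma> assume "\<gamma> \<in> {y \<in> carrier (Free \<Gamma> r). \<Psi> y = \<zero>\<^sub>N}"
   then have gc: "\<gamma> \<in> carrier (Free \<Gamma> r)" and "\<Psi> \<gamma> = \<zero>\<^sub>N" by blast+
   then have k: "pair r \<gamma> x = \<zero>\<^sub>M" if "x \<in> carrier (Mp r)" "q x = \<zero>\<^bsub>C1\<^esub>" for x using ker[OF gc] that by blast
   obtain g where g: "g \<in> Hom R C1 M" "\<And>x. x \<in> carrier (Mp r) \<Longrightarrow> g (q x) = pair r \<gamma> x"
    by (rule Hom_factor[OF Mp_lm assms(1) M_lm assms(2) pair_hom[OF gc] assms(3) k]) (assumption | rule that)+
   have "iota r q C1 g i = \<gamma> i" if i: "i < r" for i
   proof -
    have "iota r q C1 g i = (\<lambda>m\<in>carrier M. \<gamma> i m)"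
     using g(1) i g(2)[OF mi_closed[OF i]] pair_mi[OF gc i] by (simp cong: restrict_cong)
    then show ?thesis using Hom_restrict_self[OF free_app[OF gc i]] by simp
   qed
   then have eq: "\<gamma> i = iota r q C1 g i" if "i \<in> {..<r}" for i using that by simp
   have "\<gamma> \<in> {..<r} \<rightarrow>\<^sub>E Hom R M M" "iota r q C1 g \<in> {..<r} \<rightarrow>\<^sub>E Hom R M M" using gc \<iota>c[OF g(1)] by simp_all
   then have "\<gamma> = iota r q C1 g" using eq by (rule PiE_ext)
   then show "\<gamma> \<in> iota r q C1 ` carrier (star R M C1)" using g(1) unfolding star_simps by blast
  qed
 qed
qed

text \<open>Otherwise the tuple of the values of \<open>A\<close> at the generators of \<open>Hom(C, M)\<close> would not be in the image of
 \<open>C\<close> in \<open>M\<^sup>r\<close>, and a map from the cokernel to \<open>M\<close> that detects it would be a relation which \<open>A\<close> violates.\<close>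

lemma reflexive:
 fixes C :: "'r lmod"
 assumes C: "LMod R C" and p: "p \<in> Hom \<Gamma> (Free \<Gamma> r) (star R M C)" "p ` carrier (Free \<Gamma> r) = carrier (star R M C)"
  and A: "A \<in> Hom \<Gamma> (star R M C) (Reg \<Gamma>)" and m: "m \<in> carrier M"
 obtains c where "c \<in> carrier C" "\<And>f. f \<in> Hom R C M \<Longrightarrow> f c = A f m"
proof -
 let ?f = "\<lambda>i. p (basis \<Gamma> r i)"
 have f: "?f i \<in> Hom R C M" for i using Hom_closed[OF p(1) basis_closed[OF \<Gamma>_ring]] by simp
 have Af: "A g \<in> Hom R M M" if "g \<in> Hom R C M" for g using Hom_closed[OF A, of g] that by simp
 define y where "y = (\<lambda>i\<in>{..<r}. A (?f i) m)"
 have y: "y \<in> carrier (Mp r)" unfolding y_def using Hom_closed[OF Af[OF f] m] by auto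
 \<comment> \<open>By linearity, \<open>A\<close> followed by evaluation at \<open>m\<close> is
   evaluation at the tuple \<open>y\<close>; it remains to see that \<open>y\<close> comes from a
   point of \<open>C\<close>.\<close>
 have ev: "A (p \<gamma>) m = pair r \<gamma> y" if \<gamma>: "\<gamma> \<in> carrier (Free \<Gamma> r)" for \<gamma>
 proof -
  let ?h = "\<lambda>\<gamma>\<in>carrier (Free \<Gamma> r). A (p \<gamma>)"
  have h: "?h \<in> Hom \<Gamma> (Free \<Gamma> r) (Reg \<Gamma>)" by (rule Hom_comp[OF free_left_module[OF \<Gamma>_ring] p(1) A])
  have hb: "?h (basis \<Gamma> r i) = A (?f i)" for i using basis_closed[OF \<Gamma>_ring] by (simp only: restrict_apply')
  have gA: "(\<lambda>m\<in>carrier M. \<gamma> i (A (?f i) m)) \<in> Hom R M M" if "i < r" for i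
   by (rule Hom_comp[OF M_lm Af[OF f] free_app[OF \<gamma> that]])
  have gc: "\<gamma> i (A (?f i) m) \<in> carrier M" if "i < r" for i
   by (rule Hom_closed[OF free_app[OF \<gamma> that] Hom_closed[OF Af[OF f] m]])
  have "A (p \<gamma>) = ?h \<gamma>" using \<gamma> by (simp only: restrict_apply')
  also have "\<dots> = finsum (Reg \<Gamma>) (\<lambda>i. \<gamma> i \<odot>\<^bsub>Reg \<Gamma>\<^esub> A (?f i)) {..<r}"
   using free_hom_eval[OF \<Gamma>_ring regular_left_module[OF \<Gamma>_ring] h \<gamma>] unfolding hb .
  finally have "A (p \<gamma>) m = finsum (Reg \<Gamma>) (\<lambda>i. \<gamma> i \<odot>\<^bsub>Reg \<Gamma>\<^esub> A (?f i)) {..<r} m" by (rule fun_cong)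
  also have "\<dots> = finsum M (\<lambda>i. (\<gamma> i \<odot>\<^bsub>Reg \<Gamma>\<^esub> A (?f i)) m) {..<r}"
   using gA by (intro regular_finsum[OF finite_lessThan _ m]) auto
  also have "\<dots> = finsum M (\<lambda>i. \<gamma> i (y i)) {..<r}"
   using gc m by (intro MM.M.finsum_cong' refl) (auto simp: y_def)
  finally show ?thesis using y by (simp only: pair_def restrict_apply')
 qed
 let ?e = "\<lambda>c\<in>carrier C. \<lambda>i\<in>{..<r}. ?f i c"
 have e: "?e \<in> Hom R C (Mp r)" by (rule pi_tuple_hom[OF C f])
 interpret e: lhom R C "Mp r" ?e using C Mp_lm e by (rule lhomI)
 have "y \<in> ?e ` carrier C"
 proof (rule ccontr)
  assume ny: "y \<notin> ?e ` carrier C"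
  obtain Q :: "('r, nat \<Rightarrow> (nat \<Rightarrow> 'r) set) module" and q where Q: "LMod R Q" "q \<in> Hom R (Mp r) Q"
   "q ` carrier (Mp r) = carrier Q" "\<And>x. x \<in> carrier (Mp r) \<Longrightarrow> q x = \<zero>\<^sub>Q \<longleftrightarrow> x \<in> ?e ` carrier C"
   by (rule quotient_module_exists[OF Mp_lm e.range]) (rule that)
  have "q y \<noteq> \<zero>\<^sub>Q" using Q(4)[OF y] ny by blast
  then obtain g where g: "g \<in> Hom R Q M" "g (q y) \<noteq> \<zero>\<^sub>M"
   by (rule cogenerator[OF Q(1) Hom_closed[OF Q(2) y]]) (rule that)
  \<comment> \<open>The composite of \<open>g\<close> and \<open>q\<close>, read as a tuple of
    endomorphisms. It vanishes on the image of \<open>C\<close>, so \<open>p \<gamma>\<close> is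
    zero, but it does not vanish at \<open>y\<close>.\<close>
  define \<gamma> where "\<gamma> = (\<lambda>i\<in>{..<r}. \<lambda>m\<in>carrier M. g (q (mi r i m)))"
  have "\<gamma> i \<in> Hom R M M" if "i < r" for i
   using Hom_comp[OF M_lm Hom_comp[OF M_lm mi_hom[OF that] Q(2)] g(1)] that by (simp add: \<gamma>_def cong: restrict_cong)
  then have \<gamma>: "\<gamma> \<in> carrier (Free \<Gamma> r)" by (auto simp: \<gamma>_def)
  have key: "pair r \<gamma> x = g (q x)" if x: "x \<in> carrier (Mp r)" for x
  proof -
   have xi: "x i \<in> carrier M" if "i < r" for i using x that by auto
   have "g (q x) = (\<lambda>x\<in>carrier (Mp r). g (q x)) x" using x by (simp only: restrict_apply')
   also have "\<dots> = finsum M (\<lambda>i. (\<lambda>x\<in>carrier (Mp r). g (q x)) (mi r i (x i))) {..<r}"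
    by (rule Mp_hom_eq[OF M_lm Hom_comp[OF Mp_lm Q(2) g(1)] x])
   also have "\<dots> = finsum M (\<lambda>i. \<gamma> i (x i)) {..<r}"
    using xi mi_closed[OF _ xi] app_closed[OF \<gamma> x] by (intro MM.M.finsum_cong' refl) (auto simp: \<gamma>_def simp del: pi_module_simps)
   finally show ?thesis using x by (simp only: pair_def restrict_apply')
  qed
  have pg: "p \<gamma> \<in> Hom R C M" using Hom_closed[OF p(1) \<gamma>] by simp
  have "p \<gamma> c = \<zero>\<^sub>M" if c: "c \<in> carrier C" for c
  proof -
   have "p \<gamma> c = g (q (?e c))" using star_eval(2)[OF C p(1) \<gamma> c] key[OF star_eval(1)[OF C p(1) \<gamma> c]] c by simp
   also have "q (?e c) = \<zero>\<^sub>Q" using Q(4)[OF e.closed[OF c]] c by blast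
   finally show ?thesis using lhom.zero[OF lhomI[OF Q(1) M_lm g(1)]] by simp
  qed
  then have "p \<gamma> = \<zero>\<^bsub>star R M C\<^esub>" using Hom_eqI[OF pg Hom_zero[OF C M_lm]] by simp
  then have "A (p \<gamma>) = \<zero>\<^bsub>Reg \<Gamma>\<^esub>"
   using lhom.zero[OF lhomI[OF star_lm[OF C] regular_left_module[OF \<Gamma>_ring] A]] by simp
  then have "A (p \<gamma>) m = \<zero>\<^sub>M" using m by simp
  then show False using ev[OF \<gamma>] key[OF y] g(2) by simp
 qed
 then obtain c where c: "c \<in> carrier C" "y = ?e c" by blast
 show ?thesis
 proof (rule that[OF c(1)])
  fix g assume "g \<in> Hom R C M"
  then have "g \<in> p ` carrier (Free \<Gamma> r)" unfolding p(2) by simp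
  then obtain \<gamma> where \<gamma>: "\<gamma> \<in> carrier (Free \<Gamma> r)" "g = p \<gamma>" by blast
  show "g c = A g m" unfolding \<gamma>(2) ev[OF \<gamma>(1)] star_eval(2)[OF C p(1) \<gamma>(1) c(1)] using c by simp
 qed
qed

text \<open>A section of \<open>p\<close> amounts to a dual basis. By \<open>reflexive\<close>, its
  coordinate functionals followed by evaluation at \<open>m\<close> are evaluations at points
  \<open>b i m\<close> of \<open>C\<close>. The maps \<open>b i\<close> from \<open>M\<close> to
  \<open>C\<close> exhibit \<open>C\<close> as a retract of \<open>M^r\<close>; identities in
  \<open>C\<close> are tested by homomorphisms to \<open>M\<close>.\<close>

lemma star_split_hull:
 assumes Co: "S.obj C" and p: "p \<in> Hom \<Gamma> (Free \<Gamma> r) (star R M C)" "p ` carrier (Free \<Gamma> r) = carrier (star R M C)"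
  and \<sigma>: "\<sigma> \<in> Hom \<Gamma> (star R M C) (Free \<Gamma> r)" "\<And>f. f \<in> Hom R C M \<Longrightarrow> p (\<sigma> f) = f"
 shows "C \<in> closure_hull S.T {M}"
proof -
 have C: "LMod R C" by (rule S.objD(1)[OF Co])
 interpret C: left_module R C by (rule C)
 let ?f = "\<lambda>i. p (basis \<Gamma> r i)"
 have f: "?f i \<in> Hom R C M" for i using Hom_closed[OF p(1) basis_closed[OF \<Gamma>_ring]] by simp
 have \<sigma>c: "\<sigma> g \<in> carrier (Free \<Gamma> r)" if "g \<in> Hom R C M" for g using Hom_closed[OF \<sigma>(1), of g] that by simp
 have "\<exists>c. c \<in> carrier C \<and> (\<forall>g\<in>Hom R C M. g c = \<sigma> g i m)" if i: "i < r" and m: "m \<in> carrier M" for i m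
 proof -
  have pr: "(\<lambda>x\<in>carrier (Free \<Gamma> r). x i) \<in> Hom \<Gamma> (Free \<Gamma> r) (Reg \<Gamma>)"
   unfolding free_module_def
   by (rule pi_proj_hom[of \<Gamma> "{..<r}" "\<lambda>_. Reg \<Gamma>" i, OF \<Gamma>_ring regular_left_module[OF \<Gamma>_ring]]) (use i in simp)
  obtain c where c: "c \<in> carrier C"
   "\<And>g. g \<in> Hom R C M \<Longrightarrow> g c = (\<lambda>g\<in>carrier (star R M C). (\<lambda>x\<in>carrier (Free \<Gamma> r). x i) (\<sigma> g)) g m"
   by (rule reflexive[OF C p Hom_comp[OF star_lm[OF C] \<sigma>(1) pr] m]) (rule that)
  have "g c = \<sigma> g i m" if "g \<in> Hom R C M" for g using c(2)[OF that] that \<sigma>c[OF that] by (simp del: free_simps)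
  then show ?thesis using c(1) by blast
 qed
 then have "\<forall>i. \<forall>m. \<exists>c. i < r \<longrightarrow> m \<in> carrier M \<longrightarrow> c \<in> carrier C \<and> (\<forall>g\<in>Hom R C M. g c = \<sigma> g i m)" by blast
 then obtain b where "\<forall>i. \<forall>m. i < r \<longrightarrow> m \<in> carrier M \<longrightarrow> b i m \<in> carrier C \<and> (\<forall>g\<in>Hom R C M. g (b i m) = \<sigma> g i m)" by metis
 then have b: "b i m \<in> carrier C" "\<And>g. g \<in> Hom R C M \<Longrightarrow> g (b i m) = \<sigma> g i m" if "i < r" "m \<in> carrier M" for i m using that by blast+
 have bh: "(\<lambda>m\<in>carrier M. b i m) \<in> Hom R M C" if i: "i < r" for i using M_lm
 proof (rule Hom_restrictI)
  fix x y assume x: "x \<in> carrier M" and y: "y \<in> carrier M"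
  show "b i (x \<oplus>\<^sub>M y) = b i x \<oplus>\<^sub>C b i y"
  proof (rule separates[OF C])
   fix g assume g: "g \<in> Hom R C M"
   show "g (b i (x \<oplus>\<^sub>M y)) = g (b i x \<oplus>\<^sub>C b i y)"
    using Hom_add[OF g b(1)[OF i x] b(1)[OF i y]] Hom_add[OF free_app[OF \<sigma>c[OF g] i] x y]
    by (simp add: b(2)[OF i _ g] x y)
  qed (use b(1)[OF i] x y in auto)
 next
  fix s x assume s: "s \<in> carrier R" and x: "x \<in> carrier M"
  show "b i (s \<odot>\<^sub>M x) = s \<odot>\<^sub>C b i x"
  proof (rule separates[OF C])
   fix g assume g: "g \<in> Hom R C M"
   show "g (b i (s \<odot>\<^sub>M x)) = g (s \<odot>\<^sub>C b i x)"
    using Hom_smult[OF g s b(1)[OF i x]] Hom_smult[OF free_app[OF \<sigma>c[OF g] i] s x]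
    by (simp add: b(2)[OF i _ g] s x)
  qed (use b(1)[OF i] s x in auto)
 qed (use b(1)[OF i] in blast)
 show ?thesis
 proof (rule S.hull_sum[OF M_obj Co, of r ?f "\<lambda>i. \<lambda>m\<in>carrier M. b i m"])
  fix w assume w: "w \<in> carrier C"
  have fw: "?f i w \<in> carrier M" for i by (rule Hom_closed[OF f w])
  have bc: "(\<lambda>i. (\<lambda>m\<in>carrier M. b i m) (?f i w)) \<in> {..<r} \<rightarrow> carrier C" using b(1) fw by auto
  show "w = finsum C (\<lambda>i. (\<lambda>m\<in>carrier M. b i m) (?f i w)) {..<r}"
  proof (rule separates[OF C w C.M.finsum_closed[OF bc]])
   fix g assume g: "g \<in> Hom R C M"
   interpret g: lhom R C M g using C M_lm g by (rule lhomI)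
   have "g w = p (\<sigma> g) w" using \<sigma>(2)[OF g] by simp
   also have "\<dots> = pair r (\<sigma> g) (\<lambda>i\<in>{..<r}. ?f i w)" by (rule star_eval(2)[OF C p(1) \<sigma>c[OF g] w])
   also have "\<dots> = finsum M (\<lambda>i. \<sigma> g i ((\<lambda>i\<in>{..<r}. ?f i w) i)) {..<r}"
    using star_eval(1)[OF C p(1) \<sigma>c[OF g] w] by (simp only: pair_def restrict_apply')
   also have "\<dots> = finsum M (\<lambda>i. g ((\<lambda>m\<in>carrier M. b i m) (?f i w))) {..<r}"
   proof (intro MM.M.finsum_cong' refl)
    fix i assume "i \<in> {..<r}"
    then show "\<sigma> g i ((\<lambda>i\<in>{..<r}. ?f i w) i) = g ((\<lambda>m\<in>carrier M. b i m) (?f i w))"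
     using b(2)[OF _ fw g] fw by (simp del: End_simps)
   qed (use b(1) fw in auto)
   also have "\<dots> = g (finsum C (\<lambda>i. (\<lambda>m\<in>carrier M. b i m) (?f i w)) {..<r})"
    by (rule g.finsum[OF finite_lessThan bc, symmetric])
   finally show "g w = g (finsum C (\<lambda>i. (\<lambda>m\<in>carrier M. b i m) (?f i w)) {..<r})" .
  qed
 qed (use f bh in auto)
qed

section \<open>Descending along a resolution over the endomorphism ring\<close>

lemma star_cover:
 assumes "S.obj C"
 obtains r p where "p \<in> Hom \<Gamma> (Free \<Gamma> r) (star R M C)" "p ` carrier (Free \<Gamma> r) = carrier (star R M C)"
 by (rule free_cover[OF star_lm[OF S.objD(1)[OF assms]] star_fin_gen[OF M_lm M_fin_gen S.objD[OF assms]]]) (rule that)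

text \<open>Generators of \<open>Hom(C, M)\<close> are the components of a map from \<open>C\<close>
  to \<open>M^r\<close> through which all homomorphisms to \<open>M\<close> factor. It is injective
  because \<open>M\<close> is a cogenerator, and for its cokernel \<open>C1\<close> the module
  \<open>Hom(C1, M)\<close> is the syzygy of \<open>Hom(C, M)\<close>; so
  \<open>free_retract_syzygy\<close> applies.\<close>

lemma ladder_step:
 fixes Q Zj Z' :: "'r lmap lmod"
 assumes Co: "S.obj C" and fr: "free_retract \<Gamma> (star R M C) Zj"
  and Z: "LMod \<Gamma> Z'" "LMod \<Gamma> Zj" "projective_module \<Gamma> Q" "short_exact \<Gamma> Z' Q Zj j d"
 obtains C1 D i q where "short_exact R C D C1 i q" "S.obj D" "S.obj C1" "D \<in> closure_hull S.T {M}" "free_retract \<Gamma> (star R M C1) Z'"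
proof -
 have C: "LMod R C" by (rule S.objD(1)[OF Co])
 obtain r p where p: "p \<in> Hom \<Gamma> (Free \<Gamma> r) (star R M C)" "p ` carrier (Free \<Gamma> r) = carrier (star R M C)"
  by (rule star_cover[OF Co]) (rule that)
 let ?f = "\<lambda>i. p (basis \<Gamma> r i)"
 have f: "?f i \<in> Hom R C M" for i using Hom_closed[OF p(1) basis_closed[OF \<Gamma>_ring]] by simp
 let ?e = "\<lambda>c\<in>carrier C. \<lambda>i\<in>{..<r}. ?f i c"
 have e: "?e \<in> Hom R C (Mp r)" by (rule pi_tuple_hom[OF C f])
 \<comment> \<open>The power of \<open>M\<close> is copied to the universe, in order to be an object
   of the stable category.\<close>
 obtain D :: "'r lmod" and a a' where D: "LMod R D" "fin_gen R D" "a \<in> Hom R (Mp r) D" "a' \<in> Hom R D (Mp r)"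
  "\<And>x. x \<in> carrier (Mp r) \<Longrightarrow> a' (a x) = x" "\<And>y. y \<in> carrier D \<Longrightarrow> a (a' y) = y"
  by (rule fin_gen_copy_iso[OF Mp_lm Mp_fin_gen]) (rule that)
 have Do: "S.obj D" using D(1,2) by (simp add: S.obj_def)
 interpret a: lhom R "Mp r" D a using Mp_lm D(1,3) by (rule lhomI)
 define i where "i = (\<lambda>c\<in>carrier C. a (?e c))"
 have i: "i \<in> Hom R C D" unfolding i_def by (rule Hom_comp[OF C e D(3)])
 have ec: "?e c \<in> carrier (Mp r)" if "c \<in> carrier C" for c by (rule Hom_closed[OF e that])
 have ie: "i c = a (?e c)" if "c \<in> carrier C" for c using that by (simp only: i_def restrict_apply')
 interpret i: lhom R C D i using C D(1) i by (rule lhomI)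
 have p_eq: "p \<gamma> c = pair r \<gamma> (?e c)" if "\<gamma> \<in> carrier (Free \<Gamma> r)" "c \<in> carrier C" for \<gamma> c
  using star_eval(2)[OF C p(1) that] that(2) by simp
 have inj: "inj_on i (carrier C)"
 proof (rule inj_onI)
  fix x y assume x: "x \<in> carrier C" and y: "y \<in> carrier C" and eq: "i x = i y"
  have "a' (i x) = a' (i y)" using eq by simp
  then have e_eq: "?e x = ?e y" unfolding ie[OF x] ie[OF y] D(5)[OF ec[OF x]] D(5)[OF ec[OF y]] .
  show "x = y"
  proof (rule separates[OF C x y])
   fix g assume "g \<in> Hom R C M"
   then have "g \<in> p ` carrier (Free \<Gamma> r)" unfolding p(2) by simp
   then obtain \<gamma> where \<gamma>: "\<gamma> \<in> carrier (Free \<Gamma> r)" "g = p \<gamma>" by blast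
   show "g x = g y" unfolding \<gamma>(2) p_eq[OF \<gamma>(1) x] p_eq[OF \<gamma>(1) y] e_eq ..
  qed
 qed
 obtain C1 :: "'r lmod" and q where C1: "LMod R C1" "q \<in> Hom R D C1" "q ` carrier D = carrier C1"
  "\<And>x. x \<in> carrier D \<Longrightarrow> q x = \<zero>\<^bsub>C1\<^esub> \<longleftrightarrow> x \<in> i ` carrier C"
  by (rule quotient_module_exists[OF D(1) i.range]) (rule that)
 have C1o: "S.obj C1" unfolding S.obj_def using C1(1) left_module.fin_gen_image[OF D(1) C1(1-3) D(2)] by simp
 have "i ` carrier C = {y \<in> carrier D. q y = \<zero>\<^bsub>C1\<^esub>}" using C1(4) i.closed by blast
 then have se: "short_exact R C D C1 i q" unfolding short_exact_def using i inj C1(2,3) by simp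
 have Dh: "D \<in> closure_hull S.T {M}"
 proof (rule S.hull_sum[OF M_obj Do, of r "\<lambda>k. \<lambda>y\<in>carrier D. (\<lambda>x\<in>carrier (Mp r). x k) (a' y)" "\<lambda>k. \<lambda>m\<in>carrier M. a ((\<lambda>m\<in>carrier M. mi r k m) m)"])
  fix k assume k: "k < r"
  show "(\<lambda>y\<in>carrier D. (\<lambda>x\<in>carrier (Mp r). x k) (a' y)) \<in> Hom R D M"
   by (rule Hom_comp[OF D(1,4) pi_proj_hom[of R "{..<r}" "\<lambda>_. M" k, OF R.ring_axioms M_lm]]) (use k in simp)
  show "(\<lambda>m\<in>carrier M. a ((\<lambda>m\<in>carrier M. mi r k m) m)) \<in> Hom R M D" by (rule Hom_comp[OF M_lm mi_hom[OF k] D(3)])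
 next
  fix y assume y: "y \<in> carrier D"
  have a'y: "a' y \<in> carrier (Mp r)" by (rule Hom_closed[OF D(4) y])
  then have yk: "a' y k \<in> carrier M" if "k < r" for k using that by auto
  have "y = a (a' y)" using D(6)[OF y] by simp
  also have "\<dots> = finsum D (\<lambda>k. a (mi r k (a' y k))) {..<r}" by (rule Mp_hom_eq[OF D(1,3) a'y])
  also have "\<dots> = finsum D (\<lambda>k. (\<lambda>m\<in>carrier M. a ((\<lambda>m\<in>carrier M. mi r k m) m)) ((\<lambda>y\<in>carrier D. (\<lambda>x\<in>carrier (Mp r). x k) (a' y)) y)) {..<r}"
   using yk mi_closed[OF _ yk] y a'y by (intro a.Y.M.finsum_cong' refl) (auto simp del: pi_module_simps)
  finally show "y = finsum D (\<lambda>k. (\<lambda>m\<in>carrier M. a ((\<lambda>m\<in>carrier M. mi r k m) m)) ((\<lambda>y\<in>carrier D. (\<lambda>x\<in>carrier (Mp r). x k) (a' y)) y)) {..<r}" .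
 qed
 let ?q = "\<lambda>x\<in>carrier (Mp r). q (a x)"
 have q: "?q \<in> Hom R (Mp r) C1" by (rule Hom_comp[OF Mp_lm D(3) C1(2)])
 have qs: "?q ` carrier (Mp r) = carrier C1"
 proof (intro equalityI subsetI)
  fix z assume "z \<in> carrier C1"
  then obtain y where y: "y \<in> carrier D" "z = q y" using C1(3) by blast
  have "z = ?q (a' y)" using y D(6)[OF y(1)] Hom_closed[OF D(4) y(1)] by (simp del: pi_module_simps)
  then show "z \<in> ?q ` carrier (Mp r)" using Hom_closed[OF D(4) y(1)] by (rule image_eqI)
 qed (use Hom_closed[OF q] in blast)
 have "short_exact \<Gamma> (star R M C1) (Free \<Gamma> r) (star R M C) (iota r ?q C1) p"
 proof (rule star_short_exact[OF C1(1) q qs p])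
  fix \<gamma> assume \<gamma>: "\<gamma> \<in> carrier (Free \<Gamma> r)"
  \<comment> \<open>The kernel of \<open>?q\<close> is the image of \<open>C\<close>, so vanishing
    of \<open>pair r \<gamma>\<close> on it means that \<open>p \<gamma>\<close> is zero.\<close>
  have "?q x = \<zero>\<^bsub>C1\<^esub> \<longleftrightarrow> (\<exists>c\<in>carrier C. x = ?e c)" if x: "x \<in> carrier (Mp r)" for x
  proof -
   have "?q x = \<zero>\<^bsub>C1\<^esub> \<longleftrightarrow> a x \<in> i ` carrier C" using C1(4)[OF a.closed[OF x]] x by (simp del: pi_module_simps)
   also have "\<dots> \<longleftrightarrow> (\<exists>c\<in>carrier C. a x = a (?e c))" using ie by auto
   also have "\<dots> \<longleftrightarrow> (\<exists>c\<in>carrier C. x = ?e c)" using D(5)[OF x] D(5)[OF ec] by metis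
   finally show ?thesis .
  qed
  then have "(\<forall>x\<in>carrier (Mp r). ?q x = \<zero>\<^bsub>C1\<^esub> \<longrightarrow> pair r \<gamma> x = \<zero>\<^sub>M) \<longleftrightarrow> (\<forall>c\<in>carrier C. pair r \<gamma> (?e c) = \<zero>\<^sub>M)"
   using ec by blast
  also have "\<dots> \<longleftrightarrow> (\<forall>c\<in>carrier C. p \<gamma> c = \<zero>\<^sub>M)" using p_eq[OF \<gamma>] by simp
  also have "\<dots> \<longleftrightarrow> p \<gamma> = \<zero>\<^bsub>star R M C\<^esub>"
  proof -
   have "p \<gamma> \<in> Hom R C M" using Hom_closed[OF p(1) \<gamma>] by simp
   then show ?thesis using Hom_eqI[OF _ Hom_zero[OF C M_lm], of "p \<gamma>"] by auto
  qed
  finally show "p \<gamma> = \<zero>\<^bsub>star R M C\<^esub> \<longleftrightarrow> (\<forall>x\<in>carrier (Mp r). ?q x = \<zero>\<^bsub>C1\<^esub> \<longrightarrow> pair r \<gamma> x = \<zero>\<^sub>M)" by blast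
 qed
 from free_retract_syzygy[OF \<Gamma>_ring star_lm[OF C1(1)] star_lm[OF C] this Z fr]
 show ?thesis by (rule that[OF se Do C1o Dh])
qed

text \<open>Each step passes from \<open>Z j\<close> to \<open>Z (Suc j)\<close> and costs one
  triangle; \<open>k\<close> counts the steps that remain. At the projective syzygy
  \<open>Z n\<close> the free cover of \<open>Hom(C, M)\<close> splits, and
  \<open>star_split_hull\<close> applies.\<close>

lemma ladder:
 fixes Q Z :: "nat \<Rightarrow> 'r lmap lmod"
 assumes Z: "\<And>i. LMod \<Gamma> (Z i)" "\<And>i. projective_module \<Gamma> (Q i)" "\<And>i. short_exact \<Gamma> (Z (Suc i)) (Q i) (Z i) (\<iota> i) (d i)"
  "bij_betw (d n) (carrier (Q n)) (carrier (Z n))"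
  and C: "S.obj C" "free_retract \<Gamma> (star R M C) (Z j)" "j + k = n"
 shows "C \<in> gen_level S.T {M} (Suc k)"
 using C
proof (induction k arbitrary: C j)
 case 0
 obtain r p where p: "p \<in> Hom \<Gamma> (Free \<Gamma> r) (star R M C)" "p ` carrier (Free \<Gamma> r) = carrier (star R M C)"
  by (rule star_cover[OF 0(1)]) (rule that)
 have "free_retract \<Gamma> (star R M C) (Z n)" using 0(2,3) by simp
 then obtain \<sigma> where \<sigma>: "\<sigma> \<in> Hom \<Gamma> (star R M C) (Free \<Gamma> r)" "\<And>x. x \<in> carrier (star R M C) \<Longrightarrow> p (\<sigma> x) = x"
  by (rule free_retract_section[OF \<Gamma>_ring star_lm[OF S.objD(1)[OF 0(1)]] Z(1,2) short_exactD(2)[OF Z(3)] Z(4) _ p]) (rule that)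
 show ?case using star_split_hull[OF 0(1) p \<sigma>(1)] \<sigma>(2) by simp
next
 case (Suc k)
 obtain C1 D i q where *: "short_exact R C D C1 i q" "S.obj D" "S.obj C1" "D \<in> closure_hull S.T {M}" "free_retract \<Gamma> (star R M C1) (Z (Suc j))"
  by (rule ladder_step[OF Suc.prems(1,2) Z(1,1,2,3)]) (rule that)
 have "C1 \<in> gen_level S.T {M} (Suc k)" by (rule Suc.IH[OF *(3,5)]) (use Suc.prems(3) in simp)
 then show ?case by (rule rotate[OF *(1) Suc.prems(1) *(2,3,4)])
qed

text \<open>Covering \<open>B\<close> and then the kernel by powers of \<open>M\<close> exhibits \<open>Hom(B, M)\<close> as a second syzygy.\<close>

lemma presentation:
 assumes X: "LMod R B" and q: "q \<in> Hom R (Mp r) B" "q ` carrier (Mp r) = carrier B"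
 obtains n \<psi> and N1 N0 :: "('r lmap, nat \<Rightarrow> 'r lmap) module" and j p where
  "LMod \<Gamma> N1" "LMod \<Gamma> N0" "fin_gen \<Gamma> N0" "\<psi> \<in> Hom \<Gamma> (Free \<Gamma> r) N1" "\<psi> ` carrier (Free \<Gamma> r) = carrier N1"
  "short_exact \<Gamma> (star R M B) (Free \<Gamma> r) N1 (iota r q B) \<psi>" "short_exact \<Gamma> N1 (Free \<Gamma> n) N0 j p"
proof -
 interpret q: lhom R "Mp r" B q using Mp_lm X q(1) by (rule lhomI)
 let ?N = "{x \<in> carrier (Mp r). q x = \<zero>\<^sub>B}"
 let ?K = "Mp r\<lparr>carrier := ?N\<rparr>"
 have K: "LMod R ?K" by (rule q.W.submodule_left_module[OF q.kernel])
 have Kf: "fin_gen R ?K" by (rule fin_gen_submodule[OF Mp_lm Mp_fin_gen q.kernel])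
 have inc: "(\<lambda>x\<in>?N. x) \<in> Hom R ?K (Mp r)" by (rule q.W.Hom_inclusion[OF q.kernel])
 interpret K: left_module R ?K by (rule K)
 obtain n :: nat and f where f: "\<And>i. f i \<in> Hom R M ?K"
  "\<And>w. w \<in> carrier ?K \<Longrightarrow> \<exists>m\<in>carrier (Mp n). w = finsum ?K (\<lambda>i. f i (m i)) {..<n}"
  by (rule generator[OF K Kf]) (rule that)
 have fN: "f i m \<in> ?N" if "m \<in> carrier M" for i m using Hom_closed[OF f(1)[of i] that] by simp
 define k where "k i = (\<lambda>m\<in>carrier M. (\<lambda>x\<in>?N. x) (f i m))" for i
 have k: "k i \<in> Hom R M (Mp r)" for i unfolding k_def by (rule Hom_comp[OF M_lm f(1) inc])
 have ke: "k i m = f i m" if "m \<in> carrier M" for i m using that fN[OF that] by (simp only: k_def restrict_apply')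
 let ?F = "Free \<Gamma> r" and ?E = "Free \<Gamma> n"
 have FE: "LMod \<Gamma> ?F" "LMod \<Gamma> ?E" by (rule free_left_module[OF \<Gamma>_ring])+
 \<comment> \<open>Restriction along a map from \<open>M^n\<close> to \<open>M^r\<close> whose image
   is the kernel of \<open>q\<close>, written between free modules; \<open>N1\<close> is its image
   and \<open>N0\<close> its cokernel.\<close>
 define \<psi> where "\<psi> = (\<lambda>\<gamma>\<in>carrier ?F. \<lambda>i\<in>{..<n}. (\<lambda>\<gamma>\<in>carrier ?F. \<lambda>m\<in>carrier M. pair r \<gamma> (k i m)) \<gamma>)"
 have "\<psi> \<in> Hom \<Gamma> ?F (pi_module {..<n} (\<lambda>_. Reg \<Gamma>))"
  unfolding \<psi>_def by (rule pi_tuple_hom[OF FE(1) pair_comp_hom[OF k]])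
 then have \<psi>: "\<psi> \<in> Hom \<Gamma> ?F ?E" by (simp only: free_module_def)
 have \<psi>e: "\<psi> \<gamma> = (\<lambda>i\<in>{..<n}. \<lambda>m\<in>carrier M. pair r \<gamma> (k i m))" if "\<gamma> \<in> carrier ?F" for \<gamma>
  using that by (simp only: \<psi>_def restrict_apply')
 interpret \<psi>: lhom \<Gamma> ?F ?E \<psi> using FE \<psi> by (rule lhomI)
 let ?N1 = "?E\<lparr>carrier := \<psi> ` carrier ?F\<rparr>"
 have N1: "LMod \<Gamma> ?N1" by (rule \<psi>.Y.submodule_left_module[OF \<psi>.range])
 have \<psi>1: "\<psi> \<in> Hom \<Gamma> ?F ?N1" using \<psi> by (auto simp: mod_hom_def PiE_def simp del: free_simps)
 obtain N0 :: "('r lmap, nat \<Rightarrow> 'r lmap) module" and p where N0: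
  "LMod \<Gamma> N0" "p \<in> Hom \<Gamma> ?E N0" "p ` carrier ?E = carrier N0" "\<And>x. x \<in> carrier ?E \<Longrightarrow> p x = \<zero>\<^bsub>N0\<^esub> \<longleftrightarrow> x \<in> \<psi> ` carrier ?F"
  by (rule quotient_module_exists[OF FE(2) \<psi>.range]) (rule that)
 have N0f: "fin_gen \<Gamma> N0" by (rule left_module.fin_gen_image[OF FE(2) N0(1-3) free_fin_gen[OF \<Gamma>_ring]])
 have se0: "short_exact \<Gamma> ?N1 ?E N0 (\<lambda>x\<in>\<psi> ` carrier ?F. x) p" unfolding short_exact_def
 proof (intro conjI \<psi>.Y.Hom_inclusion[OF \<psi>.range] N0(2,3))
  show "inj_on (\<lambda>x\<in>\<psi> ` carrier ?F. x) (carrier ?N1)" by (auto simp: inj_on_def simp del: free_simps)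
  have "(\<lambda>x\<in>\<psi> ` carrier ?F. x) ` carrier ?N1 = \<psi> ` carrier ?F" by (simp del: free_simps)
  also have "\<dots> = {y \<in> carrier ?E. p y = \<zero>\<^bsub>N0\<^esub>}" using N0(4) \<psi>.closed by blast
  finally show "(\<lambda>x\<in>\<psi> ` carrier ?F. x) ` carrier ?N1 = {y \<in> carrier ?E. p y = \<zero>\<^bsub>N0\<^esub>}" .
 qed
 have img: "\<psi> ` carrier ?F = carrier ?N1" by simp
 have se1: "short_exact \<Gamma> (star R M B) ?F ?N1 (iota r q B) \<psi>"
 proof (rule star_short_exact[OF X q \<psi>1 img])
  fix \<gamma> assume \<gamma>: "\<gamma> \<in> carrier ?F"
  have kN: "k i m \<in> carrier (Mp r)" "q (k i m) = \<zero>\<^sub>B" if "m \<in> carrier M" for i m using fN[OF that, of i] ke[OF that, of i] by simp_all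
  show "\<psi> \<gamma> = \<zero>\<^bsub>?N1\<^esub> \<longleftrightarrow> (\<forall>x\<in>carrier (Mp r). q x = \<zero>\<^sub>B \<longrightarrow> pair r \<gamma> x = \<zero>\<^sub>M)" (is "_ \<longleftrightarrow> ?R")
  proof
   assume "\<psi> \<gamma> = \<zero>\<^bsub>?N1\<^esub>"
   then have eq: "(\<lambda>i\<in>{..<n}. \<lambda>m\<in>carrier M. pair r \<gamma> (k i m)) = (\<lambda>i\<in>{..<n}. \<lambda>m\<in>carrier M. \<zero>\<^sub>M)" unfolding \<psi>e[OF \<gamma>] by simp
   have z: "pair r \<gamma> (f i m) = \<zero>\<^sub>M" if "i < n" "m \<in> carrier M" for i m
    using fun_cong[OF fun_cong[OF eq, of i], of m] that ke[of m i] by simp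
   let ?h = "\<lambda>x\<in>carrier ?K. pair r \<gamma> ((\<lambda>x\<in>?N. x) x)"
   have h: "?h \<in> Hom R ?K M" by (rule Hom_comp[OF K inc pair_hom[OF \<gamma>]])
   interpret h: lhom R ?K M ?h using K M_lm h by (rule lhomI)
   show ?R
   proof (intro ballI impI)
    fix x assume x: "x \<in> carrier (Mp r)" "q x = \<zero>\<^sub>B"
    then have xN: "x \<in> ?N" by blast
    then have "x \<in> carrier ?K" by simp
    then obtain m where m: "m \<in> carrier (Mp n)" "x = finsum ?K (\<lambda>i. f i (m i)) {..<n}" using f(2) by blast
    have mc: "m i \<in> carrier M" if "i < n" for i using m(1) that by auto
    have c: "(\<lambda>i. f i (m i)) \<in> {..<n} \<rightarrow> carrier ?K" using Hom_closed[OF f(1) mc] by (intro Pi_I) blast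
    have he: "?h y = pair r \<gamma> y" if "y \<in> ?N" for y using that by simp
    have "pair r \<gamma> x = ?h x" using he[OF xN] by (rule sym)
    also have "?h x = finsum M (\<lambda>i. ?h (f i (m i))) {..<n}" unfolding m(2) by (rule h.finsum[OF finite_lessThan c])
    also have "\<dots> = finsum M (\<lambda>i. \<zero>\<^sub>M) {..<n}"
    proof (intro MM.M.finsum_cong' refl)
     fix i assume i: "i \<in> {..<n}"
     then have im: "m i \<in> carrier M" using mc by simp
     show "?h (f i (m i)) = \<zero>\<^sub>M" using he[OF fN[OF im]] z[OF _ im] i by simp
    qed simp
    finally show "pair r \<gamma> x = \<zero>\<^sub>M" by simp
   qed
  next
   assume R: ?R
   have "pair r \<gamma> (k i m) = \<zero>\<^sub>M" if "m \<in> carrier M" for i m using R kN[OF that] by blast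
   then show "\<psi> \<gamma> = \<zero>\<^bsub>?N1\<^esub>" unfolding \<psi>e[OF \<gamma>] by (simp cong: restrict_cong)
  qed
 qed
 show ?thesis by (rule that[OF N1 N0(1) N0f \<psi>1 img se1 se0])
qed

text \<open>The hypothesis is applied to a copy of \<open>N0\<close>, and one comparison leads from
  \<open>N0\<close> to \<open>N1\<close> and the first syzygy. As \<open>Hom(B, M)\<close> is the
  kernel of a free cover of \<open>N1\<close>, a further comparison leads to the second.\<close>

lemma syzygies:
 assumes gl: "gl_dim \<Gamma> \<le> enat n" and X: "LMod R B" and q: "q \<in> Hom R (Mp r) B" "q ` carrier (Mp r) = carrier B"
 obtains \<psi> and N1 :: "('r lmap, nat \<Rightarrow> 'r lmap) module"
  and Z Q :: "nat \<Rightarrow> 'r lmap lmod" and \<iota> d where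
  "LMod \<Gamma> N1" "\<psi> \<in> Hom \<Gamma> (Free \<Gamma> r) N1" "\<psi> ` carrier (Free \<Gamma> r) = carrier N1"
  "short_exact \<Gamma> (star R M B) (Free \<Gamma> r) N1 (iota r q B) \<psi>" "\<And>i. LMod \<Gamma> (Z i)" "\<And>i. projective_module \<Gamma> (Q i)"
  "\<And>i. short_exact \<Gamma> (Z (Suc i)) (Q i) (Z i) (\<iota> i) (d i)" "bij_betw (d n) (carrier (Q n)) (carrier (Z n))" "free_retract \<Gamma> N1 (Z 1)"
proof -
 obtain m \<psi> and N1 N0 :: "('r lmap, nat \<Rightarrow> 'r lmap) module" and j p where *:
  "LMod \<Gamma> N1" "LMod \<Gamma> N0" "fin_gen \<Gamma> N0" "\<psi> \<in> Hom \<Gamma> (Free \<Gamma> r) N1" "\<psi> ` carrier (Free \<Gamma> r) = carrier N1"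
  "short_exact \<Gamma> (star R M B) (Free \<Gamma> r) N1 (iota r q B) \<psi>" "short_exact \<Gamma> N1 (Free \<Gamma> m) N0 j p"
  by (rule presentation[OF X q]) (rule that)
 obtain N :: "'r lmap lmod" and a b where N: "LMod \<Gamma> N" "fin_gen \<Gamma> N" "a \<in> Hom \<Gamma> N0 N" "b \<in> Hom \<Gamma> N N0"
  "\<And>x. x \<in> carrier N0 \<Longrightarrow> b (a x) = x" "\<And>y. y \<in> carrier N \<Longrightarrow> a (b y) = y"
  by (rule fin_gen_copy_iso[OF *(2,3)]) (rule that)
 obtain Z Q :: "nat \<Rightarrow> 'r lmap lmod" and \<iota> d where Z: "Z 0 = N" "\<And>i. LMod \<Gamma> (Z i)" "\<And>i. projective_module \<Gamma> (Q i)"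
  "\<And>i. short_exact \<Gamma> (Z (Suc i)) (Q i) (Z i) (\<iota> i) (d i)" "bij_betw (d n) (carrier (Q n)) (carrier (Z n))"
  by (rule resolution_syzygies[OF N(1) gl_dim_resolution[OF gl N(1)]]) (rule that)
 have "free_retract \<Gamma> N0 (Z 0)" unfolding Z(1) by (rule free_retract_iso[OF *(2) N(1,3,4,5)])
 from free_retract_syzygy[OF \<Gamma>_ring *(1,2,7) Z(2,2,3,4) this] have "free_retract \<Gamma> N1 (Z 1)" by simp
 then show ?thesis by (rule that[OF *(1,4,5,6) Z(2,3,4,5)])
qed

section \<open>Consequences of a bound on the global dimension\<close>

lemma generator_surj:
 assumes "LMod R W" "fin_gen R W"
 obtains r f where "\<And>i. f i \<in> Hom R M W"
  "(\<lambda>x\<in>carrier (Mp r). finsum W (\<lambda>i. f i (x i)) {..<r}) \<in> Hom R (Mp r) W"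
  "(\<lambda>x\<in>carrier (Mp r). finsum W (\<lambda>i. f i (x i)) {..<r}) ` carrier (Mp r) = carrier W"
proof -
 obtain r :: nat and f where f: "\<And>i. f i \<in> Hom R M W"
  "\<And>w. w \<in> carrier W \<Longrightarrow> \<exists>m\<in>carrier (Mp r). w = finsum W (\<lambda>i. f i (m i)) {..<r}"
  by (rule generator[OF assms]) (rule that)
 let ?h = "\<lambda>x\<in>carrier (Mp r). finsum W (\<lambda>i. f i (x i)) {..<r}"
 have h: "?h \<in> Hom R (Mp r) W" by (rule pi_sum_hom[OF R.ring_axioms M_lm assms(1) finite_lessThan f(1)])
 have "w \<in> ?h ` carrier (Mp r)" if w: "w \<in> carrier W" for w
 proof -
  obtain m where m: "m \<in> carrier (Mp r)" "w = finsum W (\<lambda>i. f i (m i)) {..<r}" using f(2)[OF w] by blast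
  have "w = ?h m" using m by (simp only: restrict_apply')
  then show ?thesis using m(1) by (rule image_eqI)
 qed
 then have "?h ` carrier (Mp r) = carrier W" using Hom_closed[OF h] by blast
 with f(1) h show ?thesis by (rule that)
qed

lemma gl_dim_bound:
 assumes gl: "gl_dim \<Gamma> \<le> enat n" and "2 \<le> n" and X: "S.obj B"
 shows "B \<in> gen_level S.T {M} (Suc (n - 2))"
proof -
 obtain r f where *: "(\<lambda>x\<in>carrier (Mp r). finsum B (\<lambda>i. f i (x i)) {..<r}) \<in> Hom R (Mp r) B"
  "(\<lambda>x\<in>carrier (Mp r). finsum B (\<lambda>i. f i (x i)) {..<r}) ` carrier (Mp r) = carrier B"
  by (rule generator_surj[OF S.objD[OF X]]) (rule that)
 let ?q = "\<lambda>x\<in>carrier (Mp r). finsum B (\<lambda>i. f i (x i)) {..<r}"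
 obtain \<psi> and N1 :: "('r lmap, nat \<Rightarrow> 'r lmap) module"
  and Z Q :: "nat \<Rightarrow> 'r lmap lmod" and \<iota> d where
  Z: "LMod \<Gamma> N1" "\<psi> \<in> Hom \<Gamma> (Free \<Gamma> r) N1" "\<psi> ` carrier (Free \<Gamma> r) = carrier N1"
  "short_exact \<Gamma> (star R M B) (Free \<Gamma> r) N1 (iota r ?q B) \<psi>" "\<And>i. LMod \<Gamma> (Z i)" "\<And>i. projective_module \<Gamma> (Q i)"
  "\<And>i. short_exact \<Gamma> (Z (Suc i)) (Q i) (Z i) (\<iota> i) (d i)" "bij_betw (d n) (carrier (Q n)) (carrier (Z n))" "free_retract \<Gamma> N1 (Z 1)"
  by (rule syzygies[OF gl S.objD(1)[OF X] *]) (rule that)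
 \<comment> \<open>Comparison with the second syzygy leaves \<open>n - 2\<close> steps of
   \<open>ladder\<close>.\<close>
 have fr: "free_retract \<Gamma> (star R M B) (Z (Suc 1))"
  by (rule free_retract_syzygy[OF \<Gamma>_ring star_lm[OF S.objD(1)[OF X]] Z(1,4,5,5,6,7,9)])
 show ?thesis by (rule ladder[OF Z(5-8) X fr]) (use assms(2) in simp)
qed

lemma tri_dim_le_gl_dim:
 assumes "gl_dim \<Gamma> \<le> enat n" "2 \<le> n"
 shows "tri_dim (stable_category R) \<le> enat (n - 2)"
 unfolding tri_dim_def
proof (rule Inf_lower, rule CollectI, intro exI conjI bexI)
 show "M \<in> Ob S.T" using M_obj by (simp add: S.cat_simps)
 have "B \<in> gen_level S.T {M} (Suc (n - 2)) \<longleftrightarrow> S.obj B" for B using gl_dim_bound[OF assms] S.gen_level_obj by blast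
 then show "gen_level S.T {M} (n - 2 + 1) = Ob S.T" by (auto simp: S.cat_simps simp del: gen_level.simps)
qed (rule refl)

text \<open>Here \<open>Z 1\<close> is projective, so the embedding \<open>iota\<close> of
  \<open>Hom(V, M)\<close> in a free module has a retraction \<open>\<tau>\<close>. The values of
  \<open>\<tau>\<close> on the basis are the components of a map from \<open>V\<close> to
  \<open>M^r\<close>, and composing it with the cover of \<open>B\<close> gives the section.\<close>

lemma gl_dim_one_splits:
 fixes B :: "('r, 'b) module" and V :: "('r, 'v) module"
 assumes gl: "gl_dim \<Gamma> \<le> enat 1" and B: "LMod R B" "fin_gen R B" and V: "LMod R V"
  and q: "q \<in> Hom R B V" "q ` carrier B = carrier V"
 obtains s where "s \<in> Hom R V B" "\<And>x. x \<in> carrier V \<Longrightarrow> q (s x) = x"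
proof -
 obtain r f where f: "\<And>i. f i \<in> Hom R M B"
  "(\<lambda>x\<in>carrier (Mp r). finsum B (\<lambda>i. f i (x i)) {..<r}) \<in> Hom R (Mp r) B"
  "(\<lambda>x\<in>carrier (Mp r). finsum B (\<lambda>i. f i (x i)) {..<r}) ` carrier (Mp r) = carrier B"
  by (rule generator_surj[OF B]) (rule that)
 let ?h = "\<lambda>x\<in>carrier (Mp r). finsum B (\<lambda>i. f i (x i)) {..<r}"
 let ?q = "\<lambda>x\<in>carrier (Mp r). q (?h x)"
 have q': "?q \<in> Hom R (Mp r) V" by (rule Hom_comp[OF Mp_lm f(2) q(1)])
 have qs: "?q ` carrier (Mp r) = carrier V"
 proof -
  have "?q ` carrier (Mp r) = q ` ?h ` carrier (Mp r)" unfolding image_image by (intro image_cong refl) (simp only: restrict_apply')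
  then show ?thesis unfolding f(3) q(2) .
 qed
 obtain \<psi> and N1 :: "('r lmap, nat \<Rightarrow> 'r lmap) module"
  and Z Q :: "nat \<Rightarrow> 'r lmap lmod" and \<iota> d where
  Z: "LMod \<Gamma> N1" "\<psi> \<in> Hom \<Gamma> (Free \<Gamma> r) N1" "\<psi> ` carrier (Free \<Gamma> r) = carrier N1"
  "short_exact \<Gamma> (star R M V) (Free \<Gamma> r) N1 (iota r ?q V) \<psi>" "\<And>i. LMod \<Gamma> (Z i)" "\<And>i. projective_module \<Gamma> (Q i)"
  "\<And>i. short_exact \<Gamma> (Z (Suc i)) (Q i) (Z i) (\<iota> i) (d i)" "bij_betw (d 1) (carrier (Q 1)) (carrier (Z 1))" "free_retract \<Gamma> N1 (Z 1)"
  by (rule syzygies[OF gl V q' qs]) (rule that)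
 note se = short_exactD[OF Z(4)]
 let ?F = "Free \<Gamma> r"
 have F: "LMod \<Gamma> ?F" by (rule free_left_module[OF \<Gamma>_ring])
 obtain \<sigma> where \<sigma>: "\<sigma> \<in> Hom \<Gamma> N1 ?F" "\<And>x. x \<in> carrier N1 \<Longrightarrow> \<psi> (\<sigma> x) = x"
  by (rule free_retract_section[OF \<Gamma>_ring Z(1,5,6) short_exactD(2)[OF Z(7)] Z(8,9,2,3)]) (rule that)
 interpret \<psi>: lhom \<Gamma> ?F N1 \<psi> using F Z(1,2) by (rule lhomI)
 interpret \<sigma>: lhom \<Gamma> N1 ?F \<sigma> using Z(1) F \<sigma>(1) by (rule lhomI)
 \<comment> \<open>The projection onto the kernel of \<open>\<psi>\<close>, which is the image of
   \<open>iota\<close>.\<close>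
 let ?u = "\<lambda>x\<in>carrier ?F. (\<lambda>x\<in>carrier ?F. x) x \<ominus>\<^bsub>?F\<^esub> (\<lambda>x\<in>carrier ?F. \<sigma> (\<psi> x)) x"
 have u: "?u \<in> Hom \<Gamma> ?F ?F" by (rule Hom_minus[OF F F Hom_id[OF F] Hom_comp[OF F Z(2) \<sigma>(1)]])
 have ue: "?u x = x \<ominus>\<^bsub>?F\<^esub> \<sigma> (\<psi> x)" if "x \<in> carrier ?F" for x using that by (simp only: restrict_apply')
 have uk: "\<exists>z\<in>carrier (star R M V). ?u x = iota r ?q V z" if x: "x \<in> carrier ?F" for x
 proof (rule se(6)[OF Hom_closed[OF u x]])
  have "\<psi> (x \<ominus>\<^bsub>?F\<^esub> \<sigma> (\<psi> x)) = \<zero>\<^bsub>N1\<^esub>"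
   using x \<psi>.minus[OF x \<sigma>.closed[OF \<psi>.closed[OF x]]] \<sigma>(2)[OF \<psi>.closed[OF x]] by (simp add: a_minus_def \<psi>.Y.M.r_neg del: free_simps)
  then show "\<psi> (?u x) = \<zero>\<^bsub>N1\<^esub>" unfolding ue[OF x] .
 qed
 obtain \<tau> where \<tau>: "\<tau> \<in> Hom \<Gamma> ?F (star R M V)" "\<And>x. x \<in> carrier ?F \<Longrightarrow> iota r ?q V (\<tau> x) = ?u x"
  by (rule Hom_into_kernel[OF F star_lm[OF V] F se(1,3) u uk]) (assumption | rule that)+
 have \<tau>\<iota>: "\<tau> (iota r ?q V g) = g" if g: "g \<in> Hom R V M" for g
 proof -
  have gc: "g \<in> carrier (star R M V)" using g by simp
  note ic = Hom_closed[OF se(1) gc]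
  have "iota r ?q V (\<tau> (iota r ?q V g)) = iota r ?q V g \<ominus>\<^bsub>?F\<^esub> \<sigma> (\<psi> (iota r ?q V g))" unfolding \<tau>(2)[OF ic] by (rule ue[OF ic])
  also have "\<dots> = iota r ?q V g"
   unfolding se(5)[OF gc] \<sigma>.zero a_minus_def \<psi>.W.M.minus_equality[OF \<psi>.W.M.r_zero[OF \<psi>.W.M.zero_closed] \<psi>.W.M.zero_closed \<psi>.W.M.zero_closed]
   by (rule \<psi>.W.M.r_zero[OF ic])
  finally show ?thesis by (rule inj_onD[OF se(3) _ Hom_closed[OF \<tau>(1) ic] gc])
 qed
 let ?g = "\<lambda>i. \<tau> (basis \<Gamma> r i)"
 have g: "?g i \<in> Hom R V M" for i using Hom_closed[OF \<tau>(1) basis_closed[OF \<Gamma>_ring]] by simp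
 let ?s = "\<lambda>x\<in>carrier V. finsum B (\<lambda>i. (\<lambda>x\<in>carrier V. f i (?g i x)) x) {..<r}"
 have s: "?s \<in> Hom R V B" by (rule Hom_finsum[OF V B(1) finite_lessThan Hom_comp[OF V g f(1)]])
 interpret B: left_module R B by (rule B(1))
 show ?thesis
 proof (rule that[OF s])
  fix x assume x: "x \<in> carrier V"
  let ?y = "\<lambda>i\<in>{..<r}. ?g i x"
  have "finsum B (\<lambda>i. f i (?y i)) {..<r} = finsum B (\<lambda>i. (\<lambda>x\<in>carrier V. f i (?g i x)) x) {..<r}"
   using x Hom_closed[OF f(1) Hom_closed[OF g x]] by (intro B.M.finsum_cong' refl) (auto simp del: End_simps)
  then have sx: "?s x = finsum B (\<lambda>i. f i (?y i)) {..<r}" using x by (simp only: restrict_apply')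
  \<comment> \<open>Homomorphisms to \<open>M\<close> separate points; for a single \<open>h\<close>
    the claim is that \<open>\<tau>\<close> undoes \<open>iota\<close>.\<close>
  show "q (?s x) = x"
  proof (rule separates[OF V Hom_closed[OF q(1) Hom_closed[OF s x]] x])
   fix h assume h: "h \<in> Hom R V M"
   have hc: "h \<in> carrier (star R M V)" using h by simp
   note ic = Hom_closed[OF se(1) hc]
   note y = star_eval[OF V \<tau>(1) ic x]
   have "h x = pair r (iota r ?q V h) ?y" using y(2) unfolding \<tau>\<iota>[OF h] .
   also have "\<dots> = h (?q ?y)" by (rule pair_iota[OF V q' h y(1)])
   also have "\<dots> = h (q (?s x))" unfolding sx using y(1) by (simp only: restrict_apply')
   finally show "h (q (?s x)) = h x" by (rule sym)
  qed
 qed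
qed

end

section \<open>The representation dimension of smash products\<close>

context fd_graded_alg
begin
text \<open>A left ideal is a summand once the projection to the quotient splits. The induced map
  splits over the smash product, and averaging with the separating family makes this splitting one
  over \<open>A\<close>.\<close>

lemma semisimple_if_splits:
 assumes sep: "separably_graded G A Gr"
  and split: "\<And>(B :: ('g \<Rightarrow> 'a, 'g \<Rightarrow> (nat \<Rightarrow> 'a) set) module) (V :: ('g \<Rightarrow> 'a, 'g \<Rightarrow> (nat \<Rightarrow> 'a) set) module) q.
   \<lbrakk>LMod smash B; fin_gen smash B; LMod smash V; q \<in> Hom smash B V; q ` carrier B = carrier V\<rbrakk>
   \<Longrightarrow> \<exists>s\<in>Hom smash V B. \<forall>x\<in>carrier V. q (s x) = x"
 shows "semisimple_ring A"
 unfolding semisimple_ring_def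
proof (intro conjI allI impI)
 show "ring A" by (rule A.ring_axioms)
 let ?R = "Reg A"
 fix L assume L: "submodule L A ?R"
 have R: "LMod A ?R" "fin_gen A ?R" by (rule regular_left_module[OF A.ring_axioms], rule regular_fin_gen[OF A.ring_axioms])
 interpret R: left_module A ?R by (rule R(1))
 note LD = R.submoduleD[OF L]
 \<comment> \<open>The regular module is copied first, since \<open>separable_retraction\<close> and
   the types in \<open>split\<close> refer to modules of the universe.\<close>
 obtain B :: "'a lmod" and e d where B: "LMod A B" "fin_gen A B" "e \<in> Hom A ?R B" "d \<in> Hom A B ?R"
  "\<And>x. x \<in> carrier ?R \<Longrightarrow> d (e x) = x" "\<And>y. y \<in> carrier B \<Longrightarrow> e (d y) = y"
  by (rule fin_gen_copy_iso[OF R]) (rule that)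
 interpret B: left_module A B by (rule B(1))
 interpret d: lhom A B ?R d using B(1) R(1) B(4) by (rule lhomI)
 let ?L = "{y \<in> carrier B. d y \<in> L}"
 have L': "submodule ?L A B"
  by (rule B.submoduleI) (use LD in \<open>auto simp del: regular_simps\<close>)
 obtain V :: "'a lmod" and q where V: "LMod A V" "q \<in> Hom A B V" "q ` carrier B = carrier V"
  "\<And>x. x \<in> carrier B \<Longrightarrow> q x = \<zero>\<^sub>V \<longleftrightarrow> x \<in> ?L"
  by (rule quotient_module_exists[OF B(1) L']) (rule that)
 interpret q: lhom A B V q using B(1) V(1,2) by (rule lhomI)
 let ?h = "\<lambda>v\<in>carrier (hmod B). \<lambda>g\<in>G0. q (v g)"
 have h: "?h \<in> Hom smash (hmod B) (hmod V)" by (rule hmap_hom[OF B(1) V(1,2)])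
 have "w \<in> ?h ` carrier (hmod B)" if w: "w \<in> carrier (hmod V)" for w
 proof -
  have "\<forall>g\<in>G0. \<exists>y. y \<in> carrier B \<and> w g = q y"
  proof
   fix g assume "g \<in> G0"
   then have "w g \<in> q ` carrier B" unfolding V(3) using w by auto
   then show "\<exists>y. y \<in> carrier B \<and> w g = q y" by blast
  qed
  from bchoice[OF this] obtain v where v: "\<forall>g\<in>G0. v g \<in> carrier B \<and> w g = q (v g)" ..
  then have c: "(\<lambda>g\<in>G0. v g) \<in> carrier (hmod B)" by simp
  have "w g = ?h (\<lambda>g\<in>G0. v g) g" if "g \<in> G0" for g using v c that by simp
  moreover have "w \<in> G0 \<rightarrow>\<^sub>E carrier V" "?h (\<lambda>g\<in>G0. v g) \<in> G0 \<rightarrow>\<^sub>E carrier V" using w Hom_closed[OF h c] by simp_all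
  ultimately have "w = ?h (\<lambda>g\<in>G0. v g)" by (metis PiE_ext)
  then show ?thesis using c by (rule image_eqI)
 qed
 then have hs: "?h ` carrier (hmod B) = carrier (hmod V)" using Hom_closed[OF h] by blast
 obtain t where t: "t \<in> Hom smash (hmod V) (hmod B)" "\<forall>w\<in>carrier (hmod V). ?h (t w) = w"
  using split[OF hmod_left_module[OF B(1)] hmod_fin_gen[OF B(1,2)] hmod_left_module[OF V(1)] h hs] by blast
 obtain x where x: "x \<in> G0 \<rightarrow> carrier A" "\<And>M :: 'a lmod. LMod A M \<Longrightarrow> (\<lambda>v\<in>carrier (hmod M). finsum M (\<lambda>g. x g \<odot>\<^sub>M v g) G0) \<in> Hom A (restr \<eta> (hmod M)) M"
  "\<And>(M :: 'a lmod) v. LMod A M \<Longrightarrow> v \<in> carrier M \<Longrightarrow> finsum M (\<lambda>g. x g \<odot>\<^sub>M v) G0 = v"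
  by (rule separable_retraction[OF sep]) (assumption | rule that)+
 let ?c = "\<lambda>z\<in>carrier V. \<lambda>g\<in>G0. z"
 let ?r = "\<lambda>v\<in>carrier (hmod B). finsum B (\<lambda>g. x g \<odot>\<^sub>B v g) G0"
 let ?s = "\<lambda>z\<in>carrier V. ?r ((\<lambda>z\<in>carrier V. t (?c z)) z)"
 have s: "?s \<in> Hom A V B"
  by (rule Hom_comp[OF V(1) Hom_comp[OF V(1) const_hom[OF V(1)] restr_hom[OF \<eta>_hom t(1)]] x(2)[OF B(1)]])
 have qs: "q (?s z) = z" if z: "z \<in> carrier V" for z
 proof -
  let ?w = "\<lambda>g\<in>G0. z"
  have w: "?w \<in> carrier (hmod V)" using z by simp
  note tw = Hom_closed[OF t(1) w]
  have xg: "x g \<in> carrier A" if "g \<in> G0" for g using x(1) that by auto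
  have twg: "t ?w g \<in> carrier B" if "g \<in> G0" for g using tw that by auto
  have "?h (t ?w) = ?w" using t(2) w by blast
  then have eq: "(\<lambda>g\<in>G0. q (t ?w g)) = ?w" using tw by (simp only: restrict_apply')
  have qt: "q (t ?w g) = z" if "g \<in> G0" for g using fun_cong[OF eq, of g] that by simp
  have "?s z = finsum B (\<lambda>g. x g \<odot>\<^sub>B t ?w g) G0" using z tw by (simp only: restrict_apply')
  then have "q (?s z) = q (finsum B (\<lambda>g. x g \<odot>\<^sub>B t ?w g) G0)" by (simp only:)
  also have "\<dots> = finsum V (\<lambda>g. q (x g \<odot>\<^sub>B t ?w g)) G0"
   using xg twg finite_group by (intro q.finsum) auto
  also have "\<dots> = finsum V (\<lambda>g. x g \<odot>\<^sub>V z) G0"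
   using xg twg qt z by (intro q.Y.M.finsum_cong' refl) auto
  also have "\<dots> = z" by (rule x(3)[OF V(1) z])
  finally show ?thesis .
 qed
 \<comment> \<open>The section is taken back from the copy to the regular module; its image is the
   complement of \<open>L\<close>.\<close>
 define s' where "s' = (\<lambda>z\<in>carrier V. d (?s z))"
 have s': "s' \<in> Hom A V ?R" unfolding s'_def by (rule Hom_comp[OF V(1) s B(4)])
 interpret s': lhom A V ?R s' using V(1) R(1) s' by (rule lhomI)
 interpret e: lhom A ?R B e using R(1) B(1,3) by (rule lhomI)
 have qe: "q (e (s' z)) = z" if z: "z \<in> carrier V" for z
 proof -
  have "e (s' z) = ?s z" using B(6)[OF Hom_closed[OF s z]] z by (simp only: s'_def restrict_apply')
  then show ?thesis using qs[OF z] by (simp only:)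
 qed
 have qL: "q (e a) = \<zero>\<^sub>V \<longleftrightarrow> a \<in> L" if a: "a \<in> carrier ?R" for a
  using V(4)[OF e.closed[OF a]] B(5)[OF a] e.closed[OF a] by simp
 show "direct_summand A L ?R"
  unfolding direct_summand_def
 proof (intro conjI exI[of _ "s' ` carrier V"] L s'.range)
  show "L \<inter> s' ` carrier V = {\<zero>\<^bsub>?R\<^esub>}"
  proof (intro equalityI subsetI)
   fix a assume "a \<in> L \<inter> s' ` carrier V"
   then obtain z where z: "z \<in> carrier V" "a = s' z" "a \<in> L" by blast
   have "z = \<zero>\<^sub>V" using qe[OF z(1)] qL[OF s'.closed[OF z(1)]] z by simp
   then show "a \<in> {\<zero>\<^bsub>?R\<^esub>}" using z(2) s'.zero by simp
  next
   fix a assume "a \<in> {\<zero>\<^bsub>?R\<^esub>}"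
   then have "a = \<zero>\<^bsub>?R\<^esub>" by simp
   moreover have "\<zero>\<^bsub>?R\<^esub> = s' \<zero>\<^sub>V" by (rule s'.zero[symmetric])
   ultimately show "a \<in> L \<inter> s' ` carrier V" using LD(2) q.Y.M.zero_closed by blast
  qed
  show "L <+>\<^bsub>?R\<^esub> s' ` carrier V = carrier ?R"
  proof (intro equalityI subsetI)
   fix a assume "a \<in> L <+>\<^bsub>?R\<^esub> s' ` carrier V"
   then obtain l z where lz: "l \<in> L" "z \<in> carrier V" "a = l \<oplus>\<^bsub>?R\<^esub> s' z"
    unfolding set_add_def set_mult_def by auto
   have "l \<in> carrier ?R" using lz(1) LD(1) by blast
   then show "a \<in> carrier ?R" unfolding lz(3) by (rule R.M.a_closed[OF _ s'.closed[OF lz(2)]])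
  next
   fix a assume a: "a \<in> carrier ?R"
   let ?z = "q (e a)"
   have z: "?z \<in> carrier V" by (rule q.closed[OF e.closed[OF a]])
   let ?l = "a \<ominus>\<^bsub>?R\<^esub> s' ?z"
   have l: "?l \<in> carrier ?R" by (rule R.M.minus_closed[OF a s'.closed[OF z]])
   have "q (e ?l) = ?z \<ominus>\<^sub>V q (e (s' ?z))"
    unfolding e.minus[OF a s'.closed[OF z]] by (rule q.minus[OF e.closed[OF a] e.closed[OF s'.closed[OF z]]])
   also have "\<dots> = \<zero>\<^sub>V" unfolding qe[OF z] using z by (simp add: a_minus_def q.Y.M.r_neg)
   finally have "?l \<in> L" using qL[OF l] by blast
   moreover have "a = ?l \<oplus>\<^bsub>?R\<^esub> s' ?z"
    unfolding a_minus_def R.M.a_assoc[OF a R.M.a_inv_closed[OF s'.closed[OF z]] s'.closed[OF z]] R.M.l_neg[OF s'.closed[OF z]]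
    by (rule R.M.r_zero[OF a, symmetric])
   ultimately show "a \<in> L <+>\<^bsub>?R\<^esub> s' ` carrier V" using z unfolding set_add_def set_mult_def by auto
  qed
 qed
qed

text \<open>Semisimple algebras have to be excluded: their stable category is zero, hence of
  dimension 0, while the smash product is again semisimple and its modules have endomorphism rings
  of global dimension 0. Otherwise \<open>n \<ge> 2\<close>, because smaller \<open>n\<close> would
  force \<open>A\<close> to be semisimple.\<close>

lemma rep_dim_bound:
 assumes sep: "separably_graded G A Gr" and self_inj: "self_injective A" and ns: "\<not> semisimple_ring A"
 shows "tri_dim (stable_category A) + 2 \<le> rep_dim K smash"
 unfolding rep_dim_def
proof (rule INF_greatest)
 fix M assume "M \<in> {M. generator_cogenerator K smash M}"
 then have M: "generator_cogenerator K smash M" by simp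
 interpret E: self_injective_algebra K smash kB M
 proof
  fix c u assume c: "c \<in> carrier K" and u: "u \<in> carrier smash"
  have "u \<in> G0 \<rightarrow>\<^sub>E carrier A" using u by simp
  from kB_mult[OF c this] show "c \<odot>\<^bsub>smash\<^esub> u = kB c \<otimes>\<^bsub>smash\<^esub> u" by (simp add: smash_product_def del: smash_simps)
 qed (rule smash_self_injective[OF self_inj], rule M)
 show "tri_dim (stable_category A) + 2 \<le> gl_dim (End_ring smash M)"
 proof (cases "gl_dim (End_ring smash M)")
  case (enat n)
  have n: "2 \<le> n"
  proof (rule ccontr)
   assume "\<not> 2 \<le> n"
   then have gl: "gl_dim (End_ring smash M) \<le> enat 1" using enat by simp
   have "semisimple_ring A"
   proof (rule semisimple_if_splits[OF sep])
    fix B V :: "('g \<Rightarrow> 'a, 'g \<Rightarrow> (nat \<Rightarrow> 'a) set) module" and q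
    assume *: "LMod smash B" "fin_gen smash B" "LMod smash V" "q \<in> Hom smash B V" "q ` carrier B = carrier V"
    obtain s where "s \<in> Hom smash V B" "\<And>x. x \<in> carrier V \<Longrightarrow> q (s x) = x"
     by (rule E.gl_dim_one_splits[OF gl *]) (rule that)
    then show "\<exists>s\<in>Hom smash V B. \<forall>x\<in>carrier V. q (s x) = x" by blast
   qed
   with ns show False by simp
  qed
  \<comment> \<open>Separability leads from \<open>A\<close> to the smash product, and the
    endomorphism ring bounds the latter.\<close>
  have "tri_dim (stable_category A) \<le> enat (n - 2)"
   using tri_dim_smash_ge[OF sep] E.tri_dim_le_gl_dim[OF _ n] enat by (auto intro: order_trans)
  then have "tri_dim (stable_category A) + 2 \<le> enat (n - 2) + 2" by (rule add_right_mono)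
  \<comment> \<open>The subtraction \<open>n - 2\<close> does not truncate.\<close>
  also have "\<dots> = enat n" using n by (simp add: numeral_eq_enat)
  finally show ?thesis using enat by simp
 qed simp
qed

end

theorem theorem1p1:
  fixes K :: "('k, 'x) ring_scheme" and G :: "('g, 'y) monoid_scheme"
    and A :: "('k, 'a) module" and Gr :: "'g \<Rightarrow> 'a set"
  assumes "algebraically_closed K"
    and "group G" and "finite (carrier G)"
    and "graded_algebra K A G Gr"
    and "fin_gen K A"
    and "self_injective A"
  shows "tri_dim (stable_category (smash_product G A Gr)) \<le> tri_dim (stable_category A)
    \<and> (separably_graded G A Gr \<longrightarrow>
         tri_dim (stable_category (smash_product G A Gr)) = tri_dim (stable_category A)
         \<and> (\<not> semisimple_ring A \<longrightarrow>
              rep_dim K (smash_product G A Gr) \<ge> tri_dim (stable_category A) + 2))"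
proof -
  interpret fd_graded_alg K A G Gr
    using graded_algI[OF assms(4)] assms(5) by (intro fd_graded_alg.intro fd_graded_alg_axioms.intro)
  show ?thesis
    using tri_dim_smash_le tri_dim_smash_ge rep_dim_bound[OF _ assms(6)] by (auto intro: antisym)
qed

end
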